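(* Let $\alpha\in(0,1)$, let $\xi_\alpha$ be the upper $\alpha$ quantile of the standard normal distribution and $\Phi$ its cumulative distribution function. In the $k$-sample factor model described in the context, put $A=\sum_{i=1}^k\Sigma_i$ and assume (A1) $\lim_{n\to\infty} n_l/n=\lambda_l\in(0,1)$ for $l=1,\dots,k$; (A2) $(\mu_l-\mu_s)^{\mathrm T}\Sigma_l(\mu_l-\mu_s)=o\{n^{-1}\mathrm{tr}(A^2)\}$ as $n,p\to\infty$ for all $l,s\in\{1,\dots,k\}$; (A3) $\mathrm{tr}(\Sigma_l\Sigma_s\Sigma_i\Sigma_j)=o\{[\mathrm{tr}(A^2)]^2\}$ as $p\to\infty$ for all $l,s,i,j\in\{1,\dots,k\}$. Then, as $n,p\to\infty$, for $\widehat T$ equal to either $\widehat T_1=T/\widehat{\sigma_T}$ or $\widehat T_2=T/\widetilde{\sigma_T}$, $$P(\widehat T\ge\xi_\alpha)=\Phi\left\{-\xi_\alpha+\frac{\frac{\sqrt2}{2}\,n\sum_{l=1}^k\lambda_l(\mu_l-\widetilde\mu)^{\mathrm T}(\mu_l-\widetilde\mu)}{\sqrt{\sum_{l=1}^k(1-\lambda_l)^2\mathrm{tr}(\Sigma_l^2)+\sum_{l\ne s}^k\lambda_l\lambda_s\mathrm{tr}(\Sigma_l\Sigma_s)}}\right\}+o(1),$$ where $\widetilde\mu=\sum_{l=1}^k\lambda_l\mu_l$.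
   Context: Model. $k\ge 2$ is a fixed number of groups, with sample sizes $n_1,\dots,n_k$ and $n=\sum_{l=1}^k n_l$. For $l=1,\dots,k$ and $i=1,\dots,n_l$, the $p$-dimensional observations are $X_{li}=\Gamma_l Z_{li}+\mu_l$, where $\mu_l\in\mathbb R^p$, $\Gamma_l$ is a (deterministic) $p\times r$ matrix with $r\ge p$ and $\Gamma_l\Gamma_l^{\mathrm T}=\Sigma_l$ positive definite, and $Z_{li}=(z_{li1},\dots,z_{lir})^{\mathrm T}$ are, for each $l$, i.i.d. in $i$ with mean $0$ and covariance $I_r$. The variables $z_{lij}$ are independent over all $l,i,j$, and $E(z_{lij}^4)=3+\gamma_l<\infty$ with $\gamma_l$ constants. Asymptotics: $n,p\to\infty$ jointly, with $k$ and $\gamma_l$ fixed; $p$, $r$, $n_l$, $\mu_l$, $\Gamma_l$, $\Sigma_l$ may all vary along the sequence. Statistics. $\overline X_l$ is the sample mean and $S_{ln_l}$ the (unbiased, divisor $n_l-1$) sample covariance matrix of group $l$. With $n_{l1}=[n_l/2]+1$ and $n_{l2}=n_l-n_{l1}$ ($[\cdot]$ is the integer part), $S_{ln_{l1}}$ and $S_{ln_{l2}}$ are the unbiased sample covariance matrices of the first $n_{l1}$ and of the remaining $n_{l2}$ observations of group $l$. Define $$T=\sum_{l=1}^k\frac{n-n_l}{n(n_l-1)}\sum_{i\ne j}^{n_l}X_{li}^{\mathrm T}X_{lj}-\sum_{l\ne s}^k\frac{n_ln_s}{n}\overline X_l^{\mathrm T}\overline X_s,$$ $\widehat{\mathrm{tr}(\Sigma_l^2)}=\mathrm{tr}(S_{ln_{l1}}S_{ln_{l2}})$;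 $\widehat{\mathrm{tr}(\Sigma_l\Sigma_s)}=\mathrm{tr}(S_{ln_l}S_{sn_s})$ for $l\neq s$; $$\widetilde{\mathrm{tr}(\Sigma_l^2)}=\frac{(n_l-1)^2}{(n_l+1)(n_l-2)}\Big\{\mathrm{tr}(S_{ln_l}^2)-\frac{1}{n_l-1}[\mathrm{tr}(S_{ln_l})]^2\Big\},$$ $$\widehat{\sigma_T}^2=\frac{2}{n^2}\Big\{\sum_{l=1}^k\frac{n_l(n-n_l)^2}{n_l-1}\widehat{\mathrm{tr}(\Sigma_l^2)}+\sum_{l\ne s}^k n_ln_s\widehat{\mathrm{tr}(\Sigma_l\Sigma_s)}\Big\},$$ $$\widetilde{\sigma_T}^2=\frac{2}{n^2}\Big\{\sum_{l=1}^k\frac{n_l(n-n_l)^2}{n_l-1}\widetilde{\mathrm{tr}(\Sigma_l^2)}+\sum_{l\ne s}^k n_ln_s\widehat{\mathrm{tr}(\Sigma_l\Sigma_s)}\Big\}.$$ Sums over $i\ne j$ and $l\ne s$ run over ordered pairs. *)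

theory Defs
  imports "HOL-Probability.Probability" "Jordan_Normal_Form.Matrix"
begin

text \<open>
  The dimensions \<^term>\<open>p\<close> and \<^term>\<open>r\<close> vary along the asymptotic sequence, so vectors and matrices are
  those of the theory \<^theory>\<open>Jordan_Normal_Form.Matrix\<close>, with explicit carriers.  Coordinates are
  indexed from 0; groups are indexed by \<open>{1..k}\<close> and the observations of group \<open>l\<close> by \<open>{1..N l}\<close>.
\<close>

unbundle no vec_syntax
unbundle no inner_syntax
hide_type (open) Finite_Cartesian_Product.vec
hide_const (open) Finite_Cartesian_Product.vec Finite_Cartesian_Product.mat
  Determinants.trace

definition mat_trace :: "real mat \<Rightarrow> real" where
  "mat_trace A = (\<Sum>a<dim_row A. A $$ (a, a))"

definition pos_def_mat :: "real mat \<Rightarrow> bool" where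
  "pos_def_mat A \<longleftrightarrow> transpose_mat A = A \<and>
     (\<forall>v \<in> carrier_vec (dim_row A). v \<noteq> 0\<^sub>v (dim_row A) \<longrightarrow> v \<bullet> (A *\<^sub>v v) > 0)"

definition weighted_vec_sum :: "nat \<Rightarrow> nat \<Rightarrow> (nat \<Rightarrow> real) \<Rightarrow> (nat \<Rightarrow> real vec) \<Rightarrow> real vec" where
  "weighted_vec_sum k p w v = vec p (\<lambda>a. \<Sum>l=1..k. w l * v l $ a)"

definition group_mat_sum :: "nat \<Rightarrow> nat \<Rightarrow> (nat \<Rightarrow> real mat) \<Rightarrow> real mat" where
  "group_mat_sum k p B = mat p p (\<lambda>(a, b). \<Sum>l=1..k. B l $$ (a, b))"


text \<open>
  Model of a single member of the sequence: \<open>z l i j\<close> is the variable $z_{lij}$.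
  The joint law of the array is only constrained to be a product law, with
  the random vectors $Z_{l1}, \dots, Z_{ln_l}$ identically distributed; the coordinates of one
  $Z_{li}$ may have different laws.
\<close>

locale factor_model = prob_space M
  for M :: "'a measure" +
  fixes k p r :: nat
    and N :: "nat \<Rightarrow> nat"
    and \<mu> :: "nat \<Rightarrow> real vec"
    and \<Gamma> \<Sigma> :: "nat \<Rightarrow> real mat"
    and \<gamma> :: "nat \<Rightarrow> real"
    and z :: "nat \<Rightarrow> nat \<Rightarrow> nat \<Rightarrow> 'a \<Rightarrow> real"
  assumes r_ge_p: "r \<ge> p"
    and mu_carrier: "l \<in> {1..k} \<Longrightarrow> \<mu> l \<in> carrier_vec p"
    and Gamma_carrier: "l \<in> {1..k} \<Longrightarrow> \<Gamma> l \<in> carrier_mat p r"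
    and Gamma_Sigma: "l \<in> {1..k} \<Longrightarrow> \<Gamma> l * transpose_mat (\<Gamma> l) = \<Sigma> l"
    and Sigma_pos_def: "l \<in> {1..k} \<Longrightarrow> pos_def_mat (\<Sigma> l)"
    and indep: "indep_vars (\<lambda>_. borel) (\<lambda>(l, i, j). z l i j)
                  {(l, i, j). l \<in> {1..k} \<and> i \<in> {1..N l} \<and> j < r}"
    and ident_distr: "\<lbrakk>l \<in> {1..k}; i \<in> {1..N l}; i' \<in> {1..N l}\<rbrakk> \<Longrightarrow>
          distr M (\<Pi>\<^sub>M j\<in>{..<r}. borel) (\<lambda>\<omega>. \<lambda>j\<in>{..<r}. z l i j \<omega>) =
          distr M (\<Pi>\<^sub>M j\<in>{..<r}. borel) (\<lambda>\<omega>. \<lambda>j\<in>{..<r}. z l i' j \<omega>)"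
    and mean_zero: "\<lbrakk>l \<in> {1..k}; i \<in> {1..N l}; j < r\<rbrakk> \<Longrightarrow>
          integrable M (z l i j) \<and> expectation (z l i j) = 0"
    and cov_identity: "\<lbrakk>l \<in> {1..k}; i \<in> {1..N l}; j < r; j' < r\<rbrakk> \<Longrightarrow>
          integrable M (\<lambda>\<omega>. z l i j \<omega> * z l i j' \<omega>) \<and>
          expectation (\<lambda>\<omega>. z l i j \<omega> * z l i j' \<omega>) = (if j = j' then 1 else 0)"
    and fourth_moment: "\<lbrakk>l \<in> {1..k}; i \<in> {1..N l}; j < r\<rbrakk> \<Longrightarrow>
          integrable M (\<lambda>\<omega>. z l i j \<omega> ^ 4) \<and> expectation (\<lambda>\<omega>. z l i j \<omega> ^ 4) = 3 + \<gamma> l"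

definition observation ::
  "nat \<Rightarrow> (nat \<Rightarrow> real vec) \<Rightarrow> (nat \<Rightarrow> real mat) \<Rightarrow> (nat \<Rightarrow> nat \<Rightarrow> nat \<Rightarrow> 'a \<Rightarrow> real)
     \<Rightarrow> 'a \<Rightarrow> nat \<Rightarrow> nat \<Rightarrow> real vec" where
  "observation r \<mu> \<Gamma> z \<omega> l i = \<Gamma> l *\<^sub>v vec r (\<lambda>j. z l i j \<omega>) + \<mu> l"


text \<open>
  The statistics are functions of data \<open>x l i\<close>.  Divisions by zero, which occur only for very
  small groups (\<open>N l \<le> 4\<close>), have HOL's default value 0.  Likewise HOL's \<^const>\<open>sqrt\<close> is
  odd and total, so the square root of a negative value of \<open>sigma2_tilde\<close> is negative.
\<close>

definition total_size :: "nat \<Rightarrow> (nat \<Rightarrow> nat) \<Rightarrow> nat" where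
  "total_size k N = (\<Sum>l=1..k. N l)"

definition sample_mean :: "nat \<Rightarrow> nat set \<Rightarrow> (nat \<Rightarrow> real vec) \<Rightarrow> real vec" where
  "sample_mean p I y = vec p (\<lambda>a. (\<Sum>i\<in>I. y i $ a) / real (card I))"

definition sample_cov :: "nat \<Rightarrow> nat set \<Rightarrow> (nat \<Rightarrow> real vec) \<Rightarrow> real mat" where
  "sample_cov p I y = mat p p (\<lambda>(a, b).
     (\<Sum>i\<in>I. (y i $ a - sample_mean p I y $ a) * (y i $ b - sample_mean p I y $ b))
       / (real (card I) - 1))"

definition T_stat :: "nat \<Rightarrow> nat \<Rightarrow> (nat \<Rightarrow> nat) \<Rightarrow> (nat \<Rightarrow> nat \<Rightarrow> real vec) \<Rightarrow> real" where
  "T_stat k p N x = (let n = real (total_size k N) in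
     (\<Sum>l=1..k. (n - real (N l)) / (n * (real (N l) - 1)) *
        (\<Sum>i\<in>{1..N l}. \<Sum>j\<in>{1..N l} - {i}. x l i \<bullet> x l j))
     - (\<Sum>l\<in>{1..k}. \<Sum>s\<in>{1..k} - {l}. real (N l) * real (N s) / n *
          (sample_mean p {1..N l} (x l) \<bullet> sample_mean p {1..N s} (x s))))"

definition tr_sq_hat :: "nat \<Rightarrow> (nat \<Rightarrow> nat) \<Rightarrow> (nat \<Rightarrow> nat \<Rightarrow> real vec) \<Rightarrow> nat \<Rightarrow> real" where
  "tr_sq_hat p N x l = (let n1 = N l div 2 + 1 in
     mat_trace (sample_cov p {1..n1} (x l) * sample_cov p {n1 + 1..N l} (x l)))"

definition tr_prod_hat ::
  "nat \<Rightarrow> (nat \<Rightarrow> nat) \<Rightarrow> (nat \<Rightarrow> nat \<Rightarrow> real vec) \<Rightarrow> nat \<Rightarrow> nat \<Rightarrow> real" where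
  "tr_prod_hat p N x l s =
     mat_trace (sample_cov p {1..N l} (x l) * sample_cov p {1..N s} (x s))"

definition tr_sq_tilde :: "nat \<Rightarrow> (nat \<Rightarrow> nat) \<Rightarrow> (nat \<Rightarrow> nat \<Rightarrow> real vec) \<Rightarrow> nat \<Rightarrow> real" where
  "tr_sq_tilde p N x l = (let nl = real (N l); S = sample_cov p {1..N l} (x l) in
     (nl - 1)\<^sup>2 / ((nl + 1) * (nl - 2)) * (mat_trace (S * S) - 1 / (nl - 1) * (mat_trace S)\<^sup>2))"

definition sigma2_with ::
  "(nat \<Rightarrow> real) \<Rightarrow> nat \<Rightarrow> nat \<Rightarrow> (nat \<Rightarrow> nat) \<Rightarrow> (nat \<Rightarrow> nat \<Rightarrow> real vec) \<Rightarrow> real" where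
  "sigma2_with t k p N x = (let n = real (total_size k N) in
     2 / n\<^sup>2 *
       ((\<Sum>l=1..k. real (N l) * (n - real (N l))\<^sup>2 / (real (N l) - 1) * t l)
        + (\<Sum>l\<in>{1..k}. \<Sum>s\<in>{1..k} - {l}. real (N l) * real (N s) * tr_prod_hat p N x l s)))"

definition sigma2_hat ::
  "nat \<Rightarrow> nat \<Rightarrow> (nat \<Rightarrow> nat) \<Rightarrow> (nat \<Rightarrow> nat \<Rightarrow> real vec) \<Rightarrow> real" where
  "sigma2_hat k p N x = sigma2_with (tr_sq_hat p N x) k p N x"

definition sigma2_tilde ::
  "nat \<Rightarrow> nat \<Rightarrow> (nat \<Rightarrow> nat) \<Rightarrow> (nat \<Rightarrow> nat \<Rightarrow> real vec) \<Rightarrow> real" where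
  "sigma2_tilde k p N x = sigma2_with (tr_sq_tilde p N x) k p N x"

definition T1_hat :: "nat \<Rightarrow> nat \<Rightarrow> (nat \<Rightarrow> nat) \<Rightarrow> (nat \<Rightarrow> nat \<Rightarrow> real vec) \<Rightarrow> real" where
  "T1_hat k p N x = T_stat k p N x / sqrt (sigma2_hat k p N x)"

definition T2_hat :: "nat \<Rightarrow> nat \<Rightarrow> (nat \<Rightarrow> nat) \<Rightarrow> (nat \<Rightarrow> nat \<Rightarrow> real vec) \<Rightarrow> real" where
  "T2_hat k p N x = T_stat k p N x / sqrt (sigma2_tilde k p N x)"


definition asymptotic_shift ::
  "nat \<Rightarrow> nat \<Rightarrow> (nat \<Rightarrow> nat) \<Rightarrow> (nat \<Rightarrow> real) \<Rightarrow> (nat \<Rightarrow> real vec) \<Rightarrow> (nat \<Rightarrow> real mat) \<Rightarrow> real" where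
  "asymptotic_shift k p N lam \<mu> \<Sigma> =
     (let \<mu>t = weighted_vec_sum k p lam \<mu> in
      (sqrt 2 / 2 * real (total_size k N) * (\<Sum>l=1..k. lam l * ((\<mu> l - \<mu>t) \<bullet> (\<mu> l - \<mu>t))))
      / sqrt ((\<Sum>l=1..k. (1 - lam l)\<^sup>2 * mat_trace (\<Sigma> l * \<Sigma> l))
              + (\<Sum>l\<in>{1..k}. \<Sum>s\<in>{1..k} - {l}. lam l * lam s * mat_trace (\<Sigma> l * \<Sigma> s))))"

end

theory Submission
  imports Defs "HOL-Real_Asymp.Real_Asymp"
begin

text \<open>
  Write $T = \sum_{u \ne v} c_{uv} X_u^T X_v$ over all observations.  After centring, $T$ is its mean plus
  a linear part, negligible by (A2), plus a quadratic form $Q$ in the independent variables $z_{lij}$.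
  Ordering the observations turns $Q$ into $\sum_a z_a \xi_a$ with $\xi_a$ depending on earlier
  variables only, so $Q$ is asymptotically normal as soon as $\sum_a \xi_a^2$ concentrates.  This sum is
  the quadratic form with matrix $L^T L$, where $L$ is the strictly block triangular coefficient
  matrix of $Q$; since $c_{uv} = O(1/n)$, the Frobenius norm of $L^T L$ is bounded by the traces of
  fourfold products that (A3) controls.  Convergence of the characteristic function follows by
  telescoping the compensated exponentials.

  The trace estimators are squared Frobenius norms of centred Gram matrices.  The entries in a row
  of the Gram matrix are uncorrelated, so the centring is negligible in $L^1$; entries of
  disjoint pairs of observations are independent, so the sum of their squares concentrates.
\<close>

subsection \<open>Moments of forms in independent standardized variables\<close>

text \<open>Neither \<open>p\<close> nor the size of the covariance matrices is tied to
  \<open>n\<close>, so no bound may contain \<open>p\<close> or a trace such as tr(\<Sigma>_l):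
  every error is measured against tr(\<Sigma>_l \<Sigma>_s), and positivity of all limiting weights
  bounds these traces by a multiple of the normalizing variance \<open>S\<close>. Only fourth
  moments of the noise are assumed. Squares of Gram entries are therefore guaranteed a second moment
  only off the diagonal, and the diagonal has to be treated in L^1; likewise the cubic Taylor
  remainder is split into a square and a fourth power by a free parameter \<eta>. The conditional
  variance in the martingale argument is unbounded, which forces a predictable truncation before the
  exponential is compensated. Finally, the shift may diverge along the sequence, so the statistic
  itself has no limit law: the distribution functions have to converge uniformly, while the shift is
  needed only up to a relative error.\<close>

context prob_space
begin

text \<open>Measurability is bundled with integrability so that the closure rules for sums and
  products compose; on a probability space \<open>fourth_int\<close> implies
  \<open>square_int\<close>, which implies integrability.\<close>

definition square_int :: "('a \<Rightarrow> real) \<Rightarrow> bool" where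
  "square_int f \<longleftrightarrow> f \<in> borel_measurable M \<and> integrable M (\<lambda>\<omega>. (f \<omega>)\<^sup>2)"

definition fourth_int :: "('a \<Rightarrow> real) \<Rightarrow> bool" where
  "fourth_int f \<longleftrightarrow> f \<in> borel_measurable M \<and> integrable M (\<lambda>\<omega>. f \<omega> ^ 4)"

lemma square_intD:
  assumes "square_int f"
  shows "f \<in> borel_measurable M" "integrable M (\<lambda>\<omega>. (f \<omega>)\<^sup>2)"
  using assms by (auto simp: square_int_def)

lemma fourth_intD:
  assumes "fourth_int f"
  shows "f \<in> borel_measurable M" "integrable M (\<lambda>\<omega>. f \<omega> ^ 4)"
  using assms by (auto simp: fourth_int_def)

lemma square_int_mult:
  assumes "square_int f" "square_int g"
  shows "integrable M (\<lambda>\<omega>. f \<omega> * g \<omega>)"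
proof (rule Bochner_Integration.integrable_bound)
  show "integrable M (\<lambda>\<omega>. (f \<omega>)\<^sup>2 + (g \<omega>)\<^sup>2)"
    using assms by (auto dest: square_intD)
  show "(\<lambda>\<omega>. f \<omega> * g \<omega>) \<in> borel_measurable M"
    using assms by (intro borel_measurable_times square_intD)
  have "\<bar>x * y\<bar> \<le> x\<^sup>2 + y\<^sup>2" for x y :: real
    using sum_squares_bound[of "\<bar>x\<bar>" "\<bar>y\<bar>"] abs_ge_zero[of "x * y"]
    unfolding abs_mult power2_abs by linarith
  then show "AE \<omega> in M. norm (f \<omega> * g \<omega>) \<le> norm ((f \<omega>)\<^sup>2 + (g \<omega>)\<^sup>2)"
    by auto
qed

lemma square_int_const [simp]: "square_int (\<lambda>_. c)"
  by (simp add: square_int_def)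

lemma fourth_int_const [simp]: "fourth_int (\<lambda>_. c)"
  by (simp add: fourth_int_def)

lemma square_int_integrable: "square_int f \<Longrightarrow> integrable M f"
  using square_int_mult[of f "\<lambda>_. 1"] by simp

lemma square_int_add:
  assumes "square_int f" "square_int g"
  shows "square_int (\<lambda>\<omega>. f \<omega> + g \<omega>)"
  unfolding square_int_def power2_sum
  unfolding mult.assoc using assms square_int_mult[OF assms]
  by (intro conjI Bochner_Integration.integrable_add integrable_mult_right borel_measurable_add)
    (auto dest: square_intD)

lemma square_int_cmult: "square_int f \<Longrightarrow> square_int (\<lambda>\<omega>. c * f \<omega>)"
  by (auto simp: square_int_def power_mult_distrib)

lemma square_int_diff:
  assumes "square_int f" "square_int g"
  shows "square_int (\<lambda>\<omega>. f \<omega> - g \<omega>)"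
  using square_int_add[OF assms(1) square_int_cmult[OF assms(2), of "-1"]] by simp

lemma square_int_sum:
  "(\<And>i. i \<in> A \<Longrightarrow> square_int (f i)) \<Longrightarrow> square_int (\<lambda>\<omega>. \<Sum>i\<in>A. f i \<omega>)"
  by (induction A rule: infinite_finite_induct) (auto intro: square_int_add)

lemma fourth_int_square: "fourth_int f \<Longrightarrow> square_int (\<lambda>\<omega>. (f \<omega>)\<^sup>2)"
  by (auto simp: square_int_def fourth_int_def)

lemma fourth_int_square_int:
  assumes "fourth_int f"
  shows "square_int f"
  using assms square_int_integrable[OF fourth_int_square[OF assms]]
  by (auto simp: square_int_def fourth_int_def)

lemma fourth_int_mult:
  assumes "fourth_int f" "fourth_int g"
  shows "square_int (\<lambda>\<omega>. f \<omega> * g \<omega>)"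
  unfolding square_int_def power_mult_distrib
  using assms square_int_mult[OF fourth_int_square[OF assms(1)] fourth_int_square[OF assms(2)]]
  by (auto intro!: borel_measurable_times dest: fourth_intD)

lemma fourth_int_add:
  assumes "fourth_int f" "fourth_int g"
  shows "fourth_int (\<lambda>\<omega>. f \<omega> + g \<omega>)"
proof -
  have "square_int (\<lambda>\<omega>. (f \<omega>)\<^sup>2 + (g \<omega>)\<^sup>2 + 2 * (f \<omega> * g \<omega>))"
    by (intro square_int_add square_int_cmult fourth_int_square fourth_int_mult assms)
  then have "square_int (\<lambda>\<omega>. (f \<omega> + g \<omega>)\<^sup>2)"
    by (simp add: power2_sum mult.assoc)
  then show ?thesis
    using assms by (auto simp: square_int_def fourth_int_def intro!: borel_measurable_add)
qed

lemma fourth_int_cmult: "fourth_int f \<Longrightarrow> fourth_int (\<lambda>\<omega>. c * f \<omega>)"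
  by (auto simp: fourth_int_def power_mult_distrib)

lemma fourth_int_sum:
  "(\<And>i. i \<in> A \<Longrightarrow> fourth_int (f i)) \<Longrightarrow> fourth_int (\<lambda>\<omega>. \<Sum>i\<in>A. f i \<omega>)"
  by (induction A rule: infinite_finite_induct) (auto intro: fourth_int_add)

text \<open>Discriminant argument: the second moment of \<open>x * f + g\<close> is a quadratic
  polynomial in \<open>x\<close> without negative values.\<close>

lemma expectation_cauchy_schwarz:
  assumes "square_int f" "square_int g"
  shows "(expectation (\<lambda>\<omega>. f \<omega> * g \<omega>))\<^sup>2 \<le>
    expectation (\<lambda>\<omega>. (f \<omega>)\<^sup>2) * expectation (\<lambda>\<omega>. (g \<omega>)\<^sup>2)"
proof -
  define a b c where "a = expectation (\<lambda>\<omega>. (f \<omega>)\<^sup>2)" and "b = expectation (\<lambda>\<omega>. f \<omega> * g \<omega>)"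
    and "c = expectation (\<lambda>\<omega>. (g \<omega>)\<^sup>2)"
  have *: "0 \<le> a * x\<^sup>2 + 2 * b * x + c" for x
  proof -
    have "0 \<le> expectation (\<lambda>\<omega>. (x * f \<omega> + g \<omega>)\<^sup>2)"
      by simp
    also have "\<dots> = expectation (\<lambda>\<omega>. x\<^sup>2 * (f \<omega>)\<^sup>2 + 2 * x * (f \<omega> * g \<omega>) + (g \<omega>)\<^sup>2)"
      by (simp add: power2_sum power_mult_distrib algebra_simps)
    also have "\<dots> = x\<^sup>2 * a + 2 * x * b + c"
      using square_intD(2)[OF assms(1)] square_intD(2)[OF assms(2)] square_int_mult[OF assms]
      by (simp add: a_def b_def c_def)
    finally show ?thesis
      by (simp add: algebra_simps)
  qed
  have "0 \<le> a" "0 \<le> c"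
    by (auto simp: a_def c_def)
  show ?thesis
  proof (cases "a = 0")
    case True
    have "b = 0"
    proof (rule ccontr)
      assume "b \<noteq> 0"
      \<comment> \<open>With \<open>a = 0\<close> the polynomial is linear with nonzero slope, and
        this \<open>x\<close> gives it the value -1.\<close>
      then show False
        using *[of "- (c + 1) / (2 * b)"] True by simp
    qed
    then show ?thesis
      by (simp add: True a_def[symmetric] b_def[symmetric] c_def[symmetric])
  next
    case False
    with \<open>0 \<le> a\<close> have "a > 0" by simp
    then have "0 \<le> c - b\<^sup>2 / a"
      using *[of "- b / a"] by (simp add: power2_eq_square field_simps)
    then show ?thesis
      using \<open>a > 0\<close> by (simp add: field_simps a_def[symmetric] b_def[symmetric] c_def[symmetric])
  qed
qed

text \<open>Cauchy-Schwarz against the constant 1. It turns variance bounds into L^1 bounds, the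
  form in which the errors are finally added up.\<close>

lemma expectation_abs_le_sqrt:
  assumes "square_int f"
  shows "expectation (\<lambda>\<omega>. \<bar>f \<omega>\<bar>) \<le> sqrt (expectation (\<lambda>\<omega>. (f \<omega>)\<^sup>2))"
proof (rule real_le_rsqrt)
  have "square_int (\<lambda>\<omega>. \<bar>f \<omega>\<bar>)"
    using assms by (auto simp: square_int_def)
  from expectation_cauchy_schwarz[OF this, of "\<lambda>_. 1"]
  show "(expectation (\<lambda>\<omega>. \<bar>f \<omega>\<bar>))\<^sup>2 \<le> expectation (\<lambda>\<omega>. (f \<omega>)\<^sup>2)"
    by (simp add: prob_space)
qed

end

section \<open>Sigma-algebras of subfamilies, and moments of linear and quadratic forms\<close>

locale std_family = prob_space M for M :: "'a measure" +
  fixes I :: "'i set" and Z :: "'i \<Rightarrow> 'a \<Rightarrow> real" and K :: real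
  assumes finite_I: "finite I"
    and indep: "indep_vars (\<lambda>_. borel) Z I"
    and fourth_int_Z: "i \<in> I \<Longrightarrow> fourth_int (Z i)"
    and mean_Z: "i \<in> I \<Longrightarrow> expectation (Z i) = 0"
    and var_Z: "i \<in> I \<Longrightarrow> expectation (\<lambda>\<omega>. (Z i \<omega>)\<^sup>2) = 1"
    and fourth_Z: "i \<in> I \<Longrightarrow> expectation (\<lambda>\<omega>. Z i \<omega> ^ 4) \<le> K"
    and K_ge: "3 \<le> K"
begin

text \<open>The sigma-algebra generated by the \<open>Z i\<close> with \<open>i\<close> in
  \<open>S\<close>, written as the pullback of the product sigma-algebra because this is the form in
  which \<open>indep_var_restrict\<close> yields independence.\<close>

definition F :: "'i set \<Rightarrow> 'a measure" where
  "F S = vimage_algebra (space M) (\<lambda>\<omega>. \<lambda>i\<in>S. Z i \<omega>) (PiM S (\<lambda>_. borel))"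

lemma space_F [simp]: "space (F S) = space M"
  by (simp add: F_def)

lemma measurable_Z: "i \<in> I \<Longrightarrow> Z i \<in> borel_measurable M"
  using indep by (auto simp: indep_vars_def)

lemma sets_F_subset:
  assumes "S \<subseteq> I"
  shows "sets (F S) \<subseteq> sets M"
proof -
  have "(\<lambda>\<omega>. \<lambda>i\<in>S. Z i \<omega>) \<in> measurable M (PiM S (\<lambda>_. borel))"
    using assms measurable_Z by (intro measurable_restrict) auto
  then show ?thesis
    unfolding F_def sets_vimage_algebra
    by (intro sets.sigma_sets_subset) (auto simp: measurable_sets)
qed

lemma measurable_F_M: "S \<subseteq> I \<Longrightarrow> f \<in> measurable (F S) N \<Longrightarrow> f \<in> measurable M N"
  by (rule measurable_from_subalg[of M "F S"]) (auto simp: subalgebra_def sets_F_subset)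

lemma measurable_F_Z: "i \<in> S \<Longrightarrow> Z i \<in> borel_measurable (F S)"
proof -
  assume "i \<in> S"
  have "(\<lambda>\<omega>. \<lambda>i\<in>S. Z i \<omega>) \<in> measurable (F S) (PiM S (\<lambda>_. borel))"
    unfolding F_def by (rule measurable_vimage_algebra1) (auto simp: space_PiM)
  from measurable_compose[OF this measurable_component_singleton[OF \<open>i \<in> S\<close>]]
  show ?thesis
    using \<open>i \<in> S\<close> by simp
qed

lemma measurable_F_mono:
  assumes "S \<subseteq> T" "f \<in> measurable (F S) N"
  shows "f \<in> measurable (F T) N"
proof -
  have "(\<lambda>\<omega>. \<lambda>i\<in>S. Z i \<omega>) \<in> measurable (F T) (PiM S (\<lambda>_. borel))"
    using assms measurable_F_Z by (intro measurable_restrict) auto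
  then have "sets (F S) \<subseteq> sets (F T)"
    unfolding F_def[of S] sets_vimage_algebra
    using sets.sigma_sets_subset[of _ "F T"]
    by (intro sets.sigma_sets_subset[of _ "F T", simplified]) (auto dest: measurable_sets)
  then show ?thesis
    using assms(2) by (intro measurable_from_subalg[of "F T" "F S"]) (auto simp: subalgebra_def)
qed

text \<open>The sigma-algebras of disjoint index sets are independent, and those generated by
  \<open>f\<close> and \<open>g\<close> are contained in them. Measurability in \<open>F S\<close>
  thus replaces an explicit representation as a function of the variables in
  \<open>S\<close>.\<close>

lemma indep_var_F:
  assumes "f \<in> measurable (F S) N1" "g \<in> measurable (F T) N2" "S \<inter> T = {}" "S \<subseteq> I" "T \<subseteq> I"
  shows "indep_var N1 f N2 g"
proof -
  have *: "sigma_sets (space M) {X -` A \<inter> space M |A. A \<in> sets N} \<subseteq> sets (F S)"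
    if "X \<in> measurable (F S) N" for X and N :: "'z measure" and S
  proof -
    have "{X -` A \<inter> space M |A. A \<in> sets N} \<subseteq> sets (F S)"
      using measurable_sets[OF that] by auto
    from sets.sigma_sets_subset[OF this] show ?thesis
      by simp
  qed
  have "indep_set (sets (F S)) (sets (F T))"
    using indep_var_restrict[OF indep assms(3-5)]
    unfolding indep_var_eq F_def sets_vimage_algebra by simp
  then have "indep_set (sigma_sets (space M) {f -` A \<inter> space M |A. A \<in> sets N1})
     (sigma_sets (space M) {g -` A \<inter> space M |A. A \<in> sets N2})"
    unfolding indep_set_def
    by (rule indep_sets_mono_sets) (use *[OF assms(1)] *[OF assms(2)] in \<open>auto split: bool.split\<close>)
  then show ?thesis
    unfolding indep_var_eq using assms measurable_F_M by auto
qed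

lemma
  fixes f g :: "'a \<Rightarrow> 'b::{real_normed_field, banach, second_countable_topology}"
  assumes "f \<in> borel_measurable (F S)" "g \<in> borel_measurable (F T)" "S \<inter> T = {}" "S \<subseteq> I" "T \<subseteq> I"
    and "integrable M f" "integrable M g"
  shows expectation_F_mult: "expectation (\<lambda>\<omega>. f \<omega> * g \<omega>) = expectation f * expectation g"
    and integrable_F_mult: "integrable M (\<lambda>\<omega>. f \<omega> * g \<omega>)"
  using indep_var_lebesgue_integral indep_var_integrable indep_var_F[OF assms(1-5)] assms(6-7) by blast+

text \<open>Independence keeps the fourth moment of a product finite; for dependent factors
  \<open>fourth_int_mult\<close> gives a second moment only.\<close>

lemma fourth_int_F_mult:
  assumes "f \<in> borel_measurable (F S)" "g \<in> borel_measurable (F T)" "S \<inter> T = {}" "S \<subseteq> I" "T \<subseteq> I"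
    and "fourth_int f" "fourth_int g"
  shows "fourth_int (\<lambda>\<omega>. f \<omega> * g \<omega>)"
  unfolding fourth_int_def power_mult_distrib
  using assms by (auto dest: fourth_intD intro!: borel_measurable_times integrable_F_mult[OF _ _ assms(3-5)])

lemma square_int_F_mult:
  assumes "f \<in> borel_measurable (F S)" "g \<in> borel_measurable (F T)" "S \<inter> T = {}" "S \<subseteq> I" "T \<subseteq> I"
    and "square_int f" "square_int g"
  shows "square_int (\<lambda>\<omega>. f \<omega> * g \<omega>)"
  unfolding square_int_def power_mult_distrib
  using assms by (auto dest: square_intD intro!: borel_measurable_times integrable_F_mult[OF _ _ assms(3-5)])

lemma expectation_linear_form_mult:
  assumes "S \<inter> T = {}" "S \<subseteq> I" "T \<subseteq> I"
    and "\<And>j. j \<in> S \<Longrightarrow> a j \<in> borel_measurable (F T)" "w \<in> borel_measurable (F T)"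
    and "\<And>j. j \<in> S \<Longrightarrow> integrable M (\<lambda>\<omega>. a j \<omega> * w \<omega>)"
  shows "expectation (\<lambda>\<omega>. (\<Sum>j\<in>S. a j \<omega> * Z j \<omega>) * w \<omega>) = 0"
proof -
  have *: "integrable M (\<lambda>\<omega>. Z j \<omega> * (a j \<omega> * w \<omega>))"
    "expectation (\<lambda>\<omega>. Z j \<omega> * (a j \<omega> * w \<omega>)) = 0" if "j \<in> S" for j
  proof -
    have [measurable]: "a j \<in> borel_measurable (F T)" "w \<in> borel_measurable (F T)"
      using that assms by auto
    have j: "j \<in> I" and d: "{j} \<inter> T = {}" "{j} \<subseteq> I" "integrable M (Z j)"
      using that assms square_int_integrable fourth_int_square_int fourth_int_Z by auto
    show "integrable M (\<lambda>\<omega>. Z j \<omega> * (a j \<omega> * w \<omega>))"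
      by (rule integrable_F_mult[OF _ _ d(1,2) assms(3) d(3) assms(6)[OF that]]) (auto intro: measurable_F_Z)
    have "expectation (\<lambda>\<omega>. Z j \<omega> * (a j \<omega> * w \<omega>)) = expectation (Z j) * expectation (\<lambda>\<omega>. a j \<omega> * w \<omega>)"
      by (rule expectation_F_mult[OF _ _ d(1,2) assms(3) d(3) assms(6)[OF that]]) (auto intro: measurable_F_Z)
    then show "expectation (\<lambda>\<omega>. Z j \<omega> * (a j \<omega> * w \<omega>)) = 0"
      using mean_Z[OF j] by simp
  qed
  have "expectation (\<lambda>\<omega>. (\<Sum>j\<in>S. a j \<omega> * Z j \<omega>) * w \<omega>) =
    expectation (\<lambda>\<omega>. \<Sum>j\<in>S. Z j \<omega> * (a j \<omega> * w \<omega>))"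
    by (simp add: sum_distrib_right sum_distrib_left mult_ac)
  also have "\<dots> = 0"
    using * by (subst Bochner_Integration.integral_sum) auto
  finally show ?thesis .
qed

lemma square_int_Z: "i \<in> I \<Longrightarrow> square_int (Z i)"
  by (intro fourth_int_square_int fourth_int_Z)

lemma integrable_Z: "i \<in> I \<Longrightarrow> integrable M (Z i)"
  by (intro square_int_integrable square_int_Z)

text \<open>Bookkeeping shared by the next two inductions: when \<open>x\<close> is added, the old
  form and all coefficients are measurable on \<open>S \<union> T\<close>, hence independent of
  \<open>Z x\<close>.\<close>

lemma linear_form_insert:
  assumes "x \<notin> S" "insert x S \<inter> T = {}" "insert x S \<subseteq> I" "T \<subseteq> I" "finite S"
    and "\<And>j. j \<in> insert x S \<Longrightarrow> a j \<in> borel_measurable (F T)"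
    and "\<And>j. j \<in> insert x S \<Longrightarrow> fourth_int (a j)"
  shows "x \<notin> S \<union> T" "S \<union> T \<subseteq> I"
    "\<And>j. j \<in> insert x S \<Longrightarrow> a j \<in> borel_measurable (F (S \<union> T))"
    "(\<lambda>\<omega>. \<Sum>j\<in>S. a j \<omega> * Z j \<omega>) \<in> borel_measurable (F (S \<union> T))"
    "fourth_int (\<lambda>\<omega>. \<Sum>j\<in>S. a j \<omega> * Z j \<omega>)"
proof -
  show "x \<notin> S \<union> T" "S \<union> T \<subseteq> I" using assms by auto
  show *: "\<And>j. j \<in> insert x S \<Longrightarrow> a j \<in> borel_measurable (F (S \<union> T))"
    using assms(6) by (rule measurable_F_mono[of T, rotated]) auto
  show "(\<lambda>\<omega>. \<Sum>j\<in>S. a j \<omega> * Z j \<omega>) \<in> borel_measurable (F (S \<union> T))"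
    using *
    by (intro borel_measurable_sum borel_measurable_times measurable_F_Z) auto
  have "fourth_int (\<lambda>\<omega>. a j \<omega> * Z j \<omega>)" if "j \<in> S" for j
    using that assms fourth_int_Z[of j]
    by (intro fourth_int_F_mult[of _ T _ "{j}"] measurable_F_Z) auto
  then show "fourth_int (\<lambda>\<omega>. \<Sum>j\<in>S. a j \<omega> * Z j \<omega>)"
    by (rule fourth_int_sum)
qed

text \<open>The variables are orthonormal given \<open>F T\<close>, so the conditional second moment
  is the sum of the squared coefficients. The factor \<open>w\<close> is carried along because the
  fourth moment bound applies this with \<open>w\<close> the coefficient of one further
  variable.\<close>

lemma expectation_square_linear_form:
  assumes "finite S" "S \<inter> T = {}" "S \<subseteq> I" "T \<subseteq> I"
    and "\<And>j. j \<in> S \<Longrightarrow> a j \<in> borel_measurable (F T)" "w \<in> borel_measurable (F T)"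
    and "\<And>j. j \<in> S \<Longrightarrow> fourth_int (a j)" "fourth_int w"
  shows "expectation (\<lambda>\<omega>. (\<Sum>j\<in>S. a j \<omega> * Z j \<omega>)\<^sup>2 * (w \<omega>)\<^sup>2) =
    expectation (\<lambda>\<omega>. (\<Sum>j\<in>S. (a j \<omega>)\<^sup>2) * (w \<omega>)\<^sup>2)"
  using assms
proof (induction S rule: finite_induct)
  case (insert x S)
  define A where "A \<omega> = (\<Sum>j\<in>S. a j \<omega> * Z j \<omega>)" for \<omega>
  note * = linear_form_insert[of x S T a, OF insert.hyps(2) insert.prems(1-3) insert.hyps(1) insert.prems(4,6), folded A_def]
  have d: "(S \<union> T) \<inter> {x} = {}" "{x} \<subseteq> I" "x \<in> I"
    using *(1) insert.prems by auto
  have meas: "a x \<in> borel_measurable (F (S \<union> T))" "w \<in> borel_measurable (F (S \<union> T))"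
    using *(3)[of x] measurable_F_mono[OF _ insert.prems(5), of "S \<union> T"] by auto
  have [simp]: "fourth_int (a x)" "fourth_int w" "fourth_int A"
    using insert.prems *(5) by (auto simp: A_def[abs_def])
  have [measurable]: "a x \<in> borel_measurable (F (S \<union> T))" "w \<in> borel_measurable (F (S \<union> T))"
    "A \<in> borel_measurable (F (S \<union> T))" using meas *(4) by (auto simp: A_def[abs_def])
  have iA: "integrable M (\<lambda>\<omega>. (A \<omega>)\<^sup>2 * (w \<omega>)\<^sup>2)" "integrable M (\<lambda>\<omega>. (a x \<omega>)\<^sup>2 * (w \<omega>)\<^sup>2)"
    "integrable M (\<lambda>\<omega>. A \<omega> * a x \<omega> * (w \<omega>)\<^sup>2)"
    by (auto intro!: square_int_mult fourth_int_square fourth_int_mult)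
  have iZ: "integrable M (\<lambda>\<omega>. (Z x \<omega>)\<^sup>2)" "integrable M (Z x)"
    using square_intD(2)[OF square_int_Z[OF d(3)]] integrable_Z[OF d(3)] by auto
  note [measurable] = measurable_F_Z[of x "{x}"]
  have 1: "expectation (\<lambda>\<omega>. (a x \<omega>)\<^sup>2 * (w \<omega>)\<^sup>2 * (Z x \<omega>)\<^sup>2) = expectation (\<lambda>\<omega>. (a x \<omega>)\<^sup>2 * (w \<omega>)\<^sup>2)"
    "integrable M (\<lambda>\<omega>. (a x \<omega>)\<^sup>2 * (w \<omega>)\<^sup>2 * (Z x \<omega>)\<^sup>2)"
    using expectation_F_mult[OF _ _ d(1) *(2) d(2) iA(2) iZ(1)]
      integrable_F_mult[OF _ _ d(1) *(2) d(2) iA(2) iZ(1)] var_Z[OF d(3)] by auto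
  have 2: "expectation (\<lambda>\<omega>. A \<omega> * a x \<omega> * (w \<omega>)\<^sup>2 * Z x \<omega>) = 0"
    "integrable M (\<lambda>\<omega>. A \<omega> * a x \<omega> * (w \<omega>)\<^sup>2 * Z x \<omega>)"
    using expectation_F_mult[OF _ _ d(1) *(2) d(2) iA(3) iZ(2)]
      integrable_F_mult[OF _ _ d(1) *(2) d(2) iA(3) iZ(2)] mean_Z[OF d(3)] by auto
  have iS: "integrable M (\<lambda>\<omega>. (\<Sum>j\<in>S. (a j \<omega>)\<^sup>2) * (w \<omega>)\<^sup>2)"
    using insert.prems by (intro square_int_mult square_int_sum fourth_int_square) auto
  have "(u * y + v)\<^sup>2 * w = v\<^sup>2 * w + 2 * (v * u * w * y) + u\<^sup>2 * w * y\<^sup>2" for u v w y :: real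
    by (simp add: power2_eq_square algebra_simps)
  then have "expectation (\<lambda>\<omega>. (\<Sum>j\<in>insert x S. a j \<omega> * Z j \<omega>)\<^sup>2 * (w \<omega>)\<^sup>2) =
    expectation (\<lambda>\<omega>. (A \<omega>)\<^sup>2 * (w \<omega>)\<^sup>2 + 2 * (A \<omega> * a x \<omega> * (w \<omega>)\<^sup>2 * Z x \<omega>)
      + (a x \<omega>)\<^sup>2 * (w \<omega>)\<^sup>2 * (Z x \<omega>)\<^sup>2)"
    using insert.hyps by (simp add: A_def)
  also have "\<dots> = expectation (\<lambda>\<omega>. (A \<omega>)\<^sup>2 * (w \<omega>)\<^sup>2) + expectation (\<lambda>\<omega>. (a x \<omega>)\<^sup>2 * (w \<omega>)\<^sup>2)"
    using iA 1 2 by simp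
  also have "expectation (\<lambda>\<omega>. (A \<omega>)\<^sup>2 * (w \<omega>)\<^sup>2) = expectation (\<lambda>\<omega>. (\<Sum>j\<in>S. (a j \<omega>)\<^sup>2) * (w \<omega>)\<^sup>2)"
    unfolding A_def using insert.prems by (intro insert.IH) auto
  also have "\<dots> + expectation (\<lambda>\<omega>. (a x \<omega>)\<^sup>2 * (w \<omega>)\<^sup>2) =
    expectation (\<lambda>\<omega>. (\<Sum>j\<in>insert x S. (a j \<omega>)\<^sup>2) * (w \<omega>)\<^sup>2)"
    using insert.hyps iA iS by (simp add: algebra_simps)
  finally show ?case .
qed simp

text \<open>Expand the fourth power when one variable is added. The terms odd in \<open>Z x\<close>
  vanish; as \<open>K\<close> is at least 3, the factor 6 of the middle term is at most
  \<open>2 * K\<close>, and what remains is bounded by \<open>K\<close> times the expansion of the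
  square of \<open>B + (a x)\<^sup>2\<close>. So the constant reproduces itself.\<close>

lemma expectation_fourth_linear_form:
  assumes "finite S" "S \<inter> T = {}" "S \<subseteq> I" "T \<subseteq> I"
    and "\<And>j. j \<in> S \<Longrightarrow> a j \<in> borel_measurable (F T)"
    and "\<And>j. j \<in> S \<Longrightarrow> fourth_int (a j)"
  shows "expectation (\<lambda>\<omega>. (\<Sum>j\<in>S. a j \<omega> * Z j \<omega>) ^ 4) \<le>
    K * expectation (\<lambda>\<omega>. (\<Sum>j\<in>S. (a j \<omega>)\<^sup>2)\<^sup>2)"
  using assms
proof (induction S rule: finite_induct)
  case (insert x S)
  define A where "A \<omega> = (\<Sum>j\<in>S. a j \<omega> * Z j \<omega>)" for \<omega>
  define B where "B \<omega> = (\<Sum>j\<in>S. (a j \<omega>)\<^sup>2)" for \<omega>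
  note * = linear_form_insert[of x S T a, OF insert.hyps(2) insert.prems(1-3) insert.hyps(1) insert.prems(4,5), folded A_def]
  have d: "(S \<union> T) \<inter> {x} = {}" "{x} \<subseteq> I" "x \<in> I"
    using *(1) insert.prems by auto
  have [simp]: "fourth_int (a x)" "fourth_int A"
    using insert.prems *(5) by (auto simp: A_def[abs_def])
  have sB: "square_int B"
    unfolding B_def using insert.prems by (intro square_int_sum fourth_int_square) auto
  have [measurable]: "a x \<in> borel_measurable (F (S \<union> T))" "A \<in> borel_measurable (F (S \<union> T))"
    using *(3)[of x] *(4) by (auto simp: A_def[abs_def])
  note [measurable] = measurable_F_Z[of x "{x}"]
  have p: "x1 ^ 3 = x1\<^sup>2 * x1" "x1 ^ 4 = x1\<^sup>2 * x1\<^sup>2" for x1 :: real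
    by (simp_all add: power2_eq_square power3_eq_cube power4_eq_xxxx)
  have iA: "integrable M (\<lambda>\<omega>. A \<omega> ^ 4)" "integrable M (\<lambda>\<omega>. A \<omega> ^ 3 * a x \<omega>)"
    "integrable M (\<lambda>\<omega>. (A \<omega>)\<^sup>2 * (a x \<omega>)\<^sup>2)" "integrable M (\<lambda>\<omega>. A \<omega> * a x \<omega> ^ 3)"
    "integrable M (\<lambda>\<omega>. a x \<omega> ^ 4)"
    using fourth_intD(2)[of A] fourth_intD(2)[of "a x"] square_int_mult[OF fourth_int_square fourth_int_square, of A "a x"]
      square_int_mult[OF fourth_int_square fourth_int_mult, of A A "a x"]
      square_int_mult[OF fourth_int_square fourth_int_mult, of "a x" A "a x"]
    by (auto simp: p(1) mult_ac)
  have Z4: "fourth_int (Z x)" using fourth_int_Z d by auto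
  have iZ: "integrable M (Z x)" "integrable M (\<lambda>\<omega>. (Z x \<omega>)\<^sup>2)" "integrable M (\<lambda>\<omega>. Z x \<omega> ^ 3)"
    "integrable M (\<lambda>\<omega>. Z x \<omega> ^ 4)"
    using integrable_Z[OF d(3)] square_intD(2)[OF square_int_Z[OF d(3)]]
      fourth_intD[OF Z4] square_int_mult[OF fourth_int_square fourth_int_square_int, OF Z4 Z4]
    by (auto simp: p(1))
  have 1: "expectation (\<lambda>\<omega>. A \<omega> ^ 3 * a x \<omega> * Z x \<omega>) = 0"
    "integrable M (\<lambda>\<omega>. A \<omega> ^ 3 * a x \<omega> * Z x \<omega>)"
    using expectation_F_mult[OF _ _ d(1) *(2) d(2) iA(2) iZ(1)]
      integrable_F_mult[OF _ _ d(1) *(2) d(2) iA(2) iZ(1)] mean_Z[OF d(3)] by auto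
  have 2: "expectation (\<lambda>\<omega>. (A \<omega>)\<^sup>2 * (a x \<omega>)\<^sup>2 * (Z x \<omega>)\<^sup>2) = expectation (\<lambda>\<omega>. (A \<omega>)\<^sup>2 * (a x \<omega>)\<^sup>2)"
    "integrable M (\<lambda>\<omega>. (A \<omega>)\<^sup>2 * (a x \<omega>)\<^sup>2 * (Z x \<omega>)\<^sup>2)"
    using expectation_F_mult[OF _ _ d(1) *(2) d(2) iA(3) iZ(2)]
      integrable_F_mult[OF _ _ d(1) *(2) d(2) iA(3) iZ(2)] var_Z[OF d(3)] by auto
  \<comment> \<open>The third moment of \<open>Z x\<close> need not vanish; its term drops out
    because the other factor is linear in the centred variables of \<open>S\<close>.\<close>
  have "integrable M (\<lambda>\<omega>. a j \<omega> * a x \<omega> ^ 3)" if "j \<in> S" for j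
    using square_int_mult[OF fourth_int_square fourth_int_mult, of "a x" "a j" "a x"] that insert.prems
    by (auto simp: p(1) mult_ac)
  then have "expectation (\<lambda>\<omega>. A \<omega> * a x \<omega> ^ 3) = 0"
    unfolding A_def using insert.prems
    by (intro expectation_linear_form_mult[where T=T] borel_measurable_power) auto
  then have 3: "expectation (\<lambda>\<omega>. A \<omega> * a x \<omega> ^ 3 * Z x \<omega> ^ 3) = 0"
    "integrable M (\<lambda>\<omega>. A \<omega> * a x \<omega> ^ 3 * Z x \<omega> ^ 3)"
    using expectation_F_mult[OF _ _ d(1) *(2) d(2) iA(4) iZ(3)]
      integrable_F_mult[OF _ _ d(1) *(2) d(2) iA(4) iZ(3)] by auto
  have 4: "expectation (\<lambda>\<omega>. a x \<omega> ^ 4 * Z x \<omega> ^ 4) = expectation (\<lambda>\<omega>. a x \<omega> ^ 4) * expectation (\<lambda>\<omega>. Z x \<omega> ^ 4)"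
    "integrable M (\<lambda>\<omega>. a x \<omega> ^ 4 * Z x \<omega> ^ 4)"
    using expectation_F_mult[OF _ _ d(1) *(2) d(2) iA(5) iZ(4)]
      integrable_F_mult[OF _ _ d(1) *(2) d(2) iA(5) iZ(4)] by auto
  have "(u + v * z) ^ 4 = u ^ 4 + 4 * (u ^ 3 * v * z) + 6 * (u\<^sup>2 * v\<^sup>2 * z\<^sup>2) + 4 * (u * v ^ 3 * z ^ 3)
      + v ^ 4 * z ^ 4" for u v z :: real
    by (simp add: power2_eq_square power3_eq_cube power4_eq_xxxx algebra_simps)
  then have "expectation (\<lambda>\<omega>. (\<Sum>j\<in>insert x S. a j \<omega> * Z j \<omega>) ^ 4) =
    expectation (\<lambda>\<omega>. A \<omega> ^ 4 + 4 * (A \<omega> ^ 3 * a x \<omega> * Z x \<omega>) + 6 * ((A \<omega>)\<^sup>2 * (a x \<omega>)\<^sup>2 * (Z x \<omega>)\<^sup>2)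
      + 4 * (A \<omega> * a x \<omega> ^ 3 * Z x \<omega> ^ 3) + a x \<omega> ^ 4 * Z x \<omega> ^ 4)"
    using insert.hyps by (simp add: A_def[symmetric] add.commute)
  also have "\<dots> = expectation (\<lambda>\<omega>. A \<omega> ^ 4) + 6 * expectation (\<lambda>\<omega>. (A \<omega>)\<^sup>2 * (a x \<omega>)\<^sup>2) +
      expectation (\<lambda>\<omega>. a x \<omega> ^ 4) * expectation (\<lambda>\<omega>. Z x \<omega> ^ 4)"
    using iA 1 2 3 4 by simp
  also have "expectation (\<lambda>\<omega>. (A \<omega>)\<^sup>2 * (a x \<omega>)\<^sup>2) = expectation (\<lambda>\<omega>. B \<omega> * (a x \<omega>)\<^sup>2)"
    unfolding A_def B_def using insert.prems insert.hyps
    by (intro expectation_square_linear_form[where T=T]) auto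
  also have "expectation (\<lambda>\<omega>. A \<omega> ^ 4) \<le> K * expectation (\<lambda>\<omega>. (B \<omega>)\<^sup>2)"
    unfolding A_def B_def using insert.prems by (intro insert.IH) auto
  also have "expectation (\<lambda>\<omega>. a x \<omega> ^ 4) * expectation (\<lambda>\<omega>. Z x \<omega> ^ 4) \<le> expectation (\<lambda>\<omega>. a x \<omega> ^ 4) * K"
    by (intro mult_left_mono fourth_Z d) simp
  also have "6 * expectation (\<lambda>\<omega>. B \<omega> * (a x \<omega>)\<^sup>2) \<le> 2 * K * expectation (\<lambda>\<omega>. B \<omega> * (a x \<omega>)\<^sup>2)"
    using K_ge by (intro mult_right_mono) (auto simp: B_def intro!: Bochner_Integration.integral_nonneg mult_nonneg_nonneg sum_nonneg)
  also have "K * expectation (\<lambda>\<omega>. (B \<omega>)\<^sup>2) + 2 * K * expectation (\<lambda>\<omega>. B \<omega> * (a x \<omega>)\<^sup>2) +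
      expectation (\<lambda>\<omega>. a x \<omega> ^ 4) * K =
     K * expectation (\<lambda>\<omega>. (B \<omega>)\<^sup>2 + 2 * (B \<omega> * (a x \<omega>)\<^sup>2) + a x \<omega> ^ 4)"
    using iA(5) square_intD(2)[OF sB] square_int_mult[OF sB fourth_int_square, of "a x"]
    by (simp add: distrib_left)
  also have "\<dots> = K * expectation (\<lambda>\<omega>. (\<Sum>j\<in>insert x S. (a j \<omega>)\<^sup>2)\<^sup>2)"
  proof -
    have "(u\<^sup>2 + v)\<^sup>2 = v\<^sup>2 + 2 * (v * u\<^sup>2) + u ^ 4" for u v :: real
      by (simp add: power2_eq_square power4_eq_xxxx algebra_simps)
    then show ?thesis
      using insert.hyps by (simp add: B_def)
  qed
  finally show ?case by simp
qed simp

corollary fourth_int_linear_form: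
  assumes "S \<subseteq> I"
  shows "fourth_int (\<lambda>\<omega>. \<Sum>j\<in>S. c j * Z j \<omega>)"
  using assms by (intro fourth_int_sum fourth_int_cmult fourth_int_Z) auto

corollary expectation_fourth_linear_form_const:
  assumes "S \<subseteq> I"
  shows "expectation (\<lambda>\<omega>. (\<Sum>j\<in>S. c j * Z j \<omega>) ^ 4) \<le> K * (\<Sum>j\<in>S. (c j)\<^sup>2)\<^sup>2"
  using expectation_fourth_linear_form[of S "{}" "\<lambda>j _. c j"] assms finite_subset[OF assms finite_I]
  by (simp add: prob_space)

corollary expectation_square_linear_form_const:
  assumes "S \<subseteq> I"
  shows "expectation (\<lambda>\<omega>. (\<Sum>j\<in>S. c j * Z j \<omega>)\<^sup>2) = (\<Sum>j\<in>S. (c j)\<^sup>2)"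
  using expectation_square_linear_form[of S "{}" "\<lambda>j _. c j" "\<lambda>_. 1"] assms finite_subset[OF assms finite_I]
  by (simp add: prob_space)

corollary expectation_linear_form_const:
  assumes "S \<subseteq> I"
  shows "expectation (\<lambda>\<omega>. \<Sum>j\<in>S. c j * Z j \<omega>) = 0"
  using expectation_linear_form_mult[of S "{}" "\<lambda>j _. c j" "\<lambda>_. 1"] assms by simp

text \<open>Adding the index \<open>x\<close> changes the centred form by \<open>l * Z x\<close>,
  with \<open>l\<close> linear in the earlier variables, and by a multiple of
  \<open>(Z x)\<^sup>2 - 1\<close>. These increments are uncorrelated with the old form and with
  each other; a third moment of \<open>Z x\<close> occurs only together with the mean of
  \<open>l\<close>, which is 0. The matrix need not be symmetric: \<open>K\<close> absorbs the
  factor 2 from squaring \<open>m x k + m k x\<close>.\<close>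

lemma quadratic_form:
  fixes m :: "'i \<Rightarrow> 'i \<Rightarrow> real"
  assumes "finite S" "S \<subseteq> I"
  defines "q \<equiv> \<lambda>S \<omega>. (\<Sum>j\<in>S. \<Sum>k\<in>S. m j k * Z j \<omega> * Z k \<omega>) - (\<Sum>j\<in>S. m j j)"
  shows "square_int (q S) \<and> expectation (q S) = 0 \<and>
    expectation (\<lambda>\<omega>. (q S \<omega>)\<^sup>2) \<le> K * (\<Sum>j\<in>S. \<Sum>k\<in>S. (m j k)\<^sup>2)"
  using assms(1,2)
proof (induction S rule: finite_induct)
  case empty
  then show ?case by (simp add: q_def)
next
  case (insert x S)
  define l where "l \<omega> = (\<Sum>k\<in>S. (m x k + m k x) * Z k \<omega>)" for \<omega>
  have d: "S \<inter> {x} = {}" "S \<subseteq> I" "{x} \<subseteq> I" "x \<in> I" and x: "x \<notin> S" "finite S"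
    using insert by auto
  have IH: "square_int (q S)" "expectation (q S) = 0"
    "expectation (\<lambda>\<omega>. (q S \<omega>)\<^sup>2) \<le> K * (\<Sum>j\<in>S. \<Sum>k\<in>S. (m j k)\<^sup>2)"
    using insert by auto
  have q: "q (insert x S) = (\<lambda>\<omega>. q S \<omega> + l \<omega> * Z x \<omega> + m x x * ((Z x \<omega>)\<^sup>2 - 1))"
    unfolding q_def l_def using x
    by (auto simp: fun_eq_iff sum.distrib sum_distrib_right sum_distrib_left algebra_simps power2_eq_square)
  have Zx: "fourth_int (Z x)" "square_int (Z x)"
    using fourth_int_Z square_int_Z d by auto
  have sl: "square_int l" "expectation l = 0" "expectation (\<lambda>\<omega>. (l \<omega>)\<^sup>2) = (\<Sum>k\<in>S. (m x k + m k x)\<^sup>2)"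
    unfolding l_def using d fourth_int_linear_form fourth_int_square_int
    by (auto simp: expectation_linear_form_const expectation_square_linear_form_const)
  have [measurable]: "Z k \<in> borel_measurable (F S)" if "k \<in> S" for k
    using that by (rule measurable_F_Z)
  have [measurable]: "l \<in> borel_measurable (F S)" "q S \<in> borel_measurable (F S)"
    unfolding l_def q_def by measurable
  note [measurable] = measurable_F_Z[of x "{x}"]
  define e where "e \<omega> = (Z x \<omega>)\<^sup>2 - 1" for \<omega>
  have se: "square_int e"
    unfolding e_def using Zx by (intro square_int_diff fourth_int_square) auto
  have Ee: "expectation e = 0"
    using square_intD(2)[OF Zx(2)] var_Z[OF d(4)] by (simp add: e_def[abs_def] prob_space)
  have "expectation (\<lambda>\<omega>. (e \<omega>)\<^sup>2) = expectation (\<lambda>\<omega>. Z x \<omega> ^ 4 - 2 * (Z x \<omega>)\<^sup>2 + 1)"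
    by (simp add: e_def power2_eq_square power4_eq_xxxx algebra_simps)
  also have "\<dots> \<le> K"
    using square_intD(2)[OF Zx(2)] fourth_intD(2)[OF Zx(1)] var_Z[OF d(4)] fourth_Z[OF d(4)]
    by (simp add: prob_space)
  finally have Ee2: "expectation (\<lambda>\<omega>. (e \<omega>)\<^sup>2) \<le> K" .
  have [measurable]: "e \<in> borel_measurable (F {x})"
    unfolding e_def by measurable
  have lZ: "square_int (\<lambda>\<omega>. l \<omega> * Z x \<omega>)"
    by (rule square_int_F_mult[OF _ _ d(1-3) sl(1) Zx(2)]) auto
  have sq: "square_int (q (insert x S))"
    unfolding q e_def[symmetric]
    by (intro square_int_add IH(1) lZ square_int_cmult se)
  have i: "integrable M l" "integrable M (Z x)" "integrable M (q S)" "integrable M e"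
    using square_int_integrable sl Zx IH se by auto
  note E = expectation_F_mult[OF _ _ d(1-3)]
  have 0: "expectation (\<lambda>\<omega>. l \<omega> * Z x \<omega>) = 0"
    using E[OF _ _ i(1,2)] sl(2) by simp
  have 1: "expectation (\<lambda>\<omega>. q S \<omega> * l \<omega> * Z x \<omega>) = 0"
    using E[OF _ _ square_int_mult[OF IH(1) sl(1)] i(2)] mean_Z[OF d(4)] by simp
  have 2: "expectation (\<lambda>\<omega>. q S \<omega> * e \<omega>) = 0"
    using E[OF _ _ i(3,4)] Ee by simp
  have 3: "expectation (\<lambda>\<omega>. l \<omega> * (Z x \<omega> * e \<omega>)) = 0"
    using E[OF _ _ i(1) square_int_mult[OF Zx(2) se]] sl(2) by simp
  have 4: "expectation (\<lambda>\<omega>. (l \<omega>)\<^sup>2 * (Z x \<omega>)\<^sup>2) = (\<Sum>k\<in>S. (m x k + m k x)\<^sup>2)"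
    using E[OF _ _ square_intD(2)[OF sl(1)] square_intD(2)[OF Zx(2)]] sl(3) var_Z[OF d(4)] by simp
  have ii: "integrable M (\<lambda>\<omega>. q S \<omega> * l \<omega> * Z x \<omega>)" "integrable M (\<lambda>\<omega>. q S \<omega> * e \<omega>)"
    "integrable M (\<lambda>\<omega>. l \<omega> * (Z x \<omega> * e \<omega>))" "integrable M (\<lambda>\<omega>. (l \<omega>)\<^sup>2 * (Z x \<omega>)\<^sup>2)"
    using square_int_mult[OF IH(1) lZ] square_int_mult[OF IH(1) se] square_int_mult[OF lZ se] square_intD(2)[OF lZ]
    by (auto simp: mult_ac power_mult_distrib)
  have "expectation (q (insert x S)) = 0"
    unfolding q e_def[symmetric] using i square_int_integrable[OF lZ] IH 0 Ee by simp
  moreover have "expectation (\<lambda>\<omega>. (q (insert x S) \<omega>)\<^sup>2) \<le>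
     K * (\<Sum>j\<in>insert x S. \<Sum>k\<in>insert x S. (m j k)\<^sup>2)"
  proof -
    have "expectation (\<lambda>\<omega>. (q (insert x S) \<omega>)\<^sup>2) = expectation (\<lambda>\<omega>. (q S \<omega>)\<^sup>2 + (l \<omega>)\<^sup>2 * (Z x \<omega>)\<^sup>2
       + (m x x)\<^sup>2 * (e \<omega>)\<^sup>2 + 2 * (q S \<omega> * l \<omega> * Z x \<omega>) + 2 * m x x * (q S \<omega> * e \<omega>)
       + 2 * m x x * (l \<omega> * (Z x \<omega> * e \<omega>)))"
      unfolding q e_def[symmetric] by (simp add: power2_eq_square algebra_simps)
    also have "\<dots> = expectation (\<lambda>\<omega>. (q S \<omega>)\<^sup>2) + (\<Sum>k\<in>S. (m x k + m k x)\<^sup>2)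
       + (m x x)\<^sup>2 * expectation (\<lambda>\<omega>. (e \<omega>)\<^sup>2)"
      using ii square_intD(2)[OF IH(1)] square_intD(2)[OF se] 1 2 3 4 by simp
    also have "\<dots> \<le> K * (\<Sum>j\<in>S. \<Sum>k\<in>S. (m j k)\<^sup>2) + (\<Sum>k\<in>S. K * (m x k)\<^sup>2 + K * (m k x)\<^sup>2) + (m x x)\<^sup>2 * K"
    proof (intro add_mono IH sum_mono mult_left_mono Ee2)
      fix k
      have "(m x k + m k x)\<^sup>2 \<le> 2 * (m x k)\<^sup>2 + 2 * (m k x)\<^sup>2"
        using sum_squares_bound[of "m x k" "m k x"] by (simp add: power2_sum)
      also have "\<dots> \<le> K * (m x k)\<^sup>2 + K * (m k x)\<^sup>2"
        using K_ge by (intro add_mono mult_right_mono) auto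
      finally show "(m x k + m k x)\<^sup>2 \<le> K * (m x k)\<^sup>2 + K * (m k x)\<^sup>2" .
    qed simp
    also have "\<dots> = K * (\<Sum>j\<in>insert x S. \<Sum>k\<in>insert x S. (m j k)\<^sup>2)"
      using x by (simp add: sum.distrib sum_distrib_left algebra_simps)
    finally show ?thesis .
  qed
  ultimately show ?case using sq by simp
qed

end

subsection \<open>A central limit theorem for quadratic forms\<close>

text \<open>The third-order Taylor remainder is summed over many differences, whose squares and
  fourth powers are the controlled quantities. With \<eta> tending to 0 more slowly than the sum of
  the fourth moments, both terms become negligible.\<close>

lemma cubic_le_quadratic_quartic:
  fixes x \<eta> :: real
  assumes "\<eta> > 0"
  shows "\<bar>x\<bar> ^ 3 \<le> \<eta> * x\<^sup>2 + x ^ 4 / \<eta>"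
proof -
  have "0 \<le> x\<^sup>2 * ((\<eta> - \<bar>x\<bar>)\<^sup>2 + \<eta> * \<bar>x\<bar>)"
    using assms by simp
  also have "\<dots> = \<eta>\<^sup>2 * x\<^sup>2 + x ^ 4 - \<eta> * \<bar>x\<bar> ^ 3"
    by (cases "x \<ge> 0") (simp_all add: power2_eq_square power3_eq_cube power4_eq_xxxx algebra_simps)
  finally have "\<eta> * \<bar>x\<bar> ^ 3 \<le> \<eta> * (\<eta> * x\<^sup>2 + x ^ 4 / \<eta>)"
    using assms by (simp add: power2_eq_square algebra_simps)
  then show ?thesis
    using assms by simp
qed

lemma iexp_second_order: "cmod (iexp y - (1 + \<i> * y - y\<^sup>2 / 2)) \<le> \<bar>y\<bar> ^ 3"
proof -
  have "cmod (iexp y - (1 + \<i> * y - y\<^sup>2 / 2)) \<le> \<bar>y\<bar> ^ 3 / 6"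
    using iexp_approx1[of y 2]
    by (simp add: numeral_eq_Suc power2_eq_square algebra_simps)
  then show ?thesis
    using zero_le_power[OF abs_ge_zero, of y 3] by linarith
qed

lemma exp_minus_second_order:
  fixes s :: real
  assumes "s \<ge> 0"
  shows "\<bar>exp (- s) - (1 - s)\<bar> \<le> s\<^sup>2"
proof (cases "s \<le> 1")
  case True
  have "exp (- s) \<le> 1 / (1 + s)"
    using exp_ge_add_one_self[of s] assms by (simp add: exp_minus divide_simps)
  also have "\<dots> \<le> 1 - s + s\<^sup>2"
    using assms by (simp add: divide_simps power2_eq_square algebra_simps)
  finally show ?thesis
    using exp_ge_add_one_self[of "-s"] by auto
next
  case False
  then have "s * 1 \<le> s * s" "exp (- s) \<le> 1"
    using assms mult_left_mono[of 1 s s] by auto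
  then show ?thesis
    using exp_ge_add_one_self[of "-s"] False unfolding power2_eq_square abs_le_iff by linarith
qed

context std_family
begin

text \<open>\<open>Vf S\<close> is the sum of the conditional variances of the martingale differences with sum
  \<open>Qf S\<close>.  It is unbounded and \<open>exp (t\<^sup>2 * Vf S \<omega> / 2)\<close> need not be integrable, so the differences
  are dropped as soon as \<open>Vf\<close> would exceed 2.\<close>

lemma stopped_quadratic_form:
  fixes L :: "'i \<Rightarrow> 'i \<Rightarrow> real" and rank :: "'i \<Rightarrow> nat" and t \<eta> :: real
  assumes rank: "\<And>a b. a \<in> I \<Longrightarrow> b \<in> I \<Longrightarrow> L a b \<noteq> 0 \<Longrightarrow> rank b < rank a"
    and "\<eta> > 0" "S \<subseteq> I"
  defines "\<rho> \<equiv> \<lambda>a. \<Sum>b\<in>I. (L a b)\<^sup>2"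
  defines "W \<equiv> \<lambda>q v. exp (complex_of_real (t\<^sup>2 * v / 2) + \<i> * complex_of_real (t * q))"
  defines "\<beta> \<equiv> \<lambda>a. \<bar>t\<bar> ^ 3 * (\<eta> * \<rho> a + K * (K * (\<rho> a)\<^sup>2) / \<eta>) + t ^ 4 * (K * (\<rho> a)\<^sup>2)"
  defines "Qf \<equiv> \<lambda>S \<omega>. \<Sum>a\<in>S. \<Sum>b\<in>S. L a b * Z b \<omega> * Z a \<omega>"
  defines "Vf \<equiv> \<lambda>S \<omega>. \<Sum>a\<in>S. (\<Sum>b\<in>S. L a b * Z b \<omega>)\<^sup>2"
  shows "\<exists>Q V. Q \<in> borel_measurable (F S) \<and> V \<in> borel_measurable (F S) \<and>
    (\<forall>\<omega>. 0 \<le> V \<omega> \<and> V \<omega> \<le> 2 \<and> (Vf S \<omega> \<le> 2 \<longrightarrow> Q \<omega> = Qf S \<omega> \<and> V \<omega> = Vf S \<omega>)) \<and>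
    cmod (expectation (\<lambda>\<omega>. W (Q \<omega>) (V \<omega>)) - 1) \<le> exp (t\<^sup>2) * (\<Sum>a\<in>S. \<beta> a)"
  using finite_subset[OF \<open>S \<subseteq> I\<close> finite_I] \<open>S \<subseteq> I\<close>
proof (induction S rule: finite_ranking_induct[where f=rank])
  case empty
  show ?case
    by (intro exI[of _ "\<lambda>_. 0"]) (auto simp: Qf_def Vf_def W_def prob_space)
next
  case (insert x S)
  show ?case
  proof (cases "x \<in> S")
    case True
    then show ?thesis using insert by (simp add: insert_absorb)
  next
    case False
    have d: "S \<inter> {x} = {}" "S \<subseteq> I" "{x} \<subseteq> I" "x \<in> I" "finite S"
      using insert False by auto
    \<comment> \<open>The ranking induction inserts \<open>x\<close> with maximal rank, whereas a
      nonzero \<open>L a x\<close> would require \<open>rank x < rank a\<close>. So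
      \<open>Z x\<close> enters no coefficient so far.\<close>
    have Lx: "L a x = 0" if "a \<in> insert x S" for a
      using rank[of a x] insert.hyps(2)[of a] that d by (cases "a = x") fastforce+
    obtain Q V where [measurable]: "Q \<in> borel_measurable (F S)" "V \<in> borel_measurable (F S)"
      and V: "\<And>\<omega>. 0 \<le> V \<omega>" "\<And>\<omega>. V \<omega> \<le> 2"
        "\<And>\<omega>. Vf S \<omega> \<le> 2 \<Longrightarrow> Q \<omega> = Qf S \<omega> \<and> V \<omega> = Vf S \<omega>"
      and IH: "cmod (expectation (\<lambda>\<omega>. W (Q \<omega>) (V \<omega>)) - 1) \<le> exp (t\<^sup>2) * (\<Sum>a\<in>S. \<beta> a)"
      using insert.IH d by auto
    have [measurable]: "Z k \<in> borel_measurable (F S)" if "k \<in> S" for k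
      using that by (rule measurable_F_Z)
    note [measurable] = measurable_F_Z[of x "{x}"]
    define \<xi> where "\<xi> \<omega> = (\<Sum>b\<in>S. L x b * Z b \<omega>)" for \<omega>
    have [measurable]: "\<xi> \<in> borel_measurable (F S)" "Vf S \<in> borel_measurable (F S)"
      unfolding \<xi>_def Vf_def by measurable
    have QI: "Qf (insert x S) \<omega> = Qf S \<omega> + \<xi> \<omega> * Z x \<omega>" for \<omega>
      using False d Lx by (simp add: Qf_def \<xi>_def sum_distrib_right)
    have VI: "Vf (insert x S) \<omega> = Vf S \<omega> + (\<xi> \<omega>)\<^sup>2" for \<omega>
      using False d Lx by (simp add: Vf_def \<xi>_def)
    \<comment> \<open>The truncation is predictable: the test involves the value of
      \<open>Vf\<close> after adding \<open>x\<close>, which is a function of the earlier variables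
      only. Hence \<open>\<zeta>\<close> is independent of \<open>Z x\<close>.\<close>
    define \<zeta> where "\<zeta> \<omega> = (if Vf S \<omega> + (\<xi> \<omega>)\<^sup>2 \<le> 2 then \<xi> \<omega> else 0)" for \<omega>
    have [measurable]: "\<zeta> \<in> borel_measurable (F S)"
      unfolding \<zeta>_def by measurable
    have \<zeta>_le: "(\<zeta> \<omega>)\<^sup>2 \<le> (\<xi> \<omega>)\<^sup>2" "\<zeta> \<omega> ^ 4 \<le> \<xi> \<omega> ^ 4" for \<omega>
      by (auto simp: \<zeta>_def)
    have V2: "V \<omega> + (\<zeta> \<omega>)\<^sup>2 \<le> 2" "0 \<le> V \<omega> + (\<zeta> \<omega>)\<^sup>2" for \<omega>
    proof -
      have "Vf S \<omega> \<le> 2" if "Vf S \<omega> + (\<xi> \<omega>)\<^sup>2 \<le> 2"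
        using that zero_le_power2[of "\<xi> \<omega>"] by linarith
      then show "V \<omega> + (\<zeta> \<omega>)\<^sup>2 \<le> 2"
        using V by (auto simp: \<zeta>_def)
    qed (use V in auto)
    have [measurable]: "\<xi> \<in> borel_measurable M" "\<zeta> \<in> borel_measurable M" "Q \<in> borel_measurable M"
      "V \<in> borel_measurable M"
      by (rule measurable_F_M[OF \<open>S \<subseteq> I\<close>], measurable)+
    have [measurable]: "Z x \<in> borel_measurable M"
      using d(4) by (rule measurable_Z)
    have f\<xi>: "fourth_int \<xi>"
      unfolding \<xi>_def using d by (intro fourth_int_linear_form)
    have f\<zeta>: "fourth_int \<zeta>"
      unfolding fourth_int_def using fourth_intD[OF f\<xi>] \<zeta>_le
      by (auto intro!: Bochner_Integration.integrable_bound[of M "\<lambda>\<omega>. \<xi> \<omega> ^ 4"])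
    have s\<zeta>: "square_int \<zeta>" and sZ: "square_int (Z x)"
      using fourth_int_square_int[OF f\<zeta>] square_int_Z[OF d(4)] by auto
    have "(\<Sum>b\<in>S. (L x b)\<^sup>2) \<le> \<rho> x"
      unfolding \<rho>_def using d finite_I by (intro sum_mono2) auto
    moreover have "0 \<le> (\<Sum>b\<in>S. (L x b)\<^sup>2)"
      by (simp add: sum_nonneg)
    ultimately have \<rho>: "expectation (\<lambda>\<omega>. (\<xi> \<omega>)\<^sup>2) \<le> \<rho> x" "expectation (\<lambda>\<omega>. \<xi> \<omega> ^ 4) \<le> K * (\<rho> x)\<^sup>2"
      unfolding \<xi>_def using d K_ge
      by (auto simp: expectation_square_linear_form_const
        intro!: order_trans[OF expectation_fourth_linear_form_const] mult_left_mono power_mono)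
    have E2: "expectation (\<lambda>\<omega>. (\<zeta> \<omega>)\<^sup>2) \<le> \<rho> x"
      using \<zeta>_le square_intD(2)[OF s\<zeta>] square_intD(2)[OF fourth_int_square_int[OF f\<xi>]]
      by (intro order_trans[OF integral_mono \<rho>(1)]) auto
    have E4: "expectation (\<lambda>\<omega>. \<zeta> \<omega> ^ 4) \<le> K * (\<rho> x)\<^sup>2"
      using \<zeta>_le fourth_intD(2)[OF f\<zeta>] fourth_intD(2)[OF f\<xi>]
      by (intro order_trans[OF integral_mono \<rho>(2)]) auto
    have fZ: "fourth_int (Z x)" using fourth_int_Z d by auto
    note E = expectation_F_mult[OF _ _ d(1-3)] and Ei = integrable_F_mult[OF _ _ d(1-3)]
    \<comment> \<open>The compensator already contains the new variance term: \<open>A\<close> is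
      measurable before \<open>Z x\<close>, bounded by \<open>exp (t\<^sup>2)\<close> since the
      truncated variance is at most 2, and both the old and the new \<open>W\<close> are
      \<open>A\<close> times a simple factor.\<close>
    define A where "A \<omega> = W (Q \<omega>) (V \<omega> + (\<zeta> \<omega>)\<^sup>2)" for \<omega>
    have [measurable]: "A \<in> borel_measurable (F S)"
      unfolding A_def W_def by measurable
    have [measurable]: "A \<in> borel_measurable M"
      by (rule measurable_F_M[OF \<open>S \<subseteq> I\<close>]) measurable
    have nW: "cmod (W q v) = exp (t\<^sup>2 * v / 2)" for q v
      by (simp add: W_def norm_exp)
    have nW2: "cmod (W q v) \<le> exp (t\<^sup>2)" if "v \<le> 2" for q v
      unfolding nW using that mult_left_mono[of v 2 "t\<^sup>2"] by auto
    have nA: "cmod (A \<omega>) \<le> exp (t\<^sup>2)" for \<omega>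
      unfolding A_def using V2(1) by (rule nW2)
    have iA: "integrable M (\<lambda>\<omega>. A \<omega> * complex_of_real (h \<omega>))" if "integrable M h" for h
    proof (rule Bochner_Integration.integrable_bound)
      show "integrable M (\<lambda>\<omega>. exp (t\<^sup>2) * h \<omega>)"
        using that by simp
      show "(\<lambda>\<omega>. A \<omega> * complex_of_real (h \<omega>)) \<in> borel_measurable M"
        using that by (intro borel_measurable_times) auto
      show "AE \<omega> in M. cmod (A \<omega> * complex_of_real (h \<omega>)) \<le> norm (exp (t\<^sup>2) * h \<omega>)"
        using nA by (auto simp: norm_mult abs_mult intro!: mult_right_mono)
    qed
    have i2: "integrable M (\<lambda>\<omega>. (\<zeta> \<omega>)\<^sup>2)" "integrable M \<zeta>" "integrable M (Z x)" "integrable M (\<lambda>\<omega>. (Z x \<omega>)\<^sup>2)"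
      using square_intD(2)[OF s\<zeta>] square_int_integrable[OF s\<zeta>] square_int_integrable[OF sZ] square_intD(2)[OF sZ]
      by auto
    have 1: "expectation (\<lambda>\<omega>. (A \<omega> * complex_of_real (\<zeta> \<omega>)) * complex_of_real (Z x \<omega>)) = 0"
      "integrable M (\<lambda>\<omega>. (A \<omega> * complex_of_real (\<zeta> \<omega>)) * complex_of_real (Z x \<omega>))"
      using E[OF _ _ iA[OF i2(2)], of "\<lambda>\<omega>. complex_of_real (Z x \<omega>)"] i2(3) mean_Z[OF d(4)]
        Ei[OF _ _ iA[OF i2(2)], of "\<lambda>\<omega>. complex_of_real (Z x \<omega>)"] by auto
    have 2: "expectation (\<lambda>\<omega>. (A \<omega> * complex_of_real ((\<zeta> \<omega>)\<^sup>2)) * complex_of_real ((Z x \<omega>)\<^sup>2 - 1)) = 0"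
      "integrable M (\<lambda>\<omega>. (A \<omega> * complex_of_real ((\<zeta> \<omega>)\<^sup>2)) * complex_of_real ((Z x \<omega>)\<^sup>2 - 1))"
    proof -
      have "integrable M (\<lambda>\<omega>. complex_of_real ((Z x \<omega>)\<^sup>2 - 1))"
        "expectation (\<lambda>\<omega>. complex_of_real ((Z x \<omega>)\<^sup>2 - 1)) = complex_of_real (expectation (\<lambda>\<omega>. (Z x \<omega>)\<^sup>2 - 1))"
        using i2(4) by (auto simp: complex_of_real_integrable_eq integral_complex_of_real simp del: of_real_diff of_real_power)
      moreover have "expectation (\<lambda>\<omega>. (Z x \<omega>)\<^sup>2 - 1) = 0"
        using i2(4) var_Z[OF d(4)] by (simp add: prob_space)
      ultimately show "expectation (\<lambda>\<omega>. (A \<omega> * complex_of_real ((\<zeta> \<omega>)\<^sup>2)) * complex_of_real ((Z x \<omega>)\<^sup>2 - 1)) = 0"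
      "integrable M (\<lambda>\<omega>. (A \<omega> * complex_of_real ((\<zeta> \<omega>)\<^sup>2)) * complex_of_real ((Z x \<omega>)\<^sup>2 - 1))"
        using E[OF _ _ iA[OF i2(1)], of "\<lambda>\<omega>. complex_of_real ((Z x \<omega>)\<^sup>2 - 1)"] 
        Ei[OF _ _ iA[OF i2(1)], of "\<lambda>\<omega>. complex_of_real ((Z x \<omega>)\<^sup>2 - 1)"] by auto
    qed
    define u where "u \<omega> = \<zeta> \<omega> * Z x \<omega>" for \<omega>
    have u2: "expectation (\<lambda>\<omega>. (u \<omega>)\<^sup>2) = expectation (\<lambda>\<omega>. (\<zeta> \<omega>)\<^sup>2)" "integrable M (\<lambda>\<omega>. (u \<omega>)\<^sup>2)"
      unfolding u_def power_mult_distrib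
      using E[OF _ _ i2(1,4)] Ei[OF _ _ i2(1,4)] var_Z[OF d(4)] by auto
    have u4: "expectation (\<lambda>\<omega>. u \<omega> ^ 4) \<le> K * (K * (\<rho> x)\<^sup>2)" "integrable M (\<lambda>\<omega>. u \<omega> ^ 4)"
    proof -
      show "integrable M (\<lambda>\<omega>. u \<omega> ^ 4)"
        unfolding u_def power_mult_distrib using Ei[OF _ _ fourth_intD(2)[OF f\<zeta>] fourth_intD(2)[OF fZ]] by auto
      have "expectation (\<lambda>\<omega>. u \<omega> ^ 4) = expectation (\<lambda>\<omega>. \<zeta> \<omega> ^ 4) * expectation (\<lambda>\<omega>. Z x \<omega> ^ 4)"
        unfolding u_def power_mult_distrib using E[OF _ _ fourth_intD(2)[OF f\<zeta>] fourth_intD(2)[OF fZ]] by auto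
      also have "\<dots> \<le> (K * (\<rho> x)\<^sup>2) * K"
        using K_ge by (intro mult_mono E4 fourth_Z d) auto
      finally show "expectation (\<lambda>\<omega>. u \<omega> ^ 4) \<le> K * (K * (\<rho> x)\<^sup>2)"
        by (simp add: mult_ac)
    qed
    \<comment> \<open>The second-order remainder of the new oscillating factor minus that of the
      factor that turns \<open>A\<close> back into the old \<open>W\<close>.\<close>
    define r where "r \<omega> = iexp (t * u \<omega>) - (1 + \<i> * (t * u \<omega>) - (t * u \<omega>)\<^sup>2 / 2)
      - complex_of_real (exp (- (t\<^sup>2 * (\<zeta> \<omega>)\<^sup>2 / 2)) - (1 - t\<^sup>2 * (\<zeta> \<omega>)\<^sup>2 / 2))" for \<omega>
    have r: "cmod (r \<omega>) \<le> \<bar>t\<bar> ^ 3 * (\<eta> * (u \<omega>)\<^sup>2 + u \<omega> ^ 4 / \<eta>) + t ^ 4 * \<zeta> \<omega> ^ 4" for \<omega>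
    proof -
      have "cmod (r \<omega>) \<le> \<bar>t * u \<omega>\<bar> ^ 3 + \<bar>exp (- (t\<^sup>2 * (\<zeta> \<omega>)\<^sup>2 / 2)) - (1 - t\<^sup>2 * (\<zeta> \<omega>)\<^sup>2 / 2)\<bar>"
        unfolding r_def
        by (intro order_trans[OF norm_triangle_ineq4] add_mono order_trans[OF iexp_second_order])
          (simp_all only: norm_of_real order_refl)
      also have "\<bar>t * u \<omega>\<bar> ^ 3 \<le> \<bar>t\<bar> ^ 3 * (\<eta> * (u \<omega>)\<^sup>2 + u \<omega> ^ 4 / \<eta>)"
        unfolding abs_mult power_mult_distrib
        by (intro mult_left_mono cubic_le_quadratic_quartic \<open>\<eta> > 0\<close>) simp
      also have "\<bar>exp (- (t\<^sup>2 * (\<zeta> \<omega>)\<^sup>2 / 2)) - (1 - t\<^sup>2 * (\<zeta> \<omega>)\<^sup>2 / 2)\<bar> \<le> (t\<^sup>2 * (\<zeta> \<omega>)\<^sup>2 / 2)\<^sup>2"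
        by (intro exp_minus_second_order) simp
      also have "(t\<^sup>2 * (\<zeta> \<omega>)\<^sup>2 / 2)\<^sup>2 \<le> t ^ 4 * \<zeta> \<omega> ^ 4"
        by (simp add: power_divide power_mult_distrib flip: power_mult)
      finally show ?thesis by simp
    qed
    have [measurable]: "u \<in> borel_measurable M" unfolding u_def by measurable
    have [measurable]: "r \<in> borel_measurable M" unfolding r_def by measurable
    have iB: "integrable M (\<lambda>\<omega>. \<bar>t\<bar> ^ 3 * (\<eta> * (u \<omega>)\<^sup>2 + u \<omega> ^ 4 / \<eta>) + t ^ 4 * \<zeta> \<omega> ^ 4)"
      using u2 u4 fourth_intD(2)[OF f\<zeta>] by auto
    have iWb: "integrable M (\<lambda>\<omega>. W (Q \<omega>) (V \<omega>))"
      using V nW2 by (intro integrable_const_bound[where B="exp (t\<^sup>2)"]) (auto simp: W_def)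
    have iAr: "integrable M (\<lambda>\<omega>. A \<omega> * r \<omega>)"
    proof (rule Bochner_Integration.integrable_bound)
      show "integrable M (\<lambda>\<omega>. exp (t\<^sup>2) * (\<bar>t\<bar> ^ 3 * (\<eta> * (u \<omega>)\<^sup>2 + u \<omega> ^ 4 / \<eta>) + t ^ 4 * \<zeta> \<omega> ^ 4))"
        using iB by simp
      show "AE \<omega> in M. norm (A \<omega> * r \<omega>) \<le>
         norm (exp (t\<^sup>2) * (\<bar>t\<bar> ^ 3 * (\<eta> * (u \<omega>)\<^sup>2 + u \<omega> ^ 4 / \<eta>) + t ^ 4 * \<zeta> \<omega> ^ 4))"
        using \<open>\<eta> > 0\<close> nA by (auto simp: norm_mult abs_mult intro!: mult_mono order_trans[OF r])
    qed simp
    \<comment> \<open>The two Taylor polynomials differ by a term linear in \<open>Z x\<close> and a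
      multiple of \<open>(Z x)\<^sup>2 - 1\<close>. Both have mean zero given \<open>F S\<close>, so
      only \<open>A * r\<close> contributes to the change of the expectation.\<close>
    have decomp: "W (Q \<omega> + u \<omega>) (V \<omega> + (\<zeta> \<omega>)\<^sup>2) = W (Q \<omega>) (V \<omega>) + A \<omega> * r \<omega>
      + (\<i> * t) * ((A \<omega> * complex_of_real (\<zeta> \<omega>)) * complex_of_real (Z x \<omega>))
      - complex_of_real (t\<^sup>2 / 2) * ((A \<omega> * complex_of_real ((\<zeta> \<omega>)\<^sup>2)) * complex_of_real ((Z x \<omega>)\<^sup>2 - 1))" for \<omega>
    proof -
      have "W (Q \<omega> + u \<omega>) (V \<omega> + (\<zeta> \<omega>)\<^sup>2) = A \<omega> * iexp (t * u \<omega>)"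
        by (simp add: W_def A_def algebra_simps flip: exp_add)
      moreover have "W (Q \<omega>) (V \<omega>) = A \<omega> * complex_of_real (exp (- (t\<^sup>2 * (\<zeta> \<omega>)\<^sup>2 / 2)))"
        by (simp add: W_def A_def exp_of_real[symmetric] algebra_simps add_divide_distrib flip: exp_add)
      ultimately show ?thesis
        by (simp add: r_def u_def algebra_simps power2_eq_square)
    qed
    have "expectation (\<lambda>\<omega>. W (Q \<omega> + u \<omega>) (V \<omega> + (\<zeta> \<omega>)\<^sup>2)) =
        expectation (\<lambda>\<omega>. W (Q \<omega>) (V \<omega>)) + expectation (\<lambda>\<omega>. A \<omega> * r \<omega>)"
      unfolding decomp using 1 2 iWb iAr by simp
    moreover have "cmod (expectation (\<lambda>\<omega>. A \<omega> * r \<omega>)) \<le> exp (t\<^sup>2) * \<beta> x"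
    proof -
      have "cmod (expectation (\<lambda>\<omega>. A \<omega> * r \<omega>)) \<le> expectation (\<lambda>\<omega>. cmod (A \<omega> * r \<omega>))"
        by (rule integral_norm_bound)
      also have "\<dots> \<le> expectation (\<lambda>\<omega>. exp (t\<^sup>2) * (\<bar>t\<bar> ^ 3 * (\<eta> * (u \<omega>)\<^sup>2 + u \<omega> ^ 4 / \<eta>) + t ^ 4 * \<zeta> \<omega> ^ 4))"
      proof (rule integral_mono)
        show "cmod (A \<omega> * r \<omega>) \<le> exp (t\<^sup>2) * (\<bar>t\<bar> ^ 3 * (\<eta> * (u \<omega>)\<^sup>2 + u \<omega> ^ 4 / \<eta>) + t ^ 4 * \<zeta> \<omega> ^ 4)" for \<omega>
          unfolding norm_mult by (intro mult_mono r nA) auto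
      qed (intro integrable_norm iAr integrable_mult_right iB)+
      also have "\<dots> = exp (t\<^sup>2) * (\<bar>t\<bar> ^ 3 * (\<eta> * expectation (\<lambda>\<omega>. (\<zeta> \<omega>)\<^sup>2) + expectation (\<lambda>\<omega>. u \<omega> ^ 4) / \<eta>)
         + t ^ 4 * expectation (\<lambda>\<omega>. \<zeta> \<omega> ^ 4))"
        using u2 u4(2) fourth_intD(2)[OF f\<zeta>] by simp
      also have "\<dots> \<le> exp (t\<^sup>2) * \<beta> x"
        unfolding \<beta>_def
        by (intro mult_left_mono add_mono divide_right_mono E2 E4 u4(1)) (use \<open>\<eta> > 0\<close> in auto)
      finally show ?thesis .
    qed
    ultimately have "cmod (expectation (\<lambda>\<omega>. W (Q \<omega> + u \<omega>) (V \<omega> + (\<zeta> \<omega>)\<^sup>2)) - 1) \<le>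
      exp (t\<^sup>2) * (\<Sum>a\<in>S. \<beta> a) + exp (t\<^sup>2) * \<beta> x"
      using IH norm_triangle_ineq[of "expectation (\<lambda>\<omega>. W (Q \<omega>) (V \<omega>)) - 1" "expectation (\<lambda>\<omega>. A \<omega> * r \<omega>)"]
      by (simp add: algebra_simps)
    then have fin: "cmod (expectation (\<lambda>\<omega>. W (Q \<omega> + u \<omega>) (V \<omega> + (\<zeta> \<omega>)\<^sup>2)) - 1) \<le>
      exp (t\<^sup>2) * (\<Sum>a\<in>insert x S. \<beta> a)"
      using False d by (simp add: algebra_simps)
    \<comment> \<open>\<open>Vf\<close> grows with the index set, so a value of at most 2 at the end
      means that no difference has been dropped on the way.\<close>
    have stop: "Q \<omega> + u \<omega> = Qf (insert x S) \<omega> \<and> V \<omega> + (\<zeta> \<omega>)\<^sup>2 = Vf (insert x S) \<omega>"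
      if "Vf (insert x S) \<omega> \<le> 2" for \<omega>
    proof -
      have "Vf S \<omega> \<le> 2"
        using that zero_le_power2[of "\<xi> \<omega>"] unfolding VI by linarith
      then show ?thesis
        using that V(3) by (simp add: VI QI u_def \<zeta>_def)
    qed
    have [measurable]: "\<zeta> \<in> borel_measurable (F (insert x S))" "Q \<in> borel_measurable (F (insert x S))"
      "V \<in> borel_measurable (F (insert x S))"
      by (rule measurable_F_mono[of S], blast, measurable)+
    have [measurable]: "Z x \<in> borel_measurable (F (insert x S))"
      by (rule measurable_F_Z) simp
    have "(\<lambda>\<omega>. Q \<omega> + u \<omega>) \<in> borel_measurable (F (insert x S))"
      "(\<lambda>\<omega>. V \<omega> + (\<zeta> \<omega>)\<^sup>2) \<in> borel_measurable (F (insert x S))"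
      unfolding u_def by measurable
    then show ?thesis
      using fin stop V2
      by (intro exI[of _ "\<lambda>\<omega>. Q \<omega> + u \<omega>"] exI[of _ "\<lambda>\<omega>. V \<omega> + (\<zeta> \<omega>)\<^sup>2"]) simp
  qed
qed

end

section \<open>From the truncated sum to the characteristic function of the quadratic form\<close>

lemma abs_one_minus_exp_le:
  fixes x y :: real
  assumes "x \<le> y" "0 \<le> y"
  shows "\<bar>1 - exp x\<bar> \<le> \<bar>x\<bar> * exp y"
proof (cases "x \<ge> 0")
  case True
  have "(1 - x) * exp x \<le> exp (- x) * exp x"
    using exp_ge_add_one_self[of "-x"] by (intro mult_right_mono) auto
  then have "exp x - 1 \<le> x * exp x"
    by (simp add: algebra_simps flip: exp_add)
  also have "\<dots> \<le> x * exp y"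
    using assms True by (intro mult_left_mono) auto
  finally show ?thesis
    using True by simp
next
  case False
  then have "exp x \<le> 1"
    by simp
  then have "\<bar>1 - exp x\<bar> \<le> \<bar>x\<bar> * 1"
    using exp_ge_add_one_self[of x] by linarith
  also have "\<dots> \<le> \<bar>x\<bar> * exp y"
    using assms by (intro mult_left_mono) auto
  finally show ?thesis .
qed

text \<open>The matrices L^T L and L L^T have the same Frobenius norm. The first governs the
  fluctuation of the conditional variance; the diagonal of the second consists of the row sums of
  squares, which govern the fourth moments of the differences. One quantity \<open>e\<close>
  therefore controls both.\<close>

lemma frobenius_gram_transpose:
  fixes L :: "'i \<Rightarrow> 'i \<Rightarrow> real"
  shows "(\<Sum>b\<in>I. \<Sum>c\<in>I. (\<Sum>a\<in>I. L a b * L a c)\<^sup>2) = (\<Sum>a\<in>I. \<Sum>a'\<in>I. (\<Sum>b\<in>I. L a b * L a' b)\<^sup>2)"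
proof -
  have "(\<Sum>b\<in>I. \<Sum>c\<in>I. (\<Sum>a\<in>I. L a b * L a c)\<^sup>2) =
    (\<Sum>b\<in>I. \<Sum>c\<in>I. \<Sum>a\<in>I. \<Sum>a'\<in>I. L a b * L a c * (L a' b * L a' c))"
    by (simp add: power2_eq_square sum_product)
  also have "\<dots> = (\<Sum>b\<in>I. \<Sum>a\<in>I. \<Sum>c\<in>I. \<Sum>a'\<in>I. L a b * L a c * (L a' b * L a' c))"
    by (intro sum.cong sum.swap refl)
  also have "\<dots> = (\<Sum>b\<in>I. \<Sum>a\<in>I. \<Sum>a'\<in>I. \<Sum>c\<in>I. L a b * L a c * (L a' b * L a' c))"
    by (intro sum.cong sum.swap refl)
  also have "\<dots> = (\<Sum>a\<in>I. \<Sum>b\<in>I. \<Sum>a'\<in>I. \<Sum>c\<in>I. L a b * L a c * (L a' b * L a' c))"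
    by (rule sum.swap)
  also have "\<dots> = (\<Sum>a\<in>I. \<Sum>a'\<in>I. \<Sum>b\<in>I. \<Sum>c\<in>I. L a b * L a c * (L a' b * L a' c))"
    by (intro sum.cong sum.swap refl)
  also have "\<dots> = (\<Sum>a\<in>I. \<Sum>a'\<in>I. (\<Sum>b\<in>I. L a b * L a' b)\<^sup>2)"
    by (simp add: power2_eq_square sum_product mult_ac)
  finally show ?thesis .
qed

context std_family
begin

text \<open>The compensated exponential has expectation close to 1. Removing the compensator and the
  truncation costs a multiple of the deviation of \<open>Vf\<close> from 1, whose mean is bounded
  through the variance of the quadratic form \<open>Vf\<close>.\<close>

lemma quadratic_form_char_bound:
  fixes L :: "'i \<Rightarrow> 'i \<Rightarrow> real" and rank :: "'i \<Rightarrow> nat" and t \<eta> :: real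
  assumes rank: "\<And>a b. a \<in> I \<Longrightarrow> b \<in> I \<Longrightarrow> L a b \<noteq> 0 \<Longrightarrow> rank b < rank a"
    and "\<eta> > 0"
  defines "s \<equiv> \<Sum>a\<in>I. \<Sum>b\<in>I. (L a b)\<^sup>2"
    and "e \<equiv> \<Sum>b\<in>I. \<Sum>c\<in>I. (\<Sum>a\<in>I. L a b * L a c)\<^sup>2"
  shows "cmod (expectation (\<lambda>\<omega>. iexp (t * (\<Sum>a\<in>I. \<Sum>b\<in>I. L a b * Z b \<omega> * Z a \<omega>))) - exp (- (t\<^sup>2) / 2)) \<le>
    exp (t\<^sup>2) * (\<bar>t\<bar> ^ 3 * (\<eta> * s + K * (K * e) / \<eta>) + t ^ 4 * (K * e))
    + (2 + t\<^sup>2 * exp (t\<^sup>2)) * (sqrt (K * e) + \<bar>s - 1\<bar>)"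
proof -
  define \<rho> where "\<rho> a = (\<Sum>b\<in>I. (L a b)\<^sup>2)" for a
  define W where "W q v = exp (complex_of_real (t\<^sup>2 * v / 2) + \<i> * complex_of_real (t * q))" for q v
  define \<beta> where "\<beta> a = \<bar>t\<bar> ^ 3 * (\<eta> * \<rho> a + K * (K * (\<rho> a)\<^sup>2) / \<eta>) + t ^ 4 * (K * (\<rho> a)\<^sup>2)" for a
  define Qf where "Qf \<omega> = (\<Sum>a\<in>I. \<Sum>b\<in>I. L a b * Z b \<omega> * Z a \<omega>)" for \<omega>
  define Vf where "Vf \<omega> = (\<Sum>a\<in>I. (\<Sum>b\<in>I. L a b * Z b \<omega>)\<^sup>2)" for \<omega>
  define P where "P Q V \<longleftrightarrow> Q \<in> borel_measurable (F I) \<and> V \<in> borel_measurable (F I) \<and>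
    (\<forall>\<omega>. 0 \<le> V \<omega> \<and> V \<omega> \<le> 2 \<and> (Vf \<omega> \<le> 2 \<longrightarrow> Q \<omega> = Qf \<omega> \<and> V \<omega> = Vf \<omega>)) \<and>
    cmod (expectation (\<lambda>\<omega>. W (Q \<omega>) (V \<omega>)) - 1) \<le> exp (t\<^sup>2) * (\<Sum>a\<in>I. \<beta> a)" for Q V
  have "\<exists>Q V. P Q V"
    unfolding P_def \<rho>_def W_def \<beta>_def Qf_def Vf_def
    by (rule stopped_quadratic_form[OF _ \<open>\<eta> > 0\<close> order_refl]) (rule rank)
  then obtain Q V where QV: "P Q V"
    by blast
  then have V: "\<And>\<omega>. 0 \<le> V \<omega>" "\<And>\<omega>. V \<omega> \<le> 2"
      "\<And>\<omega>. Vf \<omega> \<le> 2 \<Longrightarrow> Q \<omega> = Qf \<omega> \<and> V \<omega> = Vf \<omega>"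
    and W: "cmod (expectation (\<lambda>\<omega>. W (Q \<omega>) (V \<omega>)) - 1) \<le> exp (t\<^sup>2) * (\<Sum>a\<in>I. \<beta> a)"
    by (simp_all add: P_def)
  from QV[unfolded P_def] have [measurable]: "Q \<in> borel_measurable M" "V \<in> borel_measurable M"
    using measurable_F_M[of I] by auto
  note [measurable] = measurable_Z
  have [measurable]: "Qf \<in> borel_measurable M"
    unfolding Qf_def by measurable
  define m where "m b c = (\<Sum>a\<in>I. L a b * L a c)" for b c
  \<comment> \<open>\<open>Vf\<close> is the quadratic form with matrix L^T L, whose trace is
    \<open>s\<close> and whose squared Frobenius norm is \<open>e\<close>.\<close>
  have Vm: "Vf \<omega> = (\<Sum>b\<in>I. \<Sum>c\<in>I. m b c * Z b \<omega> * Z c \<omega>)" for \<omega>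
  proof -
    have "Vf \<omega> = (\<Sum>a\<in>I. \<Sum>b\<in>I. \<Sum>c\<in>I. L a b * L a c * Z b \<omega> * Z c \<omega>)"
      by (simp add: Vf_def power2_eq_square sum_product mult_ac)
    also have "\<dots> = (\<Sum>b\<in>I. \<Sum>a\<in>I. \<Sum>c\<in>I. L a b * L a c * Z b \<omega> * Z c \<omega>)"
      by (rule sum.swap)
    also have "\<dots> = (\<Sum>b\<in>I. \<Sum>c\<in>I. \<Sum>a\<in>I. L a b * L a c * Z b \<omega> * Z c \<omega>)"
      by (intro sum.cong sum.swap refl)
    finally show ?thesis
      by (simp add: m_def sum_distrib_right)
  qed
  have ms: "(\<Sum>b\<in>I. m b b) = s"
    unfolding m_def s_def by (subst sum.swap) (simp add: power2_eq_square)
  have me: "(\<Sum>b\<in>I. \<Sum>c\<in>I. (m b c)\<^sup>2) = e"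
    by (simp add: m_def e_def)
  have sq: "square_int (\<lambda>\<omega>. Vf \<omega> - s)" and "expectation (\<lambda>\<omega>. (Vf \<omega> - s)\<^sup>2) \<le> K * e"
    using quadratic_form[OF finite_I order_refl, of m] unfolding ms me Vm by auto
  then have dV: "expectation (\<lambda>\<omega>. \<bar>Vf \<omega> - s\<bar>) \<le> sqrt (K * e)"
    by (intro order_trans[OF expectation_abs_le_sqrt[OF sq]]) simp
  have iV: "integrable M (\<lambda>\<omega>. \<bar>Vf \<omega> - s\<bar>)"
    using square_int_integrable[OF sq] by simp
  then have iV1: "integrable M (\<lambda>\<omega>. \<bar>Vf \<omega> - 1\<bar>)"
    using Bochner_Integration.integrable_add[OF square_int_integrable[OF sq], of "\<lambda>_. s - 1"] by simp
  have "expectation (\<lambda>\<omega>. \<bar>Vf \<omega> - 1\<bar>) \<le> expectation (\<lambda>\<omega>. \<bar>Vf \<omega> - s\<bar> + \<bar>s - 1\<bar>)"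
    using iV iV1 by (intro integral_mono) auto
  also have "\<dots> \<le> sqrt (K * e) + \<bar>s - 1\<bar>"
    using iV dV by (simp add: prob_space)
  finally have EV: "expectation (\<lambda>\<omega>. \<bar>Vf \<omega> - 1\<bar>) \<le> sqrt (K * e) + \<bar>s - 1\<bar>" .
  \<comment> \<open>The left side collects the diagonal entries of L L^T alone.\<close>
  have "(\<Sum>a\<in>I. (\<rho> a)\<^sup>2) \<le> (\<Sum>a\<in>I. \<Sum>a'\<in>I. (\<Sum>b\<in>I. L a b * L a' b)\<^sup>2)"
  proof (rule sum_mono)
    fix a assume "a \<in> I"
    then show "(\<rho> a)\<^sup>2 \<le> (\<Sum>a'\<in>I. (\<Sum>b\<in>I. L a b * L a' b)\<^sup>2)"
      using member_le_sum[of a I "\<lambda>a'. (\<Sum>b\<in>I. L a b * L a' b)\<^sup>2"] finite_I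
      by (simp add: \<rho>_def power2_eq_square)
  qed
  then have \<rho>2: "(\<Sum>a\<in>I. (\<rho> a)\<^sup>2) \<le> e"
    unfolding e_def by (subst frobenius_gram_transpose)
  have "(\<Sum>a\<in>I. \<beta> a) = \<bar>t\<bar> ^ 3 * (\<eta> * (\<Sum>a\<in>I. \<rho> a) + K * (K * (\<Sum>a\<in>I. (\<rho> a)\<^sup>2)) / \<eta>) + t ^ 4 * (K * (\<Sum>a\<in>I. (\<rho> a)\<^sup>2))"
    by (simp add: \<beta>_def sum.distrib sum_distrib_left sum_divide_distrib distrib_left)
  also have "(\<Sum>a\<in>I. \<rho> a) = s"
    by (simp add: \<rho>_def s_def)
  also have "\<bar>t\<bar> ^ 3 * (\<eta> * s + K * (K * (\<Sum>a\<in>I. (\<rho> a)\<^sup>2)) / \<eta>) + t ^ 4 * (K * (\<Sum>a\<in>I. (\<rho> a)\<^sup>2))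
     \<le> \<bar>t\<bar> ^ 3 * (\<eta> * s + K * (K * e) / \<eta>) + t ^ 4 * (K * e)"
    using K_ge \<open>\<eta> > 0\<close> by (intro add_mono mult_left_mono divide_right_mono \<rho>2) auto
  finally have \<beta>: "(\<Sum>a\<in>I. \<beta> a) \<le> \<bar>t\<bar> ^ 3 * (\<eta> * s + K * (K * e) / \<eta>) + t ^ 4 * (K * e)" .
  have pw: "cmod (iexp (t * Qf \<omega>) - exp (- (t\<^sup>2) / 2) * W (Q \<omega>) (V \<omega>)) \<le>
    (2 + t\<^sup>2 * exp (t\<^sup>2)) * \<bar>Vf \<omega> - 1\<bar>" for \<omega>
  proof -
    have eq: "exp (- (t\<^sup>2) / 2) * W (Q \<omega>) (V \<omega>) = iexp (t * Q \<omega>) * complex_of_real (exp (t\<^sup>2 * (V \<omega> - 1) / 2))"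
      by (simp add: W_def exp_of_real[symmetric] algebra_simps diff_divide_distrib flip: exp_add)
    have "cmod (iexp (t * Qf \<omega>) - iexp (t * Q \<omega>)) \<le> 2 * \<bar>Vf \<omega> - 1\<bar>"
    \<comment> \<open>Where truncation may have acted, \<open>Vf\<close> exceeds 2, and the trivial
      bound 2 for the difference is already below twice the deviation of \<open>Vf\<close> from
      1.\<close>
    proof (cases "Vf \<omega> \<le> 2")
      case False
      have "cmod (iexp (t * Qf \<omega>) - iexp (t * Q \<omega>)) \<le> 1 + 1"
        by (intro order_trans[OF norm_triangle_ineq4] add_mono) simp_all
      also have "1 + 1 \<le> 2 * \<bar>Vf \<omega> - 1\<bar>"
        using False by simp
      finally show ?thesis .
    qed (use V(3) in auto)
    moreover have "cmod (iexp (t * Q \<omega>) - iexp (t * Q \<omega>) * complex_of_real (exp (t\<^sup>2 * (V \<omega> - 1) / 2)))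
       \<le> t\<^sup>2 * exp (t\<^sup>2) * \<bar>Vf \<omega> - 1\<bar>"
    proof -
      have "cmod (iexp (t * Q \<omega>) - iexp (t * Q \<omega>) * complex_of_real (exp (t\<^sup>2 * (V \<omega> - 1) / 2))) =
        cmod (iexp (t * Q \<omega>) * complex_of_real (1 - exp (t\<^sup>2 * (V \<omega> - 1) / 2)))"
        by (simp add: algebra_simps)
      also have "\<dots> = \<bar>1 - exp (t\<^sup>2 * (V \<omega> - 1) / 2)\<bar>"
        unfolding norm_mult norm_of_real by simp
      also have "\<dots> \<le> \<bar>t\<^sup>2 * (V \<omega> - 1) / 2\<bar> * exp (t\<^sup>2)"
      proof (rule abs_one_minus_exp_le)
        have "t\<^sup>2 * (V \<omega> - 1) \<le> t\<^sup>2 * 1"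
          using V(2)[of \<omega>] by (intro mult_left_mono) auto
        then show "t\<^sup>2 * (V \<omega> - 1) / 2 \<le> t\<^sup>2"
          using zero_le_power2[of t] by linarith
      qed simp
      also have "\<dots> \<le> (t\<^sup>2 * \<bar>Vf \<omega> - 1\<bar>) * exp (t\<^sup>2)"
      proof (rule mult_right_mono)
        \<comment> \<open>Either \<open>V\<close> equals \<open>Vf\<close>, or \<open>Vf\<close> is
          beyond 2 while \<open>V\<close> lies between 0 and 2.\<close>
        have "\<bar>V \<omega> - 1\<bar> \<le> \<bar>Vf \<omega> - 1\<bar>"
          using V(3)[of \<omega>] V(1)[of \<omega>] V(2)[of \<omega>] by (cases "Vf \<omega> \<le> 2") auto
        then have "t\<^sup>2 * \<bar>V \<omega> - 1\<bar> \<le> t\<^sup>2 * \<bar>Vf \<omega> - 1\<bar>"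
          by (intro mult_left_mono) auto
        moreover have "\<bar>t\<^sup>2 * (V \<omega> - 1) / 2\<bar> = t\<^sup>2 * \<bar>V \<omega> - 1\<bar> / 2" "0 \<le> t\<^sup>2 * \<bar>V \<omega> - 1\<bar>"
          by (simp_all add: abs_mult)
        ultimately show "\<bar>t\<^sup>2 * (V \<omega> - 1) / 2\<bar> \<le> t\<^sup>2 * \<bar>Vf \<omega> - 1\<bar>"
          by linarith
      qed simp
      finally show ?thesis by (simp add: mult_ac)
    qed
    ultimately show ?thesis
      unfolding eq
      using norm_triangle_ineq[of "iexp (t * Qf \<omega>) - iexp (t * Q \<omega>)" 
          "iexp (t * Q \<omega>) - iexp (t * Q \<omega>) * complex_of_real (exp (t\<^sup>2 * (V \<omega> - 1) / 2))"]
      by (simp add: algebra_simps)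
  qed
  have iW: "integrable M (\<lambda>\<omega>. W (Q \<omega>) (V \<omega>))"
  proof (rule integrable_const_bound[where B="exp (t\<^sup>2)"])
    show "AE \<omega> in M. cmod (W (Q \<omega>) (V \<omega>)) \<le> exp (t\<^sup>2)"
      using V(2) mult_left_mono[OF V(2), of "t\<^sup>2"] by (simp add: W_def norm_exp)
  qed (simp add: W_def)
  have iQ: "integrable M (\<lambda>\<omega>. iexp (t * Qf \<omega>))"
    by (rule integrable_const_bound[where B=1]) simp_all
  have "expectation (\<lambda>\<omega>. iexp (t * Qf \<omega>)) - exp (- (t\<^sup>2) / 2) =
     expectation (\<lambda>\<omega>. iexp (t * Qf \<omega>) - exp (- (t\<^sup>2) / 2) * W (Q \<omega>) (V \<omega>))
     + exp (- (t\<^sup>2) / 2) * (expectation (\<lambda>\<omega>. W (Q \<omega>) (V \<omega>)) - 1)"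
    using iW iQ by (simp add: algebra_simps)
  then have "cmod (expectation (\<lambda>\<omega>. iexp (t * Qf \<omega>)) - exp (- (t\<^sup>2) / 2)) \<le>
     cmod (expectation (\<lambda>\<omega>. iexp (t * Qf \<omega>) - exp (- (t\<^sup>2) / 2) * W (Q \<omega>) (V \<omega>)))
     + cmod (exp (- (t\<^sup>2) / 2) * (expectation (\<lambda>\<omega>. W (Q \<omega>) (V \<omega>)) - 1))"
    by (simp only: norm_triangle_ineq)
  also have "cmod (exp (- (t\<^sup>2) / 2) * (expectation (\<lambda>\<omega>. W (Q \<omega>) (V \<omega>)) - 1)) \<le>
     1 * (exp (t\<^sup>2) * (\<bar>t\<bar> ^ 3 * (\<eta> * s + K * (K * e) / \<eta>) + t ^ 4 * (K * e)))"
    unfolding norm_mult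
    by (intro mult_mono order_trans[OF W] mult_left_mono \<beta>) simp_all
  also have "cmod (expectation (\<lambda>\<omega>. iexp (t * Qf \<omega>) - exp (- (t\<^sup>2) / 2) * W (Q \<omega>) (V \<omega>))) \<le>
     (2 + t\<^sup>2 * exp (t\<^sup>2)) * (sqrt (K * e) + \<bar>s - 1\<bar>)"
  proof -
    have "cmod (expectation (\<lambda>\<omega>. iexp (t * Qf \<omega>) - exp (- (t\<^sup>2) / 2) * W (Q \<omega>) (V \<omega>))) \<le>
      expectation (\<lambda>\<omega>. cmod (iexp (t * Qf \<omega>) - exp (- (t\<^sup>2) / 2) * W (Q \<omega>) (V \<omega>)))"
      by (rule integral_norm_bound)
    also have "\<dots> \<le> expectation (\<lambda>\<omega>. (2 + t\<^sup>2 * exp (t\<^sup>2)) * \<bar>Vf \<omega> - 1\<bar>)"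
      by (intro integral_mono pw integrable_norm Bochner_Integration.integrable_diff integrable_mult_right iW iQ iV1)
    also have "\<dots> \<le> (2 + t\<^sup>2 * exp (t\<^sup>2)) * (sqrt (K * e) + \<bar>s - 1\<bar>)"
      using EV by (simp add: mult_left_mono)
    finally show ?thesis .
  qed
  finally show ?thesis
    unfolding Qf_def by simp
qed

end

lemma quadratic_form_char_tendsto:
  fixes M :: "nat \<Rightarrow> 'a measure" and I :: "nat \<Rightarrow> 'i set" and L :: "nat \<Rightarrow> 'i \<Rightarrow> 'i \<Rightarrow> real"
    and rank :: "'i \<Rightarrow> nat"
  assumes fam: "\<And>m. std_family (M m) (I m) (Z m) K"
    and rank: "\<And>m a b. a \<in> I m \<Longrightarrow> b \<in> I m \<Longrightarrow> L m a b \<noteq> 0 \<Longrightarrow> rank b < rank a"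
    and s: "(\<lambda>m. \<Sum>a\<in>I m. \<Sum>b\<in>I m. (L m a b)\<^sup>2) \<longlonglongrightarrow> 1"
    and e: "(\<lambda>m. \<Sum>b\<in>I m. \<Sum>c\<in>I m. (\<Sum>a\<in>I m. L m a b * L m a c)\<^sup>2) \<longlonglongrightarrow> 0"
  shows "(\<lambda>m. \<integral>\<omega>. iexp (t * (\<Sum>a\<in>I m. \<Sum>b\<in>I m. L m a b * Z m b \<omega> * Z m a \<omega>)) \<partial>M m)
    \<longlonglongrightarrow> exp (- (t\<^sup>2) / 2)"
proof -
  define s where "s m = (\<Sum>a\<in>I m. \<Sum>b\<in>I m. (L m a b)\<^sup>2)" for m
  define e where "e m = (\<Sum>b\<in>I m. \<Sum>c\<in>I m. (\<Sum>a\<in>I m. L m a b * L m a c)\<^sup>2)" for m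
  \<comment> \<open>Both \<eta> and \<open>e m / \<eta> m\<close> must tend to 0, which the square
    root achieves; the second summand keeps \<eta> positive where \<open>e m = 0\<close>.\<close>
  define \<eta> where "\<eta> m = sqrt (e m) + 1 / (1 + real m)" for m
  have lim: "s \<longlonglongrightarrow> 1" "e \<longlonglongrightarrow> 0" using assms by (auto simp: s_def[abs_def] e_def[abs_def])
  have e0: "e m \<ge> 0" for m
    by (auto simp: e_def intro!: sum_nonneg)
  have \<eta>0: "\<eta> m > 0" for m
    unfolding \<eta>_def using e0[of m] by (intro add_nonneg_pos) auto
  have "\<eta> \<longlonglongrightarrow> sqrt 0 + 0"
    unfolding \<eta>_def[abs_def] by (intro tendsto_intros lim LIMSEQ_Suc[OF lim_inverse_n', simplified])
  then have \<eta>: "\<eta> \<longlonglongrightarrow> 0" by simp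
  have "e m / \<eta> m \<le> sqrt (e m)" for m
  proof -
    have "e m = sqrt (e m) * sqrt (e m)" using e0 by simp
    also have "\<dots> \<le> sqrt (e m) * \<eta> m"
      using e0 by (intro mult_left_mono) (auto simp: \<eta>_def)
    finally show ?thesis using \<eta>0[of m] by (simp add: field_simps)
  qed
  moreover have "(\<lambda>m. sqrt (e m)) \<longlonglongrightarrow> 0"
    using tendsto_real_sqrt[OF lim(2)] by simp
  ultimately have e\<eta>: "(\<lambda>m. e m / \<eta> m) \<longlonglongrightarrow> 0"
    using e0 \<eta>0 by (intro tendsto_sandwich[of "\<lambda>_. 0" "\<lambda>m. e m / \<eta> m" sequentially "\<lambda>m. sqrt (e m)"])
      (auto intro!: always_eventually divide_nonneg_pos)
  have "(\<lambda>m. exp (t\<^sup>2) * (\<bar>t\<bar> ^ 3 * (\<eta> m * s m + K * K * (e m / \<eta> m)) + t ^ 4 * (K * e m))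
    + (2 + t\<^sup>2 * exp (t\<^sup>2)) * (sqrt (K * e m) + \<bar>s m - 1\<bar>)) \<longlonglongrightarrow>
    exp (t\<^sup>2) * (\<bar>t\<bar> ^ 3 * (0 * 1 + K * K * 0) + t ^ 4 * (K * 0))
    + (2 + t\<^sup>2 * exp (t\<^sup>2)) * (sqrt (K * 0) + \<bar>1 - 1\<bar>)"
    by (intro tendsto_intros lim \<eta> e\<eta>)
  then have lim0: "(\<lambda>m. exp (t\<^sup>2) * (\<bar>t\<bar> ^ 3 * (\<eta> m * s m + K * K * (e m / \<eta> m)) + t ^ 4 * (K * e m))
    + (2 + t\<^sup>2 * exp (t\<^sup>2)) * (sqrt (K * e m) + \<bar>s m - 1\<bar>)) \<longlonglongrightarrow> 0"
    by simp
  have bound: "cmod ((\<integral>\<omega>. iexp (t * (\<Sum>a\<in>I m. \<Sum>b\<in>I m. L m a b * Z m b \<omega> * Z m a \<omega>)) \<partial>M m) - exp (- (t\<^sup>2) / 2)) \<le>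
     exp (t\<^sup>2) * (\<bar>t\<bar> ^ 3 * (\<eta> m * s m + K * (K * e m) / \<eta> m) + t ^ 4 * (K * e m))
    + (2 + t\<^sup>2 * exp (t\<^sup>2)) * (sqrt (K * e m) + \<bar>s m - 1\<bar>)" for m
    unfolding s_def e_def by (rule std_family.quadratic_form_char_bound[OF fam _ \<eta>0]) (rule rank)
  show ?thesis
    by (intro LIM_zero_cancel[OF Lim_null_comparison[OF always_eventually lim0]] allI)
      (use bound in \<open>simp only: mult.assoc times_divide_eq_right\<close>)
qed

subsection \<open>Convergence of tail probabilities\<close>

interpretation std_normal: real_distribution std_normal_distribution
  by (rule real_dist_normal_dist)

abbreviation normal_cdf :: "real \<Rightarrow> real" where
  "normal_cdf \<equiv> cdf std_normal_distribution"

text \<open>The normal density is below 1; the crude constant keeps the later error budgets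
  simple.\<close>

lemma normal_cdf_lipschitz:
  assumes "x \<le> y"
  shows "normal_cdf y - normal_cdf x \<le> y - x"
proof (cases "x = y")
  case False
  have "std_normal_density z \<le> 1" for z
  proof -
    have "exp (- z\<^sup>2 / 2) \<le> 1" by simp
    moreover have "1 \<le> sqrt (2 * pi)" using pi_gt3 by simp
    ultimately have "exp (- z\<^sup>2 / 2) / sqrt (2 * pi) \<le> 1 / 1"
      by (intro frac_le) auto
    then show ?thesis by (simp add: normal_density_def)
  qed
  then have "(\<integral>\<^sup>+z. ennreal (std_normal_density z) * indicator {x<..y} z \<partial>lborel) \<le>
      (\<integral>\<^sup>+z. indicator {x<..y} z \<partial>lborel)"
    by (intro nn_integral_mono) (auto split: split_indicator)
  then have "emeasure std_normal_distribution {x<..y} \<le> (\<integral>\<^sup>+z. indicator {x<..y} z \<partial>lborel)"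
    by (simp add: emeasure_density)
  also have "\<dots> = ennreal (y - x)"
    using assms by simp
  finally have "measure std_normal_distribution {x<..y} \<le> y - x"
    using assms by (simp add: measure_def enn2real_leI)
  then show ?thesis
    using std_normal.cdf_diff_eq[of x y] assms False by simp
qed simp

lemma normal_cdf_lipschitz_abs: "\<bar>normal_cdf y - normal_cdf x\<bar> \<le> \<bar>y - x\<bar>"
proof (cases "x \<le> y")
  case True
  then show ?thesis using normal_cdf_lipschitz std_normal.cdf_nondecreasing[OF True] by simp
next
  case False
  then have "y \<le> x" by simp
  then show ?thesis using normal_cdf_lipschitz[OF \<open>y \<le> x\<close>] std_normal.cdf_nondecreasing[OF \<open>y \<le> x\<close>] by simp
qed

lemma isCont_normal_cdf: "isCont normal_cdf x"
  unfolding continuous_at_eps_delta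
  by (intro allI impI) (metis normal_cdf_lipschitz_abs dist_real_def order_le_less_trans)

text \<open>Symmetry of the law, together with the absence of atoms, which turns the open half-line
  into the closed one.\<close>

lemma normal_cdf_minus: "normal_cdf (- x) = 1 - normal_cdf x"
proof -
  have d: "distributed std_normal_distribution lborel (\<lambda>x. x) (normal_density 0 1)"
    by (auto simp: distributed_def distr_id2)
  have "prob_space std_normal_distribution"
    by (rule std_normal.prob_space_axioms)
  from prob_space.normal_density_affine[OF this d, of "-1" 0]
  have "distributed std_normal_distribution lborel uminus (normal_density 0 1)"
    by (simp add: comp_def)
  then have eq: "distr std_normal_distribution borel uminus = std_normal_distribution"
    using distributed_distr_eq_density[of std_normal_distribution lborel uminus "normal_density 0 1"] 
    by (simp cong: distr_cong)
  have "normal_cdf (- x) = measure (distr std_normal_distribution borel uminus) {..- x}"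
    by (simp add: eq cdf_def)
  also have "\<dots> = measure std_normal_distribution {x..}"
    by (subst measure_distr) (auto intro!: arg_cong[where f="measure std_normal_distribution"])
  also have "{x..} = UNIV - {..<x}" by auto
  also have "measure std_normal_distribution (UNIV - {..<x}) = 1 - measure std_normal_distribution {..<x}"
    using std_normal.prob_compl[of "{..<x}"] by simp
  also have "measure std_normal_distribution {..<x} = normal_cdf x"
  proof -
    have "{..x} = {..<x} \<union> {x}" by auto
    then have "normal_cdf x = measure std_normal_distribution {..<x} + measure std_normal_distribution {x}"
      using std_normal.finite_measure_Union[of "{..<x}" "{x}"] by (simp add: cdf_def)
    then show ?thesis
      using isCont_normal_cdf[of x] by (simp add: std_normal.isCont_cdf)
  qed
  finally show ?thesis .
qed

text \<open>Polya's theorem: pointwise convergence on a finite grid extends to the whole line by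
  monotonicity, with the Lipschitz bound between grid points and the small tails beyond
  \<open>a\<close> and \<open>b\<close>. Uniformity is needed because the argument of the
  distribution function moves with \<open>m\<close> and may diverge.\<close>

lemma normal_uniform_convergence:
  assumes "\<And>m. real_distribution (\<mu> m)" "weak_conv_m \<mu> std_normal_distribution" "\<epsilon> > 0"
  shows "\<forall>\<^sub>F m in sequentially. \<forall>x. \<bar>cdf (\<mu> m) x - normal_cdf x\<bar> < \<epsilon>"
proof -
  define d where "d = \<epsilon> / 4"
  have d: "d > 0" using assms by (simp add: d_def)
  have "\<forall>\<^sub>F x in at_top. normal_cdf x > 1 - d"
    using std_normal.cdf_lim_at_top_prob d by (intro order_tendstoD) auto
  then obtain b where b: "\<And>x. x \<ge> b \<Longrightarrow> normal_cdf x > 1 - d"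
    by (auto simp: eventually_at_top_linorder)
  have "\<forall>\<^sub>F x in at_bot. normal_cdf x < d"
    using std_normal.cdf_lim_at_bot d by (intro order_tendstoD) auto
  then obtain a where a: "\<And>x. x \<le> a \<Longrightarrow> normal_cdf x < d"
    by (auto simp: eventually_at_bot_linorder)
  define n where "n = nat \<lceil>(b - a) / d\<rceil>"
  define y where "y i = a + real i * d" for i
  have yn: "y n \<ge> b"
  proof -
    have "(b - a) / d \<le> real n" unfolding n_def by linarith
    then show ?thesis using d by (simp add: y_def field_simps)
  qed
  have "(\<lambda>m. cdf (\<mu> m) z) \<longlonglongrightarrow> normal_cdf z" for z
    using assms(2) isCont_normal_cdf by (auto simp: weak_conv_m_def weak_conv_def)
  then have "\<forall>\<^sub>F m in sequentially. \<bar>cdf (\<mu> m) z - normal_cdf z\<bar> < d" for z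
    using tendstoD[OF _ d, of "\<lambda>m. cdf (\<mu> m) z" "normal_cdf z"] by (simp add: dist_real_def)
  then have "\<forall>\<^sub>F m in sequentially. \<forall>i\<in>{..n}. \<bar>cdf (\<mu> m) (y i) - normal_cdf (y i)\<bar> < d"
    by (intro eventually_ball_finite) auto
  then show ?thesis
  proof eventually_elim
    case (elim m)
    interpret \<mu>: real_distribution "\<mu> m" by fact
    show ?case
    proof
      fix x
      consider "x \<le> a" | "x \<ge> y n" | "a < x" "x < y n" by linarith
      then show "\<bar>cdf (\<mu> m) x - normal_cdf x\<bar> < \<epsilon>"
      proof cases
        case 1
        have "cdf (\<mu> m) x \<le> cdf (\<mu> m) (y 0)"
          using 1 by (intro \<mu>.cdf_nondecreasing) (simp add: y_def)
        moreover have "\<bar>cdf (\<mu> m) (y 0) - normal_cdf (y 0)\<bar> < d" "normal_cdf (y 0) < d" "normal_cdf x < d"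
          using elim[rule_format, of 0] a 1 by (auto simp: y_def)
        ultimately show ?thesis
          using \<mu>.cdf_nonneg[of x] std_normal.cdf_nonneg[of x] d
          unfolding d_def abs_less_iff by linarith
      next
        case 2
        have "cdf (\<mu> m) x \<ge> cdf (\<mu> m) (y n)"
          using 2 by (intro \<mu>.cdf_nondecreasing)
        moreover have "\<bar>cdf (\<mu> m) (y n) - normal_cdf (y n)\<bar> < d" "normal_cdf (y n) > 1 - d" "normal_cdf x > 1 - d"
          using elim b yn 2 by auto
        ultimately show ?thesis
          using \<mu>.cdf_bounded_prob[of x] std_normal.cdf_bounded_prob[of x] d
          unfolding d_def abs_less_iff by linarith
      next
        case 3
        define i where "i = nat \<lfloor>(x - a) / d\<rfloor>"
        have "0 \<le> (x - a) / d" using 3 d by simp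
        then have "real i \<le> (x - a) / d" "(x - a) / d < real i + 1"
          unfolding i_def by linarith+
        then have i: "y i \<le> x" "x < y (Suc i)"
          using d by (auto simp: y_def field_simps)
        have "real i * d < real n * d" using i(1) 3 by (simp add: y_def)
        then have "i < n" using d by simp
        then have *: "\<bar>cdf (\<mu> m) (y i) - normal_cdf (y i)\<bar> < d" "\<bar>cdf (\<mu> m) (y (Suc i)) - normal_cdf (y (Suc i))\<bar> < d"
          using elim by auto
        have "cdf (\<mu> m) (y i) \<le> cdf (\<mu> m) x" "cdf (\<mu> m) x \<le> cdf (\<mu> m) (y (Suc i))"
          "normal_cdf (y i) \<le> normal_cdf x" "normal_cdf x \<le> normal_cdf (y (Suc i))"
          using i by (auto intro!: \<mu>.cdf_nondecreasing std_normal.cdf_nondecreasing)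
        moreover have "normal_cdf (y (Suc i)) - normal_cdf (y i) \<le> d"
          using normal_cdf_lipschitz[of "y i" "y (Suc i)"] d by (simp add: y_def algebra_simps)
        ultimately show ?thesis
          using * d unfolding d_def abs_less_iff by linarith
      qed
    qed
  qed
qed

text \<open>The shift is known only up to a relative error, and its size is not bounded. While
  \<theta> stays below a constant the relative error is an absolute one; once \<theta> is large, so
  is \<open>b\<close>, and both values of the distribution function are close to 1.\<close>

lemma normal_cdf_shift_tendsto:
  assumes "e \<longlonglongrightarrow> 0" "\<forall>\<^sub>F m in sequentially. 0 \<le> \<theta> m \<and> \<bar>b m - \<theta> m\<bar> \<le> e m * \<theta> m"
  shows "(\<lambda>m. normal_cdf (- \<xi> + b m) - normal_cdf (- \<xi> + \<theta> m)) \<longlonglongrightarrow> 0"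
proof (rule tendstoI)
  fix \<epsilon> :: real assume "\<epsilon> > 0"
  have "\<forall>\<^sub>F x in at_top. normal_cdf x > 1 - \<epsilon>"
    using std_normal.cdf_lim_at_top_prob \<open>\<epsilon> > 0\<close> by (intro order_tendstoD) auto
  then obtain B where B: "\<And>x. x \<ge> B \<Longrightarrow> normal_cdf x > 1 - \<epsilon>"
    by (auto simp: eventually_at_top_linorder)
  \<comment> \<open>When \<open>e m\<close> is below 1/2, \<open>b m\<close> is at least half of
    \<open>\<theta> m\<close>; with \<theta> beyond \<open>C\<close> both arguments then exceed
    \<open>B\<close>.\<close>
  define C where "C = 2 * \<bar>B + \<xi>\<bar> + 1"
  have "C > 0"
    unfolding C_def by (intro add_nonneg_pos) simp_all
  then have "\<forall>\<^sub>F m in sequentially. e m < min (1 / 2) (\<epsilon> / C)"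
    using assms(1) \<open>\<epsilon> > 0\<close> by (intro order_tendstoD) auto
  with assms(2) show "\<forall>\<^sub>F m in sequentially. dist (normal_cdf (- \<xi> + b m) - normal_cdf (- \<xi> + \<theta> m)) 0 < \<epsilon>"
  proof eventually_elim
    case (elim m)
    show ?case
    proof (cases "\<theta> m \<ge> C")
      case True
      have "e m * \<theta> m \<le> 1 / 2 * \<theta> m"
        using elim by (intro mult_right_mono) auto
      then have "b m \<ge> \<theta> m / 2" using elim by linarith
      moreover have "2 * (B + \<xi>) \<le> \<theta> m" "0 \<le> \<theta> m"
        using True abs_ge_self[of "B + \<xi>"] elim by (auto simp: C_def)
      ultimately have "- \<xi> + b m \<ge> B" "- \<xi> + \<theta> m \<ge> B"
        by simp_all
      then show ?thesis
        using B[of "- \<xi> + b m"] B[of "- \<xi> + \<theta> m"] std_normal.cdf_bounded_prob[of "- \<xi> + b m"]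
          std_normal.cdf_bounded_prob[of "- \<xi> + \<theta> m"] by (auto simp: dist_real_def)
    next
      case False
      have "\<bar>b m - \<theta> m\<bar> \<le> max 0 (e m) * \<theta> m"
        using elim by (intro order_trans[OF _ mult_right_mono[of "e m" "max 0 (e m)"]]) auto
      also have "\<dots> \<le> max 0 (e m) * C"
        using False by (intro mult_left_mono) auto
      also have "\<dots> < \<epsilon>"
        using elim \<open>C > 0\<close> \<open>\<epsilon> > 0\<close> by (auto simp: max_def field_simps)
      finally show ?thesis
        using normal_cdf_lipschitz_abs[of "- \<xi> + b m" "- \<xi> + \<theta> m"] by (auto simp: dist_real_def)
    qed
  qed
qed

text \<open>A Slutsky argument with a moving threshold: off an event of small probability the random
  threshold and \<open>R\<close> perturb the cut for \<open>Q\<close> by a fixed small amount, and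
  the uniform convergence of the distribution functions applies wherever the cut lies.\<close>

lemma tail_probability_tendsto:
  fixes M :: "nat \<Rightarrow> 'a measure" and Q R V T :: "nat \<Rightarrow> 'a \<Rightarrow> real"
  assumes prob: "\<And>m. prob_space (M m)"
    and [measurable]: "\<And>m. Q m \<in> borel_measurable (M m)" "\<And>m. R m \<in> borel_measurable (M m)"
      "\<And>m. V m \<in> borel_measurable (M m)" "\<And>m. T m \<in> borel_measurable (M m)"
    and char: "\<And>t. (\<lambda>m. \<integral>\<omega>. iexp (t * Q m \<omega>) \<partial>M m) \<longlonglongrightarrow> exp (- (t\<^sup>2) / 2)"
    and R: "\<And>\<epsilon>. \<epsilon> > 0 \<Longrightarrow> (\<lambda>m. measure (M m) {\<omega>\<in>space (M m). \<bar>R m \<omega>\<bar> \<ge> \<epsilon>}) \<longlonglongrightarrow> 0"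
    and V: "\<And>\<epsilon>. \<epsilon> > 0 \<Longrightarrow> (\<lambda>m. measure (M m) {\<omega>\<in>space (M m). \<bar>V m \<omega> - 1\<bar> \<ge> \<epsilon>}) \<longlonglongrightarrow> 0"
    and b: "e \<longlonglongrightarrow> 0" "\<forall>\<^sub>F m in sequentially. 0 \<le> \<theta> m \<and> \<bar>b m - \<theta> m\<bar> \<le> e m * \<theta> m"
    and T: "\<forall>\<^sub>F m in sequentially. \<forall>\<omega>\<in>space (M m). V m \<omega> > 0 \<longrightarrow>
      (T m \<omega> \<ge> \<xi> \<longleftrightarrow> Q m \<omega> + R m \<omega> + b m \<ge> \<xi> * sqrt (V m \<omega>))"
  shows "(\<lambda>m. measure (M m) {\<omega>\<in>space (M m). T m \<omega> \<ge> \<xi>} - normal_cdf (- \<xi> + \<theta> m)) \<longlonglongrightarrow> 0"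
proof -
  define \<mu> where "\<mu> m = distr (M m) borel (Q m)" for m
  have rd: "real_distribution (\<mu> m)" for m
    unfolding \<mu>_def using prob by (intro prob_space.real_distribution_distr) auto
  have "weak_conv_m \<mu> std_normal_distribution"
  proof (rule levy_continuity)
    fix t
    have "char (\<mu> m) t = (\<integral>\<omega>. iexp (t * Q m \<omega>) \<partial>M m)" for m
      unfolding char_def \<mu>_def by (subst integral_distr) auto
    then show "(\<lambda>m. char (\<mu> m) t) \<longlonglongrightarrow> char std_normal_distribution t"
      using char[of t] by (simp add: char_std_normal_distribution)
  qed (use rd real_dist_normal_dist in auto)
  note unif = normal_uniform_convergence[OF rd this]
  have "(\<lambda>m. measure (M m) {\<omega>\<in>space (M m). T m \<omega> \<ge> \<xi>} - normal_cdf (- \<xi> + b m)) \<longlonglongrightarrow> 0"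
  proof (rule tendstoI)
    fix \<epsilon> :: real assume "\<epsilon> > 0"
    \<comment> \<open>At most \<open>6 * d\<close> is lost: less than \<open>2 * d\<close> for the
      exceptional event, \<open>d\<close> for uniform convergence, and \<open>3 * d\<close> for
      moving the argument.\<close>
    define d where "d = \<epsilon> / 7"
    \<comment> \<open>The 1/2 keeps \<open>V\<close> positive; the other bound moves the threshold
      \<open>\<xi> * sqrt V\<close> by at most \<open>d\<close>, also for \<xi> = 0.\<close>
    define d' where "d' = min (1 / 2) (d / (1 + \<bar>\<xi>\<bar>))"
    have d: "d > 0" "d' > 0" using \<open>\<epsilon> > 0\<close> by (auto simp: d_def d'_def)
    have "\<forall>\<^sub>F m in sequentially. measure (M m) {\<omega>\<in>space (M m). \<bar>R m \<omega>\<bar> \<ge> d} < d"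
      "\<forall>\<^sub>F m in sequentially. measure (M m) {\<omega>\<in>space (M m). \<bar>V m \<omega> - 1\<bar> \<ge> d'} < d"
      using R[OF d(1)] V[OF d(2)] d by (auto intro: order_tendstoD)
    with unif[OF d(1)] T
    show "\<forall>\<^sub>F m in sequentially. dist (measure (M m) {\<omega>\<in>space (M m). T m \<omega> \<ge> \<xi>} - normal_cdf (- \<xi> + b m)) 0 < \<epsilon>"
    proof eventually_elim
      case (elim m)
      interpret prob_space "M m" by (rule prob)
      define B where "B = {\<omega>\<in>space (M m). \<bar>R m \<omega>\<bar> \<ge> d} \<union> {\<omega>\<in>space (M m). \<bar>V m \<omega> - 1\<bar> \<ge> d'}"
      have [measurable]: "B \<in> events" unfolding B_def by measurable
      have "prob B \<le> prob {\<omega>\<in>space (M m). \<bar>R m \<omega>\<bar> \<ge> d} + prob {\<omega>\<in>space (M m). \<bar>V m \<omega> - 1\<bar> \<ge> d'}"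
        unfolding B_def by (rule measure_Un_le) auto
      then have B: "prob B < 2 * d" using elim by linarith
      have G: "prob {\<omega>\<in>space (M m). Q m \<omega> > y} = 1 - cdf (\<mu> m) y" for y
      proof -
        have "cdf (\<mu> m) y = prob {\<omega>\<in>space (M m). Q m \<omega> \<le> y}"
          unfolding \<mu>_def cdf_def by (subst measure_distr) (auto intro!: arg_cong[where f=prob])
        moreover have "prob {\<omega>\<in>space (M m). Q m \<omega> > y} = 1 - prob {\<omega>\<in>space (M m). Q m \<omega> \<le> y}"
          by (subst prob_compl[symmetric]) (auto intro!: arg_cong[where f=prob])
        ultimately show ?thesis by simp
      qed
      have near: "\<bar>\<xi> * sqrt (V m \<omega>) - \<xi>\<bar> \<le> d \<and> \<bar>R m \<omega>\<bar> < d \<and> V m \<omega> > 0" if "\<omega> \<in> space (M m)" "\<omega> \<notin> B" for \<omega>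
      proof -
        have *: "\<bar>R m \<omega>\<bar> < d" "\<bar>V m \<omega> - 1\<bar> < d'"
          using that by (auto simp: B_def)
        then have "\<bar>V m \<omega> - 1\<bar> < 1 / 2" by (auto simp: d'_def)
        then have v: "V m \<omega> > 0" unfolding abs_less_iff by linarith
        have "\<bar>sqrt (V m \<omega>) - 1\<bar> * 1 \<le> \<bar>sqrt (V m \<omega>) - 1\<bar> * (sqrt (V m \<omega>) + 1)"
          using v by (intro mult_left_mono) auto
        also have "\<dots> = \<bar>(sqrt (V m \<omega>) - 1) * (sqrt (V m \<omega>) + 1)\<bar>"
          using v by (simp add: abs_mult)
        also have "(sqrt (V m \<omega>) - 1) * (sqrt (V m \<omega>) + 1) = V m \<omega> - 1"
          using v by (simp add: algebra_simps)
        finally have "\<bar>sqrt (V m \<omega>) - 1\<bar> \<le> d / (1 + \<bar>\<xi>\<bar>)"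
          using * by (auto simp: d'_def)
        then have "\<bar>\<xi>\<bar> * \<bar>sqrt (V m \<omega>) - 1\<bar> \<le> (1 + \<bar>\<xi>\<bar>) * (d / (1 + \<bar>\<xi>\<bar>))"
          by (intro mult_mono) auto
        moreover have "(1 + \<bar>\<xi>\<bar>) * (d / (1 + \<bar>\<xi>\<bar>)) = d" "\<bar>\<xi>\<bar> * \<bar>sqrt (V m \<omega>) - 1\<bar> = \<bar>\<xi> * sqrt (V m \<omega>) - \<xi>\<bar>"
          by (simp_all add: field_simps abs_mult[symmetric])
        ultimately show ?thesis
          using * v by simp
      qed
      have tiff: "T m \<omega> \<ge> \<xi> \<longleftrightarrow> Q m \<omega> + R m \<omega> + b m \<ge> \<xi> * sqrt (V m \<omega>)" if "\<omega> \<in> space (M m)" "\<omega> \<notin> B" for \<omega>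
        using elim near that by blast
      have "{\<omega>\<in>space (M m). T m \<omega> \<ge> \<xi>} \<subseteq> {\<omega>\<in>space (M m). Q m \<omega> > \<xi> - b m - 3 * d} \<union> B"
      proof safe
        fix \<omega> assume \<omega>: "\<omega> \<in> space (M m)" "\<xi> \<le> T m \<omega>" "\<omega> \<notin> B"
        then show "Q m \<omega> > \<xi> - b m - 3 * d"
          using near[of \<omega>] tiff[of \<omega>] d by linarith
      qed
      then have "prob {\<omega>\<in>space (M m). T m \<omega> \<ge> \<xi>} \<le> prob ({\<omega>\<in>space (M m). Q m \<omega> > \<xi> - b m - 3 * d} \<union> B)"
        by (intro finite_measure_mono) auto
      also have "\<dots> \<le> prob {\<omega>\<in>space (M m). Q m \<omega> > \<xi> - b m - 3 * d} + prob B"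
        by (intro measure_Un_le) auto
      finally have up: "prob {\<omega>\<in>space (M m). T m \<omega> \<ge> \<xi>} < 1 - cdf (\<mu> m) (\<xi> - b m - 3 * d) + 2 * d"
        using B unfolding G by linarith
      have "{\<omega>\<in>space (M m). Q m \<omega> > \<xi> - b m + 2 * d} \<subseteq> {\<omega>\<in>space (M m). T m \<omega> \<ge> \<xi>} \<union> B"
      proof safe
        fix \<omega> assume \<omega>: "\<omega> \<in> space (M m)" "\<xi> - b m + 2 * d < Q m \<omega>" "\<omega> \<notin> B"
        then show "T m \<omega> \<ge> \<xi>"
          using near[of \<omega>] tiff[of \<omega>] d by linarith
      qed
      then have "prob {\<omega>\<in>space (M m). Q m \<omega> > \<xi> - b m + 2 * d} \<le> prob ({\<omega>\<in>space (M m). T m \<omega> \<ge> \<xi>} \<union> B)"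
        by (intro finite_measure_mono) auto
      also have "\<dots> \<le> prob {\<omega>\<in>space (M m). T m \<omega> \<ge> \<xi>} + prob B"
        by (intro measure_Un_le) auto
      finally have lo: "prob {\<omega>\<in>space (M m). T m \<omega> \<ge> \<xi>} > 1 - cdf (\<mu> m) (\<xi> - b m + 2 * d) - 2 * d"
        using B unfolding G by linarith
      have "\<bar>cdf (\<mu> m) (\<xi> - b m - 3 * d) - normal_cdf (\<xi> - b m - 3 * d)\<bar> < d"
        "\<bar>cdf (\<mu> m) (\<xi> - b m + 2 * d) - normal_cdf (\<xi> - b m + 2 * d)\<bar> < d"
        using elim by auto
      moreover have "\<bar>normal_cdf (\<xi> - b m) - normal_cdf (\<xi> - b m - 3 * d)\<bar> \<le> 3 * d"
        "\<bar>normal_cdf (\<xi> - b m) - normal_cdf (\<xi> - b m + 2 * d)\<bar> \<le> 2 * d"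
        using normal_cdf_lipschitz_abs[of "\<xi> - b m" "\<xi> - b m - 3 * d"]
         normal_cdf_lipschitz_abs[of "\<xi> - b m" "\<xi> - b m + 2 * d"] d by auto
      moreover have "normal_cdf (- \<xi> + b m) = 1 - normal_cdf (\<xi> - b m)"
        using normal_cdf_minus[of "\<xi> - b m"] by simp
      ultimately show ?case
        using up lo d unfolding dist_real_def d_def diff_zero abs_less_iff abs_le_iff by linarith
    qed
  qed
  from tendsto_add[OF this normal_cdf_shift_tendsto[OF b, of \<xi>]] show ?thesis
    by simp
qed

subsection \<open>Centred Gram matrices\<close>

lemma sum_square_centred:
  fixes x :: "'j \<Rightarrow> real"
  assumes "finite J"
  shows "(\<Sum>j\<in>J. (x j - (\<Sum>j'\<in>J. x j') / card J)\<^sup>2) = (\<Sum>j\<in>J. (x j)\<^sup>2) - (\<Sum>j\<in>J. x j)\<^sup>2 / card J"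
proof (cases "J = {}")
  case False
  then have c: "real (card J) > 0" using assms by (simp add: card_gt_0_iff)
  define s where "s = (\<Sum>j\<in>J. x j)"
  have "(\<Sum>j\<in>J. (x j - s / card J)\<^sup>2) = (\<Sum>j\<in>J. (x j)\<^sup>2 - 2 * (s / card J) * x j + (s / card J)\<^sup>2)"
    by (simp add: power2_diff algebra_simps)
  also have "\<dots> = (\<Sum>j\<in>J. (x j)\<^sup>2) - 2 * (s / card J) * s + card J * (s / card J)\<^sup>2"
    by (simp only: sum.distrib sum_subtractf sum_constant s_def flip: sum_distrib_left)
  also have "\<dots> = (\<Sum>j\<in>J. (x j)\<^sup>2) - s\<^sup>2 / card J"
    using c by (simp add: power2_eq_square field_simps)
  finally show ?thesis by (simp add: s_def)
qed simp

text \<open>The matrix P H Q, where P and Q are the projections orthogonal to the constant vectors.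
  For a matrix of inner products this gives the inner products of the vectors centred at their
  averages.\<close>

definition centred :: "'i set \<Rightarrow> 'j set \<Rightarrow> ('i \<Rightarrow> 'j \<Rightarrow> real) \<Rightarrow> 'i \<Rightarrow> 'j \<Rightarrow> real" where
  "centred I J H i j = H i j - (\<Sum>j'\<in>J. H i j') / card J - (\<Sum>i'\<in>I. H i' j) / card I
     + (\<Sum>i'\<in>I. \<Sum>j'\<in>J. H i' j') / (card I * card J)"

text \<open>The one-dimensional identity is used along the rows of the column-centred matrix
  \<open>b\<close>, then along the columns and for the row sums. The centring error is thereby
  expressed by squared row, column and total sums.\<close>

lemma sum_square_double_centred:
  assumes "finite I" "finite J"
  shows "(\<Sum>i\<in>I. \<Sum>j\<in>J. (centred I J H i j)\<^sup>2) =
    (\<Sum>i\<in>I. \<Sum>j\<in>J. (H i j)\<^sup>2) - (\<Sum>i\<in>I. (\<Sum>j\<in>J. H i j)\<^sup>2) / card J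
    - (\<Sum>j\<in>J. (\<Sum>i\<in>I. H i j)\<^sup>2) / card I + (\<Sum>i\<in>I. \<Sum>j\<in>J. H i j)\<^sup>2 / (card I * card J)"
proof (cases "I = {} \<or> J = {}")
  case False
  then have c: "real (card J) > 0" "real (card I) > 0" using assms by (auto simp: card_gt_0_iff)
  define b where "b i j = H i j - (\<Sum>i'\<in>I. H i' j) / card I" for i j
  define r where "r i = (\<Sum>j\<in>J. H i j)" for i
  have br: "(\<Sum>j\<in>J. b i j) = r i - (\<Sum>i'\<in>I. r i') / card I" for i
    unfolding b_def r_def by (simp add: sum_subtractf sum_divide_distrib[symmetric], subst sum.swap, simp)
  have "centred I J H i j = b i j - (\<Sum>j'\<in>J. b i j') / card J" for i j
    unfolding centred_def br using c by (simp add: b_def r_def field_simps)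
  then have "(\<Sum>i\<in>I. \<Sum>j\<in>J. (centred I J H i j)\<^sup>2) =
    (\<Sum>i\<in>I. \<Sum>j\<in>J. (b i j - (\<Sum>j'\<in>J. b i j') / card J)\<^sup>2)"
    by simp
  also have "\<dots> = (\<Sum>i\<in>I. (\<Sum>j\<in>J. (b i j)\<^sup>2) - (r i - (\<Sum>i'\<in>I. r i') / card I)\<^sup>2 / card J)"
    unfolding sum_square_centred[OF assms(2)] unfolding br ..
  also have "\<dots> = (\<Sum>j\<in>J. \<Sum>i\<in>I. (b i j)\<^sup>2) - (\<Sum>i\<in>I. (r i - (\<Sum>i'\<in>I. r i') / card I)\<^sup>2) / card J"
    by (simp add: sum_subtractf sum_divide_distrib[symmetric], subst sum.swap, simp)
  also have "(\<Sum>j\<in>J. \<Sum>i\<in>I. (b i j)\<^sup>2) = (\<Sum>j\<in>J. (\<Sum>i\<in>I. (H i j)\<^sup>2) - (\<Sum>i\<in>I. H i j)\<^sup>2 / card I)"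
    unfolding b_def by (simp add: sum_square_centred[OF assms(1)])
  also have "\<dots> = (\<Sum>i\<in>I. \<Sum>j\<in>J. (H i j)\<^sup>2) - (\<Sum>j\<in>J. (\<Sum>i\<in>I. H i j)\<^sup>2) / card I"
    by (simp add: sum_subtractf sum_divide_distrib[symmetric], subst sum.swap, simp)
  also have "(\<Sum>i\<in>I. (r i - (\<Sum>i'\<in>I. r i') / card I)\<^sup>2) = (\<Sum>i\<in>I. (r i)\<^sup>2) - (\<Sum>i\<in>I. r i)\<^sup>2 / card I"
    by (rule sum_square_centred[OF assms(1)])
  finally show ?thesis
    using c by (simp add: r_def diff_divide_distrib)
qed (auto)

text \<open>The projection reproduces itself under double centring, so adding \<open>t\<close> times
  the identity matrix adds \<open>t\<close> times the projection.\<close>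

lemma centred_add_identity:
  assumes "finite I" "I \<noteq> {}" "i \<in> I" "j \<in> I"
    and "\<And>i j. i \<in> I \<Longrightarrow> j \<in> I \<Longrightarrow> G i j = H i j + (if i = j then t else 0)"
  shows "centred I I G i j = centred I I H i j + t * ((if i = j then 1 else 0) - 1 / card I)"
proof -
  have c: "real (card I) > 0" using assms by (simp add: card_gt_0_iff)
  have "(\<Sum>j'\<in>I. G i j') = (\<Sum>j'\<in>I. H i j') + t" "(\<Sum>i'\<in>I. G i' j) = (\<Sum>i'\<in>I. H i' j) + t"
    "(\<Sum>i'\<in>I. \<Sum>j'\<in>I. G i' j') = (\<Sum>i'\<in>I. \<Sum>j'\<in>I. H i' j') + card I * t"
    using assms by (simp_all add: sum.distrib)
  then show ?thesis
    using c assms by (simp add: centred_def field_simps)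
qed

lemma sum_centred:
  assumes "finite I" "I \<noteq> {}"
  shows "(\<Sum>i\<in>I. \<Sum>j\<in>I. centred I I H i j) = 0"
    and "(\<Sum>i\<in>I. centred I I H i i) = (\<Sum>i\<in>I. H i i) - (\<Sum>i\<in>I. \<Sum>j\<in>I. H i j) / card I"
proof -
  have c: "real (card I) > 0" using assms by (simp add: card_gt_0_iff)
  have sw: "(\<Sum>i\<in>I. \<Sum>j\<in>I. H j i) = (\<Sum>i\<in>I. \<Sum>j\<in>I. H i j)" by (rule sum.swap)
  show "(\<Sum>i\<in>I. \<Sum>j\<in>I. centred I I H i j) = 0"
    using c by (simp add: centred_def sum.distrib sum_subtractf sw flip: sum_divide_distrib sum_distrib_left)
  show "(\<Sum>i\<in>I. centred I I H i i) = (\<Sum>i\<in>I. H i i) - (\<Sum>i\<in>I. \<Sum>j\<in>I. H i j) / card I"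
    using c by (simp add: centred_def sum.distrib sum_subtractf sw flip: sum_divide_distrib)
qed

text \<open>The Gram matrix may thus be replaced by one whose diagonal consists of the fluctuations of the
  squared norms only.  Their second moments are controlled by fourth moments of the noise and are
  of order \<open>tr \<Sigma>\<^sup>2\<close>, whereas the squared norms themselves may be much larger.\<close>

lemma centred_trace_identity:
  assumes "finite I" "card I \<ge> 2"
    and GH: "\<And>i j. i \<in> I \<Longrightarrow> j \<in> I \<Longrightarrow> G i j = H i j + (if i = j then t else 0)"
  shows "(\<Sum>i\<in>I. \<Sum>j\<in>I. (centred I I G i j)\<^sup>2) - (\<Sum>i\<in>I. centred I I G i i)\<^sup>2 / (card I - 1) =
    (\<Sum>i\<in>I. \<Sum>j\<in>I. (centred I I H i j)\<^sup>2) - (\<Sum>i\<in>I. centred I I H i i)\<^sup>2 / (card I - 1)"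
proof -
  have ne: "I \<noteq> {}" using assms by auto
  define n where "n = real (card I)"
  have n: "n \<ge> 2" "real (card I - 1) = n - 1" using assms by (auto simp: n_def)
  define h where "h = centred I I H"
  define d where "d i j = (if i = j then 1 else 0) - 1 / n" for i j :: 'a
  have G: "centred I I G i j = h i j + t * d i j" if "i \<in> I" "j \<in> I" for i j
    unfolding h_def d_def n_def by (rule centred_add_identity) (use that assms ne in auto)
  \<comment> \<open>\<open>d\<close> is the projection itself: its diagonal part yields the trace of
    \<open>h\<close>, while its constant part pairs with the total sum of \<open>h\<close>, which is
    0.\<close>
  have hd: "(\<Sum>i\<in>I. \<Sum>j\<in>I. h i j * d i j) = (\<Sum>i\<in>I. h i i)"
  proof -
    have "(\<Sum>i\<in>I. \<Sum>j\<in>I. h i j * d i j) = (\<Sum>i\<in>I. h i i - (\<Sum>j\<in>I. h i j) / n)"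
    proof (intro sum.cong refl)
      fix i assume "i \<in> I"
      have "h i j * d i j = (if i = j then h i j else 0) - h i j / n" for j
        by (simp add: d_def right_diff_distrib)
      then show "(\<Sum>j\<in>I. h i j * d i j) = h i i - (\<Sum>j\<in>I. h i j) / n"
        using assms(1) \<open>i \<in> I\<close> by (simp add: sum_subtractf sum_divide_distrib)
    qed
    also have "\<dots> = (\<Sum>i\<in>I. h i i)"
      using sum_centred(1)[OF assms(1) ne, of H] by (simp add: sum_subtractf h_def flip: sum_divide_distrib)
    finally show ?thesis .
  qed
  \<comment> \<open>The squared Frobenius norm of a projection is its rank.\<close>
  have dd: "(\<Sum>i\<in>I. \<Sum>j\<in>I. (d i j)\<^sup>2) = n - 1"
  proof -
    have "(d i j)\<^sup>2 = (if i = j then 1 - 2 / n else 0) + 1 / n\<^sup>2" for i j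
      using n by (auto simp: d_def power2_eq_square field_simps)
    then have "(\<Sum>i\<in>I. \<Sum>j\<in>I. (d i j)\<^sup>2) = n * (1 - 2 / n) + n * n * (1 / n\<^sup>2)"
      using assms(1) by (simp add: sum.distrib n_def distrib_left)
    also have "\<dots> = n - 1"
      using n by (simp add: power2_eq_square field_simps)
    finally show ?thesis .
  qed
  have "(\<Sum>i\<in>I. \<Sum>j\<in>I. (centred I I G i j)\<^sup>2) = (\<Sum>i\<in>I. \<Sum>j\<in>I. (h i j)\<^sup>2 + 2 * t * (h i j * d i j) + t\<^sup>2 * (d i j)\<^sup>2)"
    by (intro sum.cong) (simp_all add: G power2_eq_square algebra_simps)
  also have "\<dots> = (\<Sum>i\<in>I. \<Sum>j\<in>I. (h i j)\<^sup>2) + 2 * t * (\<Sum>i\<in>I. h i i) + t\<^sup>2 * (n - 1)"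
    by (simp only: sum.distrib hd dd flip: sum_distrib_left)
  finally have 1: "(\<Sum>i\<in>I. \<Sum>j\<in>I. (centred I I G i j)\<^sup>2) =
    (\<Sum>i\<in>I. \<Sum>j\<in>I. (h i j)\<^sup>2) + 2 * t * (\<Sum>i\<in>I. h i i) + t\<^sup>2 * (n - 1)" .
  have "(\<Sum>i\<in>I. centred I I G i i) = (\<Sum>i\<in>I. h i i + t * (1 - 1 / n))"
    by (intro sum.cong) (simp_all add: G d_def)
  also have "\<dots> = (\<Sum>i\<in>I. h i i) + n * (t * (1 - 1 / n))"
    by (simp add: sum.distrib n_def)
  also have "n * (t * (1 - 1 / n)) = t * (n - 1)"
    using n by (simp add: field_simps)
  finally have 2: "(\<Sum>i\<in>I. centred I I G i i) = (\<Sum>i\<in>I. h i i) + t * (n - 1)" .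
  \<comment> \<open>Passing from \<open>H\<close> to \<open>G\<close> raises the sum of squares and
    the normalized squared trace by the same amount, \<open>2 * t\<close> times the trace of
    \<open>h\<close> plus \<open>t\<^sup>2 * (n - 1)\<close>.\<close>
  show ?thesis
    unfolding 1 2 n(2) h_def[symmetric] using n by (simp add: power2_eq_square field_simps)
qed

section \<open>Expected errors of centring, and of sums over weakly dependent pairs\<close>

context prob_space
begin

lemma expectation_square_sum_uncorrelated:
  assumes "finite J" "\<And>j. j \<in> J \<Longrightarrow> square_int (X j)"
    and "\<And>j j'. j \<in> J \<Longrightarrow> j' \<in> J \<Longrightarrow> j \<noteq> j' \<Longrightarrow> expectation (\<lambda>\<omega>. X j \<omega> * X j' \<omega>) = 0"
  shows "expectation (\<lambda>\<omega>. (\<Sum>j\<in>J. X j \<omega>)\<^sup>2) = (\<Sum>j\<in>J. expectation (\<lambda>\<omega>. (X j \<omega>)\<^sup>2))"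
proof -
  have "expectation (\<lambda>\<omega>. (\<Sum>j\<in>J. X j \<omega>)\<^sup>2) = expectation (\<lambda>\<omega>. \<Sum>j\<in>J. \<Sum>j'\<in>J. X j \<omega> * X j' \<omega>)"
    by (simp add: power2_eq_square sum_product)
  also have "\<dots> = (\<Sum>j\<in>J. \<Sum>j'\<in>J. expectation (\<lambda>\<omega>. X j \<omega> * X j' \<omega>))"
    using assms square_int_mult by (simp add: Bochner_Integration.integral_sum)
  also have "\<dots> = (\<Sum>j\<in>J. \<Sum>j'\<in>J. if j' = j then expectation (\<lambda>\<omega>. (X j \<omega>)\<^sup>2) else 0)"
    using assms by (intro sum.cong) (auto simp: power2_eq_square)
  finally show ?thesis
    using assms(1) by simp
qed

text \<open>Uncorrelated entries make a squared row or column sum only linear in its length. After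
  division by that length the correction is of order \<open>n * a\<close>, against
  \<open>n * n * a\<close> for the sum of squares itself. The total sum is not assumed uncorrelated;
  Cauchy-Schwarz bounds it by the row sums.\<close>

lemma expectation_centred_gram:
  fixes a :: real
  assumes fin: "finite I" "finite J" "I \<noteq> {}" "J \<noteq> {}"
    and sq: "\<And>i j. i \<in> I \<Longrightarrow> j \<in> J \<Longrightarrow> square_int (H i j)"
    and a: "\<And>i j. i \<in> I \<Longrightarrow> j \<in> J \<Longrightarrow> expectation (\<lambda>\<omega>. (H i j \<omega>)\<^sup>2) \<le> a"
    and rows: "\<And>i j j'. i \<in> I \<Longrightarrow> j \<in> J \<Longrightarrow> j' \<in> J \<Longrightarrow> j \<noteq> j' \<Longrightarrow> expectation (\<lambda>\<omega>. H i j \<omega> * H i j' \<omega>) = 0"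
    and cols: "\<And>i i' j. i \<in> I \<Longrightarrow> i' \<in> I \<Longrightarrow> j \<in> J \<Longrightarrow> i \<noteq> i' \<Longrightarrow> expectation (\<lambda>\<omega>. H i j \<omega> * H i' j \<omega>) = 0"
  shows "integrable M (\<lambda>\<omega>. \<Sum>i\<in>I. \<Sum>j\<in>J. (centred I J (\<lambda>i j. H i j \<omega>) i j)\<^sup>2)"
    and "expectation (\<lambda>\<omega>. \<bar>(\<Sum>i\<in>I. \<Sum>j\<in>J. (centred I J (\<lambda>i j. H i j \<omega>) i j)\<^sup>2) - (\<Sum>i\<in>I. \<Sum>j\<in>J. (H i j \<omega>)\<^sup>2)\<bar>)
      \<le> (2 * real (card I) + real (card J)) * a"
    and "expectation (\<lambda>\<omega>. (\<Sum>i\<in>I. \<Sum>j\<in>J. H i j \<omega>)\<^sup>2) \<le> real (card I) * (card I * card J * a)"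
proof -
  have c: "real (card J) > 0" "real (card I) > 0" using fin by (auto simp: card_gt_0_iff)
  define R where "R \<omega> = (\<Sum>i\<in>I. (\<Sum>j\<in>J. H i j \<omega>)\<^sup>2)" for \<omega>
  define C where "C \<omega> = (\<Sum>j\<in>J. (\<Sum>i\<in>I. H i j \<omega>)\<^sup>2)" for \<omega>
  define A where "A \<omega> = (\<Sum>i\<in>I. \<Sum>j\<in>J. H i j \<omega>)\<^sup>2" for \<omega>
  have iR: "integrable M R" and iC: "integrable M C" and iA: "integrable M A"
    and iH: "integrable M (\<lambda>\<omega>. \<Sum>i\<in>I. \<Sum>j\<in>J. (H i j \<omega>)\<^sup>2)"
    unfolding R_def C_def A_def
    using sq by (auto intro!: Bochner_Integration.integrable_sum square_intD(2) square_int_sum)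
  have eq: "(\<Sum>i\<in>I. \<Sum>j\<in>J. (centred I J (\<lambda>i j. H i j \<omega>) i j)\<^sup>2) =
     (\<Sum>i\<in>I. \<Sum>j\<in>J. (H i j \<omega>)\<^sup>2) - R \<omega> / card J - C \<omega> / card I + A \<omega> / (card I * card J)" for \<omega>
    unfolding R_def C_def A_def by (rule sum_square_double_centred[OF fin(1,2)])
  show "integrable M (\<lambda>\<omega>. \<Sum>i\<in>I. \<Sum>j\<in>J. (centred I J (\<lambda>i j. H i j \<omega>) i j)\<^sup>2)"
    unfolding eq using iR iC iA iH by auto
  have "expectation R = (\<Sum>i\<in>I. \<Sum>j\<in>J. expectation (\<lambda>\<omega>. (H i j \<omega>)\<^sup>2))"
    unfolding R_def using fin sq rows
    by (simp add: Bochner_Integration.integral_sum square_intD(2) square_int_sum expectation_square_sum_uncorrelated)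
  also have "\<dots> \<le> (\<Sum>i\<in>I. \<Sum>j\<in>J. a)"
    by (intro sum_mono a)
  finally have ER: "expectation R \<le> card I * card J * a" by simp
  have "expectation C = (\<Sum>j\<in>J. \<Sum>i\<in>I. expectation (\<lambda>\<omega>. (H i j \<omega>)\<^sup>2))"
    unfolding C_def using fin sq cols
    by (simp add: Bochner_Integration.integral_sum square_intD(2) square_int_sum expectation_square_sum_uncorrelated)
  also have "\<dots> \<le> (\<Sum>j\<in>J. \<Sum>i\<in>I. a)"
    by (intro sum_mono a)
  finally have EC: "expectation C \<le> card I * card J * a" by (simp add: mult_ac)
  have AR: "A \<omega> \<le> card I * R \<omega>" for \<omega>
    using Cauchy_Schwarz_ineq_sum[of "\<lambda>_. 1" "\<lambda>i. \<Sum>j\<in>J. H i j \<omega>" I] by (simp add: A_def R_def)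
  have pos: "0 \<le> A \<omega>" "0 \<le> R \<omega>" "0 \<le> C \<omega>" for \<omega>
    by (auto simp: A_def R_def C_def intro!: sum_nonneg)
  have "expectation A \<le> expectation (\<lambda>\<omega>. card I * R \<omega>)"
    by (intro integral_mono iA integrable_mult_right iR AR)
  also have "\<dots> \<le> card I * (card I * card J * a)"
    using ER by (simp add: mult_left_mono)
  finally show "expectation (\<lambda>\<omega>. (\<Sum>i\<in>I. \<Sum>j\<in>J. H i j \<omega>)\<^sup>2) \<le> real (card I) * (card I * card J * a)"
    by (simp add: A_def[abs_def])
  have "expectation (\<lambda>\<omega>. \<bar>(\<Sum>i\<in>I. \<Sum>j\<in>J. (centred I J (\<lambda>i j. H i j \<omega>) i j)\<^sup>2) - (\<Sum>i\<in>I. \<Sum>j\<in>J. (H i j \<omega>)\<^sup>2)\<bar>)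
     \<le> expectation (\<lambda>\<omega>. 2 * (R \<omega> / card J) + C \<omega> / card I)"
  proof (rule integral_mono)
    fix \<omega>
    have "A \<omega> / (card I * card J) \<le> R \<omega> / card J"
      using AR[of \<omega>] c by (simp add: field_simps)
    moreover have "0 \<le> A \<omega> / (card I * card J)" "0 \<le> R \<omega> / card J" "0 \<le> C \<omega> / card I"
      using pos by auto
    ultimately show "\<bar>(\<Sum>i\<in>I. \<Sum>j\<in>J. (centred I J (\<lambda>i j. H i j \<omega>) i j)\<^sup>2) - (\<Sum>i\<in>I. \<Sum>j\<in>J. (H i j \<omega>)\<^sup>2)\<bar>
      \<le> 2 * (R \<omega> / card J) + C \<omega> / card I"
      unfolding eq abs_le_iff by linarith
  qed (use iR iC iA iH in \<open>auto simp: eq\<close>)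
  also have "\<dots> = 2 * (expectation R / card J) + expectation C / card I"
    using iR iC by simp
  also have "\<dots> \<le> 2 * (card I * card J * a / card J) + card I * card J * a / card I"
    by (intro add_mono mult_left_mono divide_right_mono ER EC) auto
  also have "\<dots> = (2 * real (card I) + real (card J)) * a"
    using c by (simp add: field_simps)
  finally show "expectation (\<lambda>\<omega>. \<bar>(\<Sum>i\<in>I. \<Sum>j\<in>J. (centred I J (\<lambda>i j. H i j \<omega>) i j)\<^sup>2) - (\<Sum>i\<in>I. \<Sum>j\<in>J. (H i j \<omega>)\<^sup>2)\<bar>)
      \<le> (2 * real (card I) + real (card J)) * a" .
qed

text \<open>Only pairs that share an index are correlated, and each pair meets at most
  \<open>4 * n\<close> others. The variance is therefore of order \<open>n^3 * b\<close> rather than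
  \<open>n^4 * b\<close>, which leaves the factor \<open>n * sqrt n\<close> in the L^1
  bound.\<close>

lemma expectation_abs_sum_weakly_dependent:
  fixes I J :: "'u set" and b :: real
  assumes fin: "finite I" "finite J" and n: "card I \<le> n" "card J \<le> n"
    and sq: "\<And>i j. i \<in> I \<Longrightarrow> j \<in> J \<Longrightarrow> square_int (D i j)"
    and b: "\<And>i j. i \<in> I \<Longrightarrow> j \<in> J \<Longrightarrow> expectation (\<lambda>\<omega>. (D i j \<omega>)\<^sup>2) \<le> b"
    and uncorr: "\<And>i j i' j'. i \<in> I \<Longrightarrow> j \<in> J \<Longrightarrow> i' \<in> I \<Longrightarrow> j' \<in> J \<Longrightarrow> {i, j} \<inter> {i', j'} = {} \<Longrightarrow>
      expectation (\<lambda>\<omega>. D i j \<omega> * D i' j' \<omega>) = 0"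
    and "0 \<le> b"
  shows "expectation (\<lambda>\<omega>. \<bar>\<Sum>i\<in>I. \<Sum>j\<in>J. D i j \<omega>\<bar>) \<le> 2 * (real n * sqrt (real n)) * sqrt b"
proof -
  define S where "S \<omega> = (\<Sum>x\<in>I \<times> J. D (fst x) (snd x) \<omega>)" for \<omega>
  have S: "S \<omega> = (\<Sum>i\<in>I. \<Sum>j\<in>J. D i j \<omega>)" for \<omega>
    by (simp add: S_def sum.cartesian_product split_def)
  define meet where "meet x y \<longleftrightarrow> {fst x, snd x} \<inter> {fst y, snd y} \<noteq> {}" for x y :: "'u \<times> 'u"
  have Dsq: "square_int (D (fst x) (snd x))" if "x \<in> I \<times> J" for x
    using that sq by auto
  have *: "expectation (\<lambda>\<omega>. D (fst x) (snd x) \<omega> * D (fst y) (snd y) \<omega>) \<le> (if meet x y then b else 0)"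
    if "x \<in> I \<times> J" "y \<in> I \<times> J" for x y
  proof (cases "meet x y")
    case True
    have "(expectation (\<lambda>\<omega>. D (fst x) (snd x) \<omega> * D (fst y) (snd y) \<omega>))\<^sup>2 \<le> b * b"
      using that b by (intro order_trans[OF expectation_cauchy_schwarz] Dsq mult_mono \<open>0 \<le> b\<close>) auto
    then show ?thesis
      using True \<open>0 \<le> b\<close> by (simp add: abs_le_square_iff[of _ b, symmetric] power2_eq_square[of b, symmetric])
  qed (use that uncorr in \<open>auto simp: meet_def\<close>)
  have count: "card {y \<in> I \<times> J. meet x y} \<le> 4 * n" for x
  proof -
    have "{y \<in> I \<times> J. meet x y} \<subseteq> {fst x, snd x} \<times> J \<union> I \<times> {fst x, snd x}"
      by (auto simp: meet_def)
    then have "card {y \<in> I \<times> J. meet x y} \<le> card ({fst x, snd x} \<times> J \<union> I \<times> {fst x, snd x})"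
      using fin by (intro card_mono) auto
    also have "\<dots> \<le> card {fst x, snd x} * card J + card I * card {fst x, snd x}"
      by (rule order_trans[OF card_Un_le]) (simp add: card_cartesian_product)
    also have "\<dots> \<le> 2 * n + n * 2"
      using n by (intro add_mono mult_mono) (auto simp: card_insert_if)
    finally show ?thesis by simp
  qed
  have sqS: "square_int S"
    unfolding S_def[abs_def] by (intro square_int_sum Dsq)
  have "expectation (\<lambda>\<omega>. (S \<omega>)\<^sup>2) = expectation (\<lambda>\<omega>. \<Sum>x\<in>I \<times> J. \<Sum>y\<in>I \<times> J. D (fst x) (snd x) \<omega> * D (fst y) (snd y) \<omega>)"
    by (simp add: S_def power2_eq_square sum_product)
  also have "\<dots> = (\<Sum>x\<in>I \<times> J. \<Sum>y\<in>I \<times> J. expectation (\<lambda>\<omega>. D (fst x) (snd x) \<omega> * D (fst y) (snd y) \<omega>))"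
    using Dsq square_int_mult by (simp add: Bochner_Integration.integral_sum)
  also have "\<dots> \<le> (\<Sum>x\<in>I \<times> J. \<Sum>y\<in>I \<times> J. if meet x y then b else 0)"
    by (intro sum_mono *)
  also have "\<dots> = (\<Sum>x\<in>I \<times> J. card {y \<in> I \<times> J. meet x y} * b)"
    using fin by (simp add: sum.If_cases Int_def)
  also have "\<dots> \<le> (\<Sum>x\<in>I \<times> J. real (4 * n) * b)"
    using count \<open>0 \<le> b\<close> by (intro sum_mono mult_right_mono) (auto simp del: of_nat_mult)
  also have "\<dots> = real (card I) * real (card J) * (4 * n * b)"
    by (simp add: card_cartesian_product)
  also have "\<dots> \<le> real n * real n * (4 * n * b)"
    using n \<open>0 \<le> b\<close> by (intro mult_right_mono mult_mono) auto
  finally have "sqrt (expectation (\<lambda>\<omega>. (S \<omega>)\<^sup>2)) \<le> sqrt ((2 * real n)\<^sup>2 * (n * b))"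
    by (simp add: power2_eq_square mult_ac)
  also have "\<dots> = 2 * (real n * sqrt (real n)) * sqrt b"
    by (simp add: real_sqrt_mult)
  finally show ?thesis
    using expectation_abs_le_sqrt[OF sqS] by (simp add: S)
qed

end

subsection \<open>Gram matrices of independent observations\<close>

text \<open>One family holds the observations of all groups: the loading matrix
  \<open>\<Gamma> u\<close> is attached to the observation \<open>u\<close>, and
  \<open>(u, j)\<close> indexes its noise coordinates. Means are left out, so \<open>y u\<close> is
  a centred observation.\<close>

locale obs_family = std_family M "Ob \<times> {..<r}" Z K
  for M :: "'a measure" and Ob :: "'u set" and r :: nat and Z :: "'u \<times> nat \<Rightarrow> 'a \<Rightarrow> real" and K :: real +
  fixes p :: nat and \<Gamma> :: "'u \<Rightarrow> nat \<Rightarrow> nat \<Rightarrow> real"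
  assumes finite_Ob: "finite Ob"
begin

definition y :: "'u \<Rightarrow> nat \<Rightarrow> 'a \<Rightarrow> real" where
  "y u a \<omega> = (\<Sum>j<r. \<Gamma> u a j * Z (u, j) \<omega>)"

definition Sg :: "'u \<Rightarrow> nat \<Rightarrow> nat \<Rightarrow> real" where
  "Sg u a b = (\<Sum>j<r. \<Gamma> u a j * \<Gamma> u b j)"

definition G :: "'u \<Rightarrow> 'u \<Rightarrow> 'a \<Rightarrow> real" where
  "G u v \<omega> = (\<Sum>a<p. y u a \<omega> * y v a \<omega>)"

text \<open>The trace of the product of the covariance matrices of \<open>u\<close> and
  \<open>v\<close>, which are symmetric.\<close>

definition tau :: "'u \<Rightarrow> 'u \<Rightarrow> real" where
  "tau u v = (\<Sum>a<p. \<Sum>b<p. Sg u a b * Sg v a b)"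

text \<open>The Gram matrix minus its expectation. Only the diagonal changes: there the mean is
  tr(\<Sigma>), whose square may be far larger than tr(\<Sigma>^2).\<close>

definition H :: "'u \<Rightarrow> 'u \<Rightarrow> 'a \<Rightarrow> real" where
  "H u v \<omega> = G u v \<omega> - (if u = v then \<Sum>a<p. Sg u a a else 0)"

abbreviation FO :: "'u set \<Rightarrow> 'a measure" where
  "FO U \<equiv> F (U \<times> {..<r})"

lemma y_eq: "y u a \<omega> = (\<Sum>x\<in>{u} \<times> {..<r}. \<Gamma> u a (snd x) * Z x \<omega>)"
proof -
  have "{u} \<times> {..<r} = (\<lambda>j. (u, j)) ` {..<r}" by auto
  then show ?thesis
    by (simp add: y_def sum.reindex inj_on_def)
qed

lemma times_obs_subset:
  assumes "U \<subseteq> Ob"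
  shows "U \<times> {..<r} \<subseteq> Ob \<times> {..<r}"
  using assms by auto

lemma y_measurable: "u \<in> U \<Longrightarrow> y u a \<in> borel_measurable (FO U)"
  unfolding y_def[abs_def] by (intro borel_measurable_sum borel_measurable_times measurable_F_Z) auto

lemma G_measurable: "u \<in> U \<Longrightarrow> v \<in> U \<Longrightarrow> G u v \<in> borel_measurable (FO U)"
  unfolding G_def[abs_def] by (intro borel_measurable_sum borel_measurable_times y_measurable) auto

lemma H_measurable: "u \<in> U \<Longrightarrow> v \<in> U \<Longrightarrow> H u v \<in> borel_measurable (FO U)"
  unfolding H_def[abs_def] by (intro borel_measurable_diff G_measurable) auto

lemma y_fourth: "u \<in> Ob \<Longrightarrow> fourth_int (y u a)"
  unfolding y_eq[abs_def] by (intro fourth_int_linear_form) auto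

lemma y_mean: "u \<in> Ob \<Longrightarrow> expectation (y u a) = 0"
  unfolding y_eq[abs_def] by (intro expectation_linear_form_const) auto

lemma y_square_int: "u \<in> Ob \<Longrightarrow> square_int (y u a)"
  by (intro fourth_int_square_int y_fourth)

text \<open>Polarization: the second moment of \<open>y u a + c * y u b\<close>, a linear form in
  the noise of \<open>u\<close>, is compared for different values of \<open>c\<close>.\<close>

lemma y_cov:
  assumes "u \<in> Ob"
  shows "expectation (\<lambda>\<omega>. y u a \<omega> * y u b \<omega>) = Sg u a b"
proof -
  have sq: "expectation (\<lambda>\<omega>. (y u a \<omega> + c * y u b \<omega>)\<^sup>2) = Sg u a a + 2 * c * Sg u a b + c\<^sup>2 * Sg u b b" for c
  proof -
    have "(y u a \<omega> + c * y u b \<omega>) = (\<Sum>x\<in>{u} \<times> {..<r}. (\<Gamma> u a (snd x) + c * \<Gamma> u b (snd x)) * Z x \<omega>)" for \<omega>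
      by (simp add: y_eq sum.distrib sum_distrib_left algebra_simps)
    then have "expectation (\<lambda>\<omega>. (y u a \<omega> + c * y u b \<omega>)\<^sup>2) = (\<Sum>x\<in>{u} \<times> {..<r}. (\<Gamma> u a (snd x) + c * \<Gamma> u b (snd x))\<^sup>2)"
      using assms by (simp, subst expectation_square_linear_form_const) auto
    also have "\<dots> = (\<Sum>j<r. (\<Gamma> u a j + c * \<Gamma> u b j)\<^sup>2)"
    proof -
      have "{u} \<times> {..<r} = (\<lambda>j. (u, j)) ` {..<r}" by auto
      then show ?thesis by (simp add: sum.reindex inj_on_def)
    qed
    finally show ?thesis
      by (simp add: Sg_def power2_eq_square sum.distrib sum_distrib_left algebra_simps)
  qed
  have i: "integrable M (\<lambda>\<omega>. (y u a \<omega>)\<^sup>2)" "integrable M (\<lambda>\<omega>. (y u b \<omega>)\<^sup>2)" "integrable M (\<lambda>\<omega>. y u a \<omega> * y u b \<omega>)"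
    using y_square_int[OF assms] square_int_mult square_intD(2) by auto
  have "(y u a \<omega> + 1 * y u b \<omega>)\<^sup>2 = (y u a \<omega>)\<^sup>2 + 2 * (y u a \<omega> * y u b \<omega>) + (y u b \<omega>)\<^sup>2" for \<omega>
    by (simp add: power2_eq_square algebra_simps)
  then have "expectation (\<lambda>\<omega>. (y u a \<omega> + 1 * y u b \<omega>)\<^sup>2) =
    expectation (\<lambda>\<omega>. (y u a \<omega>)\<^sup>2) + 2 * expectation (\<lambda>\<omega>. y u a \<omega> * y u b \<omega>) + expectation (\<lambda>\<omega>. (y u b \<omega>)\<^sup>2)"
    using i by simp
  moreover have "expectation (\<lambda>\<omega>. (y u a \<omega>)\<^sup>2) = Sg u a a"
    using sq[of 0] by simp
  moreover have "expectation (\<lambda>\<omega>. (y u b \<omega>)\<^sup>2) = Sg u b b" 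
  proof -
    have "Sg u b b = (\<Sum>x\<in>{u} \<times> {..<r}. (\<Gamma> u b (snd x))\<^sup>2)"
    proof -
      have "{u} \<times> {..<r} = (\<lambda>j. (u, j)) ` {..<r}" by auto
      then show ?thesis by (simp add: sum.reindex inj_on_def Sg_def power2_eq_square)
    qed
    then show ?thesis
      unfolding y_eq[abs_def] using assms by (simp, intro expectation_square_linear_form_const) auto
  qed
  ultimately show ?thesis
    unfolding sq by simp
qed

lemma Sg_sym: "Sg u a b = Sg u b a"
  by (simp add: Sg_def mult.commute)

lemma tau_sym: "tau u v = tau v u"
  by (simp add: tau_def mult.commute)

lemma G_sym: "G u v = G v u"
  by (simp add: G_def fun_eq_iff mult.commute)

lemma H_sym: "H u v = H v u"
  by (auto simp: H_def fun_eq_iff G_sym[of u v])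

lemma times_obs_disjoint: "U \<inter> V = {} \<Longrightarrow> (U \<times> {..<r}) \<inter> (V \<times> {..<r}) = {}"
  by auto

lemmas expectation_FO_mult = expectation_F_mult[OF _ _ times_obs_disjoint times_obs_subset times_obs_subset]
lemmas integrable_FO_mult = integrable_F_mult[OF _ _ times_obs_disjoint times_obs_subset times_obs_subset]
lemmas fourth_int_FO_mult = fourth_int_F_mult[OF _ _ times_obs_disjoint times_obs_subset times_obs_subset]

lemma G_fourth:
  assumes "u \<in> Ob" "v \<in> Ob" "u \<noteq> v"
  shows "fourth_int (G u v)"
  unfolding G_def[abs_def] using assms
  by (intro fourth_int_sum fourth_int_FO_mult[of _ "{u}" _ "{v}"] y_measurable y_fourth) auto

text \<open>\<open>G u v\<close> is linear in the centred observation \<open>v\<close>, which is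
  independent of everything measurable on \<open>T\<close>.\<close>

lemma expectation_G_mult:
  assumes "u \<in> T" "T \<subseteq> Ob" "v \<in> Ob" "v \<notin> T" "f \<in> borel_measurable (FO T)" "square_int f"
  shows "expectation (\<lambda>\<omega>. G u v \<omega> * f \<omega>) = 0"
proof -
  have *: "integrable M (\<lambda>\<omega>. y v a \<omega> * (y u a \<omega> * f \<omega>)) \<and> expectation (\<lambda>\<omega>. y v a \<omega> * (y u a \<omega> * f \<omega>)) = 0" for a
  proof -
    have i: "integrable M (y v a)" "integrable M (\<lambda>\<omega>. y u a \<omega> * f \<omega>)"
      using assms y_square_int square_int_integrable square_int_mult by auto
    have m: "y v a \<in> borel_measurable (FO {v})" "(\<lambda>\<omega>. y u a \<omega> * f \<omega>) \<in> borel_measurable (FO T)"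
      using assms by (auto intro!: y_measurable borel_measurable_times)
    have d: "{v} \<inter> T = {}" "{v} \<subseteq> Ob" using assms by auto
    show ?thesis
      using expectation_FO_mult[OF m d assms(2) i] integrable_FO_mult[OF m d assms(2) i] y_mean[OF assms(3)] by simp
  qed
  have "expectation (\<lambda>\<omega>. G u v \<omega> * f \<omega>) = expectation (\<lambda>\<omega>. \<Sum>a<p. y v a \<omega> * (y u a \<omega> * f \<omega>))"
    by (simp add: G_def sum_distrib_left sum_distrib_right mult_ac)
  also have "\<dots> = 0"
    using * by (subst Bochner_Integration.integral_sum) auto
  finally show ?thesis .
qed

lemma expectation_G_square:
  assumes "u \<in> Ob" "v \<in> Ob" "u \<noteq> v"
  shows "expectation (\<lambda>\<omega>. (G u v \<omega>)\<^sup>2) = tau u v"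
proof -
  have *: "integrable M (\<lambda>\<omega>. (y u a \<omega> * y u b \<omega>) * (y v a \<omega> * y v b \<omega>)) \<and>
    expectation (\<lambda>\<omega>. (y u a \<omega> * y u b \<omega>) * (y v a \<omega> * y v b \<omega>)) = Sg u a b * Sg v a b" for a b
  proof -
    have i: "integrable M (\<lambda>\<omega>. y u a \<omega> * y u b \<omega>)" "integrable M (\<lambda>\<omega>. y v a \<omega> * y v b \<omega>)"
      using assms y_square_int square_int_mult by auto
    have m: "(\<lambda>\<omega>. y u a \<omega> * y u b \<omega>) \<in> borel_measurable (FO {u})" "(\<lambda>\<omega>. y v a \<omega> * y v b \<omega>) \<in> borel_measurable (FO {v})"
      using assms by (auto intro!: y_measurable borel_measurable_times)
    have d: "{u} \<inter> {v} = {}" "{u} \<subseteq> Ob" "{v} \<subseteq> Ob" using assms by auto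
    show ?thesis
      using expectation_FO_mult[OF m d i] integrable_FO_mult[OF m d i] y_cov assms by simp
  qed
  have "expectation (\<lambda>\<omega>. (G u v \<omega>)\<^sup>2) = expectation (\<lambda>\<omega>. \<Sum>a<p. \<Sum>b<p. (y u a \<omega> * y u b \<omega>) * (y v a \<omega> * y v b \<omega>))"
    by (simp add: G_def power2_eq_square sum_product mult_ac)
  also have "\<dots> = tau u v"
    using * by (simp add: tau_def Bochner_Integration.integral_sum)
  finally show ?thesis .
qed

text \<open>The trace is the squared Frobenius norm of the product of the transposed loading matrix
  of \<open>u\<close> with that of \<open>v\<close>; in particular it is nonnegative, and it matches
  the bound in \<open>quadratic_form\<close>.\<close>

lemma tau_eq_sum_squares:
  "tau u v = (\<Sum>j<r. \<Sum>k<r. (\<Sum>a<p. \<Gamma> u a j * \<Gamma> v a k)\<^sup>2)"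
proof -
  have "(\<Sum>j<r. \<Sum>k<r. (\<Sum>a<p. \<Gamma> u a j * \<Gamma> v a k)\<^sup>2) =
    (\<Sum>j<r. \<Sum>k<r. \<Sum>a<p. \<Sum>b<p. (\<Gamma> u a j * \<Gamma> u b j) * (\<Gamma> v a k * \<Gamma> v b k))"
    by (simp add: power2_eq_square sum_product mult_ac)
  also have "\<dots> = (\<Sum>j<r. \<Sum>a<p. \<Sum>k<r. \<Sum>b<p. (\<Gamma> u a j * \<Gamma> u b j) * (\<Gamma> v a k * \<Gamma> v b k))"
    by (intro sum.cong sum.swap refl)
  also have "\<dots> = (\<Sum>a<p. \<Sum>j<r. \<Sum>k<r. \<Sum>b<p. (\<Gamma> u a j * \<Gamma> u b j) * (\<Gamma> v a k * \<Gamma> v b k))"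
    by (rule sum.swap)
  also have "\<dots> = (\<Sum>a<p. \<Sum>j<r. \<Sum>b<p. \<Sum>k<r. (\<Gamma> u a j * \<Gamma> u b j) * (\<Gamma> v a k * \<Gamma> v b k))"
    by (intro sum.cong sum.swap refl)
  also have "\<dots> = (\<Sum>a<p. \<Sum>b<p. \<Sum>j<r. \<Sum>k<r. (\<Gamma> u a j * \<Gamma> u b j) * (\<Gamma> v a k * \<Gamma> v b k))"
    by (intro sum.cong sum.swap refl)
  also have "\<dots> = tau u v"
    by (simp add: tau_def Sg_def sum_product)
  finally show ?thesis by simp
qed

lemma tau_nonneg: "0 \<le> tau u v"
  unfolding tau_eq_sum_squares by (intro sum_nonneg) simp

lemma sum_single_obs: "(\<Sum>x\<in>{u} \<times> {..<r}. f x) = (\<Sum>j<r. f (u, j))"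
proof -
  have "{u} \<times> {..<r} = (\<lambda>j. (u, j)) ` {..<r}" by auto
  then show ?thesis by (simp add: sum.reindex inj_on_def)
qed

text \<open>Given the observation \<open>v\<close>, \<open>G u v\<close> is a linear form in the
  noise of \<open>u\<close> with coefficients \<open>\<eta> j\<close>, themselves linear forms in
  the noise of \<open>v\<close> with second moments \<open>\<rho> j\<close>. The fourth moment bound
  is used on both levels, each time at the price of a factor \<open>K\<close>, and the
  \<open>\<rho> j\<close> add up to \<open>tau u v\<close>.\<close>

lemma expectation_G_fourth:
  assumes "u \<in> Ob" "v \<in> Ob" "u \<noteq> v"
  shows "expectation (\<lambda>\<omega>. G u v \<omega> ^ 4) \<le> K\<^sup>2 * (tau u v)\<^sup>2"
proof -
  define \<eta> where "\<eta> j \<omega> = (\<Sum>a<p. \<Gamma> u a j * y v a \<omega>)" for j \<omega>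
  define \<rho> where "\<rho> j = (\<Sum>k<r. (\<Sum>a<p. \<Gamma> u a j * \<Gamma> v a k)\<^sup>2)" for j
  have \<rho>0: "0 \<le> \<rho> j" for j
    by (simp add: \<rho>_def sum_nonneg)
  have \<eta>: "\<eta> j \<omega> = (\<Sum>x\<in>{v} \<times> {..<r}. (\<Sum>a<p. \<Gamma> u a j * \<Gamma> v a (snd x)) * Z x \<omega>)" for j \<omega>
  proof -
    have "\<eta> j \<omega> = (\<Sum>a<p. \<Sum>k<r. \<Gamma> u a j * \<Gamma> v a k * Z (v, k) \<omega>)"
      by (simp add: \<eta>_def y_def sum_distrib_left mult_ac)
    also have "\<dots> = (\<Sum>k<r. \<Sum>a<p. \<Gamma> u a j * \<Gamma> v a k * Z (v, k) \<omega>)"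
      by (rule sum.swap)
    finally show ?thesis by (simp add: sum_single_obs sum_distrib_right)
  qed
  have G: "G u v \<omega> = (\<Sum>x\<in>{u} \<times> {..<r}. \<eta> (snd x) \<omega> * Z x \<omega>)" for \<omega>
  proof -
    have "G u v \<omega> = (\<Sum>a<p. \<Sum>j<r. \<Gamma> u a j * y v a \<omega> * Z (u, j) \<omega>)"
      by (simp add: G_def y_def[of u] sum_distrib_left sum_distrib_right mult_ac)
    also have "\<dots> = (\<Sum>j<r. \<Sum>a<p. \<Gamma> u a j * y v a \<omega> * Z (u, j) \<omega>)"
      by (rule sum.swap)
    finally show ?thesis by (simp add: sum_single_obs \<eta>_def sum_distrib_right)
  qed
  have f\<eta>: "fourth_int (\<eta> j)" for j
    unfolding \<eta>[abs_def] using assms by (intro fourth_int_linear_form) auto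
  have E4: "expectation (\<lambda>\<omega>. \<eta> j \<omega> ^ 4) \<le> K * (\<rho> j)\<^sup>2" for j
    using expectation_fourth_linear_form_const[of "{v} \<times> {..<r}" "\<lambda>x. \<Sum>a<p. \<Gamma> u a j * \<Gamma> v a (snd x)"] assms
    by (auto simp: \<eta> \<rho>_def sum_single_obs)
  have E22: "expectation (\<lambda>\<omega>. (\<eta> j \<omega>)\<^sup>2 * (\<eta> k \<omega>)\<^sup>2) \<le> K * (\<rho> j * \<rho> k)" for j k
  proof (rule power2_le_imp_le)
    have "(expectation (\<lambda>\<omega>. (\<eta> j \<omega>)\<^sup>2 * (\<eta> k \<omega>)\<^sup>2))\<^sup>2 \<le>
      expectation (\<lambda>\<omega>. ((\<eta> j \<omega>)\<^sup>2)\<^sup>2) * expectation (\<lambda>\<omega>. ((\<eta> k \<omega>)\<^sup>2)\<^sup>2)"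
      by (intro expectation_cauchy_schwarz fourth_int_square f\<eta>)
    also have "\<dots> \<le> (K * (\<rho> j)\<^sup>2) * (K * (\<rho> k)\<^sup>2)"
      using E4 K_ge by (intro mult_mono) (auto simp flip: power_mult)
    finally show "(expectation (\<lambda>\<omega>. (\<eta> j \<omega>)\<^sup>2 * (\<eta> k \<omega>)\<^sup>2))\<^sup>2 \<le> (K * (\<rho> j * \<rho> k))\<^sup>2"
      by (simp add: power2_eq_square mult_ac)
    show "0 \<le> K * (\<rho> j * \<rho> k)" using \<rho>0 K_ge by simp
  qed
  have "expectation (\<lambda>\<omega>. G u v \<omega> ^ 4) \<le> K * expectation (\<lambda>\<omega>. (\<Sum>x\<in>{u} \<times> {..<r}. (\<eta> (snd x) \<omega>)\<^sup>2)\<^sup>2)"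
    unfolding G using assms f\<eta>
    by (intro expectation_fourth_linear_form[where T="{v} \<times> {..<r}"])
      (auto simp: \<eta>_def[abs_def] intro!: borel_measurable_sum borel_measurable_times y_measurable)
  also have "expectation (\<lambda>\<omega>. (\<Sum>x\<in>{u} \<times> {..<r}. (\<eta> (snd x) \<omega>)\<^sup>2)\<^sup>2) =
    expectation (\<lambda>\<omega>. \<Sum>j<r. \<Sum>k<r. (\<eta> j \<omega>)\<^sup>2 * (\<eta> k \<omega>)\<^sup>2)"
    by (simp add: sum_single_obs power2_eq_square[of "sum _ _"] sum_product)
  also have "\<dots> = (\<Sum>j<r. \<Sum>k<r. expectation (\<lambda>\<omega>. (\<eta> j \<omega>)\<^sup>2 * (\<eta> k \<omega>)\<^sup>2))"
    using square_int_mult[OF fourth_int_square[OF f\<eta>] fourth_int_square[OF f\<eta>]]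
    by (simp add: Bochner_Integration.integral_sum)
  also have "\<dots> \<le> (\<Sum>j<r. \<Sum>k<r. K * (\<rho> j * \<rho> k))"
    by (intro sum_mono E22)
  also have "\<dots> = K * ((\<Sum>j<r. \<rho> j) * (\<Sum>k<r. \<rho> k))"
    by (simp only: sum_product sum_distrib_left[of K])
  also have "(\<Sum>j<r. \<rho> j) = tau u v"
    by (simp add: \<rho>_def tau_eq_sum_squares)
  finally show ?thesis
    using K_ge by (simp add: power2_eq_square mult_ac)
qed

text \<open>The fluctuation of a squared norm is a centred quadratic form in the noise of one
  observation. Its matrix has squared Frobenius norm \<open>tau u u\<close>, so diagonal entries
  have the same order as the others.\<close>

lemma H_diag:
  assumes "u \<in> Ob"
  shows "square_int (H u u)" "expectation (\<lambda>\<omega>. (H u u \<omega>)\<^sup>2) \<le> K * tau u u"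
proof -
  define m where "m x x' = (\<Sum>a<p. \<Gamma> u a (snd x) * \<Gamma> u a (snd x'))" for x x' :: "'u \<times> nat"
  have "H u u = (\<lambda>\<omega>. (\<Sum>x\<in>{u} \<times> {..<r}. \<Sum>x'\<in>{u} \<times> {..<r}. m x x' * Z x \<omega> * Z x' \<omega>) - (\<Sum>x\<in>{u} \<times> {..<r}. m x x))"
  proof
    fix \<omega>
    have "G u u \<omega> = (\<Sum>a<p. \<Sum>j<r. \<Sum>k<r. \<Gamma> u a j * \<Gamma> u a k * Z (u, j) \<omega> * Z (u, k) \<omega>)"
      by (simp add: G_def y_def sum_product mult_ac)
    also have "\<dots> = (\<Sum>j<r. \<Sum>a<p. \<Sum>k<r. \<Gamma> u a j * \<Gamma> u a k * Z (u, j) \<omega> * Z (u, k) \<omega>)"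
      by (rule sum.swap)
    also have "\<dots> = (\<Sum>j<r. \<Sum>k<r. \<Sum>a<p. \<Gamma> u a j * \<Gamma> u a k * Z (u, j) \<omega> * Z (u, k) \<omega>)"
      by (intro sum.cong sum.swap refl)
    finally have "G u u \<omega> = (\<Sum>j<r. \<Sum>k<r. m (u, j) (u, k) * Z (u, j) \<omega> * Z (u, k) \<omega>)"
      by (simp add: m_def sum_distrib_right)
    moreover have "(\<Sum>a<p. Sg u a a) = (\<Sum>j<r. m (u, j) (u, j))"
      unfolding Sg_def m_def by (subst sum.swap) simp
    ultimately show "H u u \<omega> = (\<Sum>x\<in>{u} \<times> {..<r}. \<Sum>x'\<in>{u} \<times> {..<r}. m x x' * Z x \<omega> * Z x' \<omega>)
        - (\<Sum>x\<in>{u} \<times> {..<r}. m x x)"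
      by (simp add: H_def sum_single_obs)
  qed
  moreover have "(\<Sum>x\<in>{u} \<times> {..<r}. \<Sum>x'\<in>{u} \<times> {..<r}. (m x x')\<^sup>2) = tau u u"
    by (simp add: sum_single_obs m_def tau_eq_sum_squares)
  ultimately show "square_int (H u u)" "expectation (\<lambda>\<omega>. (H u u \<omega>)\<^sup>2) \<le> K * tau u u"
    using quadratic_form[of "{u} \<times> {..<r}" m] assms by auto
qed

lemma H_square_int:
  assumes "u \<in> Ob" "v \<in> Ob"
  shows "square_int (H u v)"
  using H_diag(1)[of u] fourth_int_square_int[OF G_fourth[OF assms]] assms
  by (cases "u = v") (auto simp: H_def[abs_def])

lemma H_square_le:
  assumes "u \<in> Ob" "v \<in> Ob"
  shows "expectation (\<lambda>\<omega>. (H u v \<omega>)\<^sup>2) \<le> K * tau u v"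
proof (cases "u = v")
  case False
  have "1 * tau u v \<le> K * tau u v"
    using K_ge tau_nonneg by (intro mult_right_mono) auto
  then show ?thesis
    using False expectation_G_square[OF assms False] by (simp add: H_def)
qed (use H_diag(2) assms in auto)

text \<open>At least one of \<open>v\<close> and \<open>w\<close> differs from \<open>u\<close>. The
  observation with that index is centred and enters the product linearly, independently of the
  rest.\<close>

lemma H_uncorrelated:
  assumes "u \<in> Ob" "v \<in> Ob" "w \<in> Ob" "v \<noteq> w"
  shows "expectation (\<lambda>\<omega>. H u v \<omega> * H u w \<omega>) = 0"
proof -
  have *: "expectation (\<lambda>\<omega>. H u v \<omega> * H u w \<omega>) = 0" if "v \<in> Ob" "w \<in> Ob" "v \<noteq> w" "v \<noteq> u" for v w
    using expectation_G_mult[of u "{u, w}" v "H u w"] H_measurable[of u "{u, w}" w] H_square_int[of u w] that assms(1)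
    by (simp add: H_def[of u v])
  show ?thesis
    using *[of v w] *[of w v] assms by (cases "v = u") (auto simp: mult.commute)
qed

text \<open>Three errors are added: centring costs at most \<open>3 * n * K * \<tau>\<close>, the
  fluctuation of the off-diagonal squares \<open>2 * K * \<tau>\<close> times
  \<open>n * sqrt n\<close>, and the diagonal at most \<open>n * (K + 1) * \<tau>\<close>. The two
  index sets may be disjoint or equal, so the estimators for two groups, for two halves of a group
  and for one full group are all covered.\<close>

lemma centred_gram_concentration:
  assumes IJ: "I \<subseteq> Ob" "J \<subseteq> Ob" "I \<noteq> {}" "J \<noteq> {}" "card I \<le> n" "card J \<le> n"
    and \<tau>: "\<And>u v. u \<in> I \<Longrightarrow> v \<in> J \<Longrightarrow> tau u v = \<tau>"
  shows "integrable M (\<lambda>\<omega>. \<Sum>u\<in>I. \<Sum>v\<in>J. (centred I J (\<lambda>u v. H u v \<omega>) u v)\<^sup>2)"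
    and "expectation (\<lambda>\<omega>. \<bar>(\<Sum>u\<in>I. \<Sum>v\<in>J. (centred I J (\<lambda>u v. H u v \<omega>) u v)\<^sup>2) - real (card I) * real (card J) * \<tau>\<bar>)
      \<le> (6 * K + 1) * (real n * sqrt (real n)) * \<tau>"
proof -
  have fin: "finite I" "finite J" using IJ finite_Ob finite_subset by auto
  obtain u0 v0 where "u0 \<in> I" "v0 \<in> J" using IJ by auto
  then have \<tau>0: "0 \<le> \<tau>" using \<tau> tau_nonneg by metis
  have n1: "1 \<le> real n" using IJ fin card_gt_0_iff[of I] by simp
  have sq: "square_int (H u v)" if "u \<in> I" "v \<in> J" for u v
    using that IJ by (intro H_square_int) auto
  have le: "expectation (\<lambda>\<omega>. (H u v \<omega>)\<^sup>2) \<le> K * \<tau>" if "u \<in> I" "v \<in> J" for u v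
    using H_square_le[of u v] \<tau>[OF that] that IJ by auto
  have rows: "expectation (\<lambda>\<omega>. H u v \<omega> * H u w \<omega>) = 0" if "u \<in> I" "v \<in> J" "w \<in> J" "v \<noteq> w" for u v w
    using that IJ by (intro H_uncorrelated) auto
  have cols: "expectation (\<lambda>\<omega>. H v u \<omega> * H w u \<omega>) = 0" if "v \<in> I" "w \<in> I" "u \<in> J" "v \<noteq> w" for u v w
    unfolding H_sym[of _ u] using that IJ by (intro H_uncorrelated) auto
  define C where "C \<omega> = (\<Sum>u\<in>I. \<Sum>v\<in>J. (centred I J (\<lambda>u v. H u v \<omega>) u v)\<^sup>2)" for \<omega>
  define B where "B \<omega> = (\<Sum>u\<in>I. \<Sum>v\<in>J. (H u v \<omega>)\<^sup>2)" for \<omega>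
  note cg = expectation_centred_gram[of I J H "K * \<tau>", OF fin IJ(3,4) sq le rows cols, folded C_def B_def]
  have iC: "integrable M C" using cg(1) by (simp add: C_def[abs_def])
  then show "integrable M (\<lambda>\<omega>. \<Sum>u\<in>I. \<Sum>v\<in>J. (centred I J (\<lambda>u v. H u v \<omega>) u v)\<^sup>2)"
    unfolding C_def[abs_def] .
  \<comment> \<open>The diagonal is left out here: the square of a diagonal entry is of degree four
    in the noise, and a second moment for it would require eighth moments.\<close>
  define D where "D u v \<omega> = (if u = v then 0 else (H u v \<omega>)\<^sup>2 - \<tau>)" for u v \<omega>
  have fH: "fourth_int (H u v)" if "u \<in> I" "v \<in> J" "u \<noteq> v" for u v
    using G_fourth[of u v] that IJ by (auto simp: H_def[abs_def])
  have sqD: "square_int (D u v)" if "u \<in> I" "v \<in> J" for u v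
    using fH[OF that] by (cases "u = v") (auto simp: D_def[abs_def] intro!: square_int_diff fourth_int_square)
  have EH2: "expectation (\<lambda>\<omega>. (H u v \<omega>)\<^sup>2) = \<tau>" if "u \<in> I" "v \<in> J" "u \<noteq> v" for u v
    using expectation_G_square[of u v] that IJ \<tau> by (auto simp: H_def)
  have ED: "expectation (D u v) = 0" if "u \<in> I" "v \<in> J" for u v
    using square_intD(2)[OF sq[OF that]] EH2[OF that]
    by (cases "u = v") (auto simp: D_def[abs_def] prob_space)
  have ED2: "expectation (\<lambda>\<omega>. (D u v \<omega>)\<^sup>2) \<le> K\<^sup>2 * \<tau>\<^sup>2" if "u \<in> I" "v \<in> J" for u v
  proof (cases "u = v")
    case False
    have "expectation (\<lambda>\<omega>. (D u v \<omega>)\<^sup>2) = expectation (\<lambda>\<omega>. H u v \<omega> ^ 4 - 2 * \<tau> * (H u v \<omega>)\<^sup>2 + \<tau>\<^sup>2)"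
      using False by (simp add: D_def power2_eq_square power4_eq_xxxx algebra_simps)
    also have "\<dots> = expectation (\<lambda>\<omega>. H u v \<omega> ^ 4) - \<tau>\<^sup>2"
      using square_intD(2)[OF sq[OF that]] fourth_intD(2)[OF fH[OF that False]] EH2[OF that False]
      by (simp add: prob_space power2_eq_square)
    also have "\<dots> \<le> expectation (\<lambda>\<omega>. H u v \<omega> ^ 4)"
      by simp
    also have "\<dots> \<le> K\<^sup>2 * \<tau>\<^sup>2"
      using expectation_G_fourth[of u v] False that IJ \<tau>[OF that] by (auto simp: H_def)
    finally show ?thesis .
  qed (simp add: D_def)
  have uncorr: "expectation (\<lambda>\<omega>. D u v \<omega> * D u' v' \<omega>) = 0"
    if "u \<in> I" "v \<in> J" "u' \<in> I" "v' \<in> J" "{u, v} \<inter> {u', v'} = {}" for u v u' v'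
  proof -
    have m: "D u v \<in> borel_measurable (FO {u, v})" for u v
      using H_measurable[of u "{u, v}" v] by (cases "u = v") (auto simp: D_def[abs_def])
    have "expectation (\<lambda>\<omega>. D u v \<omega> * D u' v' \<omega>) = expectation (D u v) * expectation (D u' v')"
      using that IJ square_int_integrable[OF sqD] by (intro expectation_FO_mult[OF m m]) auto
    then show ?thesis using ED that by simp
  qed
  have DB: "expectation (\<lambda>\<omega>. \<bar>\<Sum>u\<in>I. \<Sum>v\<in>J. D u v \<omega>\<bar>) \<le> 2 * (real n * sqrt (real n)) * sqrt (K\<^sup>2 * \<tau>\<^sup>2)"
    by (rule expectation_abs_sum_weakly_dependent[OF fin IJ(5,6) sqD ED2 uncorr]) auto
  have sK: "sqrt (K\<^sup>2 * \<tau>\<^sup>2) = K * \<tau>"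
    using K_ge \<tau>0 by (simp add: real_sqrt_mult)
  \<comment> \<open>At most \<open>n\<close> diagonal terms remain, so a first moment bound suffices
    for them.\<close>
  define E where "E \<omega> = (\<Sum>u\<in>I \<inter> J. (H u u \<omega>)\<^sup>2 - \<tau>)" for \<omega>
  have split: "B \<omega> - real (card I) * real (card J) * \<tau> = (\<Sum>u\<in>I. \<Sum>v\<in>J. D u v \<omega>) + E \<omega>" for \<omega>
  proof -
    have "(H u v \<omega>)\<^sup>2 - \<tau> = D u v \<omega> + (if v = u then (H u u \<omega>)\<^sup>2 - \<tau> else 0)" for u v
      by (simp add: D_def)
    then have "(\<Sum>u\<in>I. \<Sum>v\<in>J. (H u v \<omega>)\<^sup>2 - \<tau>) = (\<Sum>u\<in>I. \<Sum>v\<in>J. D u v \<omega>) + (\<Sum>u\<in>I. if u \<in> J then (H u u \<omega>)\<^sup>2 - \<tau> else 0)"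
      using fin by (simp add: sum.distrib)
    also have "(\<Sum>u\<in>I. if u \<in> J then (H u u \<omega>)\<^sup>2 - \<tau> else 0) = E \<omega>"
      unfolding E_def using fin by (simp add: sum.inter_restrict)
    finally show ?thesis
      using fin by (simp add: B_def sum_subtractf mult_ac)
  qed
  have iE: "integrable M E" and iD: "integrable M (\<lambda>\<omega>. \<Sum>u\<in>I. \<Sum>v\<in>J. D u v \<omega>)" and iB: "integrable M B"
    unfolding E_def[abs_def] B_def[abs_def] using sq sqD square_intD(2) square_int_integrable
    by (auto intro!: Bochner_Integration.integrable_sum Bochner_Integration.integrable_diff)
  have EE: "expectation (\<lambda>\<omega>. \<bar>E \<omega>\<bar>) \<le> real n * ((K + 1) * \<tau>)"
  proof -
    have i: "integrable M (\<lambda>\<omega>. (H u u \<omega>)\<^sup>2 + \<tau>)" if "u \<in> I \<inter> J" for u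
      using that sq square_intD(2) by auto
    have "expectation (\<lambda>\<omega>. \<bar>E \<omega>\<bar>) \<le> expectation (\<lambda>\<omega>. \<Sum>u\<in>I \<inter> J. (H u u \<omega>)\<^sup>2 + \<tau>)"
    proof (intro integral_mono integrable_abs iE Bochner_Integration.integrable_sum i)
      fix \<omega>
      have "\<bar>(H u u \<omega>)\<^sup>2 - \<tau>\<bar> \<le> (H u u \<omega>)\<^sup>2 + \<tau>" for u
        using \<tau>0 abs_triangle_ineq4[of "(H u u \<omega>)\<^sup>2" \<tau>] by simp
      then show "\<bar>E \<omega>\<bar> \<le> (\<Sum>u\<in>I \<inter> J. (H u u \<omega>)\<^sup>2 + \<tau>)"
        unfolding E_def by (intro order_trans[OF sum_abs] sum_mono)
    qed
    also have "\<dots> = (\<Sum>u\<in>I \<inter> J. expectation (\<lambda>\<omega>. (H u u \<omega>)\<^sup>2 + \<tau>))"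
      using i by (simp add: Bochner_Integration.integral_sum)
    also have "\<dots> \<le> (\<Sum>u\<in>I \<inter> J. (K + 1) * \<tau>)"
    proof (rule sum_mono)
      fix u assume "u \<in> I \<inter> J"
      then show "expectation (\<lambda>\<omega>. (H u u \<omega>)\<^sup>2 + \<tau>) \<le> (K + 1) * \<tau>"
        using le[of u u] square_intD(2)[OF sq[of u u]] by (simp add: prob_space algebra_simps)
    qed
    also have "\<dots> \<le> real n * ((K + 1) * \<tau>)"
      using card_mono[of I "I \<inter> J"] fin IJ K_ge \<tau>0 by (simp, intro mult_right_mono) auto
    finally show ?thesis .
  qed
  have "expectation (\<lambda>\<omega>. \<bar>C \<omega> - real (card I) * real (card J) * \<tau>\<bar>) \<le>
    expectation (\<lambda>\<omega>. \<bar>C \<omega> - B \<omega>\<bar> + \<bar>\<Sum>u\<in>I. \<Sum>v\<in>J. D u v \<omega>\<bar> + \<bar>E \<omega>\<bar>)"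
  proof (rule integral_mono)
    fix \<omega>
    have "C \<omega> - real (card I) * real (card J) * \<tau> = (C \<omega> - B \<omega>) + (\<Sum>u\<in>I. \<Sum>v\<in>J. D u v \<omega>) + E \<omega>"
      using split[of \<omega>] by simp
    then show "\<bar>C \<omega> - real (card I) * real (card J) * \<tau>\<bar> \<le> \<bar>C \<omega> - B \<omega>\<bar> + \<bar>\<Sum>u\<in>I. \<Sum>v\<in>J. D u v \<omega>\<bar> + \<bar>E \<omega>\<bar>"
      by linarith
  qed (use iC iB iD iE in auto)
  also have "\<dots> = expectation (\<lambda>\<omega>. \<bar>C \<omega> - B \<omega>\<bar>) + expectation (\<lambda>\<omega>. \<bar>\<Sum>u\<in>I. \<Sum>v\<in>J. D u v \<omega>\<bar>) + expectation (\<lambda>\<omega>. \<bar>E \<omega>\<bar>)"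
    using iC iB iD iE by simp
  also have "\<dots> \<le> (2 * real (card I) + real (card J)) * (K * \<tau>) + 2 * (real n * sqrt (real n)) * (K * \<tau>) + real n * ((K + 1) * \<tau>)"
    using cg(2) DB EE unfolding sK by linarith
  also have "\<dots> \<le> (3 * real n) * (K * \<tau>) + 2 * (real n * sqrt (real n)) * (K * \<tau>) + real n * ((K + 1) * \<tau>)"
    using IJ K_ge \<tau>0 by (intro add_mono mult_right_mono order_refl) auto
  also have "\<dots> = real n * ((4 * K + 1) * \<tau>) + 2 * (real n * sqrt (real n)) * (K * \<tau>)"
    by (simp add: algebra_simps)
  also have "\<dots> \<le> (real n * sqrt (real n)) * ((4 * K + 1) * \<tau>) + 2 * (real n * sqrt (real n)) * (K * \<tau>)"
  proof -
    have "real n * 1 \<le> real n * sqrt (real n)"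
      using n1 by (intro mult_left_mono) auto
    then show ?thesis
      using K_ge \<tau>0 by (intro add_mono mult_right_mono order_refl) auto
  qed
  also have "\<dots> = (6 * K + 1) * (real n * sqrt (real n)) * \<tau>"
    by (simp add: algebra_simps)
  finally show "expectation (\<lambda>\<omega>. \<bar>(\<Sum>u\<in>I. \<Sum>v\<in>J. (centred I J (\<lambda>u v. H u v \<omega>) u v)\<^sup>2) - real (card I) * real (card J) * \<tau>\<bar>)
      \<le> (6 * K + 1) * (real n * sqrt (real n)) * \<tau>"
    by (simp add: C_def)
qed

end

text \<open>Summing over the common noise index of two loading matrices contracts them to a
  covariance matrix.\<close>

lemma sum_bilinear:
  fixes g h :: "'a \<Rightarrow> 'k \<Rightarrow> real"
  shows "(\<Sum>k\<in>R. (\<Sum>a\<in>P. g a k * m a) * (\<Sum>b\<in>P. h b k * n b)) =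
    (\<Sum>a\<in>P. \<Sum>b\<in>P. (\<Sum>k\<in>R. g a k * h b k) * (m a * n b))"
proof -
  have "(\<Sum>k\<in>R. (\<Sum>a\<in>P. g a k * m a) * (\<Sum>b\<in>P. h b k * n b)) =
    (\<Sum>k\<in>R. \<Sum>a\<in>P. \<Sum>b\<in>P. (g a k * h b k) * (m a * n b))"
    by (simp add: sum_product mult_ac)
  also have "\<dots> = (\<Sum>a\<in>P. \<Sum>k\<in>R. \<Sum>b\<in>P. (g a k * h b k) * (m a * n b))"
    by (rule sum.swap)
  also have "\<dots> = (\<Sum>a\<in>P. \<Sum>b\<in>P. \<Sum>k\<in>R. (g a k * h b k) * (m a * n b))"
    by (intro sum.cong sum.swap refl)
  finally show ?thesis
    by (simp add: sum_distrib_right)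
qed

text \<open>Since \<open>rk\<close> is injective, every unordered pair occurs exactly once on the
  left, where the factor 2 compensates for the two orders counted on the right.\<close>

lemma sum_ranked_pairs:
  fixes g :: "'u \<Rightarrow> 'u \<Rightarrow> real" and rk :: "'u \<Rightarrow> nat"
  assumes "finite U" "inj_on rk U" "\<And>u v. g u v = g v u"
  shows "(\<Sum>u\<in>U. \<Sum>v\<in>U. if rk v < rk u then 2 * g u v else 0) = (\<Sum>u\<in>U. \<Sum>v\<in>U - {u}. g u v)"
proof -
  have "(\<Sum>u\<in>U. \<Sum>v\<in>U. if rk v < rk u then 2 * g u v else 0) =
    (\<Sum>u\<in>U. \<Sum>v\<in>U. (if rk v < rk u then g u v else 0) + (if rk v < rk u then g u v else 0))"
    by (intro sum.cong) auto
  also have "\<dots> = (\<Sum>u\<in>U. \<Sum>v\<in>U. if rk v < rk u then g u v else 0) + (\<Sum>u\<in>U. \<Sum>v\<in>U. if rk v < rk u then g u v else 0)"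
    by (simp only: sum.distrib)
  also have "\<dots> = (\<Sum>u\<in>U. \<Sum>v\<in>U. if rk v < rk u then g u v else 0) + (\<Sum>v\<in>U. \<Sum>u\<in>U. if rk v < rk u then g u v else 0)"
    by (intro arg_cong2[where f="(+)"] refl sum.swap)
  also have "\<dots> = (\<Sum>u\<in>U. \<Sum>v\<in>U. (if rk v < rk u then g u v else 0) + (if rk u < rk v then g v u else 0))"
    by (simp add: sum.distrib)
  also have "\<dots> = (\<Sum>u\<in>U. \<Sum>v\<in>U. if v \<in> U - {u} then g u v else 0)"
  proof (intro sum.cong refl)
    fix u v assume "u \<in> U" "v \<in> U"
    then have "rk u = rk v \<longleftrightarrow> u = v" using assms(2) by (auto dest: inj_onD)
    then show "(if rk v < rk u then g u v else 0) + (if rk u < rk v then g v u else 0) = (if v \<in> U - {u} then g u v else 0)"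
      using assms(3)[of u v] \<open>v \<in> U\<close> by (cases "rk u" "rk v" rule: linorder_cases) auto
  qed
  also have "\<dots> = (\<Sum>u\<in>U. \<Sum>v\<in>U - {u}. g u v)"
  proof (rule sum.cong[OF refl])
    fix u assume "u \<in> U"
    have "(\<Sum>v\<in>U. if v \<in> U - {u} then g u v else 0) = (\<Sum>v\<in>U \<inter> (U - {u}). g u v)"
      using assms(1) by (simp only: sum.inter_restrict)
    also have "U \<inter> (U - {u}) = U - {u}" by auto
    finally show "(\<Sum>v\<in>U. if v \<in> U - {u} then g u v else 0) = (\<Sum>v\<in>U - {u}. g u v)" .
  qed
  finally show ?thesis .
qed

section \<open>The bias-corrected trace estimator, and the triangular coefficient matrix of the
  quadratic form\<close>

context obs_family
begin

text \<open>Compared with \<open>centred_gram_concentration\<close> only the squared trace is new.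
  Diagonal entries of \<open>H\<close> have second moments of order \<tau>, so the trace has a
  second moment of order \<open>n * n * \<tau>\<close>; division by \<open>n - 1\<close> leaves
  order \<open>n * \<tau>\<close>. For the Gram matrix itself the squared trace need not be
  negligible.\<close>

lemma centred_gram_tilde_concentration:
  assumes I: "I \<subseteq> Ob" "card I = n" "n \<ge> 2"
    and \<tau>: "\<And>u v. u \<in> I \<Longrightarrow> v \<in> I \<Longrightarrow> tau u v = \<tau>"
  defines "X \<equiv> \<lambda>\<omega>. (\<Sum>u\<in>I. \<Sum>v\<in>I. (centred I I (\<lambda>u v. H u v \<omega>) u v)\<^sup>2)
      - (\<Sum>u\<in>I. centred I I (\<lambda>u v. H u v \<omega>) u u)\<^sup>2 / (real n - 1)"
  shows "integrable M X"
    and "expectation (\<lambda>\<omega>. \<bar>X \<omega> - real n * real n * \<tau>\<bar>) \<le> (14 * K + 1) * (real n * sqrt (real n)) * \<tau>"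
proof -
  have fin: "finite I" "I \<noteq> {}" using I finite_Ob finite_subset by auto
  then obtain u0 where "u0 \<in> I" by auto
  then have \<tau>0: "0 \<le> \<tau>" using \<tau> tau_nonneg by metis
  define C where "C \<omega> = (\<Sum>u\<in>I. \<Sum>v\<in>I. (centred I I (\<lambda>u v. H u v \<omega>) u v)\<^sup>2)" for \<omega>
  define E where "E \<omega> = (\<Sum>u\<in>I. H u u \<omega>)" for \<omega>
  define A where "A \<omega> = (\<Sum>u\<in>I. \<Sum>v\<in>I. H u v \<omega>)" for \<omega>
  have sq: "square_int (H u v)" if "u \<in> I" "v \<in> I" for u v
    using that I by (intro H_square_int) auto
  have le: "expectation (\<lambda>\<omega>. (H u v \<omega>)\<^sup>2) \<le> K * \<tau>" if "u \<in> I" "v \<in> I" for u v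
    using H_square_le[of u v] \<tau>[OF that] that I by auto
  have rows: "expectation (\<lambda>\<omega>. H u v \<omega> * H u w \<omega>) = 0" if "u \<in> I" "v \<in> I" "w \<in> I" "v \<noteq> w" for u v w
    using that I by (intro H_uncorrelated) auto
  have cols: "expectation (\<lambda>\<omega>. H v u \<omega> * H w u \<omega>) = 0" if "v \<in> I" "w \<in> I" "u \<in> I" "v \<noteq> w" for u v w
    unfolding H_sym[of _ u] using that I by (intro H_uncorrelated) auto
  have EA: "expectation (\<lambda>\<omega>. (A \<omega>)\<^sup>2) \<le> real n * (real n * real n * (K * \<tau>))"
    using expectation_centred_gram(3)[of I I H "K * \<tau>", OF fin(1) fin(1) fin(2) fin(2) sq le rows cols] I
    by (simp add: A_def)
  have sA: "square_int A" and sE: "square_int E"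
    unfolding A_def[abs_def] E_def[abs_def] using sq by (auto intro!: square_int_sum)
  have EE: "expectation (\<lambda>\<omega>. (E \<omega>)\<^sup>2) \<le> real n * (real n * (K * \<tau>))"
  proof -
    have "expectation (\<lambda>\<omega>. (E \<omega>)\<^sup>2) \<le> expectation (\<lambda>\<omega>. real n * (\<Sum>u\<in>I. (H u u \<omega>)\<^sup>2))"
    proof (rule integral_mono)
      show "(E \<omega>)\<^sup>2 \<le> real n * (\<Sum>u\<in>I. (H u u \<omega>)\<^sup>2)" for \<omega>
        using Cauchy_Schwarz_ineq_sum[of "\<lambda>_. 1" "\<lambda>u. H u u \<omega>" I] I by (simp add: E_def)
    qed (use sE sq square_intD(2) in \<open>auto intro!: Bochner_Integration.integrable_sum integrable_mult_right\<close>)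
    also have "\<dots> = real n * (\<Sum>u\<in>I. expectation (\<lambda>\<omega>. (H u u \<omega>)\<^sup>2))"
      using sq square_intD(2) by (simp add: Bochner_Integration.integral_sum)
    also have "\<dots> \<le> real n * (\<Sum>u\<in>I. K * \<tau>)"
      by (intro mult_left_mono sum_mono le) auto
    finally show ?thesis using I by simp
  qed
  define D where "D \<omega> = E \<omega> - A \<omega> / real n" for \<omega>
  have sD: "square_int D"
    unfolding D_def[abs_def] using square_int_diff[OF sE square_int_cmult[OF sA, of "1 / real n"]] by simp
  have D: "(\<Sum>u\<in>I. centred I I (\<lambda>u v. H u v \<omega>) u u) = D \<omega>" for \<omega>
    using sum_centred(2)[OF fin] I by (simp add: D_def E_def A_def)
  have n: "real n \<ge> 2" using I by simp
  have "expectation (\<lambda>\<omega>. (D \<omega>)\<^sup>2) \<le> expectation (\<lambda>\<omega>. 2 * (E \<omega>)\<^sup>2 + 2 * ((A \<omega>)\<^sup>2 / (real n)\<^sup>2))"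
  proof (rule integral_mono)
    show "(D \<omega>)\<^sup>2 \<le> 2 * (E \<omega>)\<^sup>2 + 2 * ((A \<omega>)\<^sup>2 / (real n)\<^sup>2)" for \<omega>
      using sum_squares_bound[of "E \<omega>" "- (A \<omega> / real n)"]
      unfolding D_def power2_diff power_divide[symmetric] by simp
  qed (use square_intD(2)[OF sE] square_intD(2)[OF sA] square_intD(2)[OF sD] in auto)
  also have "\<dots> = 2 * expectation (\<lambda>\<omega>. (E \<omega>)\<^sup>2) + 2 * (expectation (\<lambda>\<omega>. (A \<omega>)\<^sup>2) / (real n)\<^sup>2)"
    using square_intD(2)[OF sE] square_intD(2)[OF sA] by simp
  also have "\<dots> \<le> 2 * (real n * (real n * (K * \<tau>))) + 2 * (real n * (real n * real n * (K * \<tau>)) / (real n)\<^sup>2)"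
    using EE EA by (intro add_mono mult_left_mono divide_right_mono) auto
  also have "\<dots> = 2 * (real n * (real n * (K * \<tau>))) + 2 * (real n * (K * \<tau>))"
    using n by (simp add: power2_eq_square)
  also have "\<dots> \<le> 2 * (real n * (real n * (K * \<tau>))) + real n * (real n * (K * \<tau>))"
    using n K_ge \<tau>0 by (intro add_left_mono mult_right_mono) auto
  also have "\<dots> \<le> (8 * (K * \<tau>) * real n) * (real n - 1)"
  proof -
    have "3 * real n \<le> 8 * (real n - 1)" using n by simp
    then have "(3 * real n) * (real n * (K * \<tau>)) \<le> (8 * (real n - 1)) * (real n * (K * \<tau>))"
      using K_ge \<tau>0 by (intro mult_right_mono) auto
    then show ?thesis by (simp add: algebra_simps)
  qed
  finally have ED: "expectation (\<lambda>\<omega>. (D \<omega>)\<^sup>2) / (real n - 1) \<le> 8 * (K * \<tau>) * real n"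
    using n by (simp add: pos_divide_le_eq)
  have iC: "integrable M C" and EC: "expectation (\<lambda>\<omega>. \<bar>C \<omega> - real n * real n * \<tau>\<bar>) \<le> (6 * K + 1) * (real n * sqrt (real n)) * \<tau>"
    using centred_gram_concentration[of I I n \<tau>] I fin \<tau> by (auto simp: C_def[abs_def])
  have X: "X = (\<lambda>\<omega>. C \<omega> - (D \<omega>)\<^sup>2 / (real n - 1))"
    by (simp add: X_def C_def D)
  show "integrable M X"
    unfolding X using iC square_intD(2)[OF sD] by simp
  have "expectation (\<lambda>\<omega>. \<bar>X \<omega> - real n * real n * \<tau>\<bar>) \<le>
    expectation (\<lambda>\<omega>. \<bar>C \<omega> - real n * real n * \<tau>\<bar> + (D \<omega>)\<^sup>2 / (real n - 1))"
  proof (rule integral_mono)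
    fix \<omega>
    have "0 \<le> (D \<omega>)\<^sup>2 / (real n - 1)" using n by simp
    then show "\<bar>X \<omega> - real n * real n * \<tau>\<bar> \<le> \<bar>C \<omega> - real n * real n * \<tau>\<bar> + (D \<omega>)\<^sup>2 / (real n - 1)"
      unfolding X by linarith
  qed (use iC square_intD(2)[OF sD] in \<open>auto simp: X\<close>)
  also have "\<dots> = expectation (\<lambda>\<omega>. \<bar>C \<omega> - real n * real n * \<tau>\<bar>) + expectation (\<lambda>\<omega>. (D \<omega>)\<^sup>2) / (real n - 1)"
    using iC square_intD(2)[OF sD] by simp
  also have "\<dots> \<le> (6 * K + 1) * (real n * sqrt (real n)) * \<tau> + 8 * (K * \<tau>) * real n"
    by (intro add_mono EC ED)
  also have "\<dots> \<le> (6 * K + 1) * (real n * sqrt (real n)) * \<tau> + 8 * (K * \<tau>) * (real n * sqrt (real n))"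
    using n K_ge \<tau>0 by (intro add_left_mono mult_left_mono) auto
  also have "\<dots> = (14 * K + 1) * (real n * sqrt (real n)) * \<tau>"
    by (simp add: algebra_simps)
  finally show "expectation (\<lambda>\<omega>. \<bar>X \<omega> - real n * real n * \<tau>\<bar>) \<le> (14 * K + 1) * (real n * sqrt (real n)) * \<tau>" .
qed

text \<open>Strictly triangular in observations, not in single coordinates: each pair of
  observations is charged, with factor 2, to the one of larger rank. Coordinates of one observation
  do not interact, as the quadratic form has no diagonal pairs.\<close>

definition tri_coeff :: "('u \<Rightarrow> nat) \<Rightarrow> ('u \<Rightarrow> 'u \<Rightarrow> real) \<Rightarrow> 'u \<times> nat \<Rightarrow> 'u \<times> nat \<Rightarrow> real" where
  "tri_coeff rk c x x' = (if rk (fst x') < rk (fst x)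
     then 2 * c (fst x) (fst x') * (\<Sum>a<p. \<Gamma> (fst x) a (snd x) * \<Gamma> (fst x') a (snd x')) else 0)"

definition cross :: "'u \<Rightarrow> 'u \<Rightarrow> nat \<Rightarrow> nat \<Rightarrow> real" where
  "cross u v j k = (\<Sum>a<p. \<Gamma> u a j * \<Gamma> v a k)"

lemma tri_coeff_cross: "tri_coeff rk c (u, j) (v, k) = (if rk v < rk u then 2 * c u v * cross u v j k else 0)"
  by (simp add: tri_coeff_def cross_def)

text \<open>The trace of the product of the covariance matrices of \<open>v\<close>,
  \<open>u\<close>, \<open>w\<close>, \<open>u'\<close> in this order, with the sums arranged as
  they arise from contracting the loading matrices of \<open>v\<close> and \<open>w\<close>.\<close>

definition trace4 :: "'u \<Rightarrow> 'u \<Rightarrow> 'u \<Rightarrow> 'u \<Rightarrow> real" where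
  "trace4 v u w u' = (\<Sum>a<p. \<Sum>a'<p. Sg v a a' * (\<Sum>b<p. \<Sum>b'<p. Sg w b b' * (Sg u a b * Sg u' a' b')))"

lemma sum_Ob_times: "(\<Sum>x\<in>U \<times> {..<r}. f x) = (\<Sum>u\<in>U. \<Sum>j<r. f (u, j))"
  by (simp add: sum.cartesian_product)

lemma G_expand: "G u v \<omega> = (\<Sum>j<r. \<Sum>k<r. (\<Sum>a<p. \<Gamma> u a j * \<Gamma> v a k) * Z (v, k) \<omega> * Z (u, j) \<omega>)"
proof -
  have "G u v \<omega> = (\<Sum>a<p. \<Sum>j<r. \<Sum>k<r. \<Gamma> u a j * \<Gamma> v a k * Z (v, k) \<omega> * Z (u, j) \<omega>)"
    by (simp add: G_def y_def sum_product mult_ac)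
  also have "\<dots> = (\<Sum>j<r. \<Sum>a<p. \<Sum>k<r. \<Gamma> u a j * \<Gamma> v a k * Z (v, k) \<omega> * Z (u, j) \<omega>)"
    by (rule sum.swap)
  also have "\<dots> = (\<Sum>j<r. \<Sum>k<r. \<Sum>a<p. \<Gamma> u a j * \<Gamma> v a k * Z (v, k) \<omega> * Z (u, j) \<omega>)"
    by (intro sum.cong sum.swap refl)
  finally show ?thesis by (simp add: sum_distrib_right)
qed

lemma tri_coeff_form:
  assumes "inj_on rk Ob" "\<And>u v. c u v = c v u"
  shows "(\<Sum>x\<in>Ob \<times> {..<r}. \<Sum>x'\<in>Ob \<times> {..<r}. tri_coeff rk c x x' * Z x' \<omega> * Z x \<omega>) =
    (\<Sum>u\<in>Ob. \<Sum>v\<in>Ob - {u}. c u v * G u v \<omega>)"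
proof -
  have "(\<Sum>x\<in>Ob \<times> {..<r}. \<Sum>x'\<in>Ob \<times> {..<r}. tri_coeff rk c x x' * Z x' \<omega> * Z x \<omega>) =
    (\<Sum>u\<in>Ob. \<Sum>j<r. \<Sum>v\<in>Ob. \<Sum>k<r. tri_coeff rk c (u, j) (v, k) * Z (v, k) \<omega> * Z (u, j) \<omega>)"
    by (simp only: sum_Ob_times)
  also have "\<dots> = (\<Sum>u\<in>Ob. \<Sum>v\<in>Ob. \<Sum>j<r. \<Sum>k<r. tri_coeff rk c (u, j) (v, k) * Z (v, k) \<omega> * Z (u, j) \<omega>)"
    by (intro sum.cong sum.swap refl)
  also have "\<dots> = (\<Sum>u\<in>Ob. \<Sum>v\<in>Ob. if rk v < rk u then 2 * (c u v * G u v \<omega>) else 0)"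
    by (intro sum.cong refl) (simp add: tri_coeff_cross G_expand flip: cross_def, simp add: sum_distrib_left mult_ac)
  also have "\<dots> = (\<Sum>u\<in>Ob. \<Sum>v\<in>Ob - {u}. c u v * G u v \<omega>)"
    using assms by (intro sum_ranked_pairs finite_Ob) (auto simp: G_sym)
  finally show ?thesis .
qed

lemma tri_coeff_square:
  assumes "inj_on rk Ob" "\<And>u v. c u v = c v u"
  shows "(\<Sum>x\<in>Ob \<times> {..<r}. \<Sum>x'\<in>Ob \<times> {..<r}. (tri_coeff rk c x x')\<^sup>2) =
    2 * (\<Sum>u\<in>Ob. \<Sum>v\<in>Ob - {u}. (c u v)\<^sup>2 * tau u v)"
proof -
  have "(\<Sum>x\<in>Ob \<times> {..<r}. \<Sum>x'\<in>Ob \<times> {..<r}. (tri_coeff rk c x x')\<^sup>2) =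
    (\<Sum>u\<in>Ob. \<Sum>j<r. \<Sum>v\<in>Ob. \<Sum>k<r. (tri_coeff rk c (u, j) (v, k))\<^sup>2)"
    by (simp only: sum_Ob_times)
  also have "\<dots> = (\<Sum>u\<in>Ob. \<Sum>v\<in>Ob. \<Sum>j<r. \<Sum>k<r. (tri_coeff rk c (u, j) (v, k))\<^sup>2)"
    by (intro sum.cong sum.swap refl)
  also have "\<dots> = (\<Sum>u\<in>Ob. \<Sum>v\<in>Ob. if rk v < rk u then 2 * (2 * (c u v)\<^sup>2 * tau u v) else 0)"
    by (intro sum.cong refl) (simp add: tri_coeff_cross tau_eq_sum_squares flip: cross_def, simp add: sum_distrib_left power_mult_distrib mult_ac)
  also have "\<dots> = (\<Sum>u\<in>Ob. \<Sum>v\<in>Ob - {u}. 2 * (c u v)\<^sup>2 * tau u v)"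
    using assms by (intro sum_ranked_pairs finite_Ob) (auto simp: tau_sym)
  finally show ?thesis by (simp add: sum_distrib_left mult_ac)
qed

text \<open>The noise indices \<open>k\<close> and \<open>k'\<close> occur only in the loading
  matrices of \<open>v\<close> and \<open>w\<close>; summing over them turns two copies of each into
  its covariance matrix.\<close>

lemma trace4_eq:
  "(\<Sum>k<r. \<Sum>k'<r. (\<Sum>a<p. \<Sum>b<p. Sg u a b * (\<Gamma> v a k * \<Gamma> w b k')) * (\<Sum>a<p. \<Sum>b<p. Sg u' a b * (\<Gamma> v a k * \<Gamma> w b k'))) =
    trace4 v u w u'"
proof -
  define m where "m u a k' = (\<Sum>b<p. \<Gamma> w b k' * Sg u a b)" for u a k'
  have 1: "(\<Sum>a<p. \<Sum>b<p. Sg u a b * (\<Gamma> v a k * \<Gamma> w b k')) = (\<Sum>a<p. \<Gamma> v a k * m u a k')" for u k k'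
    by (simp add: m_def sum_distrib_left mult_ac)
  have "(\<Sum>k<r. \<Sum>k'<r. (\<Sum>a<p. \<Gamma> v a k * m u a k') * (\<Sum>a<p. \<Gamma> v a k * m u' a k')) =
    (\<Sum>k'<r. \<Sum>k<r. (\<Sum>a<p. \<Gamma> v a k * m u a k') * (\<Sum>a<p. \<Gamma> v a k * m u' a k'))"
    by (rule sum.swap)
  also have "\<dots> = (\<Sum>k'<r. \<Sum>a<p. \<Sum>a'<p. Sg v a a' * (m u a k' * m u' a' k'))"
    by (simp only: sum_bilinear Sg_def)
  also have "\<dots> = (\<Sum>a<p. \<Sum>k'<r. \<Sum>a'<p. Sg v a a' * (m u a k' * m u' a' k'))"
    by (rule sum.swap)
  also have "\<dots> = (\<Sum>a<p. \<Sum>a'<p. \<Sum>k'<r. Sg v a a' * (m u a k' * m u' a' k'))"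
    by (intro sum.cong sum.swap refl)
  also have "\<dots> = (\<Sum>a<p. \<Sum>a'<p. Sg v a a' * (\<Sum>k'<r. m u a k' * m u' a' k'))"
    by (simp only: sum_distrib_left)
  also have "\<dots> = (\<Sum>a<p. \<Sum>a'<p. Sg v a a' * (\<Sum>b<p. \<Sum>b'<p. Sg w b b' * (Sg u a b * Sg u' a' b')))"
    by (simp only: m_def sum_bilinear) (simp only: Sg_def)
  finally show ?thesis
    unfolding 1 trace4_def .
qed

text \<open>The block of L^T L at \<open>(v, w)\<close> is a weighted sum over \<open>u\<close> of
  \<Sigma>_u between the loadings of \<open>v\<close> and \<open>w\<close>; its squared norm is a
  double sum of fourfold traces. The weights \<open>\<alpha>\<close> record which observations come
  later. They are bounded by \<open>4 * c0\<^sup>2\<close>, and this bound removes all dependence on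
  the ordering at the price of absolute values.\<close>

lemma tri_coeff_fourth:
  assumes c0: "\<And>u v. u \<in> Ob \<Longrightarrow> v \<in> Ob \<Longrightarrow> \<bar>c u v\<bar> \<le> c0" "0 \<le> c0"
  shows "(\<Sum>x\<in>Ob \<times> {..<r}. \<Sum>x'\<in>Ob \<times> {..<r}. (\<Sum>z\<in>Ob \<times> {..<r}. tri_coeff rk c z x * tri_coeff rk c z x')\<^sup>2) \<le>
    16 * c0 ^ 4 * (\<Sum>v\<in>Ob. \<Sum>w\<in>Ob. \<Sum>u\<in>Ob. \<Sum>u'\<in>Ob. \<bar>trace4 v u w u'\<bar>)"
proof -
  define \<alpha> where "\<alpha> u v w = (if rk v < rk u \<and> rk w < rk u then 4 * (c u v * c u w) else 0)" for u v w
  define X where "X u v w k k' = (\<Sum>a<p. \<Sum>b<p. Sg u a b * (\<Gamma> v a k * \<Gamma> w b k'))" for u v w k k'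
  have inner: "(\<Sum>z\<in>Ob \<times> {..<r}. tri_coeff rk c z (v, k) * tri_coeff rk c z (w, k')) = (\<Sum>u\<in>Ob. \<alpha> u v w * X u v w k k')" for v w k k'
  proof -
    have "(\<Sum>j<r. tri_coeff rk c (u, j) (v, k) * tri_coeff rk c (u, j) (w, k')) = \<alpha> u v w * X u v w k k'" for u
    proof -
      have "X u v w k k' = (\<Sum>j<r. (\<Sum>a<p. \<Gamma> u a j * \<Gamma> v a k) * (\<Sum>b<p. \<Gamma> u b j * \<Gamma> w b k'))"
        by (simp only: sum_bilinear X_def Sg_def)
      then have "X u v w k k' = (\<Sum>j<r. cross u v j k * cross u w j k')"
        by (simp only: cross_def)
      then show ?thesis
        by (cases "rk v < rk u"; cases "rk w < rk u") (simp_all add: tri_coeff_cross \<alpha>_def sum_distrib_left mult_ac)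
    qed
    then show ?thesis by (simp add: sum_Ob_times)
  qed
  have \<alpha>: "\<bar>\<alpha> u v w\<bar> \<le> 4 * c0\<^sup>2" if "u \<in> Ob" "v \<in> Ob" "w \<in> Ob" for u v w
    using that c0 by (auto simp: \<alpha>_def abs_mult power2_eq_square intro!: mult_mono)
  have blk: "(\<Sum>k<r. \<Sum>k'<r. (\<Sum>u\<in>Ob. \<alpha> u v w * X u v w k k')\<^sup>2) \<le> (\<Sum>u\<in>Ob. \<Sum>u'\<in>Ob. 16 * c0 ^ 4 * \<bar>trace4 v u w u'\<bar>)"
    if vw: "v \<in> Ob" "w \<in> Ob" for v w
  proof -
    have "(\<Sum>k<r. \<Sum>k'<r. (\<Sum>u\<in>Ob. \<alpha> u v w * X u v w k k')\<^sup>2) =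
      (\<Sum>k<r. \<Sum>k'<r. \<Sum>u\<in>Ob. \<Sum>u'\<in>Ob. \<alpha> u v w * \<alpha> u' v w * (X u v w k k' * X u' v w k k'))"
      by (simp add: power2_eq_square sum_product mult_ac)
    also have "\<dots> = (\<Sum>k<r. \<Sum>u\<in>Ob. \<Sum>k'<r. \<Sum>u'\<in>Ob. \<alpha> u v w * \<alpha> u' v w * (X u v w k k' * X u' v w k k'))"
      by (intro sum.cong sum.swap refl)
    also have "\<dots> = (\<Sum>k<r. \<Sum>u\<in>Ob. \<Sum>u'\<in>Ob. \<Sum>k'<r. \<alpha> u v w * \<alpha> u' v w * (X u v w k k' * X u' v w k k'))"
      by (intro sum.cong sum.swap refl)
    also have "\<dots> = (\<Sum>u\<in>Ob. \<Sum>k<r. \<Sum>u'\<in>Ob. \<Sum>k'<r. \<alpha> u v w * \<alpha> u' v w * (X u v w k k' * X u' v w k k'))"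
      by (rule sum.swap)
    also have "\<dots> = (\<Sum>u\<in>Ob. \<Sum>u'\<in>Ob. \<Sum>k<r. \<Sum>k'<r. \<alpha> u v w * \<alpha> u' v w * (X u v w k k' * X u' v w k k'))"
      by (intro sum.cong sum.swap refl)
    also have "\<dots> = (\<Sum>u\<in>Ob. \<Sum>u'\<in>Ob. \<alpha> u v w * \<alpha> u' v w * trace4 v u w u')"
      by (simp only: X_def trace4_eq flip: sum_distrib_left)
    also have "\<dots> \<le> (\<Sum>u\<in>Ob. \<Sum>u'\<in>Ob. 16 * c0 ^ 4 * \<bar>trace4 v u w u'\<bar>)"
    proof (intro sum_mono)
      fix u u' assume "u \<in> Ob" "u' \<in> Ob"
      have "\<alpha> u v w * \<alpha> u' v w * trace4 v u w u' \<le> \<bar>\<alpha> u v w\<bar> * \<bar>\<alpha> u' v w\<bar> * \<bar>trace4 v u w u'\<bar>"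
        by (metis abs_ge_self abs_mult)
      also have "\<dots> \<le> (4 * c0\<^sup>2) * (4 * c0\<^sup>2) * \<bar>trace4 v u w u'\<bar>"
        using vw \<open>u \<in> Ob\<close> \<open>u' \<in> Ob\<close> by (intro mult_right_mono mult_mono \<alpha>) auto
      also have "\<dots> = 16 * c0 ^ 4 * \<bar>trace4 v u w u'\<bar>"
        by (simp add: power2_eq_square power4_eq_xxxx)
      finally show "\<alpha> u v w * \<alpha> u' v w * trace4 v u w u' \<le> 16 * c0 ^ 4 * \<bar>trace4 v u w u'\<bar>" .
    qed
    finally show ?thesis .
  qed
  have "(\<Sum>x\<in>Ob \<times> {..<r}. \<Sum>x'\<in>Ob \<times> {..<r}. (\<Sum>z\<in>Ob \<times> {..<r}. tri_coeff rk c z x * tri_coeff rk c z x')\<^sup>2) =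
    (\<Sum>v\<in>Ob. \<Sum>k<r. \<Sum>w\<in>Ob. \<Sum>k'<r. (\<Sum>u\<in>Ob. \<alpha> u v w * X u v w k k')\<^sup>2)"
    by (subst sum_Ob_times, intro sum.cong refl, subst sum_Ob_times, simp only: inner)
  also have "\<dots> = (\<Sum>v\<in>Ob. \<Sum>w\<in>Ob. \<Sum>k<r. \<Sum>k'<r. (\<Sum>u\<in>Ob. \<alpha> u v w * X u v w k k')\<^sup>2)"
    by (intro sum.cong sum.swap refl)
  also have "\<dots> \<le> (\<Sum>v\<in>Ob. \<Sum>w\<in>Ob. \<Sum>u\<in>Ob. \<Sum>u'\<in>Ob. 16 * c0 ^ 4 * \<bar>trace4 v u w u'\<bar>)"
    by (intro sum_mono blk)
  finally show ?thesis
    by (simp only: sum_distrib_left)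
qed

end

subsection \<open>The factor model\<close>

lemma mat_trace_mult:
  assumes "A \<in> carrier_mat p q" "B \<in> carrier_mat q p"
  shows "mat_trace (A * B) = (\<Sum>a<p. \<Sum>b<q. A $$ (a, b) * B $$ (b, a))"
  using assms by (simp add: mat_trace_def scalar_prod_def atLeast0LessThan)

lemma sample_cov_carrier: "sample_cov p I X \<in> carrier_mat p p"
  by (simp add: sample_cov_def)

lemma sample_cov_entry:
  assumes "finite I" "I \<noteq> {}" "a < p" "b < p"
    and X: "\<And>i a. i \<in> I \<Longrightarrow> a < p \<Longrightarrow> X i $ a = y i a + m a"
  shows "sample_cov p I X $$ (a, b) = (\<Sum>i\<in>I. (y i a - (\<Sum>i'\<in>I. y i' a) / card I) * (y i b - (\<Sum>i'\<in>I. y i' b) / card I)) / (real (card I) - 1)"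
proof -
  have c: "real (card I) > 0" using assms by (simp add: card_gt_0_iff)
  have mean: "sample_mean p I X $ a = (\<Sum>i'\<in>I. y i' a) / card I + m a" if "a < p" for a
    using that c by (simp add: sample_mean_def X sum.distrib add_divide_distrib)
  show ?thesis
    using assms by (simp add: sample_cov_def mean X cong: sum.cong)
qed

lemma centred_gram:
  fixes y :: "'i \<Rightarrow> nat \<Rightarrow> real" and y' :: "'j \<Rightarrow> nat \<Rightarrow> real"
  assumes "finite I" "I \<noteq> {}" "finite J" "J \<noteq> {}"
  shows "(\<Sum>a<p. (y i a - (\<Sum>i'\<in>I. y i' a) / card I) * (y' j a - (\<Sum>j'\<in>J. y' j' a) / card J)) =
    centred I J (\<lambda>i j. \<Sum>a<p. y i a * y' j a) i j"
proof -
  have c: "real (card I) > 0" "real (card J) > 0" using assms by (auto simp: card_gt_0_iff)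
  have 1: "(\<Sum>j'\<in>J. \<Sum>a<p. y i a * y' j' a) = (\<Sum>a<p. y i a * (\<Sum>j'\<in>J. y' j' a))" for i
    by (subst sum.swap) (simp add: sum_distrib_left)
  have 2: "(\<Sum>i'\<in>I. \<Sum>a<p. y i' a * y' j a) = (\<Sum>a<p. (\<Sum>i'\<in>I. y i' a) * y' j a)"
    by (subst sum.swap) (simp add: sum_distrib_right)
  have 3: "(\<Sum>i'\<in>I. \<Sum>j'\<in>J. \<Sum>a<p. y i' a * y' j' a) = (\<Sum>a<p. (\<Sum>i'\<in>I. y i' a) * (\<Sum>j'\<in>J. y' j' a))"
    unfolding 1 by (subst sum.swap) (simp add: sum_distrib_right)
  have "(\<Sum>a<p. (y i a - (\<Sum>i'\<in>I. y i' a) / card I) * (y' j a - (\<Sum>j'\<in>J. y' j' a) / card J)) =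
    (\<Sum>a<p. y i a * y' j a - y i a * (\<Sum>j'\<in>J. y' j' a) / card J - (\<Sum>i'\<in>I. y i' a) * y' j a / card I
      + (\<Sum>i'\<in>I. y i' a) * (\<Sum>j'\<in>J. y' j' a) / (card I * card J))"
    by (intro sum.cong refl) (simp add: algebra_simps)
  then show ?thesis
    unfolding centred_def 3 unfolding 1 2 by (simp add: sum.distrib sum_subtractf sum_divide_distrib)
qed

text \<open>With centred data matrices D and E, the trace of D^T D E^T E is the squared Frobenius
  norm of D E^T: sums over coordinates are exchanged for sums over observations. The unknown means
  cancel in the centring.\<close>

lemma trace_sample_cov_mult:
  assumes "finite I" "I \<noteq> {}" "finite J" "J \<noteq> {}"
    and X: "\<And>i a. i \<in> I \<Longrightarrow> a < p \<Longrightarrow> X i $ a = y i a + m a"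
    and Y: "\<And>j a. j \<in> J \<Longrightarrow> a < p \<Longrightarrow> Y j $ a = y' j a + m' a"
  shows "mat_trace (sample_cov p I X * sample_cov p J Y) =
    (\<Sum>i\<in>I. \<Sum>j\<in>J. (centred I J (\<lambda>i j. \<Sum>a<p. y i a * y' j a) i j)\<^sup>2) / ((real (card I) - 1) * (real (card J) - 1))"
proof -
  define d where "d i a = y i a - (\<Sum>i'\<in>I. y i' a) / card I" for i a
  define e where "e j a = y' j a - (\<Sum>j'\<in>J. y' j' a) / card J" for j a
  define C where "C = (real (card I) - 1) * (real (card J) - 1)"
  have "mat_trace (sample_cov p I X * sample_cov p J Y) =
     (\<Sum>a<p. \<Sum>b<p. (\<Sum>i\<in>I. d i a * d i b) * (\<Sum>j\<in>J. e j b * e j a) / C)"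
    unfolding mat_trace_mult[OF sample_cov_carrier sample_cov_carrier] d_def e_def C_def
    by (intro sum.cong refl)
      (simp add: sample_cov_entry[OF assms(1,2) _ _ X] sample_cov_entry[OF assms(3,4) _ _ Y])
  also have "\<dots> = (\<Sum>a<p. \<Sum>b<p. \<Sum>i\<in>I. \<Sum>j\<in>J. (d i a * e j a) * (d i b * e j b)) / C"
    by (simp add: sum_product sum_divide_distrib mult_ac)
  also have "(\<Sum>a<p. \<Sum>b<p. \<Sum>i\<in>I. \<Sum>j\<in>J. (d i a * e j a) * (d i b * e j b)) =
    (\<Sum>a<p. \<Sum>i\<in>I. \<Sum>b<p. \<Sum>j\<in>J. (d i a * e j a) * (d i b * e j b))"
    by (intro sum.cong sum.swap refl)
  also have "\<dots> = (\<Sum>i\<in>I. \<Sum>a<p. \<Sum>b<p. \<Sum>j\<in>J. (d i a * e j a) * (d i b * e j b))"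
    by (rule sum.swap)
  also have "\<dots> = (\<Sum>i\<in>I. \<Sum>a<p. \<Sum>j\<in>J. \<Sum>b<p. (d i a * e j a) * (d i b * e j b))"
    by (intro sum.cong sum.swap refl)
  also have "\<dots> = (\<Sum>i\<in>I. \<Sum>j\<in>J. \<Sum>a<p. \<Sum>b<p. (d i a * e j a) * (d i b * e j b))"
    by (intro sum.cong sum.swap refl)
  also have "\<dots> = (\<Sum>i\<in>I. \<Sum>j\<in>J. (\<Sum>a<p. d i a * e j a)\<^sup>2)"
    by (simp add: power2_eq_square sum_product)
  finally show ?thesis
    unfolding d_def e_def centred_gram[OF assms(1-4)] C_def .
qed

lemma trace_sample_cov:
  assumes "finite I" "I \<noteq> {}"
    and X: "\<And>i a. i \<in> I \<Longrightarrow> a < p \<Longrightarrow> X i $ a = y i a + m a"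
  shows "mat_trace (sample_cov p I X) =
    (\<Sum>i\<in>I. centred I I (\<lambda>i j. \<Sum>a<p. y i a * y j a) i i) / (real (card I) - 1)"
proof -
  have "mat_trace (sample_cov p I X) = (\<Sum>a<p. sample_cov p I X $$ (a, a))"
    by (simp add: mat_trace_def sample_cov_def)
  also have "\<dots> = (\<Sum>a<p. \<Sum>i\<in>I. (y i a - (\<Sum>i'\<in>I. y i' a) / card I) * (y i a - (\<Sum>i'\<in>I. y i' a) / card I)) / (real (card I) - 1)"
    unfolding sum_divide_distrib[of _ "{..<p}"]
    by (intro sum.cong refl) (simp add: sample_cov_entry[OF assms(1,2) _ _ X])
  also have "\<dots> = (\<Sum>i\<in>I. centred I I (\<lambda>i j. \<Sum>a<p. y i a * y j a) i i) / (real (card I) - 1)"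
    by (subst sum.swap) (simp add: centred_gram[OF assms(1,2,1,2)])
  finally show ?thesis .
qed

lemma centred_image:
  assumes "inj_on f I" "inj_on g J"
  shows "centred (f ` I) (g ` J) H (f i) (g j) = centred I J (\<lambda>i j. H (f i) (g j)) i j"
  using assms by (simp add: centred_def sum.reindex card_image)

text \<open>Needed to regroup the triple index of the noise as an observation paired with a
  coordinate.\<close>

lemma (in prob_space) indep_vars_reindex:
  assumes ind: "indep_vars M' X (h ` J)" and inj: "inj_on h J"
  shows "indep_vars (\<lambda>j. M' (h j)) (\<lambda>j. X (h j)) J"
proof -
  define E where "E i = {X i -` A \<inter> space M |A. A \<in> sets (M' i)}" for i
  have E: "indep_sets E (h ` J)" and rv: "\<And>j. j \<in> J \<Longrightarrow> random_variable (M' (h j)) (X (h j))"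
    using ind unfolding indep_vars_def2 E_def by auto
  have "indep_sets (\<lambda>j. E (h j)) J"
  proof (rule indep_setsI)
    show "E (h j) \<subseteq> events" if "j \<in> J" for j
      using E that by (auto simp: indep_sets_def)
    fix A L assume L: "L \<noteq> {}" "L \<subseteq> J" "finite L" and A: "\<forall>j\<in>L. A j \<in> E (h j)"
    have injL: "inj_on h L" using inj L inj_on_subset by blast
    define B where "B i = A (inv_into L h i)" for i
    have B: "B (h j) = A j" if "j \<in> L" for j
      using that injL by (simp add: B_def)
    have "prob (\<Inter>i\<in>h ` L. B i) = (\<Prod>i\<in>h ` L. prob (B i))"
      using L A B by (intro indep_setsD[OF E]) auto
    then show "prob (\<Inter>j\<in>L. A j) = (\<Prod>j\<in>L. prob (A j))"
      using B injL by (simp add: prod.reindex)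
  qed
  then show ?thesis
    unfolding indep_vars_def2 E_def using rv by auto
qed

section \<open>All groups as one family of observations\<close>

definition obs_set :: "nat \<Rightarrow> (nat \<Rightarrow> nat) \<Rightarrow> (nat \<times> nat) set" where
  "obs_set k N = Sigma {1..k} (\<lambda>l. {1..N l})"

definition obs_noise :: "(nat \<Rightarrow> nat \<Rightarrow> nat \<Rightarrow> 'a \<Rightarrow> real) \<Rightarrow> (nat \<times> nat) \<times> nat \<Rightarrow> 'a \<Rightarrow> real" where
  "obs_noise z x = z (fst (fst x)) (snd (fst x)) (snd x)"

definition obs_load :: "(nat \<Rightarrow> real mat) \<Rightarrow> nat \<times> nat \<Rightarrow> nat \<Rightarrow> nat \<Rightarrow> real" where
  "obs_load \<Gamma> u a j = \<Gamma> (fst u) $$ (a, j)"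

text \<open>One bound for the fourth moments of all groups, the same along the whole sequence since
  the \<open>\<gamma> l\<close> are fixed.\<close>

definition moment_bound :: "nat \<Rightarrow> (nat \<Rightarrow> real) \<Rightarrow> real" where
  "moment_bound k \<gamma> = 3 + (\<Sum>l=1..k. \<bar>\<gamma> l\<bar>)"

lemma sum_obs_set: "(\<Sum>u\<in>obs_set k N. f u) = (\<Sum>l=1..k. \<Sum>i=1..N l. f (l, i))"
  by (simp add: obs_set_def sum.Sigma)

lemma obs_set_group: "l \<in> {1..k} \<Longrightarrow> I \<subseteq> {1..N l} \<Longrightarrow> Pair l ` I \<subseteq> obs_set k N"
  by (auto simp: obs_set_def)

sublocale factor_model \<subseteq> obs: obs_family M "obs_set k N" r "obs_noise z" "moment_bound k \<gamma>" p "obs_load \<Gamma>"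
proof
  show fO: "finite (obs_set k N)" by (simp add: obs_set_def)
  then show "finite (obs_set k N \<times> {..<r})" by simp
  define h :: "(nat \<times> nat) \<times> nat \<Rightarrow> nat \<times> nat \<times> nat" where "h x = (fst (fst x), snd (fst x), snd x)" for x
  have "h ` (obs_set k N \<times> {..<r}) = {(l, i, j). l \<in> {1..k} \<and> i \<in> {1..N l} \<and> j < r}"
    by (force simp: h_def obs_set_def image_iff)
  then have "indep_vars (\<lambda>_. borel) (\<lambda>(l, i, j). z l i j) (h ` (obs_set k N \<times> {..<r}))"
    using indep by simp
  moreover have "inj_on h (obs_set k N \<times> {..<r})"
    by (rule inj_onI) (auto simp: h_def prod_eq_iff)
  ultimately have "indep_vars (\<lambda>_. borel) (\<lambda>x. (\<lambda>(l, i, j). z l i j) (h x)) (obs_set k N \<times> {..<r})"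
    by (rule indep_vars_reindex)
  then show iv: "indep_vars (\<lambda>_. borel) (obs_noise z) (obs_set k N \<times> {..<r})"
    by (simp add: h_def obs_noise_def[abs_def])
  fix x assume x: "x \<in> obs_set k N \<times> {..<r}"
  then have m: "fst (fst x) \<in> {1..k}" "snd (fst x) \<in> {1..N (fst (fst x))}" "snd x < r"
    by (auto simp: obs_set_def)
  have "obs_noise z x \<in> borel_measurable M"
    using iv x unfolding indep_vars_def2 by auto
  then show "fourth_int (obs_noise z x)"
    using fourth_moment[OF m] by (simp add: fourth_int_def obs_noise_def)
  show "expectation (obs_noise z x) = 0"
    using mean_zero[OF m] by (simp add: obs_noise_def[abs_def])
  show "expectation (\<lambda>\<omega>. (obs_noise z x \<omega>)\<^sup>2) = 1"
    using cov_identity[OF m m(3)] by (simp add: obs_noise_def power2_eq_square)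
  have "\<gamma> (fst (fst x)) \<le> (\<Sum>l=1..k. \<bar>\<gamma> l\<bar>)"
    using member_le_sum[of "fst (fst x)" "{1..k}" "\<lambda>l. \<bar>\<gamma> l\<bar>"] m(1) by auto
  then show "expectation (\<lambda>\<omega>. obs_noise z x \<omega> ^ 4) \<le> moment_bound k \<gamma>"
    using fourth_moment[OF m] by (simp add: obs_noise_def moment_bound_def)
next
  show "3 \<le> moment_bound k \<gamma>" by (simp add: moment_bound_def sum_nonneg)
qed

context factor_model
begin

lemma Sigma_carrier: "l \<in> {1..k} \<Longrightarrow> \<Sigma> l \<in> carrier_mat p p"
  using Gamma_Sigma[of l] Gamma_carrier[of l] by (metis mult_carrier_mat transpose_carrier_mat)

lemma Sigma_entry:
  assumes "l \<in> {1..k}" "a < p" "b < p"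
  shows "\<Sigma> l $$ (a, b) = obs.Sg (l, i) a b"
proof -
  have "\<Sigma> l $$ (a, b) = (\<Gamma> l * transpose_mat (\<Gamma> l)) $$ (a, b)"
    using Gamma_Sigma assms by simp
  also have "\<dots> = obs.Sg (l, i) a b"
    using Gamma_carrier[OF assms(1)] assms
    by (simp add: obs.Sg_def obs_load_def scalar_prod_def atLeast0LessThan)
  finally show ?thesis .
qed

lemma Sigma_entry_swap:
  assumes "l \<in> {1..k}" "a < p" "b < p"
  shows "\<Sigma> l $$ (a, b) = obs.Sg (l, i) b a"
  using Sigma_entry[OF assms] obs.Sg_sym by metis

lemma tau_trace:
  assumes "l \<in> {1..k}" "s \<in> {1..k}"
  shows "obs.tau (l, i) (s, j) = mat_trace (\<Sigma> l * \<Sigma> s)"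
  unfolding mat_trace_mult[OF Sigma_carrier[OF assms(1)] Sigma_carrier[OF assms(2)]] obs.tau_def
  using assms by (intro sum.cong refl) (simp add: Sigma_entry[of l _ _ i] Sigma_entry_swap[of s _ _ j])

lemma observation_component:
  assumes "l \<in> {1..k}" "a < p"
  shows "observation r \<mu> \<Gamma> z \<omega> l i $ a = obs.y (l, i) a \<omega> + \<mu> l $ a"
  using Gamma_carrier[OF assms(1)] mu_carrier[OF assms(1)] assms
  by (simp add: observation_def obs.y_def obs_load_def obs_noise_def scalar_prod_def atLeast0LessThan)

lemma observation_dim: "l \<in> {1..k} \<Longrightarrow> dim_vec (observation r \<mu> \<Gamma> z \<omega> l i) = p"
  using mu_carrier by (auto simp: observation_def)

lemma trace4_trace:
  assumes "l \<in> {1..k}" "s \<in> {1..k}" "i \<in> {1..k}" "j \<in> {1..k}"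
  shows "obs.trace4 (l, l') (s, s') (i, i') (j, j') = mat_trace (\<Sigma> l * \<Sigma> s * \<Sigma> i * \<Sigma> j)"
proof -
  note C = Sigma_carrier[OF assms(1)] Sigma_carrier[OF assms(2)] Sigma_carrier[OF assms(3)] Sigma_carrier[OF assms(4)]
  have LS: "(\<Sigma> l * \<Sigma> s) $$ (a', b) = (\<Sum>a<p. \<Sigma> l $$ (a', a) * \<Sigma> s $$ (a, b))" if "a' < p" "b < p" for a' b
    using that C by (simp add: scalar_prod_def atLeast0LessThan)
  have IJ: "(\<Sigma> i * \<Sigma> j) $$ (b, a') = (\<Sum>b'<p. \<Sigma> i $$ (b, b') * \<Sigma> j $$ (b', a'))" if "a' < p" "b < p" for a' b
    using that C by (simp add: scalar_prod_def atLeast0LessThan)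
  have "\<Sigma> l * \<Sigma> s * \<Sigma> i * \<Sigma> j = (\<Sigma> l * \<Sigma> s) * (\<Sigma> i * \<Sigma> j)"
    using C by (intro assoc_mult_mat[of _ p p _ p _ p]) auto
  then have "mat_trace (\<Sigma> l * \<Sigma> s * \<Sigma> i * \<Sigma> j) =
    (\<Sum>a'<p. \<Sum>b<p. (\<Sum>a<p. \<Sigma> l $$ (a', a) * \<Sigma> s $$ (a, b)) * (\<Sum>b'<p. \<Sigma> i $$ (b, b') * \<Sigma> j $$ (b', a')))"
  proof -
    have "mat_trace ((\<Sigma> l * \<Sigma> s) * (\<Sigma> i * \<Sigma> j)) =
      (\<Sum>a'<p. \<Sum>b<p. (\<Sigma> l * \<Sigma> s) $$ (a', b) * (\<Sigma> i * \<Sigma> j) $$ (b, a'))"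
      by (rule mat_trace_mult) (use C in auto)
    then show ?thesis
      using \<open>\<Sigma> l * \<Sigma> s * \<Sigma> i * \<Sigma> j = _\<close> by (simp only:) (intro sum.cong refl, simp only: LS IJ lessThan_iff)
  qed
  also have "\<dots> = (\<Sum>a'<p. \<Sum>b<p. \<Sum>a<p. \<Sum>b'<p. \<Sigma> l $$ (a', a) * (\<Sigma> i $$ (b, b') * (\<Sigma> s $$ (a, b) * \<Sigma> j $$ (b', a'))))"
    by (simp only: sum_product) (simp only: mult_ac)
  also have "\<dots> = (\<Sum>a'<p. \<Sum>a<p. \<Sum>b<p. \<Sum>b'<p. \<Sigma> l $$ (a', a) * (\<Sigma> i $$ (b, b') * (\<Sigma> s $$ (a, b) * \<Sigma> j $$ (b', a'))))"
    by (intro sum.cong sum.swap refl)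
  also have "\<dots> = (\<Sum>a<p. \<Sum>a'<p. \<Sum>b<p. \<Sum>b'<p. \<Sigma> l $$ (a', a) * (\<Sigma> i $$ (b, b') * (\<Sigma> s $$ (a, b) * \<Sigma> j $$ (b', a'))))"
    by (rule sum.swap)
  also have "\<dots> = obs.trace4 (l, l') (s, s') (i, i') (j, j')"
    unfolding obs.trace4_def sum_distrib_left
    using assms
    by (intro sum.cong refl) (simp add: Sigma_entry_swap[of l _ _ l'] Sigma_entry[of s _ _ s']
        Sigma_entry[of i _ _ i'] Sigma_entry_swap[of j _ _ j'])
  finally show ?thesis by simp
qed

end

section \<open>Relative errors of the trace estimators\<close>

lemma centred_cong:
  assumes "\<And>i j. i \<in> I \<Longrightarrow> j \<in> J \<Longrightarrow> H i j = H' i j" "i \<in> I" "j \<in> J"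
  shows "centred I J H i j = centred I J H' i j"
  using assms by (simp add: centred_def cong: sum.cong)

text \<open>The first term is the random fluctuation divided by the degrees of freedom; the second
  is the bias from dividing by \<open>a - 1\<close> and \<open>b - 1\<close> a sum of squares that
  concentrates at \<open>a * b\<close> times the trace.\<close>

definition rel_error :: "real \<Rightarrow> nat \<Rightarrow> nat \<Rightarrow> nat \<Rightarrow> real" where
  "rel_error c n a b = c * (real n * sqrt (real n)) / ((real a - 1) * (real b - 1))
     + \<bar>real a * real b / ((real a - 1) * (real b - 1)) - 1\<bar>"

text \<open>The factor \<open>(n - 1)\<^sup>2\<close> of the estimator cancels against the divisors
  of the two sample covariance matrices, which leaves \<open>(n + 1) * (n - 2)\<close> as the
  divisor.\<close>

definition rel_error_tilde :: "real \<Rightarrow> nat \<Rightarrow> real" where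
  "rel_error_tilde c n = c * (real n * sqrt (real n)) / ((real n + 1) * (real n - 2))
     + \<bar>real n * real n / ((real n + 1) * (real n - 2)) - 1\<bar>"

lemma (in prob_space) expectation_scaled_error:
  fixes A B C D t :: real
  assumes i: "integrable M X" and e: "expectation (\<lambda>\<omega>. \<bar>X \<omega> - A * t\<bar>) \<le> B * t" and "D > 0" "0 \<le> t"
  shows "expectation (\<lambda>\<omega>. \<bar>X \<omega> / D - t\<bar>) \<le> (B / D + \<bar>A / D - 1\<bar>) * t"
proof -
  have "expectation (\<lambda>\<omega>. \<bar>X \<omega> / D - t\<bar>) \<le> expectation (\<lambda>\<omega>. \<bar>X \<omega> - A * t\<bar> / D + \<bar>A / D - 1\<bar> * t)"
  proof (rule integral_mono)
    fix \<omega>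
    have "X \<omega> / D - t = (X \<omega> - A * t) / D + (A / D - 1) * t"
      using assms by (simp add: field_simps)
    then have "\<bar>X \<omega> / D - t\<bar> \<le> \<bar>(X \<omega> - A * t) / D\<bar> + \<bar>(A / D - 1) * t\<bar>"
      by (simp only: abs_triangle_ineq)
    also have "\<dots> = \<bar>X \<omega> - A * t\<bar> / D + \<bar>A / D - 1\<bar> * t"
      using assms by (simp add: abs_mult)
    finally show "\<bar>X \<omega> / D - t\<bar> \<le> \<bar>X \<omega> - A * t\<bar> / D + \<bar>A / D - 1\<bar> * t" .
  qed (use i in auto)
  also have "\<dots> = expectation (\<lambda>\<omega>. \<bar>X \<omega> - A * t\<bar>) / D + \<bar>A / D - 1\<bar> * t"
    using i by (simp add: prob_space)
  also have "\<dots> \<le> B * t / D + \<bar>A / D - 1\<bar> * t"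
    using e assms(3) by (simp add: divide_right_mono)
  finally show ?thesis
    by (simp add: algebra_simps)
qed

context factor_model
begin

abbreviation obsv :: "'a \<Rightarrow> nat \<Rightarrow> nat \<Rightarrow> real vec" where
  "obsv \<equiv> observation r \<mu> \<Gamma> z"

abbreviation trp :: "nat \<Rightarrow> nat \<Rightarrow> real" where
  "trp l s \<equiv> mat_trace (\<Sigma> l * \<Sigma> s)"

lemma trp_nonneg: "l \<in> {1..k} \<Longrightarrow> s \<in> {1..k} \<Longrightarrow> 0 \<le> trp l s"
  using obs.tau_nonneg[of "(l, 0)" "(s, 0)"] by (simp add: tau_trace)

text \<open>Different groups, or disjoint halves of one group: in both cases no observation is
  paired with itself, so \<open>G\<close> and \<open>H\<close> coincide on the block and the
  concentration of \<open>H\<close> applies directly.\<close>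

lemma trace_product_estimator:
  assumes ls: "l \<in> {1..k}" "s \<in> {1..k}" and I: "I \<subseteq> {1..N l}" "card I \<ge> 2" "card I \<le> n"
    and J: "J \<subseteq> {1..N s}" "card J \<ge> 2" "card J \<le> n" and disj: "l \<noteq> s \<or> I \<inter> J = {}"
  defines "X \<equiv> \<lambda>\<omega>. mat_trace (sample_cov p I (obsv \<omega> l) * sample_cov p J (obsv \<omega> s))"
  shows "integrable M X"
    and "expectation (\<lambda>\<omega>. \<bar>X \<omega> - trp l s\<bar>) \<le> rel_error (6 * moment_bound k \<gamma> + 1) n (card I) (card J) * trp l s"
proof -
  have fin: "finite I" "finite J" "I \<noteq> {}" "J \<noteq> {}"
    using I J finite_subset by (auto intro: finite_subset)
  define D where "D = (real (card I) - 1) * (real (card J) - 1)"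
  have D: "D > 0" using I J by (simp add: D_def)
  define U V where "U = Pair l ` I" and "V = Pair s ` J"
  have UV: "U \<subseteq> obs_set k N" "V \<subseteq> obs_set k N" "U \<noteq> {}" "V \<noteq> {}" "card U = card I" "card V = card J"
    using obs_set_group ls I J fin by (auto simp: U_def V_def card_image inj_on_def)
  define C where "C \<omega> = (\<Sum>u\<in>U. \<Sum>v\<in>V. (centred U V (\<lambda>u v. obs.H u v \<omega>) u v)\<^sup>2)" for \<omega>
  have X: "X \<omega> = C \<omega> / D" for \<omega>
  proof -
    have "X \<omega> = (\<Sum>i\<in>I. \<Sum>j\<in>J. (centred I J (\<lambda>i j. obs.G (l, i) (s, j) \<omega>) i j)\<^sup>2) / D"
      unfolding X_def D_def obs.G_def
      by (rule trace_sample_cov_mult[OF fin(1,3,2,4)]) (use ls in \<open>auto simp: observation_component\<close>)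
    also have "(\<Sum>i\<in>I. \<Sum>j\<in>J. (centred I J (\<lambda>i j. obs.G (l, i) (s, j) \<omega>) i j)\<^sup>2) =
       (\<Sum>i\<in>I. \<Sum>j\<in>J. (centred U V (\<lambda>u v. obs.H u v \<omega>) (l, i) (s, j))\<^sup>2)"
    proof (intro sum.cong refl arg_cong[where f="\<lambda>x. x\<^sup>2"])
      fix i j assume ij: "i \<in> I" "j \<in> J"
      have "centred U V (\<lambda>u v. obs.H u v \<omega>) (l, i) (s, j) = centred I J (\<lambda>i j. obs.H (l, i) (s, j) \<omega>) i j"
        unfolding U_def V_def by (rule centred_image) (auto simp: inj_on_def)
      also have "\<dots> = centred I J (\<lambda>i j. obs.G (l, i) (s, j) \<omega>) i j"
        using disj by (intro centred_cong ij) (auto simp: obs.H_def)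
      finally show "centred I J (\<lambda>i j. obs.G (l, i) (s, j) \<omega>) i j = centred U V (\<lambda>u v. obs.H u v \<omega>) (l, i) (s, j)" ..
    qed
    also have "\<dots> = C \<omega>"
      by (simp add: C_def U_def V_def sum.reindex inj_on_def)
    finally show ?thesis .
  qed
  have t: "obs.tau u v = trp l s" if "u \<in> U" "v \<in> V" for u v
    using that ls by (auto simp: U_def V_def tau_trace)
  note cg = obs.centred_gram_concentration[OF UV(1-4), of n "trp l s", unfolded UV(5,6), OF I(3) J(3) t, folded C_def]
  show "integrable M X"
    unfolding X using cg(1) by simp
  show "expectation (\<lambda>\<omega>. \<bar>X \<omega> - trp l s\<bar>) \<le> rel_error (6 * moment_bound k \<gamma> + 1) n (card I) (card J) * trp l s"
    unfolding X using expectation_scaled_error[OF cg(1) cg(2) D trp_nonneg[OF ls]]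
    by (simp add: rel_error_def D_def)
qed

lemma tr_prod_hat_error:
  assumes "l \<in> {1..k}" "s \<in> {1..k}" "l \<noteq> s" "N l \<ge> 2" "N s \<ge> 2" "N l \<le> n" "N s \<le> n"
  shows "integrable M (\<lambda>\<omega>. tr_prod_hat p N (obsv \<omega>) l s)"
    and "expectation (\<lambda>\<omega>. \<bar>tr_prod_hat p N (obsv \<omega>) l s - trp l s\<bar>) \<le>
      rel_error (6 * moment_bound k \<gamma> + 1) n (N l) (N s) * trp l s"
  using trace_product_estimator[of l s "{1..N l}" n "{1..N s}"] assms by (auto simp: tr_prod_hat_def)

text \<open>A group of at least 6 observations splits into parts of at least 4 and 2, so both sample
  covariances have a positive divisor.\<close>

lemma tr_sq_hat_error:
  assumes "l \<in> {1..k}" "N l \<ge> 6" "N l \<le> n"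
  shows "integrable M (\<lambda>\<omega>. tr_sq_hat p N (obsv \<omega>) l)"
    and "expectation (\<lambda>\<omega>. \<bar>tr_sq_hat p N (obsv \<omega>) l - trp l l\<bar>) \<le>
      rel_error (6 * moment_bound k \<gamma> + 1) n (N l div 2 + 1) (N l - (N l div 2 + 1)) * trp l l"
  using trace_product_estimator[of l l "{1..N l div 2 + 1}" n "{N l div 2 + 1 + 1..N l}"] assms
  by (auto simp: tr_sq_hat_def Let_def)

text \<open>Here observations are paired with themselves. By \<open>centred_trace_identity\<close>
  the correction by the squared trace permits replacing \<open>G\<close> by \<open>H\<close>, which
  removes the large deterministic diagonal. From \<open>N l = 3\<close> on, the divisor is
  positive.\<close>

lemma tr_sq_tilde_error:
  assumes l: "l \<in> {1..k}" "N l \<ge> 3"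
  shows "integrable M (\<lambda>\<omega>. tr_sq_tilde p N (obsv \<omega>) l)"
    and "expectation (\<lambda>\<omega>. \<bar>tr_sq_tilde p N (obsv \<omega>) l - trp l l\<bar>) \<le>
      rel_error_tilde (14 * moment_bound k \<gamma> + 1) (N l) * trp l l"
proof -
  define n where "n = N l"
  define I where "I = {1..n}"
  have fin: "finite I" "I \<noteq> {}" "card I = n" using l by (auto simp: I_def n_def)
  define D where "D = (real n + 1) * (real n - 2)"
  have D: "D > 0" using l by (simp add: D_def n_def)
  define U where "U = Pair l ` I"
  have U: "U \<subseteq> obs_set k N" "U \<noteq> {}" "card U = n" "finite U"
    using obs_set_group l fin by (auto simp: U_def card_image inj_on_def I_def n_def)
  have t: "obs.tau u v = trp l l" if "u \<in> U" "v \<in> U" for u v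
    using that l by (auto simp: U_def tau_trace)
  define X where "X \<omega> = (\<Sum>u\<in>U. \<Sum>v\<in>U. (centred U U (\<lambda>u v. obs.H u v \<omega>) u v)\<^sup>2)
      - (\<Sum>u\<in>U. centred U U (\<lambda>u v. obs.H u v \<omega>) u u)\<^sup>2 / (real n - 1)" for \<omega>
  have n2: "2 \<le> n" using l by (simp add: n_def)
  note cg = obs.centred_gram_tilde_concentration[OF U(1,3) n2 t, folded X_def]
  have eq: "tr_sq_tilde p N (obsv \<omega>) l = X \<omega> / D" for \<omega>
  proof -
    define g where "g = centred U U (\<lambda>u v. obs.G u v \<omega>)"
    have gI: "g (l, i) (l, j) = centred I I (\<lambda>i j. \<Sum>a<p. obs.y (l, i) a \<omega> * obs.y (l, j) a \<omega>) i j" for i j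
      unfolding g_def U_def obs.G_def by (rule centred_image) (auto simp: inj_on_def)
    define S where "S = sample_cov p I (obsv \<omega> l)"
    have "mat_trace (S * S) = (\<Sum>i\<in>I. \<Sum>j\<in>I. (centred I I (\<lambda>i j. \<Sum>a<p. obs.y (l, i) a \<omega> * obs.y (l, j) a \<omega>) i j)\<^sup>2) / ((real n - 1) * (real n - 1))"
      unfolding S_def fin(3)[symmetric]
      by (rule trace_sample_cov_mult[OF fin(1,2,1,2)]) (use l in \<open>auto simp: observation_component\<close>)
    then have SS: "mat_trace (S * S) = (\<Sum>u\<in>U. \<Sum>v\<in>U. (g u v)\<^sup>2) / ((real n - 1) * (real n - 1))"
      by (simp add: U_def sum.reindex inj_on_def gI)
    have "mat_trace S = (\<Sum>i\<in>I. centred I I (\<lambda>i j. \<Sum>a<p. obs.y (l, i) a \<omega> * obs.y (l, j) a \<omega>) i i) / (real n - 1)"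
      unfolding S_def fin(3)[symmetric]
      by (rule trace_sample_cov[OF fin(1,2)]) (use l in \<open>auto simp: observation_component\<close>)
    then have Str: "mat_trace S = (\<Sum>u\<in>U. g u u) / (real n - 1)"
      by (simp add: U_def sum.reindex inj_on_def gI)
    \<comment> \<open>All observations of a group share one covariance matrix, so the deterministic
      diagonal is constant, as \<open>centred_trace_identity\<close> requires.\<close>
    have H: "obs.G u v \<omega> = obs.H u v \<omega> + (if u = v then \<Sum>a<p. obs.Sg (l, 0) a a else 0)" if "u \<in> U" "v \<in> U" for u v
      using that by (auto simp: obs.H_def U_def obs.Sg_def obs_load_def)
    have "(\<Sum>u\<in>U. \<Sum>v\<in>U. (g u v)\<^sup>2) - (\<Sum>u\<in>U. g u u)\<^sup>2 / (real n - 1) = X \<omega>"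
      using centred_trace_identity[OF U(4), of "\<lambda>u v. obs.G u v \<omega>" "\<lambda>u v. obs.H u v \<omega>", OF _ H] n2 U(3)
      by (simp add: g_def X_def of_nat_diff)
    moreover have "tr_sq_tilde p N (obsv \<omega>) l = (real n - 1)\<^sup>2 / D * (mat_trace (S * S) - 1 / (real n - 1) * (mat_trace S)\<^sup>2)"
      by (simp add: tr_sq_tilde_def Let_def S_def I_def n_def D_def)
    moreover have arith: "m\<^sup>2 / D * (P / (m * m) - 1 / m * (Q / m)\<^sup>2) = (P - Q\<^sup>2 / m) / D" if "m > 0" for m P Q :: real
      using that D by (simp add: field_simps power2_eq_square)
    moreover have "real n - 1 > 0" using n2 by simp
    ultimately show ?thesis
      unfolding SS Str by (simp only: arith)
  qed
  show "integrable M (\<lambda>\<omega>. tr_sq_tilde p N (obsv \<omega>) l)"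
    unfolding eq using cg(1) unfolding X_def by simp
  show "expectation (\<lambda>\<omega>. \<bar>tr_sq_tilde p N (obsv \<omega>) l - trp l l\<bar>) \<le>
      rel_error_tilde (14 * moment_bound k \<gamma> + 1) (N l) * trp l l"
  proof -
    have "integrable M X" using cg(1) unfolding X_def .
    from expectation_scaled_error[OF this cg(2) D trp_nonneg[OF l(1) l(1)]] show ?thesis
      unfolding eq by (simp add: rel_error_tilde_def D_def n_def)
  qed
qed

end

section \<open>Decomposition of the statistic into a quadratic form, a linear part and a
  mean\<close>

definition pair_weight :: "nat \<Rightarrow> (nat \<Rightarrow> nat) \<Rightarrow> nat \<times> nat \<Rightarrow> nat \<times> nat \<Rightarrow> real" where
  "pair_weight k N u v = (let n = real (total_size k N) in
     if fst u = fst v then (n - real (N (fst u))) / (n * (real (N (fst u)) - 1)) else - 1 / n)"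

lemma pair_weight_sym: "pair_weight k N u v = pair_weight k N v u"
  by (simp add: pair_weight_def Let_def)

lemma finite_obs_set: "finite (obs_set k N)"
  by (simp add: obs_set_def)

lemma sum_obs_set_Diff:
  fixes f :: "nat \<times> nat \<Rightarrow> real"
  assumes "l \<in> {1..k}" "i \<in> {1..N l}"
  shows "(\<Sum>v\<in>obs_set k N - {(l, i)}. f v) =
    (\<Sum>j\<in>{1..N l} - {i}. f (l, j)) + (\<Sum>s\<in>{1..k} - {l}. \<Sum>j=1..N s. f (s, j))"
proof -
  have "(\<Sum>v\<in>obs_set k N. f v) = f (l, i) + (\<Sum>v\<in>obs_set k N - {(l, i)}. f v)"
    using assms by (intro sum.remove finite_obs_set) (auto simp: obs_set_def)
  moreover have "(\<Sum>v\<in>obs_set k N. f v) = (\<Sum>j=1..N l. f (l, j)) + (\<Sum>s\<in>{1..k} - {l}. \<Sum>j=1..N s. f (s, j))"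
    unfolding sum_obs_set using assms by (intro sum.remove) auto
  moreover have "(\<Sum>j=1..N l. f (l, j)) = f (l, i) + (\<Sum>j\<in>{1..N l} - {i}. f (l, j))"
    using assms by (intro sum.remove) auto
  ultimately show ?thesis by simp
qed

lemma sum_pairs_swap:
  fixes g :: "'u \<Rightarrow> 'u \<Rightarrow> real"
  assumes "finite U"
  shows "(\<Sum>u\<in>U. \<Sum>v\<in>U - {u}. g u v) = (\<Sum>u\<in>U. \<Sum>v\<in>U - {u}. g v u)"
proof -
  have *: "(\<Sum>v\<in>U - {u}. f v) = (\<Sum>v\<in>U. if v = u then 0 else f v)" if "u \<in> U" for u and f :: "'u \<Rightarrow> real"
    using that assms by (simp add: sum.remove[of U u])
  have "(\<Sum>u\<in>U. \<Sum>v\<in>U - {u}. g u v) = (\<Sum>u\<in>U. \<Sum>v\<in>U. if v = u then 0 else g u v)"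
    by (intro sum.cong refl *)
  also have "\<dots> = (\<Sum>v\<in>U. \<Sum>u\<in>U. if u = v then 0 else g u v)"
    by (subst sum.swap) (simp add: eq_commute)
  also have "\<dots> = (\<Sum>v\<in>U. \<Sum>u\<in>U - {v}. g u v)"
    by (intro sum.cong refl *[symmetric])
  finally show ?thesis .
qed

text \<open>The products of sample means are expanded into single observations; the divisors
  \<open>N l * N s\<close> cancel and every pair from different groups gets the weight
  \<open>- 1 / n\<close>.\<close>

lemma T_stat_pair_sum:
  assumes N: "\<And>l. l \<in> {1..k} \<Longrightarrow> N l \<ge> 1"
    and dim: "\<And>l i. l \<in> {1..k} \<Longrightarrow> dim_vec (x l i) = p"
  shows "T_stat k p N x = (\<Sum>u\<in>obs_set k N. \<Sum>v\<in>obs_set k N - {u}.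
    pair_weight k N u v * (\<Sum>a<p. x (fst u) (snd u) $ a * x (fst v) (snd v) $ a))"
proof -
  define n where "n = real (total_size k N)"
  define d where "d u v = (\<Sum>a<p. x (fst u) (snd u) $ a * x (fst v) (snd v) $ a)" for u v :: "nat \<times> nat"
  have dot: "x l i \<bullet> x s j = d (l, i) (s, j)" if "s \<in> {1..k}" for l i s j
    using dim[OF that] by (simp add: d_def scalar_prod_def atLeast0LessThan)
  have mean: "real (N l) * real (N s) / n * (sample_mean p {1..N l} (x l) \<bullet> sample_mean p {1..N s} (x s)) =
    (\<Sum>i=1..N l. \<Sum>j=1..N s. 1 / n * d (l, i) (s, j))" if "l \<in> {1..k}" "s \<in> {1..k}" for l s
  proof -
    have c: "real (N l) > 0" "real (N s) > 0" using N[OF that(1)] N[OF that(2)] by auto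
    have "sample_mean p {1..N l} (x l) \<bullet> sample_mean p {1..N s} (x s) =
      (\<Sum>a<p. (\<Sum>i=1..N l. x l i $ a) / N l * ((\<Sum>j=1..N s. x s j $ a) / N s))"
      by (simp add: sample_mean_def scalar_prod_def atLeast0LessThan)
    also have "\<dots> = (\<Sum>a<p. (\<Sum>i=1..N l. x l i $ a) * (\<Sum>j=1..N s. x s j $ a)) / (N l * N s)"
      by (simp only: sum_divide_distrib[of _ "{..<p}"] times_divide_times_eq of_nat_mult)
    also have "(\<Sum>a<p. (\<Sum>i=1..N l. x l i $ a) * (\<Sum>j=1..N s. x s j $ a)) =
      (\<Sum>a<p. \<Sum>i=1..N l. \<Sum>j=1..N s. x l i $ a * x s j $ a)"
      by (simp only: sum_product)
    also have "\<dots> = (\<Sum>i=1..N l. \<Sum>a<p. \<Sum>j=1..N s. x l i $ a * x s j $ a)"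
      by (rule sum.swap)
    also have "\<dots> = (\<Sum>i=1..N l. \<Sum>j=1..N s. d (l, i) (s, j))"
      unfolding d_def fst_conv snd_conv by (intro sum.cong sum.swap refl)
    finally show ?thesis
      using c by (simp add: sum_distrib_left[symmetric] sum_divide_distrib[symmetric] field_simps)
  qed
  have "(\<Sum>u\<in>obs_set k N. \<Sum>v\<in>obs_set k N - {u}. pair_weight k N u v * d u v) =
    (\<Sum>l=1..k. \<Sum>i=1..N l. (\<Sum>j\<in>{1..N l} - {i}. (n - N l) / (n * (real (N l) - 1)) * d (l, i) (l, j))
      + (\<Sum>s\<in>{1..k} - {l}. \<Sum>j=1..N s. - 1 / n * d (l, i) (s, j)))"
    unfolding sum_obs_set
    by (intro sum.cong refl) (simp add: sum_obs_set_Diff pair_weight_def Let_def n_def)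
  also have "\<dots> = (\<Sum>l=1..k. (n - N l) / (n * (real (N l) - 1)) * (\<Sum>i=1..N l. \<Sum>j\<in>{1..N l} - {i}. d (l, i) (l, j)))
      - (\<Sum>l=1..k. \<Sum>i=1..N l. \<Sum>s\<in>{1..k} - {l}. \<Sum>j=1..N s. 1 / n * d (l, i) (s, j))"
    by (simp add: sum.distrib sum_distrib_left sum_negf sum_subtractf)
  also have "(\<Sum>l=1..k. \<Sum>i=1..N l. \<Sum>s\<in>{1..k} - {l}. \<Sum>j=1..N s. 1 / n * d (l, i) (s, j)) =
    (\<Sum>l=1..k. \<Sum>s\<in>{1..k} - {l}. \<Sum>i=1..N l. \<Sum>j=1..N s. 1 / n * d (l, i) (s, j))"
    by (intro sum.cong sum.swap refl)
  also have "\<dots> = (\<Sum>l=1..k. \<Sum>s\<in>{1..k} - {l}. real (N l) * real (N s) / n *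
      (sample_mean p {1..N l} (x l) \<bullet> sample_mean p {1..N s} (x s)))"
    by (intro sum.cong refl mean[symmetric]) auto
  finally show ?thesis
    unfolding T_stat_def Let_def n_def[symmetric] d_def[symmetric] using dot by simp
qed

definition weighted_mean :: "nat \<Rightarrow> (nat \<Rightarrow> nat) \<Rightarrow> (nat \<Rightarrow> real vec) \<Rightarrow> nat \<Rightarrow> real" where
  "weighted_mean k N \<mu> a = (\<Sum>s=1..k. real (N s) / real (total_size k N) * \<mu> s $ a)"

text \<open>Inside the group of \<open>u\<close> the weights add up to \<open>1 - N l / n\<close>,
  and each other group \<open>s\<close> receives \<open>- N s / n\<close>. A row of weights
  therefore acts on the means as centring at their weighted average.\<close>

lemma sum_pair_weight:
  assumes N: "\<And>l. l \<in> {1..k} \<Longrightarrow> N l \<ge> 2" and u: "u \<in> obs_set k N"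
  shows "(\<Sum>v\<in>obs_set k N - {u}. pair_weight k N u v * \<mu> (fst v) $ a) = \<mu> (fst u) $ a - weighted_mean k N \<mu> a"
proof -
  obtain l i where li: "u = (l, i)" "l \<in> {1..k}" "i \<in> {1..N l}" using u by (auto simp: obs_set_def)
  define n where "n = real (total_size k N)"
  have "N l \<le> total_size k N"
    unfolding total_size_def using li by (intro member_le_sum) auto
  then have n: "n > 0" "real (N l) - 1 > 0" using N[OF li(2)] by (auto simp: n_def)
  have "(\<Sum>v\<in>obs_set k N - {u}. pair_weight k N u v * \<mu> (fst v) $ a) =
    (real (N l) - 1) * ((n - N l) / (n * (real (N l) - 1)) * \<mu> l $ a) - (\<Sum>s\<in>{1..k} - {l}. N s / n * \<mu> s $ a)"
    using li n by (simp add: sum_obs_set_Diff pair_weight_def Let_def n_def[symmetric] sum_negf of_nat_diff)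
  also have "(real (N l) - 1) * ((n - N l) / (n * (real (N l) - 1)) * \<mu> l $ a) = \<mu> l $ a - N l / n * \<mu> l $ a"
    using n by (simp add: field_simps)
  also have "\<mu> l $ a - N l / n * \<mu> l $ a - (\<Sum>s\<in>{1..k} - {l}. N s / n * \<mu> s $ a) = \<mu> l $ a - weighted_mean k N \<mu> a"
    using li sum.remove[of "{1..k}" l "\<lambda>s. N s / n * \<mu> s $ a"] by (simp add: weighted_mean_def n_def)
  finally show ?thesis by (simp add: li)
qed

text \<open>For weights with sum 1 this is the weighted variance of the group means. The pairwise
  form is chosen because, for nonnegative weights, its terms are nonnegative and depend on the
  weights through \<open>w l * w s\<close> alone, so a relative error of the weights becomes a
  relative error of the gap.\<close>

definition mean_gap :: "nat \<Rightarrow> nat \<Rightarrow> (nat \<Rightarrow> real) \<Rightarrow> (nat \<Rightarrow> real vec) \<Rightarrow> real" where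
  "mean_gap k p w \<mu> = (\<Sum>l=1..k. \<Sum>s=1..k. w l * w s * (\<Sum>a<p. (\<mu> l $ a - \<mu> s $ a)\<^sup>2)) / 2"

text \<open>The first expression arises in the mean of the statistic, the second in the asymptotic
  shift. In each coordinate all three equal the weighted second moment minus the squared weighted
  mean.\<close>

lemma mean_gap_eq:
  assumes "(\<Sum>l=1..k. w l) = 1"
  shows "(\<Sum>l=1..k. w l * (\<Sum>a<p. \<mu> l $ a * (\<mu> l $ a - (\<Sum>s=1..k. w s * \<mu> s $ a)))) = mean_gap k p w \<mu>"
    and "(\<Sum>l=1..k. w l * (\<Sum>a<p. (\<mu> l $ a - (\<Sum>s=1..k. w s * \<mu> s $ a))\<^sup>2)) = mean_gap k p w \<mu>"
proof -
  define q where "q a = (\<Sum>l=1..k. w l * (\<mu> l $ a)\<^sup>2)" for a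
  define b where "b a = (\<Sum>s=1..k. w s * \<mu> s $ a)" for a
  have "(\<Sum>l=1..k. \<Sum>s=1..k. w l * w s * (\<Sum>a<p. (\<mu> l $ a - \<mu> s $ a)\<^sup>2)) =
    (\<Sum>l=1..k. \<Sum>a<p. \<Sum>s=1..k. w l * w s * (\<mu> l $ a - \<mu> s $ a)\<^sup>2)"
    unfolding sum_distrib_left by (intro sum.cong sum.swap refl)
  also have "\<dots> = (\<Sum>a<p. \<Sum>l=1..k. \<Sum>s=1..k. w l * w s * (\<mu> l $ a - \<mu> s $ a)\<^sup>2)"
    by (rule sum.swap)
  also have "\<dots> = (\<Sum>a<p. 2 * (q a - (b a)\<^sup>2))"
  proof (rule sum.cong[OF refl])
    fix a
    have "(\<Sum>l=1..k. \<Sum>s=1..k. w l * w s * (\<mu> l $ a - \<mu> s $ a)\<^sup>2) =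
      (\<Sum>l=1..k. \<Sum>s=1..k. (w l * (\<mu> l $ a)\<^sup>2) * w s + w l * (w s * (\<mu> s $ a)\<^sup>2) - 2 * ((w l * \<mu> l $ a) * (w s * \<mu> s $ a)))"
      by (intro sum.cong refl) (simp add: power2_eq_square algebra_simps)
    also have "\<dots> = q a * (\<Sum>s=1..k. w s) + (\<Sum>l=1..k. w l) * q a - 2 * (b a * b a)"
      by (simp only: sum.distrib sum_subtractf q_def b_def sum_product sum_distrib_left[of 2])
    finally show "(\<Sum>l=1..k. \<Sum>s=1..k. w l * w s * (\<mu> l $ a - \<mu> s $ a)\<^sup>2) = 2 * (q a - (b a)\<^sup>2)"
      using assms by (simp add: power2_eq_square)
  qed
  also have "\<dots> = 2 * (\<Sum>a<p. q a - (b a)\<^sup>2)"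
    by (simp only: sum_distrib_left)
  finally have gap: "mean_gap k p w \<mu> = (\<Sum>a<p. q a - (b a)\<^sup>2)"
    by (simp add: mean_gap_def)
  have "(\<Sum>l=1..k. w l * (\<Sum>a<p. \<mu> l $ a * (\<mu> l $ a - b a))) = (\<Sum>a<p. \<Sum>l=1..k. w l * (\<mu> l $ a * (\<mu> l $ a - b a)))"
    unfolding sum_distrib_left by (rule sum.swap)
  also have "\<dots> = (\<Sum>a<p. q a - (b a)\<^sup>2)"
  proof (rule sum.cong[OF refl])
    fix a
    have "(\<Sum>l=1..k. w l * (\<mu> l $ a * (\<mu> l $ a - b a))) = (\<Sum>l=1..k. w l * (\<mu> l $ a)\<^sup>2 - (w l * \<mu> l $ a) * b a)"
      by (intro sum.cong refl) (simp add: power2_eq_square algebra_simps)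
    also have "\<dots> = q a - b a * b a"
      by (simp only: sum_subtractf q_def b_def sum_distrib_right)
    finally show "(\<Sum>l=1..k. w l * (\<mu> l $ a * (\<mu> l $ a - b a))) = q a - (b a)\<^sup>2"
      by (simp add: power2_eq_square)
  qed
  finally show "(\<Sum>l=1..k. w l * (\<Sum>a<p. \<mu> l $ a * (\<mu> l $ a - (\<Sum>s=1..k. w s * \<mu> s $ a)))) = mean_gap k p w \<mu>"
    unfolding gap b_def .
  have "(\<Sum>l=1..k. w l * (\<Sum>a<p. (\<mu> l $ a - b a)\<^sup>2)) = (\<Sum>a<p. \<Sum>l=1..k. w l * (\<mu> l $ a - b a)\<^sup>2)"
    unfolding sum_distrib_left by (rule sum.swap)
  also have "\<dots> = (\<Sum>a<p. q a - (b a)\<^sup>2)"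
  proof (rule sum.cong[OF refl])
    fix a
    have "(\<Sum>l=1..k. w l * (\<mu> l $ a - b a)\<^sup>2) = (\<Sum>l=1..k. w l * (\<mu> l $ a)\<^sup>2 - 2 * b a * (w l * \<mu> l $ a) + (b a)\<^sup>2 * w l)"
      by (intro sum.cong refl) (simp add: power2_eq_square algebra_simps)
    also have "\<dots> = q a - 2 * b a * b a + (b a)\<^sup>2 * (\<Sum>l=1..k. w l)"
      by (simp only: sum_subtractf sum.distrib q_def b_def sum_distrib_left)
    finally show "(\<Sum>l=1..k. w l * (\<mu> l $ a - b a)\<^sup>2) = q a - (b a)\<^sup>2"
      using assms by (simp add: power2_eq_square)
  qed
  finally show "(\<Sum>l=1..k. w l * (\<Sum>a<p. (\<mu> l $ a - (\<Sum>s=1..k. w s * \<mu> s $ a))\<^sup>2)) = mean_gap k p w \<mu>"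
    unfolding gap b_def .
qed

lemma sum_obs_pairs:
  fixes g :: "nat \<Rightarrow> nat \<Rightarrow> real"
  assumes "\<And>l. l \<in> {1..k} \<Longrightarrow> N l \<ge> 1"
  shows "(\<Sum>u\<in>obs_set k N. \<Sum>v\<in>obs_set k N - {u}. g (fst u) (fst v)) =
    (\<Sum>l=1..k. \<Sum>s=1..k. (if s = l then real (N l) * (real (N l) - 1) else real (N l) * real (N s)) * g l s)"
proof -
  have "(\<Sum>u\<in>obs_set k N. \<Sum>v\<in>obs_set k N - {u}. g (fst u) (fst v)) =
    (\<Sum>l=1..k. real (N l) * ((real (N l) - 1) * g l l + (\<Sum>s\<in>{1..k} - {l}. real (N s) * g l s)))"
    unfolding sum_obs_set using assms
    by (intro sum.cong refl) (simp add: sum_obs_set_Diff of_nat_diff)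
  also have "\<dots> = (\<Sum>l=1..k. \<Sum>s=1..k. (if s = l then real (N l) * (real (N l) - 1) else real (N l) * real (N s)) * g l s)"
  proof (rule sum.cong[OF refl])
    fix l assume "l \<in> {1..k}"
    then have "(\<Sum>s=1..k. (if s = l then real (N l) * (real (N l) - 1) else real (N l) * real (N s)) * g l s) =
      real (N l) * (real (N l) - 1) * g l l + (\<Sum>s\<in>{1..k} - {l}. (if s = l then real (N l) * (real (N l) - 1) else real (N l) * real (N s)) * g l s)"
      by (subst sum.remove[of "{1..k}" l]) auto
    then show "real (N l) * ((real (N l) - 1) * g l l + (\<Sum>s\<in>{1..k} - {l}. real (N s) * g l s)) =
      (\<Sum>s=1..k. (if s = l then real (N l) * (real (N l) - 1) else real (N l) * real (N s)) * g l s)"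
      by (simp add: sum_distrib_left algebra_simps)
  qed
  finally show ?thesis .
qed

context factor_model
begin

abbreviation lin_coeff :: "(nat \<times> nat) \<times> nat \<Rightarrow> real" where
  "lin_coeff x \<equiv> 2 * (\<Sum>a<p. (\<mu> (fst (fst x)) $ a - weighted_mean k N \<mu> a) * obs_load \<Gamma> (fst x) a (snd x))"

text \<open>Each observation is split into noise and mean inside the pair sum. The two mixed sums
  agree by symmetry of the weights, hence the factor 2 in \<open>lin_coeff\<close>, and summing the
  weights against the means leaves deviations from the weighted mean.\<close>

lemma T_stat_decomposition:
  assumes N: "\<And>l. l \<in> {1..k} \<Longrightarrow> N l \<ge> 2" and "k \<ge> 1"
  shows "T_stat k p N (observation r \<mu> \<Gamma> z \<omega>) =
    (\<Sum>u\<in>obs_set k N. \<Sum>v\<in>obs_set k N - {u}. pair_weight k N u v * obs.G u v \<omega>)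
    + (\<Sum>x\<in>obs_set k N \<times> {..<r}. lin_coeff x * obs_noise z x \<omega>)
    + real (total_size k N) * mean_gap k p (\<lambda>l. real (N l) / real (total_size k N)) \<mu>"
proof -
  define Ob where "Ob = obs_set k N"
  define c where "c = pair_weight k N"
  define n where "n = real (total_size k N)"
  define m where "m u a = \<mu> (fst u) $ a" for u :: "nat \<times> nat" and a
  have fO: "finite Ob" by (simp add: Ob_def finite_obs_set)
  have cs: "c u v = c v u" for u v by (simp add: c_def pair_weight_sym)
  have N1: "N l \<ge> 1" if "l \<in> {1..k}" for l
    using N[OF that] by simp
  have n0: "n > 0"
  proof -
    have "N 1 \<le> total_size k N"
      unfolding total_size_def using \<open>k \<ge> 1\<close> by (intro member_le_sum) auto
    then show ?thesis using N[of 1] \<open>k \<ge> 1\<close> by (simp add: n_def)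
  qed
  have x: "observation r \<mu> \<Gamma> z \<omega> (fst u) (snd u) $ a = obs.y u a \<omega> + m u a" if "u \<in> Ob" "a < p" for u a
    using observation_component[of "fst u" a \<omega> "snd u"] that by (auto simp: Ob_def obs_set_def m_def)
  have mu: "(\<Sum>v\<in>Ob - {u}. c u v * m v a) = m u a - weighted_mean k N \<mu> a" if "u \<in> Ob" for u a
    unfolding Ob_def c_def m_def using that N by (intro sum_pair_weight) (auto simp: Ob_def)
  have B: "(\<Sum>u\<in>Ob. \<Sum>v\<in>Ob - {u}. c u v * (\<Sum>a<p. f u a * m v a)) =
    (\<Sum>u\<in>Ob. \<Sum>a<p. f u a * (m u a - weighted_mean k N \<mu> a))" for f
  proof (rule sum.cong[OF refl])
    fix u assume u: "u \<in> Ob"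
    have "(\<Sum>v\<in>Ob - {u}. c u v * (\<Sum>a<p. f u a * m v a)) = (\<Sum>v\<in>Ob - {u}. \<Sum>a<p. f u a * (c u v * m v a))"
      by (simp add: sum_distrib_left mult_ac)
    also have "\<dots> = (\<Sum>a<p. \<Sum>v\<in>Ob - {u}. f u a * (c u v * m v a))"
      by (rule sum.swap)
    finally show "(\<Sum>v\<in>Ob - {u}. c u v * (\<Sum>a<p. f u a * m v a)) = (\<Sum>a<p. f u a * (m u a - weighted_mean k N \<mu> a))"
      by (simp add: sum_distrib_left[symmetric] mu[OF u])
  qed
  have sw: "(\<Sum>u\<in>Ob. \<Sum>v\<in>Ob - {u}. c u v * (\<Sum>a<p. m u a * obs.y v a \<omega>)) =
    (\<Sum>u\<in>Ob. \<Sum>v\<in>Ob - {u}. c u v * (\<Sum>a<p. obs.y u a \<omega> * m v a))"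
    by (subst sum_pairs_swap[OF fO]) (simp add: cs mult.commute)
  have "T_stat k p N (observation r \<mu> \<Gamma> z \<omega>) =
    (\<Sum>u\<in>Ob. \<Sum>v\<in>Ob - {u}. c u v * (\<Sum>a<p. (obs.y u a \<omega> + m u a) * (obs.y v a \<omega> + m v a)))"
    unfolding c_def Ob_def
    by (subst T_stat_pair_sum[OF N1])
      (use x in \<open>auto simp: observation_dim Ob_def intro!: sum.cong\<close>)
  also have "\<dots> = (\<Sum>u\<in>Ob. \<Sum>v\<in>Ob - {u}. c u v * obs.G u v \<omega> + c u v * (\<Sum>a<p. obs.y u a \<omega> * m v a)
      + c u v * (\<Sum>a<p. m u a * obs.y v a \<omega>) + c u v * (\<Sum>a<p. m u a * m v a))"
  proof (intro sum.cong refl)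
    fix u v
    have "(\<Sum>a<p. (obs.y u a \<omega> + m u a) * (obs.y v a \<omega> + m v a)) = obs.G u v \<omega> + (\<Sum>a<p. obs.y u a \<omega> * m v a)
      + (\<Sum>a<p. m u a * obs.y v a \<omega>) + (\<Sum>a<p. m u a * m v a)"
      by (simp add: obs.G_def algebra_simps sum.distrib)
    then show "c u v * (\<Sum>a<p. (obs.y u a \<omega> + m u a) * (obs.y v a \<omega> + m v a)) =
      c u v * obs.G u v \<omega> + c u v * (\<Sum>a<p. obs.y u a \<omega> * m v a)
      + c u v * (\<Sum>a<p. m u a * obs.y v a \<omega>) + c u v * (\<Sum>a<p. m u a * m v a)"
      by (simp only: distrib_left)
  qed
  also have "\<dots> = (\<Sum>u\<in>Ob. \<Sum>v\<in>Ob - {u}. c u v * obs.G u v \<omega>)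
      + 2 * (\<Sum>u\<in>Ob. \<Sum>a<p. obs.y u a \<omega> * (m u a - weighted_mean k N \<mu> a))
      + (\<Sum>u\<in>Ob. \<Sum>a<p. m u a * (m u a - weighted_mean k N \<mu> a))"
    by (simp only: sum.distrib sw B mult_2 add_ac)
  also have "2 * (\<Sum>u\<in>Ob. \<Sum>a<p. obs.y u a \<omega> * (m u a - weighted_mean k N \<mu> a)) =
    (\<Sum>x\<in>Ob \<times> {..<r}. lin_coeff x * obs_noise z x \<omega>)"
  proof -
    have "(\<Sum>a<p. obs.y u a \<omega> * (m u a - weighted_mean k N \<mu> a)) =
      (\<Sum>j<r. (\<Sum>a<p. (m u a - weighted_mean k N \<mu> a) * obs_load \<Gamma> u a j) * obs_noise z (u, j) \<omega>)" for u
      unfolding obs.y_def sum_distrib_right by (subst sum.swap) (simp add: mult_ac)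
    then show ?thesis
      by (simp only: obs.sum_Ob_times fst_conv snd_conv m_def mult.assoc
          sum_distrib_left[of 2 _ Ob] sum_distrib_left[of 2 _ "{..<r}"])
  qed
  also have "(\<Sum>u\<in>Ob. \<Sum>a<p. m u a * (m u a - weighted_mean k N \<mu> a)) =
     n * mean_gap k p (\<lambda>l. real (N l) / n) \<mu>"
  proof -
    have "(\<Sum>l=1..k. real (N l) / n) = 1"
      using n0 by (simp add: n_def total_size_def flip: sum_divide_distrib)
    then have "mean_gap k p (\<lambda>l. real (N l) / n) \<mu> =
      (\<Sum>l=1..k. real (N l) / n * (\<Sum>a<p. \<mu> l $ a * (\<mu> l $ a - weighted_mean k N \<mu> a)))"
      unfolding weighted_mean_def n_def[symmetric] by (rule mean_gap_eq(1)[symmetric])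
    then show ?thesis
      using n0 by (simp add: Ob_def sum_obs_set m_def sum_distrib_left)
  qed
  finally show ?thesis
    by (simp add: Ob_def c_def n_def)
qed

text \<open>The deviation of \<open>\<mu> l\<close> from the weighted mean is a convex combination
  of the differences \<open>\<mu> l - \<mu> s\<close>. This reduces the variance to the quadratic
  forms in these differences that (A2) controls.\<close>

lemma linear_part_variance:
  assumes "k \<ge> 1" "total_size k N > 0"
  shows "expectation (\<lambda>\<omega>. (\<Sum>x\<in>obs_set k N \<times> {..<r}. lin_coeff x * obs_noise z x \<omega>)\<^sup>2) \<le>
    4 * real (total_size k N) * (\<Sum>l=1..k. \<Sum>s=1..k. (\<mu> l - \<mu> s) \<bullet> (\<Sigma> l *\<^sub>v (\<mu> l - \<mu> s)))"
proof -
  define n where "n = real (total_size k N)"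
  have n0: "n > 0" using assms by (simp add: n_def)
  define w where "w s = real (N s) / n" for s
  have w: "0 \<le> w s" for s using n0 by (simp add: w_def)
  have w1: "(\<Sum>s=1..k. w s) = 1"
    using n0 by (simp add: w_def n_def total_size_def flip: sum_divide_distrib)
  have wle: "w s \<le> 1" if "s \<in> {1..k}" for s
    using member_le_sum[of s "{1..k}" w] that w w1 by auto
  define h where "h l s j = (\<Sum>a<p. (\<mu> l $ a - \<mu> s $ a) * \<Gamma> l $$ (a, j))" for l s j
  have lc: "lin_coeff ((l, i), j) = 2 * (\<Sum>s=1..k. w s * h l s j)" for l i j
  proof -
    have "\<mu> l $ a - weighted_mean k N \<mu> a = (\<Sum>s=1..k. w s * (\<mu> l $ a - \<mu> s $ a))" for a
    proof -
      have "(\<Sum>s=1..k. w s * (\<mu> l $ a - \<mu> s $ a)) = (\<Sum>s=1..k. w s) * \<mu> l $ a - (\<Sum>s=1..k. w s * \<mu> s $ a)"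
        by (simp only: right_diff_distrib sum_subtractf sum_distrib_right)
      then show ?thesis
        unfolding w1 by (simp add: weighted_mean_def w_def n_def)
    qed
    then have "(\<Sum>a<p. (\<mu> l $ a - weighted_mean k N \<mu> a) * obs_load \<Gamma> (l, i) a j) =
      (\<Sum>a<p. \<Sum>s=1..k. w s * ((\<mu> l $ a - \<mu> s $ a) * \<Gamma> l $$ (a, j)))"
      by (simp add: obs_load_def sum_distrib_right mult.assoc)
    also have "\<dots> = (\<Sum>s=1..k. \<Sum>a<p. w s * ((\<mu> l $ a - \<mu> s $ a) * \<Gamma> l $$ (a, j)))"
      by (rule sum.swap)
    finally show ?thesis by (simp add: h_def sum_distrib_left)
  qed
  \<comment> \<open>Cauchy-Schwarz; the squared weights add up to at most 1.\<close>
  have sq: "(\<Sum>s=1..k. w s * h l s j)\<^sup>2 \<le> (\<Sum>s=1..k. (h l s j)\<^sup>2)" for l j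
  proof -
    have "(\<Sum>s=1..k. w s * h l s j)\<^sup>2 \<le> (\<Sum>s=1..k. (w s)\<^sup>2) * (\<Sum>s=1..k. (h l s j)\<^sup>2)"
      by (rule Cauchy_Schwarz_ineq_sum)
    also have "(\<Sum>s=1..k. (w s)\<^sup>2) \<le> (\<Sum>s=1..k. w s)"
      using w wle by (intro sum_mono) (auto simp: power2_eq_square mult_left_le)
    finally show ?thesis
      using w1 by (simp add: sum_nonneg mult_right_mono)
  qed
  have q: "(\<mu> l - \<mu> s) \<bullet> (\<Sigma> l *\<^sub>v (\<mu> l - \<mu> s)) = (\<Sum>j<r. (h l s j)\<^sup>2)" if ls: "l \<in> {1..k}" "s \<in> {1..k}" for l s
  proof -
    have d: "\<mu> l \<in> carrier_vec p" "\<mu> s \<in> carrier_vec p" "\<Sigma> l \<in> carrier_mat p p"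
      using mu_carrier Sigma_carrier ls by auto
    have "(\<mu> l - \<mu> s) \<bullet> (\<Sigma> l *\<^sub>v (\<mu> l - \<mu> s)) =
      (\<Sum>a<p. (\<mu> l $ a - \<mu> s $ a) * (\<Sum>b<p. \<Sigma> l $$ (a, b) * (\<mu> l $ b - \<mu> s $ b)))"
      using d by (simp add: scalar_prod_def atLeast0LessThan)
    also have "\<dots> = (\<Sum>a<p. \<Sum>b<p. obs.Sg (l, 0) a b * ((\<mu> l $ a - \<mu> s $ a) * (\<mu> l $ b - \<mu> s $ b)))"
      unfolding sum_distrib_left using ls
      by (intro sum.cong refl) (simp add: Sigma_entry[of l _ _ 0])
    also have "\<dots> = (\<Sum>j<r. (\<Sum>a<p. \<Gamma> l $$ (a, j) * (\<mu> l $ a - \<mu> s $ a)) * (\<Sum>a<p. \<Gamma> l $$ (a, j) * (\<mu> l $ a - \<mu> s $ a)))"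
      by (simp only: sum_bilinear obs.Sg_def obs_load_def fst_conv)
    finally show ?thesis by (simp add: h_def power2_eq_square mult.commute)
  qed
  have "expectation (\<lambda>\<omega>. (\<Sum>x\<in>obs_set k N \<times> {..<r}. lin_coeff x * obs_noise z x \<omega>)\<^sup>2) =
    (\<Sum>x\<in>obs_set k N \<times> {..<r}. (lin_coeff x)\<^sup>2)"
    by (rule obs.expectation_square_linear_form_const) simp
  also have "\<dots> = (\<Sum>l=1..k. \<Sum>i=1..N l. \<Sum>j<r. (lin_coeff ((l, i), j))\<^sup>2)"
    by (simp only: obs.sum_Ob_times sum_obs_set)
  also have "\<dots> = (\<Sum>l=1..k. real (N l) * (\<Sum>j<r. 4 * (\<Sum>s=1..k. w s * h l s j)\<^sup>2))"
    unfolding lc by (simp add: power_mult_distrib)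
  also have "\<dots> \<le> (\<Sum>l=1..k. n * (4 * (\<Sum>s=1..k. \<Sum>j<r. (h l s j)\<^sup>2)))"
  proof (intro sum_mono mult_mono)
    fix l assume "l \<in> {1..k}"
    then show "real (N l) \<le> n" unfolding n_def total_size_def of_nat_le_iff by (intro member_le_sum) auto
    have "(\<Sum>j<r. 4 * (\<Sum>s=1..k. w s * h l s j)\<^sup>2) \<le> (\<Sum>j<r. 4 * (\<Sum>s=1..k. (h l s j)\<^sup>2))"
      by (intro sum_mono mult_left_mono sq) simp
    also have "\<dots> = 4 * (\<Sum>s=1..k. \<Sum>j<r. (h l s j)\<^sup>2)"
      unfolding sum_distrib_left[symmetric] by (subst sum.swap) simp
    finally show "(\<Sum>j<r. 4 * (\<Sum>s=1..k. w s * h l s j)\<^sup>2) \<le> 4 * (\<Sum>s=1..k. \<Sum>j<r. (h l s j)\<^sup>2)" .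
  qed (use n0 in \<open>auto intro!: sum_nonneg\<close>)
  also have "\<dots> = 4 * n * (\<Sum>l=1..k. \<Sum>s=1..k. \<Sum>j<r. (h l s j)\<^sup>2)"
    by (simp only: sum_distrib_left mult_ac)
  also have "(\<Sum>l=1..k. \<Sum>s=1..k. \<Sum>j<r. (h l s j)\<^sup>2) = (\<Sum>l=1..k. \<Sum>s=1..k. (\<mu> l - \<mu> s) \<bullet> (\<Sigma> l *\<^sub>v (\<mu> l - \<mu> s)))"
    by (intro sum.cong refl) (simp add: q)
  finally show ?thesis by (simp add: n_def)
qed

end

section \<open>Weights of the traces in the variance, and their perturbation\<close>

definition var_weight :: "nat \<Rightarrow> (nat \<Rightarrow> nat) \<Rightarrow> nat \<Rightarrow> nat \<Rightarrow> real" where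
  "var_weight k N l s = (let n = real (total_size k N) in
     if s = l then 2 * (real (N l) * (n - real (N l))\<^sup>2 / (n\<^sup>2 * (real (N l) - 1)))
     else 2 * (real (N l) * real (N s) / n\<^sup>2))"

definition lim_weight :: "(nat \<Rightarrow> real) \<Rightarrow> nat \<Rightarrow> nat \<Rightarrow> real" where
  "lim_weight lam l s = (if s = l then 2 * (1 - lam l)\<^sup>2 else 2 * (lam l * lam s))"

lemma sum_diag_offdiag:
  fixes a :: "nat \<Rightarrow> real"
  shows "(\<Sum>l=1..k. \<Sum>s=1..k. if s = l then a l else b l s) = (\<Sum>l=1..k. a l) + (\<Sum>l\<in>{1..k}. \<Sum>s\<in>{1..k} - {l}. b l s)"
proof -
  have "(\<Sum>s=1..k. if s = l then a l else b l s) = a l + (\<Sum>s\<in>{1..k} - {l}. b l s)" if "l \<in> {1..k}" for l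
    using that by (subst sum.remove[of _ l]) auto
  then show ?thesis
    by (simp add: sum.distrib)
qed

text \<open>The estimator carries the same weights as the variance in
  \<open>normalized_variance\<close>, so one perturbation estimate serves for both.\<close>

lemma sigma2_with_eq:
  "sigma2_with t k p N x = (\<Sum>l=1..k. \<Sum>s=1..k. var_weight k N l s * (if s = l then t l else tr_prod_hat p N x l s))"
proof -
  define n where "n = real (total_size k N)"
  have "(\<Sum>l=1..k. \<Sum>s=1..k. var_weight k N l s * (if s = l then t l else tr_prod_hat p N x l s)) =
    (\<Sum>l=1..k. \<Sum>s=1..k. if s = l then 2 / n\<^sup>2 * (real (N l) * (n - real (N l))\<^sup>2 / (real (N l) - 1) * t l)
       else 2 / n\<^sup>2 * (real (N l) * real (N s) * tr_prod_hat p N x l s))"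
    by (intro sum.cong refl) (simp add: var_weight_def Let_def n_def)
  also have "\<dots> = sigma2_with t k p N x"
    unfolding sum_diag_offdiag sigma2_with_def Let_def n_def[symmetric]
    by (simp only: sum_distrib_left distrib_left)
  finally show ?thesis ..
qed

lemma sum_obs_set_le:
  assumes "\<And>l i. l \<in> {1..k} \<Longrightarrow> g (l, i) \<le> h l" "\<And>l. l \<in> {1..k} \<Longrightarrow> 0 \<le> h l"
  shows "(\<Sum>u\<in>obs_set k N. g u) \<le> real (total_size k N) * (\<Sum>l=1..k. h l)"
proof -
  have "(\<Sum>u\<in>obs_set k N. g u) \<le> (\<Sum>l=1..k. \<Sum>i=1..N l. h l)"
    unfolding sum_obs_set using assms by (intro sum_mono) auto
  also have "\<dots> = (\<Sum>l=1..k. real (N l) * h l)"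
    by simp
  also have "\<dots> \<le> (\<Sum>l=1..k. real (total_size k N) * h l)"
    using assms(2) by (intro sum_mono mult_right_mono) (auto simp: total_size_def simp del: of_nat_sum intro!: member_le_sum)
  finally show ?thesis by (simp add: sum_distrib_left)
qed

text \<open>Every \<open>\<tau> x\<close> is at most \<open>S / w x\<close>, so errors relative to
  single traces become errors relative to the total. The weights in use, \<open>w'\<close>, may
  differ from the \<open>w\<close> that define \<open>S\<close>, and the difference enters in the
  same way.\<close>

lemma (in prob_space) weighted_ratio_error:
  fixes e :: "'x \<Rightarrow> 'a \<Rightarrow> real" and \<tau> w w' \<kappa> :: "'x \<Rightarrow> real"
  assumes A: "finite A" and e: "\<And>x. x \<in> A \<Longrightarrow> integrable M (e x)"
    and err: "\<And>x. x \<in> A \<Longrightarrow> expectation (\<lambda>\<omega>. \<bar>e x \<omega> - \<tau> x\<bar>) \<le> \<kappa> x * \<tau> x"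
    and \<tau>: "\<And>x. x \<in> A \<Longrightarrow> 0 \<le> \<tau> x" and w: "\<And>x. x \<in> A \<Longrightarrow> 0 < w x"
    and S: "S = (\<Sum>x\<in>A. w x * \<tau> x)" "S > 0"
  shows "integrable M (\<lambda>\<omega>. (\<Sum>x\<in>A. w' x * e x \<omega>) / S)"
    and "expectation (\<lambda>\<omega>. \<bar>(\<Sum>x\<in>A. w' x * e x \<omega>) / S - 1\<bar>) \<le> (\<Sum>x\<in>A. (\<bar>w' x\<bar> * \<bar>\<kappa> x\<bar> + \<bar>w' x - w x\<bar>) / w x)"
proof -
  show i: "integrable M (\<lambda>\<omega>. (\<Sum>x\<in>A. w' x * e x \<omega>) / S)"
    using e by auto
  have \<tau>S: "\<tau> x / S \<le> 1 / w x" if "x \<in> A" for x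
  proof -
    have "w x * \<tau> x \<le> S"
      unfolding S(1) using that A by (intro member_le_sum) (auto intro!: mult_nonneg_nonneg \<tau> less_imp_le[OF w])
    then show ?thesis using S(2) w[OF that] by (simp add: field_simps)
  qed
  have ie: "integrable M (\<lambda>\<omega>. \<bar>e x \<omega> - \<tau> x\<bar>)" if "x \<in> A" for x
    using e[OF that] by auto
  have "expectation (\<lambda>\<omega>. \<bar>(\<Sum>x\<in>A. w' x * e x \<omega>) / S - 1\<bar>) \<le>
    expectation (\<lambda>\<omega>. \<Sum>x\<in>A. \<bar>w' x\<bar> * \<bar>e x \<omega> - \<tau> x\<bar> / S + \<bar>w' x - w x\<bar> * \<tau> x / S)"
  proof (rule integral_mono)
    fix \<omega>
    have "(\<Sum>x\<in>A. w' x * e x \<omega>) / S - 1 = ((\<Sum>x\<in>A. w' x * e x \<omega>) - (\<Sum>x\<in>A. w x * \<tau> x)) / S"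
      using S by (simp add: diff_divide_distrib)
    also have "\<dots> = (\<Sum>x\<in>A. (w' x * (e x \<omega> - \<tau> x) + (w' x - w x) * \<tau> x) / S)"
      unfolding sum_subtractf[symmetric] sum_divide_distrib by (intro sum.cong refl) (simp add: algebra_simps)
    finally have "\<bar>(\<Sum>x\<in>A. w' x * e x \<omega>) / S - 1\<bar> \<le> (\<Sum>x\<in>A. \<bar>(w' x * (e x \<omega> - \<tau> x) + (w' x - w x) * \<tau> x) / S\<bar>)"
      by (simp only: sum_abs)
    also have "\<dots> \<le> (\<Sum>x\<in>A. \<bar>w' x\<bar> * \<bar>e x \<omega> - \<tau> x\<bar> / S + \<bar>w' x - w x\<bar> * \<tau> x / S)"
    proof (rule sum_mono)
      fix x assume "x \<in> A"
      have "\<bar>(w' x * (e x \<omega> - \<tau> x) + (w' x - w x) * \<tau> x)\<bar> \<le> \<bar>w' x\<bar> * \<bar>e x \<omega> - \<tau> x\<bar> + \<bar>w' x - w x\<bar> * \<tau> x"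
        using \<tau>[OF \<open>x \<in> A\<close>] by (intro order_trans[OF abs_triangle_ineq]) (simp add: abs_mult)
      then show "\<bar>(w' x * (e x \<omega> - \<tau> x) + (w' x - w x) * \<tau> x) / S\<bar> \<le> \<bar>w' x\<bar> * \<bar>e x \<omega> - \<tau> x\<bar> / S + \<bar>w' x - w x\<bar> * \<tau> x / S"
        using S(2) by (simp add: abs_divide divide_right_mono flip: add_divide_distrib)
    qed
    finally show "\<bar>(\<Sum>x\<in>A. w' x * e x \<omega>) / S - 1\<bar> \<le> (\<Sum>x\<in>A. \<bar>w' x\<bar> * \<bar>e x \<omega> - \<tau> x\<bar> / S + \<bar>w' x - w x\<bar> * \<tau> x / S)" .
  qed (use i ie in auto)
  also have "\<dots> = (\<Sum>x\<in>A. \<bar>w' x\<bar> * expectation (\<lambda>\<omega>. \<bar>e x \<omega> - \<tau> x\<bar>) / S + \<bar>w' x - w x\<bar> * \<tau> x / S)"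
    using ie by (simp add: Bochner_Integration.integral_sum prob_space)
  also have "\<dots> \<le> (\<Sum>x\<in>A. (\<bar>w' x\<bar> * \<bar>\<kappa> x\<bar> + \<bar>w' x - w x\<bar>) / w x)"
  proof (rule sum_mono)
    fix x assume x: "x \<in> A"
    have "\<bar>w' x\<bar> * expectation (\<lambda>\<omega>. \<bar>e x \<omega> - \<tau> x\<bar>) / S \<le> \<bar>w' x\<bar> * (\<bar>\<kappa> x\<bar> * \<tau> x) / S"
      using S(2) \<tau>[OF x] by (intro divide_right_mono mult_left_mono order_trans[OF err[OF x]] mult_right_mono) auto
    then have "\<bar>w' x\<bar> * expectation (\<lambda>\<omega>. \<bar>e x \<omega> - \<tau> x\<bar>) / S + \<bar>w' x - w x\<bar> * \<tau> x / S \<le>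
      (\<bar>w' x\<bar> * \<bar>\<kappa> x\<bar> + \<bar>w' x - w x\<bar>) * (\<tau> x / S)"
      by (simp add: algebra_simps add_divide_distrib)
    also have "\<dots> \<le> (\<bar>w' x\<bar> * \<bar>\<kappa> x\<bar> + \<bar>w' x - w x\<bar>) * (1 / w x)"
      by (intro mult_left_mono \<tau>S x) auto
    finally show "\<bar>w' x\<bar> * expectation (\<lambda>\<omega>. \<bar>e x \<omega> - \<tau> x\<bar>) / S + \<bar>w' x - w x\<bar> * \<tau> x / S \<le>
      (\<bar>w' x\<bar> * \<bar>\<kappa> x\<bar> + \<bar>w' x - w x\<bar>) / w x"
      by simp
  qed
  finally show "expectation (\<lambda>\<omega>. \<bar>(\<Sum>x\<in>A. w' x * e x \<omega>) / S - 1\<bar>) \<le> (\<Sum>x\<in>A. (\<bar>w' x\<bar> * \<bar>\<kappa> x\<bar> + \<bar>w' x - w x\<bar>) / w x)" .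
qed

text \<open>Each term of the pairwise form changes by its own relative factor and is bounded by the
  whole sum, all terms being nonnegative. No bound on the means is involved.\<close>

lemma mean_gap_ratio:
  assumes lam: "\<And>l. l \<in> {1..k} \<Longrightarrow> 0 < lam l"
  shows "\<bar>mean_gap k p w \<mu> - mean_gap k p lam \<mu>\<bar> \<le> (\<Sum>l=1..k. \<Sum>s=1..k. \<bar>w l * w s / (lam l * lam s) - 1\<bar>) * mean_gap k p lam \<mu>"
    and "0 \<le> mean_gap k p lam \<mu>"
proof -
  define d where "d l s = (\<Sum>a<p. (\<mu> l $ a - \<mu> s $ a)\<^sup>2)" for l s
  have d0: "0 \<le> d l s" for l s by (simp add: d_def sum_nonneg)
  have t0: "0 \<le> lam l * lam s * d l s" if "l \<in> {1..k}" "s \<in> {1..k}" for l s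
    using lam[OF that(1)] lam[OF that(2)] d0 by simp
  then have rows: "0 \<le> (\<Sum>s=1..k. lam l * lam s * d l s)" if "l \<in> {1..k}" for l
    using that by (intro sum_nonneg) auto
  have g0: "0 \<le> (\<Sum>l=1..k. \<Sum>s=1..k. lam l * lam s * d l s)"
    by (rule sum_nonneg) (rule rows)
  then show "0 \<le> mean_gap k p lam \<mu>" by (simp add: mean_gap_def d_def)
  have "\<bar>(\<Sum>l=1..k. \<Sum>s=1..k. w l * w s * d l s) - (\<Sum>l=1..k. \<Sum>s=1..k. lam l * lam s * d l s)\<bar> =
    \<bar>\<Sum>l=1..k. \<Sum>s=1..k. (w l * w s / (lam l * lam s) - 1) * (lam l * lam s * d l s)\<bar>"
    unfolding sum_subtractf[symmetric]
    by (intro arg_cong[where f=abs] sum.cong refl) (use lam in \<open>force simp: field_simps\<close>)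
  also have "\<dots> \<le> (\<Sum>l=1..k. \<Sum>s=1..k. \<bar>(w l * w s / (lam l * lam s) - 1) * (lam l * lam s * d l s)\<bar>)"
    by (intro order_trans[OF sum_abs] sum_mono sum_abs)
  also have "\<dots> \<le> (\<Sum>l=1..k. \<Sum>s=1..k. \<bar>w l * w s / (lam l * lam s) - 1\<bar> * (\<Sum>l=1..k. \<Sum>s=1..k. lam l * lam s * d l s))"
  proof (intro sum_mono)
    fix l s assume ls: "l \<in> {1..k}" "s \<in> {1..k}"
    have "lam l * lam s * d l s \<le> (\<Sum>s=1..k. lam l * lam s * d l s)"
      using ls t0 by (intro member_le_sum[of s _ "\<lambda>s. lam l * lam s * d l s"]) auto
    also have "\<dots> \<le> (\<Sum>l=1..k. \<Sum>s=1..k. lam l * lam s * d l s)"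
      using ls rows by (intro member_le_sum[of l _ "\<lambda>l. \<Sum>s=1..k. lam l * lam s * d l s"]) auto
    finally show "\<bar>(w l * w s / (lam l * lam s) - 1) * (lam l * lam s * d l s)\<bar> \<le>
      \<bar>w l * w s / (lam l * lam s) - 1\<bar> * (\<Sum>l=1..k. \<Sum>s=1..k. lam l * lam s * d l s)"
      unfolding abs_mult[of "w l * w s / (lam l * lam s) - 1"] abs_of_nonneg[OF t0[OF ls]] by (rule mult_left_mono) simp
  qed
  finally show "\<bar>mean_gap k p w \<mu> - mean_gap k p lam \<mu>\<bar> \<le> (\<Sum>l=1..k. \<Sum>s=1..k. \<bar>w l * w s / (lam l * lam s) - 1\<bar>) * mean_gap k p lam \<mu>"
    by (simp add: mean_gap_def d_def diff_divide_distrib[symmetric] flip: sum_distrib_right)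
qed

context factor_model
begin

text \<open>Under (A1) the right-hand side is of order 1/n. Summing over the groups instead of
  taking a maximum costs only a constant factor.\<close>

lemma pair_weight_bound:
  assumes "u \<in> obs_set k N" and N: "\<And>l. l \<in> {1..k} \<Longrightarrow> N l \<ge> 2"
  shows "\<bar>pair_weight k N u v\<bar> \<le> 1 / real (total_size k N) + (\<Sum>l=1..k. 1 / (real (N l) - 1))"
proof -
  define n where "n = real (total_size k N)"
  define l where "l = fst u"
  have l: "l \<in> {1..k}" using assms by (auto simp: obs_set_def l_def)
  have "N l \<le> total_size k N" unfolding total_size_def using l by (intro member_le_sum) auto
  then have n: "real (N l) \<le> n" "n > 0" "real (N l) - 1 > 0" using N[OF l] by (auto simp: n_def)
  have pos: "0 \<le> 1 / (real (N s) - 1)" if "s \<in> {1..k}" for s using N[OF that] by simp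
  have 1: "1 / (real (N l) - 1) \<le> (\<Sum>l=1..k. 1 / (real (N l) - 1))"
    using l pos by (intro member_le_sum) auto
  have 2: "0 \<le> (\<Sum>l=1..k. 1 / (real (N l) - 1))" using pos by (intro sum_nonneg) auto
  have 3: "(n - real (N l)) / (n * (real (N l) - 1)) \<le> 1 / (real (N l) - 1)"
    using n by (simp add: divide_simps)
  have 4: "0 \<le> (n - real (N l)) / (n * (real (N l) - 1))" "0 \<le> 1 / n"
    using n by simp_all
  have "pair_weight k N u v = (if fst u = fst v then (n - real (N l)) / (n * (real (N l) - 1)) else - (1 / n))"
    by (simp add: pair_weight_def Let_def n_def l_def)
  then have "\<bar>pair_weight k N u v\<bar> = (if fst u = fst v then (n - real (N l)) / (n * (real (N l) - 1)) else 1 / n)"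
    using 4 by (simp only: abs_minus_cancel abs_of_nonneg if_distrib[of abs])
  also have "\<dots> \<le> max ((n - real (N l)) / (n * (real (N l) - 1))) (1 / n)"
    by simp
  also have "\<dots> \<le> 1 / n + (\<Sum>l=1..k. 1 / (real (N l) - 1))"
    using 1 2 3 4 by (intro max.boundedI) linarith+
  finally show ?thesis
    by (simp only: n_def)
qed

text \<open>The observations carry no distinguished order; encoding index pairs by natural numbers
  supplies one that is the same for all members of the sequence.\<close>

lemma rank_inj: "inj_on prod_encode U"
  by (simp add: inj_prod_encode)

lemma normalized_form:
  "(\<Sum>x\<in>obs_set k N \<times> {..<r}. \<Sum>x'\<in>obs_set k N \<times> {..<r}.
      obs.tri_coeff prod_encode (\<lambda>u v. pair_weight k N u v / c) x x' * obs_noise z x' \<omega> * obs_noise z x \<omega>) =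
   (\<Sum>u\<in>obs_set k N. \<Sum>v\<in>obs_set k N - {u}. pair_weight k N u v * obs.G u v \<omega>) / c"
  by (subst obs.tri_coeff_form) (auto simp: rank_inj pair_weight_sym sum_divide_distrib)

lemma normalized_variance:
  assumes N: "\<And>l. l \<in> {1..k} \<Longrightarrow> N l \<ge> 2"
  shows "(\<Sum>x\<in>obs_set k N \<times> {..<r}. \<Sum>x'\<in>obs_set k N \<times> {..<r}.
      (obs.tri_coeff prod_encode (\<lambda>u v. pair_weight k N u v / c) x x')\<^sup>2) =
   (\<Sum>l=1..k. \<Sum>s=1..k. var_weight k N l s * trp l s) / c\<^sup>2"
proof -
  define n where "n = real (total_size k N)"
  define g where "g l s = (pair_weight k N (l, 0) (s, 0))\<^sup>2 * trp l s" for l s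
  have "(\<Sum>x\<in>obs_set k N \<times> {..<r}. \<Sum>x'\<in>obs_set k N \<times> {..<r}.
      (obs.tri_coeff prod_encode (\<lambda>u v. pair_weight k N u v / c) x x')\<^sup>2) =
    2 * (\<Sum>u\<in>obs_set k N. \<Sum>v\<in>obs_set k N - {u}. (pair_weight k N u v / c)\<^sup>2 * obs.tau u v)"
    by (rule obs.tri_coeff_square) (auto simp: rank_inj pair_weight_sym)
  also have "(\<Sum>u\<in>obs_set k N. \<Sum>v\<in>obs_set k N - {u}. (pair_weight k N u v / c)\<^sup>2 * obs.tau u v) =
    (\<Sum>u\<in>obs_set k N. \<Sum>v\<in>obs_set k N - {u}. g (fst u) (fst v)) / c\<^sup>2"
    unfolding sum_divide_distrib
    by (intro sum.cong refl) (auto simp: g_def pair_weight_def Let_def power_divide obs_set_def tau_trace)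
  also have "(\<Sum>u\<in>obs_set k N. \<Sum>v\<in>obs_set k N - {u}. g (fst u) (fst v)) =
    (\<Sum>l=1..k. \<Sum>s=1..k. (if s = l then real (N l) * (real (N l) - 1) else real (N l) * real (N s)) * g l s)"
    using N by (intro sum_obs_pairs) (meson le_trans one_le_numeral)
  also have "2 * (\<dots> / c\<^sup>2) = (\<Sum>l=1..k. \<Sum>s=1..k. 2 * ((if s = l then real (N l) * (real (N l) - 1) else real (N l) * real (N s)) * g l s)) / c\<^sup>2"
    by (simp add: sum_distrib_left)
  also have "(\<Sum>l=1..k. \<Sum>s=1..k. 2 * ((if s = l then real (N l) * (real (N l) - 1) else real (N l) * real (N s)) * g l s)) =
    (\<Sum>l=1..k. \<Sum>s=1..k. var_weight k N l s * trp l s)"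
  proof (intro sum.cong refl)
    fix l s assume "l \<in> {1..k}"
    then have c: "real (N l) - 1 > 0" using N by fastforce
    have d: "N' * x * (e / (n * x))\<^sup>2 = N' * e\<^sup>2 / (n\<^sup>2 * x)" if "x > 0" for N' x e :: real
      using that by (simp add: power_divide power_mult_distrib power2_eq_square)
    show "2 * ((if s = l then real (N l) * (real (N l) - 1) else real (N l) * real (N s)) * g l s) = var_weight k N l s * trp l s"
    proof (cases "s = l")
      case True
      have "2 * (real (N l) * (real (N l) - 1) * ((n - real (N l)) / (n * (real (N l) - 1)))\<^sup>2 * trp l l) =
        2 * (real (N l) * (n - real (N l))\<^sup>2 / (n\<^sup>2 * (real (N l) - 1))) * trp l l"
        unfolding d[OF c] by simp
      then show ?thesis
        using True by (simp add: g_def pair_weight_def var_weight_def Let_def n_def mult.assoc)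
    next
      case False
      then show ?thesis
        by (simp add: g_def pair_weight_def var_weight_def Let_def power_divide)
    qed
  qed
  finally show ?thesis .
qed

text \<open>Four sums over observations contribute \<open>n ^ 4\<close>, which is matched with the
  fourth power of the weight bound. Under (A1) the product \<open>n * c0\<close> stays bounded, so
  only the fourfold traces relative to \<open>c ^ 4\<close> matter.\<close>

lemma normalized_fourth:
  assumes N: "\<And>l. l \<in> {1..k} \<Longrightarrow> N l \<ge> 2" and "c > 0"
  defines "c0 \<equiv> 1 / real (total_size k N) + (\<Sum>l=1..k. 1 / (real (N l) - 1))"
  shows "(\<Sum>x\<in>obs_set k N \<times> {..<r}. \<Sum>x'\<in>obs_set k N \<times> {..<r}.
      (\<Sum>y\<in>obs_set k N \<times> {..<r}. obs.tri_coeff prod_encode (\<lambda>u v. pair_weight k N u v / c) y x *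
         obs.tri_coeff prod_encode (\<lambda>u v. pair_weight k N u v / c) y x')\<^sup>2) \<le>
    16 * (real (total_size k N) * c0) ^ 4 *
      ((\<Sum>l=1..k. \<Sum>i=1..k. \<Sum>s=1..k. \<Sum>j=1..k. \<bar>mat_trace (\<Sigma> l * \<Sigma> s * \<Sigma> i * \<Sigma> j)\<bar>) / c ^ 4)"
proof -
  define n where "n = real (total_size k N)"
  have pos: "0 \<le> 1 / (real (N s) - 1)" if "s \<in> {1..k}" for s using N[OF that] by simp
  have c0: "0 \<le> c0" unfolding c0_def using pos by (intro add_nonneg_nonneg sum_nonneg) auto
  have "(\<Sum>x\<in>obs_set k N \<times> {..<r}. \<Sum>x'\<in>obs_set k N \<times> {..<r}.
      (\<Sum>y\<in>obs_set k N \<times> {..<r}. obs.tri_coeff prod_encode (\<lambda>u v. pair_weight k N u v / c) y x *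
         obs.tri_coeff prod_encode (\<lambda>u v. pair_weight k N u v / c) y x')\<^sup>2) \<le>
    16 * (c0 / c) ^ 4 * (\<Sum>v\<in>obs_set k N. \<Sum>w\<in>obs_set k N. \<Sum>u\<in>obs_set k N. \<Sum>u'\<in>obs_set k N. \<bar>obs.trace4 v u w u'\<bar>)"
  proof (rule obs.tri_coeff_fourth)
    fix u v assume "u \<in> obs_set k N"
    from pair_weight_bound[OF this N] show "\<bar>pair_weight k N u v / c\<bar> \<le> c0 / c"
      using \<open>c > 0\<close> by (simp add: c0_def divide_right_mono)
  qed (use c0 \<open>c > 0\<close> in simp)
  also have "\<dots> \<le> 16 * (c0 / c) ^ 4 * (n * (\<Sum>l=1..k. n * (\<Sum>i=1..k. n * (\<Sum>s=1..k. n * (\<Sum>j=1..k. \<bar>mat_trace (\<Sigma> l * \<Sigma> s * \<Sigma> i * \<Sigma> j)\<bar>)))))"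
  proof (rule mult_left_mono)
    show "(\<Sum>v\<in>obs_set k N. \<Sum>w\<in>obs_set k N. \<Sum>u\<in>obs_set k N. \<Sum>u'\<in>obs_set k N. \<bar>obs.trace4 v u w u'\<bar>) \<le>
      n * (\<Sum>l=1..k. n * (\<Sum>i=1..k. n * (\<Sum>s=1..k. n * (\<Sum>j=1..k. \<bar>mat_trace (\<Sigma> l * \<Sigma> s * \<Sigma> i * \<Sigma> j)\<bar>))))"
      unfolding n_def
      by (intro sum_obs_set_le) (auto simp: trace4_trace intro!: mult_nonneg_nonneg sum_nonneg)
  qed (use c0 \<open>c > 0\<close> in simp)
  also have "\<dots> = 16 * (n * c0) ^ 4 *
      ((\<Sum>l=1..k. \<Sum>i=1..k. \<Sum>s=1..k. \<Sum>j=1..k. \<bar>mat_trace (\<Sigma> l * \<Sigma> s * \<Sigma> i * \<Sigma> j)\<bar>) / c ^ 4)"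
    by (simp add: power4_eq_xxxx mult_ac flip: sum_distrib_left)
  finally show ?thesis
    by (simp only: n_def)
qed

text \<open>The first unit vector gives a positive diagonal entry of a positive definite matrix, and
  the trace is the sum of all squared entries. This makes the normalization \<open>S\<close>
  positive.\<close>

lemma trp_pos:
  assumes "l \<in> {1..k}" "p > 0"
  shows "0 < trp l l"
proof -
  define e where "e = (unit_vec p 0 :: real vec)"
  have "e \<in> carrier_vec p" "e \<noteq> 0\<^sub>v p"
    using assms by (auto simp: e_def)
  then have "0 < e \<bullet> (\<Sigma> l *\<^sub>v e)"
    using Sigma_pos_def[OF assms(1)] Sigma_carrier[OF assms(1)] unfolding pos_def_mat_def by auto
  also have "e \<bullet> (\<Sigma> l *\<^sub>v e) = \<Sigma> l $$ (0, 0)"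
    using Sigma_carrier[OF assms(1)] assms(2) by (simp add: e_def)
  finally have "0 < (\<Sigma> l $$ (0, 0))\<^sup>2" by simp
  also have "\<dots> \<le> (\<Sum>b<p. (\<Sigma> l $$ (0, b))\<^sup>2)"
    using assms by (intro member_le_sum[of 0 _ "\<lambda>b. (\<Sigma> l $$ (0, b))\<^sup>2"]) auto
  also have "\<dots> \<le> (\<Sum>a<p. \<Sum>b<p. (\<Sigma> l $$ (a, b))\<^sup>2)"
    using assms by (intro member_le_sum[of 0 _ "\<lambda>a. \<Sum>b<p. (\<Sigma> l $$ (a, b))\<^sup>2"]) (auto intro: sum_nonneg)
  also have "\<dots> = trp l l"
    unfolding mat_trace_mult[OF Sigma_carrier[OF assms(1)] Sigma_carrier[OF assms(1)]] using assms
    by (intro sum.cong refl) (simp add: power2_eq_square Sigma_entry[of l _ _ 0] obs.Sg_sym[of _ _ 0] , metis obs.Sg_sym)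
  finally show ?thesis .
qed

lemma trace_group_sum:
  "mat_trace (group_mat_sum k p \<Sigma> * group_mat_sum k p \<Sigma>) = (\<Sum>l=1..k. \<Sum>s=1..k. trp l s)"
proof -
  have C: "group_mat_sum k p \<Sigma> \<in> carrier_mat p p" by (simp add: group_mat_sum_def)
  have "mat_trace (group_mat_sum k p \<Sigma> * group_mat_sum k p \<Sigma>) =
    (\<Sum>a<p. \<Sum>b<p. (\<Sum>l=1..k. \<Sigma> l $$ (a, b)) * (\<Sum>s=1..k. \<Sigma> s $$ (b, a)))"
    unfolding mat_trace_mult[OF C C] by (simp add: group_mat_sum_def)
  also have "\<dots> = (\<Sum>a<p. \<Sum>b<p. \<Sum>l=1..k. \<Sum>s=1..k. \<Sigma> l $$ (a, b) * \<Sigma> s $$ (b, a))"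
    by (simp only: sum_product)
  also have "\<dots> = (\<Sum>a<p. \<Sum>l=1..k. \<Sum>b<p. \<Sum>s=1..k. \<Sigma> l $$ (a, b) * \<Sigma> s $$ (b, a))"
    by (intro sum.cong sum.swap refl)
  also have "\<dots> = (\<Sum>l=1..k. \<Sum>a<p. \<Sum>b<p. \<Sum>s=1..k. \<Sigma> l $$ (a, b) * \<Sigma> s $$ (b, a))"
    by (rule sum.swap)
  also have "\<dots> = (\<Sum>l=1..k. \<Sum>a<p. \<Sum>s=1..k. \<Sum>b<p. \<Sigma> l $$ (a, b) * \<Sigma> s $$ (b, a))"
    by (intro sum.cong sum.swap refl)
  also have "\<dots> = (\<Sum>l=1..k. \<Sum>s=1..k. \<Sum>a<p. \<Sum>b<p. \<Sigma> l $$ (a, b) * \<Sigma> s $$ (b, a))"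
    by (intro sum.cong sum.swap refl)
  also have "\<dots> = (\<Sum>l=1..k. \<Sum>s=1..k. trp l s)"
    by (intro sum.cong refl mat_trace_mult[symmetric] Sigma_carrier)
  finally show ?thesis .
qed

text \<open>The double sum is twice the quantity under the root in the shift, and
  \<open>sqrt 2 / 2 = 1 / sqrt 2\<close>. In this form the shift is the mean of the normalized
  statistic with the size ratios replaced by their limits.\<close>

lemma asymptotic_shift_eq:
  assumes lam: "(\<Sum>l=1..k. lam l) = 1"
  shows "asymptotic_shift k p N lam \<mu> \<Sigma> =
    real (total_size k N) * mean_gap k p lam \<mu> / sqrt (\<Sum>l=1..k. \<Sum>s=1..k. lim_weight lam l s * trp l s)"
proof -
  have "(\<mu> l - weighted_vec_sum k p lam \<mu>) \<bullet> (\<mu> l - weighted_vec_sum k p lam \<mu>) =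
     (\<Sum>a<p. (\<mu> l $ a - (\<Sum>s=1..k. lam s * \<mu> s $ a))\<^sup>2)" if "l \<in> {1..k}" for l
    using mu_carrier[OF that] by (simp add: scalar_prod_def weighted_vec_sum_def atLeast0LessThan power2_eq_square)
  then have num: "(\<Sum>l=1..k. lam l * ((\<mu> l - weighted_vec_sum k p lam \<mu>) \<bullet> (\<mu> l - weighted_vec_sum k p lam \<mu>))) = mean_gap k p lam \<mu>"
    using mean_gap_eq(2)[OF lam, of \<mu> p] by simp
  define D where "D = (\<Sum>l=1..k. (1 - lam l)\<^sup>2 * trp l l) + (\<Sum>l\<in>{1..k}. \<Sum>s\<in>{1..k} - {l}. lam l * lam s * trp l s)"
  have "(\<Sum>l=1..k. \<Sum>s=1..k. lim_weight lam l s * trp l s) =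
    (\<Sum>l=1..k. \<Sum>s=1..k. if s = l then 2 * ((1 - lam l)\<^sup>2 * trp l l) else 2 * (lam l * lam s * trp l s))"
    by (intro sum.cong refl) (simp add: lim_weight_def)
  also have "\<dots> = 2 * D"
    unfolding sum_diag_offdiag D_def by (simp only: sum_distrib_left distrib_left)
  finally have den: "sqrt (\<Sum>l=1..k. \<Sum>s=1..k. lim_weight lam l s * trp l s) = sqrt 2 * sqrt D"
    by (simp add: real_sqrt_mult)
  have "sqrt 2 / 2 = 1 / sqrt 2" by (simp add: field_simps)
  then show ?thesis
    unfolding asymptotic_shift_def Let_def num den D_def[symmetric] by (simp only:) simp
qed

end

subsection \<open>Asymptotics along the sequence\<close>

lemma size_ratio_tendsto:
  fixes n a :: "nat \<Rightarrow> real"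
  assumes n: "filterlim n at_top sequentially" and a: "(\<lambda>m. a m / n m) \<longlonglongrightarrow> \<alpha>" and "\<alpha> > 0"
  shows "filterlim a at_top sequentially" "(\<lambda>m. n m / (a m - 1)) \<longlonglongrightarrow> 1 / \<alpha>" "(\<lambda>m. a m / (a m - 1)) \<longlonglongrightarrow> 1"
proof -
  have n0: "\<forall>\<^sub>F m in sequentially. n m > 0"
    using n by (auto simp: filterlim_at_top_dense)
  have "filterlim (\<lambda>m. a m / n m * n m) at_top sequentially"
    by (rule filterlim_tendsto_pos_mult_at_top[OF a \<open>\<alpha> > 0\<close> n])
  then show "filterlim a at_top sequentially"
    by (rule filterlim_cong[THEN iffD1, OF refl refl, rotated]) (use n0 in eventually_elim, auto)
  have inv: "(\<lambda>m. 1 / n m) \<longlonglongrightarrow> 0"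
    by (rule tendsto_divide_0[OF tendsto_const]) (use n in \<open>rule filterlim_at_top_imp_at_infinity\<close>)
  have "(\<lambda>m. 1 / (a m / n m - 1 / n m)) \<longlonglongrightarrow> 1 / (\<alpha> - 0)"
    using \<open>\<alpha> > 0\<close> by (intro tendsto_intros a inv) auto
  then have "(\<lambda>m. 1 / (a m / n m - 1 / n m)) \<longlonglongrightarrow> 1 / \<alpha>"
    by simp
  then show 1: "(\<lambda>m. n m / (a m - 1)) \<longlonglongrightarrow> 1 / \<alpha>"
    by (rule Lim_transform_eventually) (use n0 in eventually_elim, simp add: divide_simps)
  have "(\<lambda>m. a m / n m * (n m / (a m - 1))) \<longlonglongrightarrow> \<alpha> * (1 / \<alpha>)"
    by (intro tendsto_intros a 1)
  then have "(\<lambda>m. a m / n m * (n m / (a m - 1))) \<longlonglongrightarrow> 1"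
    using \<open>\<alpha> > 0\<close> by simp
  then show "(\<lambda>m. a m / (a m - 1)) \<longlonglongrightarrow> 1"
    by (rule Lim_transform_eventually) (use n0 in eventually_elim, simp)
qed

text \<open>With sample sizes proportional to \<open>n\<close>, the fluctuation term is of order
  \<open>1 / sqrt n\<close> and the bias term vanishes.\<close>

lemma rel_error_tendsto:
  fixes n a b :: "nat \<Rightarrow> nat"
  assumes n: "filterlim n at_top sequentially" and a: "(\<lambda>m. real (a m) / real (n m)) \<longlonglongrightarrow> \<alpha>" "\<alpha> > 0"
    and b: "(\<lambda>m. real (b m) / real (n m)) \<longlonglongrightarrow> \<beta>" "\<beta> > 0"
  shows "(\<lambda>m. rel_error c (n m) (a m) (b m)) \<longlonglongrightarrow> 0"
proof -
  have rn: "filterlim (\<lambda>m. real (n m)) at_top sequentially"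
    using n by (rule filterlim_compose[OF filterlim_real_sequentially])
  have s: "(\<lambda>m. 1 / sqrt (real (n m))) \<longlonglongrightarrow> 0"
    by (rule tendsto_divide_0[OF tendsto_const])
      (intro filterlim_at_top_imp_at_infinity filterlim_compose[OF sqrt_at_top rn])
  note A = size_ratio_tendsto[OF rn a] and B = size_ratio_tendsto[OF rn b]
  have "(\<lambda>m. c * (1 / sqrt (real (n m)) * (real (n m) / (real (a m) - 1) * (real (n m) / (real (b m) - 1))))
      + \<bar>real (a m) / (real (a m) - 1) * (real (b m) / (real (b m) - 1)) - 1\<bar>)
    \<longlonglongrightarrow> c * (0 * (1 / \<alpha> * (1 / \<beta>))) + \<bar>1 * 1 - 1\<bar>"
    by (intro tendsto_intros s A B)
  moreover have "rel_error c n a b = c * (1 / sqrt (real n) * (real n / (real a - 1) * (real n / (real b - 1))))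
      + \<bar>real a / (real a - 1) * (real b / (real b - 1)) - 1\<bar>" for n a b
  proof -
    have "real n * sqrt (real n) = 1 / sqrt (real n) * (real n * real n)"
      by (cases "n = 0") (simp_all add: field_simps)
    then show ?thesis
      by (simp add: rel_error_def)
  qed
  ultimately show ?thesis by simp
qed

lemma rel_error_tilde_tendsto:
  assumes "filterlim n at_top sequentially"
  shows "(\<lambda>m. rel_error_tilde c (n m)) \<longlonglongrightarrow> 0"
proof -
  have "((\<lambda>x::real. (x * sqrt x) / ((x + 1) * (x - 2))) \<longlongrightarrow> 0) at_top" by real_asymp
  moreover have "((\<lambda>x::real. \<bar>x * x / ((x + 1) * (x - 2)) - 1\<bar>) \<longlongrightarrow> 0) at_top" by real_asymp
  ultimately have "((\<lambda>x::real. c * ((x * sqrt x) / ((x + 1) * (x - 2))) + \<bar>x * x / ((x + 1) * (x - 2)) - 1\<bar>) \<longlongrightarrow> c * 0 + 0) at_top"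
    by (intro tendsto_intros)
  from filterlim_compose[OF this filterlim_compose[OF filterlim_real_sequentially assms]] show ?thesis
    by (simp add: rel_error_tilde_def)
qed

section \<open>Limits of the weights, the coefficient matrix and the linear remainder\<close>

locale factor_sequence =
  fixes k :: nat
    and M :: "nat \<Rightarrow> 'a measure"
    and p r :: "nat \<Rightarrow> nat"
    and N :: "nat \<Rightarrow> nat \<Rightarrow> nat"
    and \<mu> :: "nat \<Rightarrow> nat \<Rightarrow> real vec"
    and \<Gamma> \<Sigma> :: "nat \<Rightarrow> nat \<Rightarrow> real mat"
    and \<gamma> lam :: "nat \<Rightarrow> real"
    and z :: "nat \<Rightarrow> nat \<Rightarrow> nat \<Rightarrow> nat \<Rightarrow> 'a \<Rightarrow> real"
    and A :: "nat \<Rightarrow> real mat"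
  assumes k: "k \<ge> 2"
    and model: "\<And>m. factor_model (M m) k (p m) (r m) (N m) (\<mu> m) (\<Gamma> m) (\<Sigma> m) \<gamma> (z m)"
    and n_infinity: "filterlim (\<lambda>m. total_size k (N m)) at_top sequentially"
    and p_infinity: "filterlim p at_top sequentially"
    and A_def: "\<And>m. A m = group_mat_sum k (p m) (\<Sigma> m)"
    and A1: "\<And>l. l \<in> {1..k} \<Longrightarrow> 0 < lam l \<and> lam l < 1 \<and>
               (\<lambda>m. real (N m l) / real (total_size k (N m))) \<longlonglongrightarrow> lam l"
    and A2: "\<And>l s. l \<in> {1..k} \<Longrightarrow> s \<in> {1..k} \<Longrightarrow>
               (\<lambda>m. (\<mu> m l - \<mu> m s) \<bullet> (\<Sigma> m l *\<^sub>v (\<mu> m l - \<mu> m s)))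
                 \<in> o(\<lambda>m. mat_trace (A m * A m) / real (total_size k (N m)))"
    and A3: "\<And>l s i j. l \<in> {1..k} \<Longrightarrow> s \<in> {1..k} \<Longrightarrow> i \<in> {1..k} \<Longrightarrow> j \<in> {1..k} \<Longrightarrow>
               (\<lambda>m. mat_trace (\<Sigma> m l * \<Sigma> m s * \<Sigma> m i * \<Sigma> m j))
                 \<in> o(\<lambda>m. (mat_trace (A m * A m))\<^sup>2)"
begin

definition n :: "nat \<Rightarrow> real" where "n m = real (total_size k (N m))"

definition tr :: "nat \<Rightarrow> nat \<Rightarrow> nat \<Rightarrow> real" where "tr m l s = mat_trace (\<Sigma> m l * \<Sigma> m s)"

definition trA :: "nat \<Rightarrow> real" where "trA m = (\<Sum>l=1..k. \<Sum>s=1..k. tr m l s)"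

text \<open>The variance of the quadratic part with the weights replaced by their limits.
  Normalizing by it instead of by the exact variance makes the mean directly comparable with
  \<open>asymptotic_shift\<close>.\<close>

definition S :: "nat \<Rightarrow> real" where "S m = (\<Sum>l=1..k. \<Sum>s=1..k. lim_weight lam l s * tr m l s)"

definition W :: "nat \<Rightarrow> nat \<Rightarrow> nat \<Rightarrow> real" where "W m = var_weight k (N m)"

definition Ix :: "nat \<Rightarrow> ((nat \<times> nat) \<times> nat) set" where "Ix m = obs_set k (N m) \<times> {..<r m}"

definition L :: "nat \<Rightarrow> (nat \<times> nat) \<times> nat \<Rightarrow> (nat \<times> nat) \<times> nat \<Rightarrow> real" where
  "L m = obs_family.tri_coeff (p m) (obs_load (\<Gamma> m)) prod_encode (\<lambda>u v. pair_weight k (N m) u v / sqrt (S m))"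

definition quad :: "nat \<Rightarrow> 'a \<Rightarrow> real" where
  "quad m \<omega> = (\<Sum>x\<in>Ix m. \<Sum>x'\<in>Ix m. L m x x' * obs_noise (z m) x' \<omega> * obs_noise (z m) x \<omega>)"

definition lin :: "nat \<Rightarrow> 'a \<Rightarrow> real" where
  "lin m \<omega> = (\<Sum>x\<in>Ix m. 2 * (\<Sum>a<p m. (\<mu> m (fst (fst x)) $ a - weighted_mean k (N m) (\<mu> m) a) *
     obs_load (\<Gamma> m) (fst x) a (snd x)) * obs_noise (z m) x \<omega>)"

abbreviation data :: "nat \<Rightarrow> 'a \<Rightarrow> nat \<Rightarrow> nat \<Rightarrow> real vec" where
  "data m \<equiv> observation (r m) (\<mu> m) (\<Gamma> m) (z m)"

lemma prob: "prob_space (M m)"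
  using model[of m] by (rule factor_model.axioms(1))

lemma n_at_top: "filterlim n at_top sequentially"
  unfolding n_def[abs_def] using n_infinity by (rule filterlim_compose[OF filterlim_real_sequentially])

lemma lam_pos: "l \<in> {1..k} \<Longrightarrow> 0 < lam l" "l \<in> {1..k} \<Longrightarrow> lam l < 1"
  using A1 by auto

lemma lam_nonzero: "l \<in> {1..k} \<Longrightarrow> lam l \<noteq> 0"
  using lam_pos(1) by (metis less_irrefl)

lemma ratio_tendsto: "l \<in> {1..k} \<Longrightarrow> (\<lambda>m. real (N m l) / n m) \<longlonglongrightarrow> lam l"
  using A1 by (auto simp: n_def)

lemma n_pos: "\<forall>\<^sub>F m in sequentially. n m > 0"
  using n_at_top by (auto simp: filterlim_at_top_dense)

text \<open>Inherited from the size ratios, which add up to 1 whenever \<open>n m\<close> is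
  positive.\<close>

lemma sum_lam: "(\<Sum>l=1..k. lam l) = 1"
proof (rule LIMSEQ_unique)
  show "(\<lambda>m. \<Sum>l=1..k. real (N m l) / n m) \<longlonglongrightarrow> (\<Sum>l=1..k. lam l)"
    by (intro tendsto_sum ratio_tendsto)
  show "(\<lambda>m. \<Sum>l=1..k. real (N m l) / n m) \<longlonglongrightarrow> 1"
    by (rule tendsto_eventually)
      (use n_pos in eventually_elim, simp add: n_def total_size_def flip: sum_divide_distrib)
qed

lemma lim_weight_pos: "l \<in> {1..k} \<Longrightarrow> s \<in> {1..k} \<Longrightarrow> 0 < lim_weight lam l s"
  using lam_pos[of l] lam_pos[of s] by (simp add: lim_weight_def)

lemma group_size_at_top:
  assumes "l \<in> {1..k}"
  shows "filterlim (\<lambda>m. N m l) at_top sequentially"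
proof -
  have "filterlim (\<lambda>m. real (N m l)) at_top sequentially"
    by (rule size_ratio_tendsto(1)[OF n_at_top ratio_tendsto lam_pos(1)]) (use assms in auto)
  then show ?thesis
    by (simp add: filterlim_sequentially_iff_filterlim_real)
qed

lemma large: "\<forall>\<^sub>F m in sequentially. p m > 0 \<and> n m > 0 \<and> (\<forall>l\<in>{1..k}. N m l \<ge> 6)"
proof -
  have "\<forall>\<^sub>F m in sequentially. p m \<ge> 1"
    using p_infinity unfolding filterlim_at_top by blast
  moreover have "\<forall>\<^sub>F m in sequentially. \<forall>l\<in>{1..k}. N m l \<ge> 6"
    by (intro eventually_ball_finite) (use group_size_at_top in \<open>auto simp: filterlim_at_top\<close>)
  ultimately show ?thesis
    using n_pos by eventually_elim auto
qed

lemma tr_nonneg: "l \<in> {1..k} \<Longrightarrow> s \<in> {1..k} \<Longrightarrow> 0 \<le> tr m l s"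
  unfolding tr_def by (rule factor_model.trp_nonneg[OF model])

lemma S_pos:
  assumes "p m > 0"
  shows "S m > 0" "trA m > 0"
proof -
  have 1: "1 \<in> {1..k}" using k by simp
  have pos: "0 < tr m 1 1"
    unfolding tr_def by (rule factor_model.trp_pos[OF model 1 assms])
  have *: "(\<Sum>l=1..k. \<Sum>s=1..k. w l s * tr m l s) > 0"
    if w: "\<And>l s. l \<in> {1..k} \<Longrightarrow> s \<in> {1..k} \<Longrightarrow> 0 < w l s" for w
  proof -
    have nn: "0 \<le> w l s * tr m l s" if "l \<in> {1..k}" "s \<in> {1..k}" for l s
      using w[OF that] tr_nonneg[OF that] by simp
    have "0 < w 1 1 * tr m 1 1" using pos w[OF 1 1] by simp
    also have "\<dots> \<le> (\<Sum>s=1..k. w 1 s * tr m 1 s)"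
      using 1 nn by (intro member_le_sum[of 1 _ "\<lambda>s. w 1 s * tr m 1 s"]) auto
    also have "\<dots> \<le> (\<Sum>l=1..k. \<Sum>s=1..k. w l s * tr m l s)"
      using 1 nn by (intro member_le_sum[of 1 _ "\<lambda>l. \<Sum>s=1..k. w l s * tr m l s"]) (auto intro!: sum_nonneg)
    finally show ?thesis .
  qed
  show "S m > 0" unfolding S_def using lim_weight_pos by (rule *)
  show "trA m > 0" unfolding trA_def using *[of "\<lambda>_ _. 1"] by simp
qed

lemma trA_eq: "mat_trace (A m * A m) = trA m"
  unfolding A_def trA_def tr_def by (rule factor_model.trace_group_sum[OF model])

definition ratio_bound :: real where
  "ratio_bound = (\<Sum>l=1..k. \<Sum>s=1..k. 1 / lim_weight lam l s)"

text \<open>All limiting weights are positive because each \<open>lam l\<close> lies strictly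
  between 0 and 1, and all traces are nonnegative. So (A2) and (A3), stated relative to tr(A^2),
  hold relative to \<open>S\<close> as well.\<close>

lemma trA_le: "trA m \<le> ratio_bound * S m"
proof -
  have nn: "0 \<le> lim_weight lam l s * tr m l s" if "l \<in> {1..k}" "s \<in> {1..k}" for l s
    using lim_weight_pos[OF that] tr_nonneg[OF that] by simp
  have "tr m l s \<le> 1 / lim_weight lam l s * S m" if ls: "l \<in> {1..k}" "s \<in> {1..k}" for l s
  proof -
    have "lim_weight lam l s * tr m l s \<le> (\<Sum>s=1..k. lim_weight lam l s * tr m l s)"
      using ls nn by (intro member_le_sum[of s _ "\<lambda>s. lim_weight lam l s * tr m l s"]) auto
    also have "\<dots> \<le> S m"
      unfolding S_def using ls nn
      by (intro member_le_sum[of l _ "\<lambda>l. \<Sum>s=1..k. lim_weight lam l s * tr m l s"]) (auto intro!: sum_nonneg)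
    finally show ?thesis using lim_weight_pos[OF ls] by (simp add: field_simps)
  qed
  then show ?thesis
    unfolding trA_def ratio_bound_def sum_distrib_right by (intro sum_mono) auto
qed

lemma W_tendsto:
  assumes ls: "l \<in> {1..k}" "s \<in> {1..k}"
  shows "(\<lambda>m. W m l s) \<longlonglongrightarrow> lim_weight lam l s"
proof (cases "s = l")
  case True
  have "(\<lambda>m. 2 * (real (N m l) / (real (N m l) - 1) * (1 - real (N m l) / n m)\<^sup>2)) \<longlonglongrightarrow> 2 * (1 * (1 - lam l)\<^sup>2)"
    by (intro tendsto_intros size_ratio_tendsto(3)[OF n_at_top ratio_tendsto lam_pos(1)] ratio_tendsto ls)
  then have "(\<lambda>m. 2 * (real (N m l) / (real (N m l) - 1) * (1 - real (N m l) / n m)\<^sup>2)) \<longlonglongrightarrow> lim_weight lam l s"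
    using True by (simp add: lim_weight_def)
  then show ?thesis
  proof (rule Lim_transform_eventually)
    show "\<forall>\<^sub>F m in sequentially. 2 * (real (N m l) / (real (N m l) - 1) * (1 - real (N m l) / n m)\<^sup>2) = W m l s"
      using n_pos
    proof eventually_elim
      case (elim m)
      have "(1 - real (N m l) / n m)\<^sup>2 = (n m - real (N m l))\<^sup>2 / (n m)\<^sup>2"
        using elim by (simp add: diff_divide_distrib flip: power_divide)
      then show ?case
        using True by (simp add: W_def var_weight_def Let_def n_def mult_ac)
    qed
  qed
next
  case False
  have "(\<lambda>m. 2 * ((real (N m l) / n m) * (real (N m s) / n m))) \<longlonglongrightarrow> 2 * (lam l * lam s)"
    by (intro tendsto_intros ratio_tendsto ls)
  then show ?thesis
    using False by (simp add: W_def var_weight_def Let_def n_def lim_weight_def power2_eq_square)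
qed

lemma weight_error_tendsto:
  assumes "\<And>l s. l \<in> {1..k} \<Longrightarrow> s \<in> {1..k} \<Longrightarrow> (\<lambda>m. \<kappa> m l s) \<longlonglongrightarrow> 0"
  shows "(\<lambda>m. \<Sum>l=1..k. \<Sum>s=1..k. (\<bar>W m l s\<bar> * \<bar>\<kappa> m l s\<bar> + \<bar>W m l s - lim_weight lam l s\<bar>) / lim_weight lam l s) \<longlonglongrightarrow> 0"
proof -
  have "(\<lambda>m. \<Sum>l=1..k. \<Sum>s=1..k. (\<bar>W m l s\<bar> * \<bar>\<kappa> m l s\<bar> + \<bar>W m l s - lim_weight lam l s\<bar>) / lim_weight lam l s)
    \<longlonglongrightarrow> (\<Sum>l=1..k. \<Sum>s=1..k. (\<bar>lim_weight lam l s\<bar> * \<bar>0\<bar> + \<bar>lim_weight lam l s - lim_weight lam l s\<bar>) / lim_weight lam l s)"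
  proof (intro tendsto_sum tendsto_divide tendsto_add tendsto_mult tendsto_rabs tendsto_diff tendsto_const W_tendsto assms)
    fix l s assume "l \<in> {1..k}" "s \<in> {1..k}"
    then show "lim_weight lam l s \<noteq> 0" using lim_weight_pos by (metis less_irrefl)
  qed
  then show ?thesis by simp
qed

lemma weighted_ratio_expectation:
  fixes e :: "nat \<Rightarrow> nat \<Rightarrow> 'a \<Rightarrow> real"
  assumes "S m > 0"
    and e: "\<And>l s. l \<in> {1..k} \<Longrightarrow> s \<in> {1..k} \<Longrightarrow> integrable (M m) (e l s)"
    and err: "\<And>l s. l \<in> {1..k} \<Longrightarrow> s \<in> {1..k} \<Longrightarrow> (\<integral>\<omega>. \<bar>e l s \<omega> - tr m l s\<bar> \<partial>M m) \<le> \<kappa> l s * tr m l s"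
  shows "integrable (M m) (\<lambda>\<omega>. (\<Sum>l=1..k. \<Sum>s=1..k. W m l s * e l s \<omega>) / S m)"
    and "(\<integral>\<omega>. \<bar>(\<Sum>l=1..k. \<Sum>s=1..k. W m l s * e l s \<omega>) / S m - 1\<bar> \<partial>M m) \<le>
      (\<Sum>l=1..k. \<Sum>s=1..k. (\<bar>W m l s\<bar> * \<bar>\<kappa> l s\<bar> + \<bar>W m l s - lim_weight lam l s\<bar>) / lim_weight lam l s)"
proof -
  interpret prob_space "M m" by (rule prob)
  have Seq: "S m = (\<Sum>x\<in>{1..k} \<times> {1..k}. lim_weight lam (fst x) (snd x) * tr m (fst x) (snd x))"
    by (simp add: S_def sum.cartesian_product split_def)
  note * = weighted_ratio_error[of "{1..k} \<times> {1..k}" "\<lambda>x. e (fst x) (snd x)" "\<lambda>x. tr m (fst x) (snd x)"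
      "\<lambda>x. \<kappa> (fst x) (snd x)" "\<lambda>x. lim_weight lam (fst x) (snd x)" "S m" "\<lambda>x. W m (fst x) (snd x)", OF _ _ _ _ _ Seq]
  show "integrable (M m) (\<lambda>\<omega>. (\<Sum>l=1..k. \<Sum>s=1..k. W m l s * e l s \<omega>) / S m)"
    unfolding sum.cartesian_product split_def
    by (rule *(1)) (use e err tr_nonneg lim_weight_pos assms(1) in auto)
  show "(\<integral>\<omega>. \<bar>(\<Sum>l=1..k. \<Sum>s=1..k. W m l s * e l s \<omega>) / S m - 1\<bar> \<partial>M m) \<le>
      (\<Sum>l=1..k. \<Sum>s=1..k. (\<bar>W m l s\<bar> * \<bar>\<kappa> l s\<bar> + \<bar>W m l s - lim_weight lam l s\<bar>) / lim_weight lam l s)"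
    unfolding sum.cartesian_product split_def
    by (rule *(2)) (use e err tr_nonneg lim_weight_pos assms(1) in auto)
qed

lemma variance_tendsto: "(\<lambda>m. \<Sum>x\<in>Ix m. \<Sum>x'\<in>Ix m. (L m x x')\<^sup>2) \<longlonglongrightarrow> 1"
proof (rule LIM_zero_cancel, rule Lim_null_comparison)
  show "(\<lambda>m. \<Sum>l=1..k. \<Sum>s=1..k. (\<bar>W m l s\<bar> * \<bar>0\<bar> + \<bar>W m l s - lim_weight lam l s\<bar>) / lim_weight lam l s) \<longlonglongrightarrow> 0"
    by (rule weight_error_tendsto) simp
  show "\<forall>\<^sub>F m in sequentially. norm ((\<Sum>x\<in>Ix m. \<Sum>x'\<in>Ix m. (L m x x')\<^sup>2) - 1) \<le>
     (\<Sum>l=1..k. \<Sum>s=1..k. (\<bar>W m l s\<bar> * \<bar>0\<bar> + \<bar>W m l s - lim_weight lam l s\<bar>) / lim_weight lam l s)"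
    using large
  proof eventually_elim
    case (elim m)
    interpret prob_space "M m" by (rule prob)
    have S: "S m > 0" using elim S_pos by auto
    have "(\<Sum>x\<in>Ix m. \<Sum>x'\<in>Ix m. (L m x x')\<^sup>2) = (\<Sum>l=1..k. \<Sum>s=1..k. W m l s * tr m l s) / S m"
      using factor_model.normalized_variance[OF model, of m "sqrt (S m)"] elim S
      by (force simp: Ix_def L_def W_def tr_def)
    \<comment> \<open>The deterministic case of the ratio estimate: the traces estimate themselves
      with error rate 0, and only the convergence of the weights is left.\<close>
    moreover have "\<bar>(\<Sum>l=1..k. \<Sum>s=1..k. W m l s * tr m l s) / S m - 1\<bar> \<le>
      (\<Sum>l=1..k. \<Sum>s=1..k. (\<bar>W m l s\<bar> * \<bar>0\<bar> + \<bar>W m l s - lim_weight lam l s\<bar>) / lim_weight lam l s)"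
      using weighted_ratio_expectation(2)[OF S, of "\<lambda>l s _. tr m l s" "\<lambda>_ _. 0"] by (simp add: prob_space)
    ultimately show ?case by simp
  qed
qed

text \<open>\<open>c m\<close> converges by (A1); each fourfold trace is negligible against the
  square of \<open>trA m\<close> by (A3), hence against the square of \<open>S m\<close> by
  \<open>trA_le\<close>.\<close>

lemma fourth_tendsto: "(\<lambda>m. \<Sum>x\<in>Ix m. \<Sum>x'\<in>Ix m. (\<Sum>y\<in>Ix m. L m y x * L m y x')\<^sup>2) \<longlonglongrightarrow> 0"
proof (rule Lim_null_comparison)
  define q where "q m = (\<Sum>l=1..k. \<Sum>i=1..k. \<Sum>s=1..k. \<Sum>j=1..k. \<bar>mat_trace (\<Sigma> m l * \<Sigma> m s * \<Sigma> m i * \<Sigma> m j) / (trA m)\<^sup>2\<bar>)" for m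
  define c where "c m = 1 + (\<Sum>l=1..k. n m / (real (N m l) - 1))" for m
  have "(\<lambda>m. mat_trace (\<Sigma> m l * \<Sigma> m s * \<Sigma> m i * \<Sigma> m j) / (trA m)\<^sup>2) \<longlonglongrightarrow> 0"
    if "l \<in> {1..k}" "s \<in> {1..k}" "i \<in> {1..k}" "j \<in> {1..k}" for l s i j
    using smalloD_tendsto[OF A3[OF that]] by (simp add: trA_eq)
  then have "q \<longlonglongrightarrow> (\<Sum>l=1..k. \<Sum>i=1..k. \<Sum>s=1..k. \<Sum>j=1..k. \<bar>0::real\<bar>)"
    unfolding q_def[abs_def] by (intro tendsto_sum tendsto_rabs) auto
  then have q: "q \<longlonglongrightarrow> 0" by simp
  have c: "c \<longlonglongrightarrow> 1 + (\<Sum>l=1..k. 1 / lam l)"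
    unfolding c_def[abs_def] by (intro tendsto_intros size_ratio_tendsto(2)[OF n_at_top ratio_tendsto lam_pos(1)])
  have "(\<lambda>m. 16 * c m ^ 4 * (ratio_bound\<^sup>2 * q m)) \<longlonglongrightarrow> 16 * (1 + (\<Sum>l=1..k. 1 / lam l)) ^ 4 * (ratio_bound\<^sup>2 * 0)"
    by (intro tendsto_intros q c)
  then show "(\<lambda>m. 16 * c m ^ 4 * (ratio_bound\<^sup>2 * q m)) \<longlonglongrightarrow> 0" by simp
  show "\<forall>\<^sub>F m in sequentially. norm (\<Sum>x\<in>Ix m. \<Sum>x'\<in>Ix m. (\<Sum>y\<in>Ix m. L m y x * L m y x')\<^sup>2) \<le> 16 * c m ^ 4 * (ratio_bound\<^sup>2 * q m)"
    using large
  proof eventually_elim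
    case (elim m)
    have S: "S m > 0" "trA m > 0" using elim S_pos by auto
    define Tm where "Tm = (\<Sum>l=1..k. \<Sum>i=1..k. \<Sum>s=1..k. \<Sum>j=1..k. \<bar>mat_trace (\<Sigma> m l * \<Sigma> m s * \<Sigma> m i * \<Sigma> m j)\<bar>)"
    have T0: "0 \<le> Tm" by (auto simp: Tm_def intro!: sum_nonneg)
    have N2: "N m l \<ge> 2" if "l \<in> {1..k}" for l using elim that by fastforce
    have ncc: "n m * (1 / n m + (\<Sum>l=1..k. 1 / (real (N m l) - 1))) = c m"
      using elim by (simp add: c_def distrib_left sum_distrib_left)
    have sq: "sqrt (S m) ^ 4 = (S m)\<^sup>2"
    proof -
      have "sqrt (S m) ^ 4 = ((sqrt (S m))\<^sup>2)\<^sup>2" by (simp flip: power_mult)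
      then show ?thesis using S by simp
    qed
    have qT: "q m = Tm / (trA m)\<^sup>2"
      by (simp add: q_def Tm_def sum_divide_distrib abs_divide)
    have "(\<Sum>x\<in>Ix m. \<Sum>x'\<in>Ix m. (\<Sum>y\<in>Ix m. L m y x * L m y x')\<^sup>2) \<le> 16 * c m ^ 4 * (Tm / (S m)\<^sup>2)"
      unfolding Ix_def L_def ncc[symmetric] sq[symmetric] n_def Tm_def
      by (rule factor_model.normalized_fourth[OF model]) (use N2 S in auto)
    also have "\<dots> \<le> 16 * c m ^ 4 * (ratio_bound\<^sup>2 * q m)"
    proof (rule mult_left_mono)
      have "(trA m)\<^sup>2 \<le> (ratio_bound * S m)\<^sup>2"
        using S trA_le by (intro power_mono) auto
      then have "Tm * (trA m)\<^sup>2 \<le> Tm * (ratio_bound * S m)\<^sup>2"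
        using T0 by (rule mult_left_mono)
      then show "Tm / (S m)\<^sup>2 \<le> ratio_bound\<^sup>2 * q m"
        unfolding qT using S by (simp add: divide_simps power_mult_distrib mult_ac)
    qed simp
    finally show ?case
      by (subst real_norm_def, subst abs_of_nonneg) (auto intro!: sum_nonneg)
  qed
qed

text \<open>A noise coordinate takes the rank of its observation. Ties within one observation are
  harmless, since the coefficient matrix vanishes there. The moment bound is the same for every
  \<open>m\<close>.\<close>

lemma quad_char_tendsto: "(\<lambda>m. \<integral>\<omega>. iexp (t * quad m \<omega>) \<partial>M m) \<longlonglongrightarrow> exp (- (t\<^sup>2) / 2)"
  unfolding quad_def
proof (rule quadratic_form_char_tendsto[where rank="\<lambda>x. prod_encode (fst x)" and K="moment_bound k \<gamma>"])
  show "std_family (M m) (Ix m) (obs_noise (z m)) (moment_bound k \<gamma>)" for m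
  proof -
    interpret factor_model "M m" k "p m" "r m" "N m" "\<mu> m" "\<Gamma> m" "\<Sigma> m" \<gamma> "z m" by (rule model)
    show ?thesis unfolding Ix_def by (rule obs.std_family_axioms)
  qed
  show "prod_encode (fst b) < prod_encode (fst a)" if "L m a b \<noteq> 0" for m a b
  proof -
    interpret factor_model "M m" k "p m" "r m" "N m" "\<mu> m" "\<Gamma> m" "\<Sigma> m" \<gamma> "z m" by (rule model)
    show ?thesis using that unfolding L_def obs.tri_coeff_def by (auto split: if_splits)
  qed
qed (rule variance_tendsto fourth_tendsto)+

lemma noise_measurable: "x \<in> Ix m \<Longrightarrow> obs_noise (z m) x \<in> borel_measurable (M m)"
proof -
  assume "x \<in> Ix m"
  interpret factor_model "M m" k "p m" "r m" "N m" "\<mu> m" "\<Gamma> m" "\<Sigma> m" \<gamma> "z m" by (rule model)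
  show ?thesis using \<open>x \<in> Ix m\<close> unfolding Ix_def by (rule obs.measurable_Z)
qed

lemma quad_measurable: "quad m \<in> borel_measurable (M m)"
  unfolding quad_def[abs_def]
  by (intro borel_measurable_sum borel_measurable_times borel_measurable_const noise_measurable)

lemma lin_measurable: "lin m \<in> borel_measurable (M m)"
  unfolding lin_def[abs_def]
  by (intro borel_measurable_sum borel_measurable_times borel_measurable_const noise_measurable)

text \<open>The factor \<open>n m\<close> of the variance bound cancels against the 1/n in (A2), and
  \<open>trA_le\<close> passes from tr(A^2) to \<open>S\<close>.\<close>

lemma lin_second_moment_tendsto: "(\<lambda>m. (\<integral>\<omega>. (lin m \<omega>)\<^sup>2 \<partial>M m) / S m) \<longlonglongrightarrow> 0"
proof (rule Lim_null_comparison)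
  define q where "q m l s = (\<mu> m l - \<mu> m s) \<bullet> (\<Sigma> m l *\<^sub>v (\<mu> m l - \<mu> m s)) / (trA m / n m)" for m l s
  have "(\<lambda>m. q m l s) \<longlonglongrightarrow> 0" if "l \<in> {1..k}" "s \<in> {1..k}" for l s
    using smalloD_tendsto[OF A2[OF that]] by (simp add: trA_eq n_def q_def)
  then have "(\<lambda>m. 4 * (ratio_bound * (\<Sum>l=1..k. \<Sum>s=1..k. \<bar>q m l s\<bar>))) \<longlonglongrightarrow>
     4 * (ratio_bound * (\<Sum>l=1..k. \<Sum>s=1..k. \<bar>0::real\<bar>))"
    by (intro tendsto_mult tendsto_const tendsto_sum tendsto_rabs) auto
  then show "(\<lambda>m. 4 * (ratio_bound * (\<Sum>l=1..k. \<Sum>s=1..k. \<bar>q m l s\<bar>))) \<longlonglongrightarrow> 0" by simp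
  show "\<forall>\<^sub>F m in sequentially. norm ((\<integral>\<omega>. (lin m \<omega>)\<^sup>2 \<partial>M m) / S m) \<le> 4 * (ratio_bound * (\<Sum>l=1..k. \<Sum>s=1..k. \<bar>q m l s\<bar>))"
    using large
  proof eventually_elim
    case (elim m)
    have S: "S m > 0" "trA m > 0" "n m > 0" using elim S_pos by auto
    define Qs where "Qs = (\<Sum>l=1..k. \<Sum>s=1..k. \<bar>q m l s\<bar>)"
    have Q0: "0 \<le> Qs" by (auto simp: Qs_def intro!: sum_nonneg)
    have "(\<integral>\<omega>. (lin m \<omega>)\<^sup>2 \<partial>M m) \<le> 4 * n m * (\<Sum>l=1..k. \<Sum>s=1..k. (\<mu> m l - \<mu> m s) \<bullet> (\<Sigma> m l *\<^sub>v (\<mu> m l - \<mu> m s)))"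
      using factor_model.linear_part_variance[OF model, of m] k S(3) by (simp add: lin_def Ix_def n_def)
    also have "\<dots> \<le> 4 * n m * (\<Sum>l=1..k. \<Sum>s=1..k. (trA m / n m) * \<bar>q m l s\<bar>)"
    proof (intro mult_left_mono sum_mono)
      fix l s
      have "(\<mu> m l - \<mu> m s) \<bullet> (\<Sigma> m l *\<^sub>v (\<mu> m l - \<mu> m s)) = (trA m / n m) * q m l s"
        using S by (simp add: q_def)
      also have "\<dots> \<le> (trA m / n m) * \<bar>q m l s\<bar>"
        using S by (intro mult_left_mono) auto
      finally show "(\<mu> m l - \<mu> m s) \<bullet> (\<Sigma> m l *\<^sub>v (\<mu> m l - \<mu> m s)) \<le> (trA m / n m) * \<bar>q m l s\<bar>" .
    qed (use S in auto)
    also have "\<dots> = 4 * (trA m * Qs)"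
    proof -
      have "(\<Sum>l=1..k. \<Sum>s=1..k. (trA m / n m) * \<bar>q m l s\<bar>) = trA m / n m * Qs"
        by (simp only: Qs_def sum_distrib_left)
      then show ?thesis using S by simp
    qed
    also have "\<dots> \<le> 4 * (ratio_bound * S m * Qs)"
      using Q0 trA_le by (intro mult_left_mono mult_right_mono) auto
    finally have "(\<integral>\<omega>. (lin m \<omega>)\<^sup>2 \<partial>M m) / S m \<le> 4 * (ratio_bound * Qs)"
      using S by (simp add: field_simps)
    moreover have "0 \<le> (\<integral>\<omega>. (lin m \<omega>)\<^sup>2 \<partial>M m) / S m"
      using S by simp
    ultimately show ?case by (simp add: Qs_def)
  qed
qed

lemma statistic_eq:
  assumes "p m > 0" "\<forall>l\<in>{1..k}. N m l \<ge> 6"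
  shows "T_stat k (p m) (N m) (data m \<omega>) / sqrt (S m) =
    quad m \<omega> + lin m \<omega> / sqrt (S m) + n m * mean_gap k (p m) (\<lambda>l. real (N m l) / n m) (\<mu> m) / sqrt (S m)"
proof -
  interpret factor_model "M m" k "p m" "r m" "N m" "\<mu> m" "\<Gamma> m" "\<Sigma> m" \<gamma> "z m" by (rule model)
  have N2: "N m l \<ge> 2" if "l \<in> {1..k}" for l using assms that by fastforce
  have k1: "k \<ge> 1" using k by simp
  have T: "T_stat k (p m) (N m) (data m \<omega>) =
    (\<Sum>u\<in>obs_set k (N m). \<Sum>v\<in>obs_set k (N m) - {u}. pair_weight k (N m) u v * obs.G u v \<omega>)
    + lin m \<omega> + n m * mean_gap k (p m) (\<lambda>l. real (N m l) / n m) (\<mu> m)"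
    unfolding lin_def Ix_def n_def by (rule T_stat_decomposition) (use N2 k1 in auto)
  show ?thesis
    unfolding T quad_def L_def Ix_def normalized_form by (simp add: add_divide_distrib)
qed

text \<open>Common to both statistics: of the estimator \<open>t\<close> of tr(\<Sigma>_l^2) only an
  L^1 error relative to this trace enters. Together with the errors of the cross traces it makes the
  ratio \<open>V\<close> of the estimated variance to \<open>S\<close> converge to 1 in L^1.\<close>

lemma power_asymptotics:
  fixes t :: "nat \<Rightarrow> (nat \<Rightarrow> nat) \<Rightarrow> (nat \<Rightarrow> nat \<Rightarrow> real vec) \<Rightarrow> nat \<Rightarrow> real" and \<kappa> :: "nat \<Rightarrow> nat \<Rightarrow> real"
  assumes t: "\<forall>\<^sub>F m in sequentially. \<forall>l\<in>{1..k}. integrable (M m) (\<lambda>\<omega>. t (p m) (N m) (data m \<omega>) l) \<and>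
      (\<integral>\<omega>. \<bar>t (p m) (N m) (data m \<omega>) l - tr m l l\<bar> \<partial>M m) \<le> \<kappa> m l * tr m l l"
    and \<kappa>: "\<And>l. l \<in> {1..k} \<Longrightarrow> (\<lambda>m. \<kappa> m l) \<longlonglongrightarrow> 0"
  shows "(\<lambda>m. measure (M m) {\<omega> \<in> space (M m).
      T_stat k (p m) (N m) (data m \<omega>) / sqrt (sigma2_with (t (p m) (N m) (data m \<omega>)) k (p m) (N m) (data m \<omega>)) \<ge> \<xi>}
    - normal_cdf (- \<xi> + asymptotic_shift k (p m) (N m) lam (\<mu> m) (\<Sigma> m))) \<longlonglongrightarrow> 0"
proof -
  define est where "est m l s \<omega> = (if s = l then t (p m) (N m) (data m \<omega>) l else tr_prod_hat (p m) (N m) (data m \<omega>) l s)" for m l s \<omega>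
  define \<kappa>' where "\<kappa>' m l s = (if s = l then \<kappa> m l else rel_error (6 * moment_bound k \<gamma> + 1) (total_size k (N m)) (N m l) (N m s))" for m l s
  define \<sigma> where "\<sigma> m \<omega> = sigma2_with (t (p m) (N m) (data m \<omega>)) k (p m) (N m) (data m \<omega>)" for m \<omega>
  define V where "V m \<omega> = \<sigma> m \<omega> / S m" for m \<omega>
  define E where "E m = (\<Sum>l=1..k. \<Sum>s=1..k. (\<bar>W m l s\<bar> * \<bar>\<kappa>' m l s\<bar> + \<bar>W m l s - lim_weight lam l s\<bar>) / lim_weight lam l s)" for m
  have V: "V m \<omega> = (\<Sum>l=1..k. \<Sum>s=1..k. W m l s * est m l s \<omega>) / S m" for m \<omega>
    unfolding V_def \<sigma>_def sigma2_with_eq W_def est_def ..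
  have "(\<lambda>m. \<kappa>' m l s) \<longlonglongrightarrow> 0" if "l \<in> {1..k}" "s \<in> {1..k}" for l s
    using \<kappa>[OF that(1)] rel_error_tendsto[OF n_infinity, of "\<lambda>m. N m l" "lam l" "\<lambda>m. N m s" "lam s"]
      A1[OF that(1)] A1[OF that(2)] by (cases "s = l") (auto simp: \<kappa>'_def)
  then have E: "E \<longlonglongrightarrow> 0"
    unfolding E_def[abs_def] by (rule weight_error_tendsto)
  define good where "good m \<longleftrightarrow> p m > 0 \<and> n m > 0 \<and> (\<forall>l\<in>{1..k}. N m l \<ge> 6) \<and>
    integrable (M m) (V m) \<and> (\<integral>\<omega>. \<bar>V m \<omega> - 1\<bar> \<partial>M m) \<le> E m" for m
  have good: "\<forall>\<^sub>F m in sequentially. good m"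
    using large t
  proof eventually_elim
    case (elim m)
    have S: "S m > 0" using elim S_pos by auto
    have sz: "N m l \<le> total_size k (N m)" if "l \<in> {1..k}" for l
      unfolding total_size_def using that by (intro member_le_sum) auto
    have *: "integrable (M m) (est m l s) \<and> (\<integral>\<omega>. \<bar>est m l s \<omega> - tr m l s\<bar> \<partial>M m) \<le> \<kappa>' m l s * tr m l s"
      if ls: "l \<in> {1..k}" "s \<in> {1..k}" for l s
    proof (cases "s = l")
      case True
      then show ?thesis using elim ls by (simp add: est_def[abs_def] \<kappa>'_def)
    next
      case False
      have "N m l \<ge> 2" "N m s \<ge> 2" using elim ls by fastforce+
      then show ?thesis
        using factor_model.tr_prod_hat_error[OF model ls, of m "total_size k (N m)"] sz ls False
        by (simp add: est_def[abs_def] \<kappa>'_def tr_def)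
    qed
    have "integrable (M m) (V m)" "(\<integral>\<omega>. \<bar>V m \<omega> - 1\<bar> \<partial>M m) \<le> E m"
      using weighted_ratio_expectation[OF S, of "est m" "\<kappa>' m"] * unfolding V[abs_def] E_def by blast+
    then show ?case using elim by (simp add: good_def)
  qed
  \<comment> \<open>Measurability is required for every \<open>m\<close>, but the variance estimate
    is known to be measurable only through its integrability, that is for good \<open>m\<close>.
    Elsewhere constants are substituted, which affects finitely many \<open>m\<close>.\<close>
  define V' where "V' m \<omega> = (if good m then V m \<omega> else 1)" for m \<omega>
  define R where "R m \<omega> = lin m \<omega> / sqrt (S m)" for m \<omega>
  define T where "T m \<omega> = (if good m then T_stat k (p m) (N m) (data m \<omega>) / sqrt (\<sigma> m \<omega>) else 0)" for m \<omega>
  define b where "b m = n m * mean_gap k (p m) (\<lambda>l. real (N m l) / n m) (\<mu> m) / sqrt (S m)" for m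
  define \<theta> where "\<theta> m = asymptotic_shift k (p m) (N m) lam (\<mu> m) (\<Sigma> m)" for m
  have [measurable]: "quad m \<in> borel_measurable (M m)" "lin m \<in> borel_measurable (M m)" for m
    by (rule quad_measurable lin_measurable)+
  have Rm [measurable]: "R m \<in> borel_measurable (M m)" for m
    unfolding R_def by measurable
  have Vm [measurable]: "V' m \<in> borel_measurable (M m)" for m
  proof (cases "good m")
    case True
    then have "V m \<in> borel_measurable (M m)" by (auto simp: good_def)
    then show ?thesis using True by (simp add: V'_def[abs_def])
  qed (simp add: V'_def[abs_def])
  have T_stat: "T_stat k (p m) (N m) (data m \<omega>) = sqrt (S m) * (quad m \<omega> + R m \<omega> + b m)" if "good m" for m \<omega>
  proof -
    have "S m > 0" using that S_pos by (auto simp: good_def)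
    then show ?thesis
      using statistic_eq[of m \<omega>] that by (simp add: good_def R_def b_def field_simps)
  qed
  have Tm: "T m \<in> borel_measurable (M m)" for m
  proof (cases "good m")
    case True
    then have "S m > 0" using S_pos by (auto simp: good_def)
    \<comment> \<open>The statistic is rewritten through quantities whose measurability has been
      shown.\<close>
    then have "T m = (\<lambda>\<omega>. sqrt (S m) * (quad m \<omega> + R m \<omega> + b m) / sqrt (S m * V' m \<omega>))"
      using True by (auto simp: T_def T_stat V'_def V_def fun_eq_iff)
    then show ?thesis by simp
  qed (simp add: T_def[abs_def])
  have "(\<lambda>m. measure (M m) {\<omega>\<in>space (M m). T m \<omega> \<ge> \<xi>} - normal_cdf (- \<xi> + \<theta> m)) \<longlonglongrightarrow> 0"
  proof (rule tail_probability_tendsto[OF prob _ Rm Vm Tm quad_char_tendsto])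
    fix \<epsilon> :: real assume "\<epsilon> > 0"
    show "(\<lambda>m. measure (M m) {\<omega>\<in>space (M m). \<bar>R m \<omega>\<bar> \<ge> \<epsilon>}) \<longlonglongrightarrow> 0"
    proof (rule Lim_null_comparison)
      show "(\<lambda>m. (\<integral>\<omega>. (lin m \<omega>)\<^sup>2 \<partial>M m) / S m / \<epsilon>\<^sup>2) \<longlonglongrightarrow> 0"
        using tendsto_divide[OF lin_second_moment_tendsto tendsto_const, of "\<epsilon>\<^sup>2"] \<open>\<epsilon> > 0\<close> by simp
      show "\<forall>\<^sub>F m in sequentially. norm (measure (M m) {\<omega>\<in>space (M m). \<bar>R m \<omega>\<bar> \<ge> \<epsilon>}) \<le> (\<integral>\<omega>. (lin m \<omega>)\<^sup>2 \<partial>M m) / S m / \<epsilon>\<^sup>2"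
        using good
      proof eventually_elim
        case (elim m)
        interpret factor_model "M m" k "p m" "r m" "N m" "\<mu> m" "\<Gamma> m" "\<Sigma> m" \<gamma> "z m" by (rule model)
        have S: "S m > 0" using elim S_pos by (auto simp: good_def)
        have "square_int (lin m)"
          unfolding lin_def[abs_def] Ix_def by (intro fourth_int_square_int obs.fourth_int_linear_form order_refl)
        then have i: "integrable (M m) (\<lambda>\<omega>. (R m \<omega>)\<^sup>2)"
          using S by (auto simp: R_def power_divide dest: square_intD)
        have "{\<omega>\<in>space (M m). \<bar>R m \<omega>\<bar> \<ge> \<epsilon>} = {\<omega>\<in>space (M m). (R m \<omega>)\<^sup>2 \<ge> \<epsilon>\<^sup>2}"
          using \<open>\<epsilon> > 0\<close> abs_le_square_iff[of \<epsilon>] by auto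
        also have "prob \<dots> \<le> (\<integral>\<omega>. (R m \<omega>)\<^sup>2 \<partial>M m) / \<epsilon>\<^sup>2"
          using \<open>\<epsilon> > 0\<close> by (intro integral_Markov_inequality_measure[OF i, of "space (M m)"]) auto
        also have "(\<integral>\<omega>. (R m \<omega>)\<^sup>2 \<partial>M m) = (\<integral>\<omega>. (lin m \<omega>)\<^sup>2 \<partial>M m) / S m"
          using S by (simp add: R_def power_divide)
        finally show ?case by simp
      qed
    qed
    show "(\<lambda>m. measure (M m) {\<omega>\<in>space (M m). \<bar>V' m \<omega> - 1\<bar> \<ge> \<epsilon>}) \<longlonglongrightarrow> 0"
    proof (rule Lim_null_comparison)
      show "(\<lambda>m. E m / \<epsilon>) \<longlonglongrightarrow> 0"
        using tendsto_divide[OF E tendsto_const, of \<epsilon>] \<open>\<epsilon> > 0\<close> by simp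
      show "\<forall>\<^sub>F m in sequentially. norm (measure (M m) {\<omega>\<in>space (M m). \<bar>V' m \<omega> - 1\<bar> \<ge> \<epsilon>}) \<le> E m / \<epsilon>"
        using good
      proof eventually_elim
        case (elim m)
        interpret prob_space "M m" by (rule prob)
        have i: "integrable (M m) (\<lambda>\<omega>. \<bar>V' m \<omega> - 1\<bar>)" and le: "(\<integral>\<omega>. \<bar>V' m \<omega> - 1\<bar> \<partial>M m) \<le> E m"
          using elim by (auto simp: V'_def good_def)
        have "measure (M m) {\<omega>\<in>space (M m). \<bar>V' m \<omega> - 1\<bar> \<ge> \<epsilon>} \<le> (\<integral>\<omega>. \<bar>V' m \<omega> - 1\<bar> \<partial>M m) / \<epsilon>"
          using \<open>\<epsilon> > 0\<close> by (intro integral_Markov_inequality_measure[OF i, of "space (M m)"]) auto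
        also have "\<dots> \<le> E m / \<epsilon>"
          using le \<open>\<epsilon> > 0\<close> by (intro divide_right_mono) auto
        finally show ?case by simp
      qed
    qed
  next
    \<comment> \<open>The relative error from replacing the size ratios by their limits; it bounds
      the relative error of the shift whatever the means are.\<close>
    define e where "e m = (\<Sum>l=1..k. \<Sum>s=1..k. \<bar>(real (N m l) / n m) * (real (N m s) / n m) / (lam l * lam s) - 1\<bar>)" for m
    have "e \<longlonglongrightarrow> (\<Sum>l=1..k. \<Sum>s=1..k. \<bar>lam l * lam s / (lam l * lam s) - 1\<bar>)"
      unfolding e_def[abs_def]
      by (intro tendsto_sum tendsto_rabs tendsto_diff tendsto_divide tendsto_mult tendsto_const ratio_tendsto)
        (simp_all add: lam_nonzero)
    also have "(\<Sum>l=1..k. \<Sum>s=1..k. \<bar>lam l * lam s / (lam l * lam s) - 1\<bar>) = 0"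
      by (intro sum.neutral ballI) (use lam_pos in force)
    finally show "e \<longlonglongrightarrow> 0" .
    show "\<forall>\<^sub>F m in sequentially. 0 \<le> \<theta> m \<and> \<bar>b m - \<theta> m\<bar> \<le> e m * \<theta> m"
      using good
    proof eventually_elim
      case (elim m)
      have S: "S m > 0" "n m > 0" using elim S_pos by (auto simp: good_def)
      define c where "c = n m / sqrt (S m)"
      have c: "c \<ge> 0" using S by (simp add: c_def)
      define g where "g = mean_gap k (p m) lam (\<mu> m)"
      have \<theta>: "\<theta> m = c * g"
        using factor_model.asymptotic_shift_eq[OF model sum_lam, of m]
        by (simp add: \<theta>_def c_def g_def S_def tr_def n_def)
      have b: "b m = c * mean_gap k (p m) (\<lambda>l. real (N m l) / n m) (\<mu> m)"
        by (simp add: b_def c_def)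
      have "\<bar>b m - \<theta> m\<bar> = c * \<bar>mean_gap k (p m) (\<lambda>l. real (N m l) / n m) (\<mu> m) - g\<bar>"
        unfolding b \<theta> right_diff_distrib[symmetric] abs_mult using c by simp
      also have "\<dots> \<le> c * (e m * g)"
        unfolding e_def g_def using c by (intro mult_left_mono mean_gap_ratio(1) lam_pos) auto
      finally have "\<bar>b m - \<theta> m\<bar> \<le> e m * \<theta> m" by (simp add: \<theta> mult_ac)
      moreover have "0 \<le> \<theta> m"
        unfolding \<theta> g_def using c by (intro mult_nonneg_nonneg mean_gap_ratio(2) lam_pos) auto
      ultimately show ?case by simp
    qed
    show "\<forall>\<^sub>F m in sequentially. \<forall>\<omega>\<in>space (M m). V' m \<omega> > 0 \<longrightarrow>
      (T m \<omega> \<ge> \<xi> \<longleftrightarrow> quad m \<omega> + R m \<omega> + b m \<ge> \<xi> * sqrt (V' m \<omega>))"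
      using good
    proof eventually_elim
      case (elim m)
      have S: "S m > 0" using elim S_pos by (auto simp: good_def)
      show ?case
      proof (intro ballI impI)
        fix \<omega> assume "V' m \<omega> > 0"
        \<comment> \<open>\<open>V'\<close> positive makes the variance estimate positive, so that
          its \<open>sqrt\<close> is positive and the inequality may be multiplied by it.
          Nonpositive estimates form an event of vanishing probability.\<close>
        then have v: "V m \<omega> > 0" "\<sigma> m \<omega> = S m * V m \<omega>" using elim S by (auto simp: V'_def V_def)
        have "T m \<omega> = (quad m \<omega> + R m \<omega> + b m) / sqrt (V m \<omega>)"
          using elim S v by (simp add: T_def T_stat real_sqrt_mult)
        then show "T m \<omega> \<ge> \<xi> \<longleftrightarrow> quad m \<omega> + R m \<omega> + b m \<ge> \<xi> * sqrt (V' m \<omega>)"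
          using v elim by (simp add: V'_def pos_le_divide_eq)
      qed
    qed
  qed measurable
  then show ?thesis
    by (rule Lim_transform_eventually)
      (use good in eventually_elim, simp add: T_def \<sigma>_def \<theta>_def)
qed

text \<open>Each half differs from half the group size by at most 2, which is negligible after
  division by \<open>n\<close>. The condition \<open>N >= 6\<close> also makes the natural
  subtraction in the second half exact.\<close>

lemma half_size_tendsto:
  assumes "l \<in> {1..k}"
  shows "(\<lambda>m. real (N m l div 2 + 1) / n m) \<longlonglongrightarrow> lam l / 2"
    and "(\<lambda>m. real (N m l - (N m l div 2 + 1)) / n m) \<longlonglongrightarrow> lam l / 2"
proof -
  have inv: "(\<lambda>m. 1 / n m) \<longlonglongrightarrow> 0"
    by (rule tendsto_divide_0[OF tendsto_const]) (use n_at_top in \<open>rule filterlim_at_top_imp_at_infinity\<close>)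
  have *: "(\<lambda>m. real (f (N m l)) / n m) \<longlonglongrightarrow> lam l / 2"
    if f: "\<And>N. N \<ge> 6 \<Longrightarrow> \<bar>real (f N) - real N / 2\<bar> \<le> 2" for f :: "nat \<Rightarrow> nat"
  proof -
    have lim: "(\<lambda>m. real (N m l) / n m / 2) \<longlonglongrightarrow> lam l / 2"
      by (intro tendsto_intros ratio_tendsto assms) simp
    have "(\<lambda>m. real (f (N m l)) / n m - real (N m l) / n m / 2) \<longlonglongrightarrow> 0"
    proof (rule Lim_null_comparison)
      show "(\<lambda>m. 2 * (1 / n m)) \<longlonglongrightarrow> 0"
        using tendsto_mult[OF tendsto_const inv, of 2] by simp
      show "\<forall>\<^sub>F m in sequentially. norm (real (f (N m l)) / n m - real (N m l) / n m / 2) \<le> 2 * (1 / n m)"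
        using large
      proof eventually_elim
        case (elim m)
        have "real (f (N m l)) / n m - real (N m l) / n m / 2 = (real (f (N m l)) - real (N m l) / 2) / n m"
          by (simp add: diff_divide_distrib)
        then show ?case
          using f[of "N m l"] elim assms by (simp add: abs_divide divide_right_mono)
      qed
    qed
    from tendsto_add[OF this lim] show ?thesis
      by simp
  qed
  have half: "2 * real (N div 2) \<le> real N" "real N \<le> 2 * real (N div 2) + 1" for N :: nat
    by linarith+
  show "(\<lambda>m. real (N m l div 2 + 1) / n m) \<longlonglongrightarrow> lam l / 2"
  proof (rule *[of "\<lambda>N. N div 2 + 1"])
    show "\<bar>real (N div 2 + 1) - real N / 2\<bar> \<le> 2" for N
      using half[of N] unfolding abs_le_iff of_nat_add of_nat_1 by linarith
  qed
  show "(\<lambda>m. real (N m l - (N m l div 2 + 1)) / n m) \<longlonglongrightarrow> lam l / 2"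
  proof (rule *[of "\<lambda>N. N - (N div 2 + 1)"])
    fix N :: nat assume "N \<ge> 6"
    then have "real (N - (N div 2 + 1)) = real N - (real (N div 2) + 1)"
      by (subst of_nat_diff) auto
    then show "\<bar>real (N - (N div 2 + 1)) - real N / 2\<bar> \<le> 2"
      using half[of N] unfolding abs_le_iff by linarith
  qed
qed

lemma power_T1:
  "(\<lambda>m. measure (M m) {\<omega> \<in> space (M m). T1_hat k (p m) (N m) (data m \<omega>) \<ge> \<xi>}
    - normal_cdf (- \<xi> + asymptotic_shift k (p m) (N m) lam (\<mu> m) (\<Sigma> m))) \<longlonglongrightarrow> 0"
  unfolding T1_hat_def sigma2_hat_def
proof (rule power_asymptotics[where \<kappa>="\<lambda>m l. rel_error (6 * moment_bound k \<gamma> + 1) (total_size k (N m))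
    (N m l div 2 + 1) (N m l - (N m l div 2 + 1))"])
  show "\<forall>\<^sub>F m in sequentially. \<forall>l\<in>{1..k}. integrable (M m) (\<lambda>\<omega>. tr_sq_hat (p m) (N m) (data m \<omega>) l) \<and>
      (\<integral>\<omega>. \<bar>tr_sq_hat (p m) (N m) (data m \<omega>) l - tr m l l\<bar> \<partial>M m) \<le>
      rel_error (6 * moment_bound k \<gamma> + 1) (total_size k (N m)) (N m l div 2 + 1) (N m l - (N m l div 2 + 1)) * tr m l l"
    using large
  proof eventually_elim
    case (elim m)
    have "N m l \<le> total_size k (N m)" if "l \<in> {1..k}" for l
      unfolding total_size_def using that by (intro member_le_sum) auto
    then show ?case
      unfolding tr_def using elim
      by (intro ballI conjI factor_model.tr_sq_hat_error[OF model]) auto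
  qed
  fix l assume l: "l \<in> {1..k}"
  show "(\<lambda>m. rel_error (6 * moment_bound k \<gamma> + 1) (total_size k (N m)) (N m l div 2 + 1) (N m l - (N m l div 2 + 1))) \<longlonglongrightarrow> 0"
    by (rule rel_error_tendsto[OF n_infinity half_size_tendsto(1)[OF l, unfolded n_def] _ half_size_tendsto(2)[OF l, unfolded n_def]])
      (use lam_pos(1)[OF l] in auto)
qed

lemma power_T2:
  "(\<lambda>m. measure (M m) {\<omega> \<in> space (M m). T2_hat k (p m) (N m) (data m \<omega>) \<ge> \<xi>}
    - normal_cdf (- \<xi> + asymptotic_shift k (p m) (N m) lam (\<mu> m) (\<Sigma> m))) \<longlonglongrightarrow> 0"
  unfolding T2_hat_def sigma2_tilde_def
proof (rule power_asymptotics[where \<kappa>="\<lambda>m l. rel_error_tilde (14 * moment_bound k \<gamma> + 1) (N m l)"])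
  show "\<forall>\<^sub>F m in sequentially. \<forall>l\<in>{1..k}. integrable (M m) (\<lambda>\<omega>. tr_sq_tilde (p m) (N m) (data m \<omega>) l) \<and>
      (\<integral>\<omega>. \<bar>tr_sq_tilde (p m) (N m) (data m \<omega>) l - tr m l l\<bar> \<partial>M m) \<le>
      rel_error_tilde (14 * moment_bound k \<gamma> + 1) (N m l) * tr m l l"
    using large
  proof eventually_elim
    case (elim m)
    have "N m l \<ge> 3" if "l \<in> {1..k}" for l using elim that by fastforce
    then show ?case
      unfolding tr_def by (intro ballI conjI factor_model.tr_sq_tilde_error[OF model]) auto
  qed
qed (intro rel_error_tilde_tendsto group_size_at_top)

end

theorem theorem2:
  fixes k :: nat
    and M :: "nat \<Rightarrow> 'a measure"
    and p r :: "nat \<Rightarrow> nat"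
    and N :: "nat \<Rightarrow> nat \<Rightarrow> nat"
    and \<mu> :: "nat \<Rightarrow> nat \<Rightarrow> real vec"
    and \<Gamma> \<Sigma> :: "nat \<Rightarrow> nat \<Rightarrow> real mat"
    and \<gamma> lam :: "nat \<Rightarrow> real"
    and z :: "nat \<Rightarrow> nat \<Rightarrow> nat \<Rightarrow> nat \<Rightarrow> 'a \<Rightarrow> real"
    and A :: "nat \<Rightarrow> real mat"
    and \<alpha> \<xi> :: real
  assumes alpha: "0 < \<alpha>" "\<alpha> < 1"
    and xi: "1 - cdf std_normal_distribution \<xi> = \<alpha>"
    and k: "k \<ge> 2"
    and model: "\<And>m. factor_model (M m) k (p m) (r m) (N m) (\<mu> m) (\<Gamma> m) (\<Sigma> m) \<gamma> (z m)"
    and n_infinity: "filterlim (\<lambda>m. total_size k (N m)) at_top sequentially"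
    and p_infinity: "filterlim p at_top sequentially"
    and A_def: "\<And>m. A m = group_mat_sum k (p m) (\<Sigma> m)"
    and A1: "\<And>l. l \<in> {1..k} \<Longrightarrow> 0 < lam l \<and> lam l < 1 \<and>
               (\<lambda>m. real (N m l) / real (total_size k (N m))) \<longlonglongrightarrow> lam l"
    and A2: "\<And>l s. l \<in> {1..k} \<Longrightarrow> s \<in> {1..k} \<Longrightarrow>
               (\<lambda>m. (\<mu> m l - \<mu> m s) \<bullet> (\<Sigma> m l *\<^sub>v (\<mu> m l - \<mu> m s)))
                 \<in> o(\<lambda>m. mat_trace (A m * A m) / real (total_size k (N m)))"
    and A3: "\<And>l s i j. l \<in> {1..k} \<Longrightarrow> s \<in> {1..k} \<Longrightarrow> i \<in> {1..k} \<Longrightarrow> j \<in> {1..k} \<Longrightarrow>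
               (\<lambda>m. mat_trace (\<Sigma> m l * \<Sigma> m s * \<Sigma> m i * \<Sigma> m j))
                 \<in> o(\<lambda>m. (mat_trace (A m * A m))\<^sup>2)"
  shows "\<forall>T_hat \<in> {T1_hat, T2_hat}.
    (\<lambda>m. measure (M m)
            {\<omega> \<in> space (M m). T_hat k (p m) (N m) (observation (r m) (\<mu> m) (\<Gamma> m) (z m) \<omega>) \<ge> \<xi>}
         - cdf std_normal_distribution (- \<xi> + asymptotic_shift k (p m) (N m) lam (\<mu> m) (\<Sigma> m)))
      \<in> o(\<lambda>_. 1)"
proof -
  have fs: "factor_sequence k M p r N \<mu> \<Gamma> \<Sigma> \<gamma> lam z A"
    unfolding factor_sequence_def
    by (intro conjI allI impI k model n_infinity p_infinity A_def A1 A2 A3)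
  show ?thesis
    using factor_sequence.power_T1[OF fs, of \<xi>] factor_sequence.power_T2[OF fs, of \<xi>]
    by (auto intro!: smalloI_tendsto)
qed

end
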